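(* Let $\nu>-1/2$ and $1<p<\infty$. The operator $\check{\mathfrak{R}}_\nu$ extends uniquely to a bounded linear operator on $L^p(d\rho_\nu)$. Moreover, $$\|\check{\mathfrak{R}}_\nu\|_{L^p(d\rho_\nu)\to L^p(d\rho_\nu)}\le 48\big(1+\sqrt K\big)(p^*-1),$$ where $K=\frac18\max\big(\nu+1/2,\,1/(\nu+1/2)\big)$ and $p^*=\max(p,p/(p-1))$.
   Context: All $L^p$ spaces are over the interval $(0,1)$. For $\nu>-1$ let $J_\nu$ be the Bessel function of the first kind of order $\nu$ on $(0,\infty)$, and let $0<\lambda_{1,\nu}<\lambda_{2,\nu}<\dots$ be its successive positive zeros. For $n\ge1$ and $x\in(0,1)$ set $$\check\varphi_n^\nu(x)=\frac{\sqrt2}{|J_{\nu+1}(\lambda_{n,\nu})|}\,\frac{x^{-\nu}J_\nu(\lambda_{n,\nu}x)}{1-x},\qquad d\rho_\nu(x)=x^{2\nu+1}(1-x)^2dx.$$ The system $\{\check\varphi_n^\nu:n\ge1\}$ is an orthonormal basis of $L^2(d\rho_\nu)$. Let $$R^\nu(x)=\lambda_{1,\nu}\frac{J_{\nu+1}(\lambda_{1,\nu}x)}{J_\nu(\lambda_{1,\nu}x)},\qquad \check d_\nu=\frac{d}{dx}+R^\nu(x)-\frac1{1-x}.$$ The Riesz transform $\check{\mathfrak{R}}_\nu$ is defined initially on $L^2(d\rho_\nu)$ (where it is a contraction) by $$\check{\mathfrak{R}}_\nu f=\sum_{n=2}^\infty\lambda_{n,\nu}^{-1}\langle f,\check\varphi_n^\nu\rangle_{d\rho_\nu}\,\check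 d_\nu\check\varphi_n^\nu,$$ where $\langle\cdot,\cdot\rangle_{d\rho_\nu}$ is the inner product in $L^2(d\rho_\nu)$. *)

theory Defs
  imports "HOL-Analysis.Analysis"
begin

definition bessel_J :: "real \<Rightarrow> real \<Rightarrow> real" where
  "bessel_J \<nu> x =
     (\<Sum>m. (-1) ^ m / (fact m * Gamma (real m + \<nu> + 1)) * (x / 2) powr (2 * real m + \<nu>))"

text \<open>For \<open>n \<ge> 1\<close> this is the \<open>n\<close>-th positive zero of \<open>J\<^sub>\<nu>\<close>; the value \<open>0\<close> at
  index \<open>0\<close> only starts the recursion and need not be a zero. For \<open>\<nu> > -1\<close> the zeros in
  \<open>(0,\<infinity>)\<close> are infinitely many and do not accumulate in \<open>[0,\<infinity>)\<close>, so each least element exists.\<close>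

primrec bessel_zero :: "real \<Rightarrow> nat \<Rightarrow> real" where
  "bessel_zero \<nu> 0 = 0"
| "bessel_zero \<nu> (Suc n) = (LEAST x. bessel_zero \<nu> n < x \<and> bessel_J \<nu> x = 0)"

definition phi_check :: "real \<Rightarrow> nat \<Rightarrow> real \<Rightarrow> real" where
  "phi_check \<nu> n x =
     sqrt 2 / \<bar>bessel_J (\<nu> + 1) (bessel_zero \<nu> n)\<bar>
       * (x powr (-\<nu>) * bessel_J \<nu> (bessel_zero \<nu> n * x) / (1 - x))"

definition rho :: "real \<Rightarrow> real measure" where
  "rho \<nu> = density (restrict_space lborel {0<..<1})
             (\<lambda>x. ennreal (x powr (2 * \<nu> + 1) * (1 - x)\<^sup>2))"

definition R_fun :: "real \<Rightarrow> real \<Rightarrow> real" where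
  "R_fun \<nu> x =
     bessel_zero \<nu> 1 * (bessel_J (\<nu> + 1) (bessel_zero \<nu> 1 * x) / bessel_J \<nu> (bessel_zero \<nu> 1 * x))"

definition d_check :: "real \<Rightarrow> (real \<Rightarrow> real) \<Rightarrow> real \<Rightarrow> real" where
  "d_check \<nu> u x = deriv u x + R_fun \<nu> x * u x - 1 / (1 - x) * u x"

text \<open>Elements of \<open>L\<^sup>p(M)\<close> are represented by complex-valued functions; identities between them
  are stated almost everywhere.\<close>

definition Lp :: "'a measure \<Rightarrow> real \<Rightarrow> ('a \<Rightarrow> complex) set" where
  "Lp M p = {f \<in> borel_measurable M. integrable M (\<lambda>x. cmod (f x) powr p)}"

definition Lp_norm :: "'a measure \<Rightarrow> real \<Rightarrow> ('a \<Rightarrow> complex) \<Rightarrow> real" where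
  "Lp_norm M p f = (\<integral>x. cmod (f x) powr p \<partial>M) powr (1 / p)"

definition L2_inner :: "'a measure \<Rightarrow> ('a \<Rightarrow> complex) \<Rightarrow> ('a \<Rightarrow> complex) \<Rightarrow> complex" where
  "L2_inner M f g = (\<integral>x. f x * cnj (g x) \<partial>M)"

definition Lp_tendsto ::
  "'a measure \<Rightarrow> real \<Rightarrow> (nat \<Rightarrow> 'a \<Rightarrow> complex) \<Rightarrow> ('a \<Rightarrow> complex) \<Rightarrow> bool" where
  "Lp_tendsto M p F f \<longleftrightarrow>
     (\<forall>n. F n \<in> Lp M p) \<and> f \<in> Lp M p \<and> (\<lambda>n. Lp_norm M p (\<lambda>x. F n x - f x)) \<longlonglongrightarrow> 0"

text \<open>No separate compatibility with almost everywhere equality is required: additivity,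
  homogeneity and the norm bound imply that \<open>T f = T g\<close> a.e. whenever \<open>f = g\<close> a.e.\<close>

definition bounded_linear_Lp ::
  "'a measure \<Rightarrow> real \<Rightarrow> (('a \<Rightarrow> complex) \<Rightarrow> 'a \<Rightarrow> complex) \<Rightarrow> bool" where
  "bounded_linear_Lp M p T \<longleftrightarrow>
     (\<forall>f \<in> Lp M p. T f \<in> Lp M p) \<and>
     (\<forall>f \<in> Lp M p. \<forall>g \<in> Lp M p. AE x in M. T (\<lambda>y. f y + g y) x = T f x + T g x) \<and>
     (\<forall>c. \<forall>f \<in> Lp M p. AE x in M. T (\<lambda>y. c * f y) x = c * T f x) \<and>
     (\<exists>C. \<forall>f \<in> Lp M p. Lp_norm M p (T f) \<le> C * Lp_norm M p f)"

text \<open>As for \<open>onorm\<close>, functions of norm \<open>0\<close> contribute the quotient \<open>0\<close>; the supremum is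
  meaningful when \<open>bounded_linear_Lp M p T\<close> holds.\<close>

definition Lp_onorm ::
  "'a measure \<Rightarrow> real \<Rightarrow> (('a \<Rightarrow> complex) \<Rightarrow> 'a \<Rightarrow> complex) \<Rightarrow> real" where
  "Lp_onorm M p T = (SUP f \<in> Lp M p. Lp_norm M p (T f) / Lp_norm M p f)"

definition riesz_partial_sum :: "real \<Rightarrow> (real \<Rightarrow> complex) \<Rightarrow> nat \<Rightarrow> real \<Rightarrow> complex" where
  "riesz_partial_sum \<nu> f N x =
     (\<Sum>n = 2..N. inverse (of_real (bessel_zero \<nu> n))
        * L2_inner (rho \<nu>) f (\<lambda>y. of_real (phi_check \<nu> n y))
        * of_real (d_check \<nu> (phi_check \<nu> n) x))"

text \<open>\<open>g\<close> represents the Riesz transform of \<open>f \<in> L\<^sup>2(d\<rho>\<^sub>\<nu>)\<close>: the defining series converges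
  to \<open>g\<close> in \<open>L\<^sup>2(d\<rho>\<^sub>\<nu>)\<close>. This determines \<open>g\<close> up to null sets.\<close>

definition is_riesz_transform :: "real \<Rightarrow> (real \<Rightarrow> complex) \<Rightarrow> (real \<Rightarrow> complex) \<Rightarrow> bool" where
  "is_riesz_transform \<nu> f g \<longleftrightarrow> Lp_tendsto (rho \<nu>) 2 (riesz_partial_sum \<nu> f) g"

definition bounded_riesz_extension ::
  "real \<Rightarrow> real \<Rightarrow> ((real \<Rightarrow> complex) \<Rightarrow> real \<Rightarrow> complex) \<Rightarrow> bool" where
  "bounded_riesz_extension \<nu> p T \<longleftrightarrow>
     bounded_linear_Lp (rho \<nu>) p T \<and>
     (\<forall>f \<in> Lp (rho \<nu>) 2 \<inter> Lp (rho \<nu>) p. is_riesz_transform \<nu> f (T f))"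

end

theory Submission
  imports Defs "HOL-Complex_Analysis.Great_Picard"
begin

text \<open>The transform maps \<open>\<phi>\<^sub>n\<close> to \<open>(\<surd>\<mu>\<^sub>n / \<lambda>\<^sub>n) \<chi>\<^sub>n\<close>, where \<open>\<mu>\<^sub>n = \<lambda>\<^sub>n\<^sup>2 - \<lambda>\<^sub>1\<^sup>2\<close> and the functions
  \<open>\<chi>\<^sub>n\<close> (\<open>n \<ge> 2\<close>) form a second orthonormal basis. For finite sums \<open>f\<close> of the \<open>\<phi>\<^sub>n\<close> and \<open>g\<close> of the \<open>\<chi>\<^sub>n\<close> let \<open>F\<close> and \<open>G\<close> be the
  Poisson extensions, damped by \<open>exp (- \<lambda>\<^sub>n t)\<close>. For a smooth Nazarov--Treil Bellman function \<open>B\<close> the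
  energy \<open>t \<mapsto> \<integral> B (F t) (G t) d\<rho>\<close> is so convex that it stays convex and bounded, hence decreasing,
  after adding a small multiple of a function whose value at \<open>0\<close> is the pairing of the transform of
  \<open>f\<close> with \<open>g\<close>. This bounds the pairing by \<open>10 (1 + \<surd>K) (p\<^sup>* - 1) \<parallel>f\<parallel>\<^sub>p \<parallel>g\<parallel>\<^sub>q\<close>. The same
  argument with \<open>B = |a|\<close> shows that both Poisson semigroups contract \<open>L\<^sup>1\<close>, so that Poisson means
  approximate bounded functions by finite sums in every \<open>L\<^sup>p\<close>, once both systems are known to be
  complete. Completeness of the Bessel functions is proved by maximising \<open>\<parallel>T u\<parallel>\<close> for the compact
  inverse \<open>T\<close> of the Bessel operator, and it passes to the \<open>\<chi>\<^sub>n\<close> by inverting the first-order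
  operator relating the two systems. Duality gives the \<open>L\<^sup>p\<close> bound for real functions; splitting into real and
  imaginary parts costs a factor \<open>2\<close>, and \<open>20 \<le> 48\<close>.\<close>

section \<open>The Bessel series\<close>

text \<open>\<open>d_check\<close> is \<open>d/dx + qq\<close>, where \<open>qq\<close> is minus the
  logarithmic derivative of the ground state \<open>phi 1\<close>. It annihilates
  \<open>phi 1\<close>, and on the other \<open>phi n\<close> it is a Darboux transformation: the
  \<open>chi n\<close> are eigenfunctions of a partner operator whose potential is larger by
  \<open>vv = 2 * R1 + a0 / x^2\<close>, with \<open>R1\<close> the derivative of \<open>R\<close>.
  Three facts about the ground state carry the analysis. By \<open>qq_squared_le\<close>,
  \<open>qq^2\<close> is at most \<open>K\<close> times the potential \<open>rr\<close> of the first
  equation; this is where \<open>K\<close> comes from. And \<open>U 1 x\<close> is at least a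
  multiple of \<open>1 - x\<close>, which controls division by it. The obstacle is that the
  coefficients are singular at both ends: the energy is therefore formed from finite sums and
  differentiated on compact subintervals only, and the boundary terms are shown to vanish. Finite
  sums in turn have to be dense, which is why completeness is needed. The 10 is
  \<open>8 * (1/8 + 9/8)\<close>: the coefficients \<open>1/8\<close> and \<open>9/8\<close> bound
  the Bellman function from above, and the 8 comes from its convexity constant
  \<open>(Q - 1) / 4\<close>.\<close>

definition bessel_coeff :: "real \<Rightarrow> nat \<Rightarrow> real" where
  "bessel_coeff \<nu> k = (-1/4) ^ k / (fact k * pochhammer (\<nu> + 1) k)"

text \<open>Normalised so that \<open>J\<^sub>\<nu>(s) = (s/2)\<^sup>\<nu> / \<Gamma>(\<nu>+1) \<cdot> bessel_A \<nu> (s\<^sup>2)\<close>.\<close>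

definition bessel_A :: "real \<Rightarrow> real \<Rightarrow> real" where
  "bessel_A \<nu> y = (\<Sum>k. bessel_coeff \<nu> k * y ^ k)"

text \<open>From \<open>\<nu> > -1/2\<close> every factor is at least \<open>1/2\<close>. Of the
  \<open>(1/4)^k\<close> in \<open>bessel_coeff\<close> this leaves \<open>(1/2)^k\<close>, enough
  for comparison with an exponential series.\<close>

lemma pochhammer_ge_half_power:
  fixes a :: real
  assumes "a \<ge> 1/2"
  shows "pochhammer a k \<ge> (1/2) ^ k"
proof (induction k)
  case (Suc k)
  have "(1/2::real) ^ k * (1/2) \<le> pochhammer a k * (a + real k)"
    using Suc assms by (intro mult_mono) (auto intro: pochhammer_nonneg)
  thus ?case by (simp add: pochhammer_Suc)
qed auto

lemma summable_bessel_coeff: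
  assumes "\<nu> > -1/2"
  shows "summable (\<lambda>k. bessel_coeff \<nu> k * y ^ k)"
proof (rule summable_comparison_test)
  show "summable (\<lambda>k. (\<bar>y\<bar> / 2) ^ k /\<^sub>R fact k)"
    by (rule summable_exp_generic)
  have "norm (bessel_coeff \<nu> k * y ^ k) \<le> (\<bar>y\<bar> / 2) ^ k /\<^sub>R fact k" for k
  proof -
    have p: "pochhammer (\<nu> + 1) k \<ge> (1/2) ^ k"
      using assms by (intro pochhammer_ge_half_power) auto
    hence p0: "pochhammer (\<nu> + 1) k > 0"
      using less_le_trans[OF zero_less_power[of "1/2::real" k]] by auto
    have "(1/4) ^ k \<le> (1/2) ^ k * pochhammer (\<nu> + 1) k"
      using mult_left_mono[OF p, of "(1/2) ^ k"] by (simp add: power_mult_distrib[symmetric])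
    hence "(1/4) ^ k / pochhammer (\<nu> + 1) k \<le> (1/2) ^ k"
      using p0 by (simp add: field_simps)
    hence "\<bar>y\<bar> ^ k / fact k * ((1/4) ^ k / pochhammer (\<nu> + 1) k) \<le> \<bar>y\<bar> ^ k / fact k * (1/2) ^ k"
      by (intro mult_left_mono) auto
    thus ?thesis
      using p0 by (simp add: bessel_coeff_def abs_mult power_abs field_simps)
  qed
  thus "\<exists>N. \<forall>k\<ge>N. norm (bessel_coeff \<nu> k * y ^ k) \<le> (\<bar>y\<bar> / 2) ^ k /\<^sub>R fact k" by blast
qed

text \<open>Differentiation raises the order by one; this is the series form of
  \<open>(x^(-\<nu>) J_\<nu>)' = - x^(-\<nu>) J_(\<nu>+1)\<close>.\<close>

lemma diffs_bessel_coeff: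
  assumes "\<nu> > -1/2"
  shows "diffs (bessel_coeff \<nu>) k = - 1 / (4 * (\<nu> + 1)) * bessel_coeff (\<nu> + 1) k"
proof -
  have "pochhammer (\<nu> + 1 + 1) k > 0"
    using assms by (intro pochhammer_pos) auto
  hence "real (Suc k) * ((-1/4) ^ Suc k / (real (Suc k) * fact k * ((\<nu> + 1) * pochhammer (\<nu> + 1 + 1) k)))
      = - 1 / (4 * (\<nu> + 1)) * ((-1/4) ^ k / (fact k * pochhammer (\<nu> + 1 + 1) k))"
    using assms by (simp del: of_nat_Suc)
  thus ?thesis
    by (simp add: diffs_def bessel_coeff_def pochhammer_rec del: of_nat_Suc)
qed

lemma bessel_A_deriv:
  assumes "\<nu> > -1/2"
  shows "DERIV (bessel_A \<nu>) y :> - bessel_A (\<nu> + 1) y / (4 * (\<nu> + 1))"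
proof -
  have "(bessel_A \<nu> has_field_derivative (\<Sum>k. diffs (bessel_coeff \<nu>) k * y ^ k)) (at y)"
    unfolding bessel_A_def
    by (rule termdiffs_strong_converges_everywhere) (rule summable_bessel_coeff[OF assms])
  also have "(\<Sum>k. diffs (bessel_coeff \<nu>) k * y ^ k)
      = (\<Sum>k. - 1 / (4 * (\<nu> + 1)) * (bessel_coeff (\<nu> + 1) k * y ^ k))"
    by (simp add: diffs_bessel_coeff[OF assms] mult.assoc)
  also have "... = - 1 / (4 * (\<nu> + 1)) * bessel_A (\<nu> + 1) y"
    unfolding bessel_A_def by (rule suminf_mult) (rule summable_bessel_coeff, use assms in auto)
  finally show ?thesis by simp
qed

lemma bessel_A_0 [simp]: "bessel_A \<nu> 0 = 1"
  by (simp add: bessel_A_def bessel_coeff_def powser_zero del: times_divide_eq_left)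

text \<open>This is the three-term recurrence of Bessel functions. The factor \<open>y\<close>
  shifts the series of order \<open>\<nu> + 2\<close> by one index, which turns its coefficients
  into \<open>k\<close> times those of order \<open>\<nu> + 1\<close>; the identity then holds
  coefficient by coefficient.\<close>

lemma bessel_A_contiguous:
  assumes "\<nu> > -1/2"
  shows "(\<nu> + 1) * bessel_A (\<nu> + 1) y - y * bessel_A (\<nu> + 2) y / (4 * (\<nu> + 2))
           = (\<nu> + 1) * bessel_A \<nu> y"
proof -
  have nu1: "\<nu> + 1 > -1/2" using assms by auto
  let ?c = "bessel_coeff (\<nu> + 1)"
  have s0: "(\<lambda>k. ?c k * y ^ k) sums bessel_A (\<nu> + 1) y"
    unfolding bessel_A_def using summable_bessel_coeff[OF nu1] by (rule summable_sums)
  have s1: "(\<lambda>k. bessel_coeff \<nu> k * y ^ k) sums bessel_A \<nu> y"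
    unfolding bessel_A_def using summable_bessel_coeff[OF assms] by (rule summable_sums)
  have nu2: "\<nu> + 2 > -1/2" using assms by auto
  have "(\<lambda>k. bessel_coeff (\<nu> + 2) k * y ^ k) sums bessel_A (\<nu> + 2) y"
    unfolding bessel_A_def using summable_bessel_coeff[OF nu2] by (rule summable_sums)
  hence "(\<lambda>k. (- y / (4 * (\<nu> + 2))) * (bessel_coeff (\<nu> + 2) k * y ^ k)) sums
      ((- y / (4 * (\<nu> + 2))) * bessel_A (\<nu> + 2) y)"
    by (rule sums_mult)
  moreover have "(- y / (4 * (\<nu> + 2))) * (bessel_coeff (\<nu> + 2) k * y ^ k)
      = real (Suc k) * ?c (Suc k) * y ^ Suc k" for k
    using diffs_bessel_coeff[OF nu1, of k] by (simp add: diffs_def add.assoc)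
  ultimately have "(\<lambda>k. real (Suc k) * ?c (Suc k) * y ^ Suc k) sums
      ((- y / (4 * (\<nu> + 2))) * bessel_A (\<nu> + 2) y)" by simp
  hence s2: "(\<lambda>k. real k * ?c k * y ^ k) sums ((- y / (4 * (\<nu> + 2))) * bessel_A (\<nu> + 2) y)"
    by (subst (asm) sums_Suc_iff) simp
  have "(\<lambda>k. (\<nu> + 1) * (?c k * y ^ k) + real k * ?c k * y ^ k) sums
      ((\<nu> + 1) * bessel_A (\<nu> + 1) y + (- y / (4 * (\<nu> + 2))) * bessel_A (\<nu> + 2) y)"
    by (intro sums_add sums_mult s0 s2)
  moreover have "(\<nu> + 1) * (?c k * y ^ k) + real k * ?c k * y ^ k
      = (\<nu> + 1) * (bessel_coeff \<nu> k * y ^ k)" for k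
  proof -
    have "pochhammer (\<nu> + 1) (Suc k) = (\<nu> + 1) * pochhammer (\<nu> + 1 + 1) k"
      by (simp add: pochhammer_rec)
    hence *: "(\<nu> + 1) * pochhammer (\<nu> + 1 + 1) k = pochhammer (\<nu> + 1) k * (\<nu> + 1 + real k)"
      by (simp add: pochhammer_Suc)
    have "pochhammer (\<nu> + 1) k > 0" "pochhammer (\<nu> + 1 + 1) k > 0"
      using assms by (auto intro!: pochhammer_pos)
    moreover have "\<nu> + 1 + real k \<noteq> 0" using assms by auto
    ultimately have "(\<nu> + 1 + real k) / pochhammer (\<nu> + 1 + 1) k = (\<nu> + 1) / pochhammer (\<nu> + 1) k"
      using * by (simp add: field_simps)
    moreover have "(\<nu> + 1) * (?c k * y ^ k) + real k * ?c k * y ^ k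
      = (-1/4) ^ k / fact k * y ^ k * ((\<nu> + 1 + real k) / pochhammer (\<nu> + 1 + 1) k)"
      by (simp add: bessel_coeff_def add_divide_distrib distrib_left distrib_right mult_ac)
    ultimately show ?thesis by (simp add: bessel_coeff_def field_simps)
  qed
  moreover have "(\<lambda>k. (\<nu> + 1) * (bessel_coeff \<nu> k * y ^ k)) sums ((\<nu> + 1) * bessel_A \<nu> y)"
    by (intro sums_mult s1)
  ultimately have "(\<nu> + 1) * bessel_A (\<nu> + 1) y + (- y / (4 * (\<nu> + 2))) * bessel_A (\<nu> + 2) y
     = (\<nu> + 1) * bessel_A \<nu> y"
    using sums_unique2 by fastforce
  thus ?thesis by simp
qed

lemma bessel_J_eq:
  assumes "\<nu> > -1/2" "s > 0"
  shows "bessel_J \<nu> s = (s / 2) powr \<nu> / Gamma (\<nu> + 1) * bessel_A \<nu> (s^2)"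
proof -
  have "bessel_J \<nu> s = (\<Sum>k. (s / 2) powr \<nu> / Gamma (\<nu> + 1) * (bessel_coeff \<nu> k * (s^2) ^ k))"
    unfolding bessel_J_def
  proof (rule suminf_cong)
    fix k
    have "\<nu> + 1 \<notin> \<int>\<^sub>\<le>\<^sub>0" using assms by (auto elim!: nonpos_Ints_cases)
    hence "Gamma (real k + \<nu> + 1) = pochhammer (\<nu> + 1) k * Gamma (\<nu> + 1)"
      using pochhammer_Gamma[of "\<nu> + 1" k] order_less_imp_not_eq2[OF Gamma_real_pos[of "\<nu> + 1"]] assms
      by (simp add: add_ac)
    moreover have "(s / 2) powr (2 * real k + \<nu>) = (s / 2) powr \<nu> * ((1/4) ^ k * (s^2) ^ k)"
    proof -
      have "(s / 2) powr (2 * real k) = (s / 2) ^ (2 * k)"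
        using assms by (subst powr_realpow[symmetric]) auto
      also have "... = (1/4) ^ k * (s^2) ^ k"
        by (simp add: power_mult power_mult_distrib[symmetric] power2_eq_square)
      finally show ?thesis by (simp add: powr_add)
    qed
    moreover have "(-1/4::real) ^ k = (-1) ^ k * (1/4) ^ k"
      by (simp add: power_mult_distrib[symmetric])
    ultimately show "(- 1) ^ k / (fact k * Gamma (real k + \<nu> + 1)) * (s / 2) powr (2 * real k + \<nu>) =
         (s / 2) powr \<nu> / Gamma (\<nu> + 1) * (bessel_coeff \<nu> k * (s^2) ^ k)"
      by (simp add: bessel_coeff_def mult_ac)
  qed
  also have "... = (s / 2) powr \<nu> / Gamma (\<nu> + 1) * bessel_A \<nu> (s^2)"
    unfolding bessel_A_def by (rule suminf_mult) (rule summable_bessel_coeff[OF assms(1)])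
  finally show ?thesis .
qed

section \<open>The regular solution of the Bessel equation\<close>

locale bessel =
  fixes \<nu> :: real
  assumes nu: "\<nu> > -1/2"
begin

text \<open>\<open>reg_p z = - (reg_u z)' / z\<close>, defined so as to make sense for \<open>z = 0\<close> as well.\<close>

definition reg_u :: "real \<Rightarrow> real \<Rightarrow> real" where
  "reg_u z x = bessel_A \<nu> (z * x^2)"

definition reg_p :: "real \<Rightarrow> real \<Rightarrow> real" where
  "reg_p z x = x * bessel_A (\<nu> + 1) (z * x^2) / (2 * (\<nu> + 1))"

lemma reg_u_deriv: "DERIV (reg_u z) x :> - z * reg_p z x"
proof -
  have "DERIV (\<lambda>x. z * x^2) x :> z * (2 * x)"
    by (auto intro!: derivative_eq_intros)
  from DERIV_chain2[OF bessel_A_deriv[OF nu] this]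
  moreover have "- bessel_A (\<nu> + 1) (z * x^2) / (4 * (\<nu> + 1)) * (z * (2 * x))
      = - z * (x * bessel_A (\<nu> + 1) (z * x^2) / (2 * (\<nu> + 1)))"
    using nu by (simp add: divide_simps)
  ultimately show ?thesis unfolding reg_u_def[abs_def] reg_p_def by simp
qed

text \<open>The contiguous relation turns the order \<open>\<nu> + 2\<close> produced by
  differentiation back into \<open>\<nu>\<close>. Together with \<open>reg_u_deriv\<close> this is
  the equation \<open>u'' + (2 \<nu> + 1)/x u' + z u = 0\<close>. The parameter \<open>z\<close> is
  arbitrary because completeness uses solutions at values not yet known to be eigenvalues.\<close>

lemma reg_p_deriv:
  assumes "x \<noteq> 0"
  shows "DERIV (reg_p z) x :> reg_u z x - (2 * \<nu> + 1) / x * reg_p z x"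
proof -
  have nu1: "\<nu> + 1 > -1/2" using nu by auto
  have "DERIV (reg_p z) x :> (bessel_A (\<nu> + 1) (z * x^2)
      + x * (- bessel_A (\<nu> + 1 + 1) (z * x^2) / (4 * (\<nu> + 1 + 1)) * (z * (2 * x)))) / (2 * (\<nu> + 1))"
  proof -
    have "DERIV (\<lambda>x. z * x^2) x :> z * (2 * x)"
      by (auto intro!: derivative_eq_intros)
    from DERIV_chain2[OF bessel_A_deriv[OF nu1] this]
    show ?thesis unfolding reg_p_def[abs_def]
      by (intro derivative_eq_intros) (use nu in auto)
  qed
  moreover have "(bessel_A (\<nu> + 1) (z * x^2)
      + x * (- bessel_A (\<nu> + 1 + 1) (z * x^2) / (4 * (\<nu> + 1 + 1)) * (z * (2 * x)))) / (2 * (\<nu> + 1))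
      = reg_u z x - (2 * \<nu> + 1) / x * reg_p z x"
  proof -
    define a b c where "a = bessel_A (\<nu> + 1) (z * x^2)" and "b = z * x^2 * bessel_A (\<nu> + 2) (z * x^2) / (4 * (\<nu> + 2))"
      and "c = bessel_A \<nu> (z * x^2)"
    have *: "b = (\<nu> + 1) * a - (\<nu> + 1) * c"
      using bessel_A_contiguous[OF nu, of "z * x^2"] unfolding a_def b_def c_def by linarith
    have "(bessel_A (\<nu> + 1) (z * x^2)
      + x * (- bessel_A (\<nu> + 1 + 1) (z * x^2) / (4 * (\<nu> + 1 + 1)) * (z * (2 * x)))) / (2 * (\<nu> + 1))
      = (a - 2 * b) / (2 * (\<nu> + 1))"
      unfolding a_def b_def by (simp add: add.assoc power2_eq_square)
    also have "... = c - (2 * \<nu> + 1) * a / (2 * (\<nu> + 1))"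
      unfolding * using nu by (simp add: field_simps)
    also have "... = reg_u z x - (2 * \<nu> + 1) / x * reg_p z x"
      using assms unfolding reg_u_def reg_p_def a_def c_def by simp
    finally show ?thesis .
  qed
  ultimately show ?thesis by simp
qed

lemma reg_u_0 [simp]: "reg_u z 0 = 1" and reg_p_0 [simp]: "reg_p z 0 = 0"
  by (simp_all add: reg_u_def reg_p_def)

lemma isCont_bessel_A: "\<mu> > -1/2 ==> isCont (bessel_A \<mu>) y"
  using bessel_A_deriv DERIV_isCont by blast

lemma continuous_on_reg_u [continuous_intros]: "continuous_on S (reg_u z)"
  by (rule continuous_at_imp_continuous_on) (use reg_u_deriv DERIV_isCont in blast)

lemma continuous_on_reg_p [continuous_intros]: "continuous_on S (reg_p z)"
proof -
  have "continuous_on UNIV (bessel_A (\<nu> + 1))"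
    using nu by (intro continuous_at_imp_continuous_on ballI isCont_bessel_A) auto
  hence "continuous_on S (\<lambda>x. bessel_A (\<nu> + 1) (z * x^2))"
    by (rule continuous_on_compose2) (auto intro!: continuous_intros)
  thus ?thesis unfolding reg_p_def by (intro continuous_intros) (use nu in auto)
qed

lemma reg_u_scale: "reg_u (c^2) x = reg_u 1 (c * x)"
  and reg_p_scale: "c * reg_p (c^2) x = reg_p 1 (c * x)"
  by (simp_all add: reg_u_def reg_p_def power_mult_distrib)

end

section \<open>Energy estimates and zeros\<close>

text \<open>The term \<open>a/x * y1\<close> acts as friction: the energy has derivative
  \<open>- 2 a/x (y1)^2\<close>.\<close>

lemma bessel_energy_decreasing:
  fixes y y1 :: "real \<Rightarrow> real"
  assumes a: "a \<ge> 0" and st: "0 \<le> s" "s \<le> t"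
    and y: "\<And>x. s < x ==> x < t ==> DERIV y x :> y1 x"
    and y1: "\<And>x. s < x ==> x < t ==> DERIV y1 x :> - (a / x) * y1 x - z * y x"
    and cont: "continuous_on {s..t} y" "continuous_on {s..t} y1"
  shows "(y1 t)^2 + z * (y t)^2 \<le> (y1 s)^2 + z * (y s)^2"
proof (cases "s = t")
  case False
  show ?thesis
  proof (rule DERIV_nonpos_imp_decreasing_open[of s t "\<lambda>x. (y1 x)^2 + z * (y x)^2"])
    show "s \<le> t" by fact
    show "continuous_on {s..t} (\<lambda>x. (y1 x)^2 + z * (y x)^2)"
      by (intro continuous_intros cont)
    fix x assume x: "s < x" "x < t"
    have "DERIV (\<lambda>x. (y1 x)^2 + z * (y x)^2) x :>
        2 * y1 x * (- (a / x) * y1 x - z * y x) + z * (2 * y x * y1 x)"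
      by (auto intro!: derivative_eq_intros y y1 x)
    moreover have "2 * y1 x * (- (a / x) * y1 x - z * y x) + z * (2 * y x * y1 x)
        = - (2 * (a / x) * (y1 x)^2)"
      by (simp add: algebra_simps power2_eq_square)
    moreover have "2 * (a / x) * (y1 x)^2 \<ge> 0"
      using a x st by (intro mult_nonneg_nonneg) auto
    ultimately show "\<exists>d. DERIV (\<lambda>x. (y1 x)^2 + z * (y x)^2) x :> d \<and> d \<le> 0"
      by (intro exI conjI) (assumption, linarith)
  qed
qed simp

text \<open>The weight over-compensates the friction and leaves the derivative
  \<open>2 a z x^(2a-1) y^2\<close>. This direction gives lower bounds at larger arguments and, read
  backwards, uniqueness from data at the right end.\<close>

lemma bessel_energy_increasing:
  fixes y y1 :: "real \<Rightarrow> real"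
  assumes a: "a \<ge> 0" "z \<ge> 0" and st: "0 < s" "s \<le> t"
    and y: "\<And>x. s < x ==> x < t ==> DERIV y x :> y1 x"
    and y1: "\<And>x. s < x ==> x < t ==> DERIV y1 x :> - (a / x) * y1 x - z * y x"
    and cont: "continuous_on {s..t} y" "continuous_on {s..t} y1"
  shows "s powr (2 * a) * ((y1 s)^2 + z * (y s)^2) \<le> t powr (2 * a) * ((y1 t)^2 + z * (y t)^2)"
proof (cases "s = t")
  case False
  show ?thesis
  proof (rule DERIV_nonneg_imp_increasing_open[of s t "\<lambda>x. x powr (2 * a) * ((y1 x)^2 + z * (y x)^2)"])
    show "s \<le> t" by fact
    show "continuous_on {s..t} (\<lambda>x. x powr (2 * a) * ((y1 x)^2 + z * (y x)^2))"
      by (intro continuous_intros cont) (use st in auto)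
    fix x assume x: "s < x" "x < t"
    hence x0: "x > 0" using st by auto
    have p: "x powr (2 * a - 1) = x powr (2 * a) / x"
      using x0 by (simp add: powr_diff)
    have "DERIV (\<lambda>x. x powr (2 * a) * ((y1 x)^2 + z * (y x)^2)) x :>
        (2 * a) * x powr (2 * a - 1) * ((y1 x)^2 + z * (y x)^2) + x powr (2 * a) *
        (2 * y1 x * (- (a / x) * y1 x - z * y x) + z * (2 * y x * y1 x))"
      by (rule derivative_eq_intros y y1 x refl | use x0 in \<open>force simp: p\<close>)+
    moreover have "(2 * a) * x powr (2 * a - 1) * ((y1 x)^2 + z * (y x)^2) + x powr (2 * a) *
        (2 * y1 x * (- (a / x) * y1 x - z * y x) + z * (2 * y x * y1 x))
        = x powr (2 * a) / x * (2 * a * z * (y x)^2)"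
      unfolding p using x0 by (simp add: field_simps power2_eq_square)
    moreover have "x powr (2 * a) / x * (2 * a * z * (y x)^2) \<ge> 0"
      using a x0 by (intro mult_nonneg_nonneg divide_nonneg_pos) auto
    ultimately show "\<exists>d. DERIV (\<lambda>x. x powr (2 * a) * ((y1 x)^2 + z * (y x)^2)) x :> d \<and> d \<ge> 0"
      by (intro exI conjI) (assumption, linarith)
  qed
qed simp

declare bessel_zero.simps(2) [simp del]

section \<open>The normalised Bessel function \<open>jj\<close> and its zeros\<close>

context bessel
begin

abbreviation "jj \<equiv> reg_u 1"
abbreviation "jp \<equiv> reg_p 1"
abbreviation "lam \<equiv> bessel_zero \<nu>"

lemma jj_deriv: "DERIV jj x :> - jp x"
  using reg_u_deriv[of 1 x] by simp

lemma mjp_deriv: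
  assumes "x \<noteq> 0"
  shows "DERIV (\<lambda>x. - jp x) x :> - ((2 * \<nu> + 1) / x) * (- jp x) - 1 * jj x"
  using DERIV_minus[OF reg_p_deriv[OF assms, of 1]] by simp

lemma jj_energy_decreasing:
  assumes "0 \<le> s" "s \<le> t"
  shows "(jp t)^2 + (jj t)^2 \<le> (jp s)^2 + (jj s)^2"
  using bessel_energy_decreasing[OF _ assms jj_deriv mjp_deriv] nu assms
  by (auto intro!: continuous_intros)

lemma jj_energy_increasing:
  assumes "0 < s" "s \<le> t"
  shows "s powr (2 * (2 * \<nu> + 1)) * ((jp s)^2 + (jj s)^2) \<le> t powr (2 * (2 * \<nu> + 1)) * ((jp t)^2 + (jj t)^2)"
  using bessel_energy_increasing[OF _ _ assms jj_deriv mjp_deriv] nu assms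
  by (auto intro!: continuous_intros)

lemma jj_energy_le_1: "0 \<le> s ==> (jp s)^2 + (jj s)^2 \<le> 1"
  using jj_energy_decreasing[of 0 s] by simp

lemma jj_le_1: "0 \<le> s ==> \<bar>jj s\<bar> \<le> 1" and jp_le_1: "0 \<le> s ==> \<bar>jp s\<bar> \<le> 1"
proof -
  assume "0 \<le> s"
  from jj_energy_le_1[OF this] have "(jj s)^2 \<le> 1" "(jp s)^2 \<le> 1"
    using zero_le_power2[of "jj s"] zero_le_power2[of "jp s"] by linarith+
  thus "\<bar>jj s\<bar> \<le> 1" "\<bar>jp s\<bar> \<le> 1" by (simp_all add: abs_square_le_1)
qed

text \<open>Near 0 the energy is positive because \<open>jj 0 = 1\<close>, and the weighted energy
  increases from there. Hence \<open>jj\<close> and \<open>jp\<close> have no common zero and the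
  zeros of \<open>jj\<close> are simple.\<close>

lemma jj_energy_pos: 
  assumes "0 \<le> s" shows "(jp s)^2 + (jj s)^2 > 0"
proof (cases "s = 0")
  case False
  hence s: "s > 0" using assms by auto
  have "isCont jj 0" using jj_deriv DERIV_isCont by blast
  hence "(jj \<longlongrightarrow> jj 0) (at_right 0)" by (simp add: isCont_def filterlim_at_split)
  hence "eventually (\<lambda>x. jj x > 0) (at_right 0)"
    by (rule order_tendstoD(1)) simp
  moreover have "eventually (\<lambda>x. 0 < x \<and> x < s) (at_right (0::real))"
    using s by (auto simp: eventually_at_right_field)
  ultimately have "eventually (\<lambda>x. jj x > 0 \<and> 0 < x \<and> x < s) (at_right 0)"
    by eventually_elim auto
  then obtain x where x: "jj x > 0" "0 < x" "x < s"
    using eventually_happens'[OF trivial_limit_at_right_real] by blast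
  have "0 < x powr (2 * (2 * \<nu> + 1)) * ((jp x)^2 + (jj x)^2)"
    using x by (intro mult_pos_pos add_nonneg_pos) auto
  also have "... \<le> s powr (2 * (2 * \<nu> + 1)) * ((jp s)^2 + (jj s)^2)"
    using x by (intro jj_energy_increasing) auto
  finally show ?thesis using s by (simp add: zero_less_mult_iff)
qed auto

text \<open>Rolle's theorem gives a point \<open>z\<close> between the zeros with
  \<open>jp z = 0\<close>. The decreasing energy bounds \<open>|jj z|\<close> by
  \<open>(z - c) * |jp c|\<close>, while the increasing one bounds it from below by
  \<open>(c / z) powr a * |jp c|\<close>; so \<open>z - c\<close> cannot be small.\<close>

lemma jj_zero_gap:
  assumes c: "c > 0" "jj c = 0" and x: "c < x" "jj x = 0"
  shows "x - c \<ge> min (2 powr (- (2 * \<nu> + 1))) c"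
proof -
  define a where "a = 2 * \<nu> + 1"
  have a: "a > 0" using nu by (simp add: a_def)
  obtain z where z: "c < z" "z < x" "jp z = 0"
    using MVT2[of c x jj "\<lambda>x. - jp x"] c x jj_deriv by auto
  define E where "E = (jp c)^2"
  have E: "E > 0" using jj_energy_pos[of c] c by (simp add: E_def)
  have "\<exists>y. c < y \<and> y < z \<and> jj z - jj c = (z - c) * (- jp y)"
    using MVT2[OF z(1), of jj "\<lambda>x. - jp x"] jj_deriv by auto
  then obtain y where y: "c < y" "y < z" "jj z = - (z - c) * jp y"
    using c(2) by (metis diff_zero minus_mult_minus minus_minus mult_minus_left)
  have "(jp y)^2 \<le> E"
  proof -
    have "(jp y)^2 + (jj y)^2 \<le> (jp c)^2"
      using jj_energy_decreasing[of c y] y c by simp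
    thus ?thesis unfolding E_def using zero_le_power2[of "jj y"] by linarith
  qed
  hence 1: "(jj z)^2 \<le> (z - c)^2 * E"
    using y(3) by (simp add: power_mult_distrib mult_left_mono power2_commute[of c])
  have 2: "c powr (2 * a) * E \<le> z powr (2 * a) * (jj z)^2"
    using jj_energy_increasing[of c z] c z by (simp add: a_def E_def)
  also have "... \<le> z powr (2 * a) * ((z - c)^2 * E)"
    by (intro mult_left_mono 1) auto
  finally have 3: "c powr (2 * a) \<le> z powr (2 * a) * (z - c)^2"
    using E by (simp add: mult.assoc[symmetric])
  \<comment> \<open>For \<open>z \<le> 2 * c\<close> the ratio \<open>c / z\<close> is at least
    \<open>1/2\<close>, which gives the first bound; beyond \<open>2 * c\<close> the distance itself
    exceeds \<open>c\<close>.\<close>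
  have "z - c \<ge> min (2 powr (- a)) c"
  proof (cases "z \<le> 2 * c")
    case True
    have "c powr (2 * a) \<le> (2 * c) powr (2 * a) * (z - c)^2"
      using 3 by (rule order_trans) (intro mult_right_mono powr_mono2, use True a c z in auto)
    also have "... = c powr (2 * a) * (2 powr a * (z - c))^2"
    proof -
      have "(2::real) powr (2 * a) = (2 powr a)^2"
        by (simp add: power2_eq_square flip: powr_add)
      thus ?thesis using c by (simp add: powr_mult power_mult_distrib)
    qed
    finally have "1 \<le> (2 powr a * (z - c))^2" using c by simp
    hence "1 \<le> 2 powr a * (z - c)"
      using z by (simp add: power2_nonneg_ge_1_iff)
    hence "2 powr (- a) \<le> z - c" by (simp add: powr_minus field_simps)
    thus ?thesis by (rule min.coboundedI1)
  next
    case False thus ?thesis by auto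
  qed
  thus ?thesis using z by (simp add: a_def)
qed

text \<open>Sturm comparison of \<open>\<surd>s J\<^sub>\<nu>(s)\<close> with \<open>sin (s/2)\<close>.\<close>

lemma jj_zeros_unbounded: "\<exists>x>a. jj x = 0"
proof (rule ccontr)
  assume "\<not> ?thesis"
  hence nz: "jj x \<noteq> 0" if "x > a" for x using that by auto
  define b where "b = \<nu> + 1/2"
  \<comment> \<open>The function \<open>u = x powr b * jj x\<close> satisfies
    \<open>u'' = (b (b - 1)/x^2 - 1) u\<close>. For \<open>x \<ge> c > b^2 + 2\<close> one has
    \<open>b (b - 1)/x^2 \<le> 3/4\<close>, so \<open>u\<close> oscillates at least as fast as
    \<open>sin (x/2)\<close>.\<close>
  define c where "c = max (max a 1) (b^2 + 2) + 1"
  have c: "c > a" "c > 1" "c > b^2 + 2" by (auto simp: c_def)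
  define e where "e = sgn (jj c)"
  have pos: "e * jj x > 0" if "x \<ge> c" for x
  proof (rule ccontr)
    assume neg: "\<not> e * jj x > 0"
    have "e * jj c > 0" using nz[of c] c by (cases "jj c > 0") (auto simp: e_def sgn_real_def)
    hence "\<exists>t\<ge>c. t \<le> x \<and> e * jj t = 0"
      using neg that by (intro IVT2) (auto intro!: continuous_intros DERIV_isCont[OF jj_deriv])
    thus False using nz c \<open>e * jj c > 0\<close> by force
  qed
  define u where "u = (\<lambda>x. x powr b * jj x)"
  define u1 where "u1 = (\<lambda>x. b * x powr (b - 1) * jj x - x powr b * jp x)"
  \<comment> \<open>The Wronskian of \<open>u\<close> and the sine, with the sign of
    \<open>u\<close>. The sine vanishes at \<open>c\<close> and \<open>c + 2 pi\<close>; without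
    zeros of \<open>jj\<close>, \<open>W\<close> would be negative at \<open>c\<close> and positive
    at \<open>c + 2 pi\<close>, yet nonincreasing in between.\<close>
  define W where "W = (\<lambda>x. e * (u1 x * sin ((x - c) / 2) - u x * (cos ((x - c) / 2) / 2)))"
  have "W (c + 2 * pi) \<le> W c"
  proof (rule DERIV_nonpos_imp_nonincreasing[of c "c + 2 * pi" W])
    fix x assume x: "c \<le> x" "x \<le> c + 2 * pi"
    have x0: "x > 0" using x c by auto
    have p1: "x powr (b - 1) = x powr b / x" and p2: "x powr (b - 2) = x powr b / x^2"
      using x0 by (simp_all add: powr_diff)
    have d1: "DERIV u x :> u1 x"
      unfolding u_def u1_def
      by (rule derivative_eq_intros jj_deriv refl | use x0 in \<open>force simp: p1\<close>)+
    have p3: "x powr (b - 1 - 1) = x powr b / x^2" using p2 by (simp add: diff_diff_eq)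
    have d2: "DERIV u1 x :> (b * (b - 1) / x^2 - 1) * u x"
    proof -
      have "DERIV u1 x :> b * ((b - 1) * x powr (b - 1 - 1)) * jj x + b * x powr (b - 1) * (- jp x)
          - (b * x powr (b - 1) * jp x + x powr b * (jj x - (2 * \<nu> + 1) / x * jp x))"
        unfolding u1_def
        by (rule derivative_eq_intros jj_deriv reg_p_deriv refl |
            use x0 in \<open>force simp: p1 p3 field_simps power2_eq_square\<close>)+
      moreover have "b * ((b - 1) * x powr (b - 1 - 1)) * jj x + b * x powr (b - 1) * (- jp x)
          - (b * x powr (b - 1) * jp x + x powr b * (jj x - (2 * \<nu> + 1) / x * jp x))
          = (b * (b - 1) / x^2 - 1) * u x"
      proof -
        have "(2 * \<nu> + 1) = 2 * b" by (simp add: b_def)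
        thus ?thesis unfolding p1 p3 u_def using x0
          by (simp only:) (simp add: field_simps power2_eq_square)
      qed
      ultimately show ?thesis by simp
    qed
    have "DERIV W x :> e * ((b * (b - 1) / x^2 - 1) * u x * sin ((x - c) / 2)
        + u1 x * (cos ((x - c) / 2) / 2) - (u1 x * (cos ((x - c) / 2) / 2) + u x * (- sin ((x - c) / 2) / 4)))"
      unfolding W_def by (auto intro!: derivative_eq_intros d1 d2 simp: diff_divide_distrib)
    moreover have "e * ((b * (b - 1) / x^2 - 1) * u x * sin ((x - c) / 2)
        + u1 x * (cos ((x - c) / 2) / 2) - (u1 x * (cos ((x - c) / 2) / 2) + u x * (- sin ((x - c) / 2) / 4)))
        = (e * u x) * sin ((x - c) / 2) * (b * (b - 1) / x^2 - 3/4)"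
      by (simp add: algebra_simps)
    moreover have "(e * u x) * sin ((x - c) / 2) * (b * (b - 1) / x^2 - 3/4) \<le> 0"
    proof -
      have "e * u x \<ge> 0"
        using mult_nonneg_nonneg[OF less_imp_le[OF pos[OF x(1)]], of "x powr b"]
        by (simp add: u_def mult_ac)
      moreover have "sin ((x - c) / 2) \<ge> 0"
        using x by (intro sin_ge_zero) auto
      moreover have "b * (b - 1) / x^2 \<le> 3/4"
      proof -
        have al: "b > 0" using nu by (simp add: b_def)
        have "b * (b - 1) \<le> b^2" using al by (simp add: power2_eq_square algebra_simps)
        also have "... \<le> x - 2" using x c by auto
        also have "... \<le> 3/4 * x^2"
        proof -
          have "0 \<le> (x - 2) * (x - 2)" by simp
          hence "4 * x \<le> x * x + 4" by (simp add: algebra_simps)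
          moreover have "0 \<le> x * x" by simp
          ultimately show ?thesis unfolding power2_eq_square by linarith
        qed
        finally show ?thesis using x0 by (simp add: field_simps)
      qed
      ultimately show ?thesis
        by (intro mult_nonneg_nonpos[OF mult_nonneg_nonneg[of "e * u x"]]) auto
    qed
    ultimately show "\<exists>y. DERIV W x :> y \<and> y \<le> 0" by force
  qed simp
  moreover have "W c = - (e * jj c * c powr b / 2)" by (simp add: W_def u_def)
  moreover have "W (c + 2 * pi) = (e * jj (c + 2 * pi)) * (c + 2 * pi) powr b / 2"
    by (simp add: W_def u_def mult_ac)
  moreover have "e * jj c * c powr b / 2 > 0" using pos[of c] c by simp
  moreover have "(e * jj (c + 2 * pi)) * (c + 2 * pi) powr b / 2 > 0"
  proof -
    have "c + 2 * pi > 0" using c pi_gt_zero by linarith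
    thus ?thesis by (intro divide_pos_pos mult_pos_pos[of "e * jj (c + 2 * pi)"] pos) auto
  qed
  ultimately show False by linarith
qed

lemma bessel_J_zero_iff:
  assumes "x > 0"
  shows "bessel_J \<nu> x = 0 \<longleftrightarrow> jj x = 0"
proof -
  have "Gamma (\<nu> + 1) > 0" using nu by (intro Gamma_real_pos) auto
  thus ?thesis using assms unfolding bessel_J_eq[OF nu assms] by (simp add: reg_u_def)
qed

text \<open>The zero set is closed, so only zeros accumulating at \<open>c\<close> from the right
  could prevent a least one. The gap lemma excludes this for a zero \<open>c > 0\<close>, and
  \<open>jj 0 = 1\<close> excludes it for \<open>c = 0\<close>.\<close>

lemma jj_least_zero:
  assumes "c = 0 \<or> c > 0 \<and> jj c = 0"
  obtains x where "c < x" "jj x = 0" "\<And>y. c < y ==> jj y = 0 ==> x \<le> y"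
proof -
  define S where "S = {x. c < x \<and> jj x = 0}"
  have ne: "S \<noteq> {}" using jj_zeros_unbounded[of c] by (auto simp: S_def)
  have bdd: "bdd_below S" by (auto simp: S_def intro!: bdd_belowI[of _ c])
  have "closed {x. jj x = 0}"
    by (intro closed_Collect_eq continuous_intros)
  moreover have "Inf S \<in> closure S" by (rule closure_contains_Inf[OF ne bdd])
  ultimately have z: "jj (Inf S) = 0"
    using closure_minimal[of S "{x. jj x = 0}"] by (auto simp: S_def)
  have ge: "c \<le> Inf S" using ne by (intro cInf_greatest) (auto simp: S_def)
  have "c \<noteq> Inf S"
  proof
    assume eq: "c = Inf S"
    hence c: "c > 0" "jj c = 0" using z assms by auto
    define g where "g = min (2 powr (- (2 * \<nu> + 1))) c"
    have "c + g \<le> Inf S"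
      using ne jj_zero_gap[OF c] by (intro cInf_greatest) (force simp: S_def g_def)+
    moreover have "g > 0" using c by (simp add: g_def)
    ultimately show False using eq by simp
  qed
  with ge have "c < Inf S" by simp
  thus ?thesis using z cInf_lower[OF _ bdd] by (intro that[of "Inf S"]) (auto simp: S_def)
qed

text \<open>The induction carries the alternative \<open>0\<close> or positive zero, since the
  recursion starts at \<open>0\<close>, where \<open>jj\<close> does not vanish; in both cases
  \<open>jj_least_zero\<close> shows that the \<open>LEAST\<close> in \<open>bessel_zero\<close> is
  attained.\<close>

lemma lam_Suc:
  shows "0 \<le> lam n" "lam n < lam (Suc n)" "jj (lam (Suc n)) = 0"
    "\<And>y. lam n < y ==> jj y = 0 ==> lam (Suc n) \<le> y"
proof -
  have step: "c < bessel_zero \<nu> (Suc m) \<and> jj (bessel_zero \<nu> (Suc m)) = 0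
      \<and> (\<forall>y. c < y \<and> jj y = 0 \<longrightarrow> bessel_zero \<nu> (Suc m) \<le> y)"
    if c: "c = bessel_zero \<nu> m" "c = 0 \<or> c > 0 \<and> jj c = 0" for m c
  proof -
    obtain x where x: "c < x" "jj x = 0" "\<And>y. c < y ==> jj y = 0 ==> x \<le> y"
      using jj_least_zero[OF c(2)] by blast
    have "c \<ge> 0" using c by auto
    hence "bessel_zero \<nu> (Suc m) = x"
      using x unfolding bessel_zero.simps c(1)[symmetric]
      by (intro Least_equality) (auto simp: bessel_J_zero_iff)
    thus ?thesis using x by auto
  qed
  have inv: "lam n = 0 \<or> lam n > 0 \<and> jj (lam n) = 0" for n
  proof (induction n)
    case (Suc n)
    thus ?case using step[OF refl Suc] by linarith
  qed simp
  show "0 \<le> lam n" using inv[of n] by auto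
  show "lam n < lam (Suc n)" "jj (lam (Suc n)) = 0" 
    "\<And>y. lam n < y ==> jj y = 0 ==> lam (Suc n) \<le> y"
    using step[OF refl inv[of n]] by auto
qed

lemma strict_mono_lam: "strict_mono lam"
  by (intro strict_mono_Suc_iff[THEN iffD2] allI lam_Suc)

lemma lam_pos: "n \<ge> 1 ==> lam n > 0"
  using strict_monoD[OF strict_mono_lam, of 0 n] by simp

lemma jj_lam [simp]: "n \<ge> 1 ==> jj (lam n) = 0"
  using lam_Suc(3)[of "n - 1"] by simp

definition gap :: real where "gap = min (2 powr (- (2 * \<nu> + 1))) (lam 1)"

lemma gap_pos: "gap > 0" using lam_pos[of 1] by (simp add: gap_def)

text \<open>Linear growth of the zeros makes \<open>exp (- s * lam n)\<close> summable against
  polynomial factors, which the Poisson means rely on.\<close>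

lemma lam_ge: "lam n \<ge> real n * gap"
proof (induction n)
  case (Suc n)
  show ?case
  proof (cases "n = 0")
    case False
    have "lam 1 \<le> lam n"
      using False strict_mono_lam by (simp add: strict_mono_less_eq)
    hence "gap \<le> min (2 powr (- (2 * \<nu> + 1))) (lam n)" by (simp add: gap_def)
    also have "... \<le> lam (Suc n) - lam n"
      using False by (intro jj_zero_gap lam_pos jj_lam lam_Suc) auto
    finally show ?thesis using Suc by (simp add: algebra_simps)
  qed (simp add: gap_def)
qed simp

lemma jj_zero_is_lam:
  assumes "x > 0" "jj x = 0"
  obtains n where "n \<ge> 1" "x = lam n"
proof -
  obtain N where "real N > x / gap" using reals_Archimedean2 by blast
  hence N: "lam N > x" using lam_ge[of N] gap_pos by (simp add: field_simps)
  define n where "n = (LEAST n. lam n \<ge> x)"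
  have n: "lam n \<ge> x" unfolding n_def by (rule LeastI[of _ N]) (use N in auto)
  hence "n \<noteq> 0" using assms by (cases n) auto
  then obtain m where m: "n = Suc m" by (cases n) auto
  have "lam m < x"
    using not_less_Least[of m "\<lambda>n. lam n \<ge> x"] m by (auto simp: n_def)
  hence "lam n \<le> x" using lam_Suc(4)[of m x] assms m by auto
  thus ?thesis using that[of n] n m by auto
qed

lemma jj_pos:
  assumes "0 \<le> x" "x < lam 1"
  shows "jj x > 0"
proof (rule ccontr)
  assume neg: "\<not> jj x > 0"
  have "\<exists>t\<ge>0. t \<le> x \<and> jj t = 0"
    using neg assms by (intro IVT2) (auto intro!: DERIV_isCont[OF jj_deriv])
  then obtain t where t: "t \<ge> 0" "t \<le> x" "jj t = 0" by auto
  hence "t > 0" by (cases "t = 0") auto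
  hence "lam 1 \<le> t" using lam_Suc(4)[of 0 t] t by auto
  thus False using t assms by simp
qed

text \<open>At a zero the weighted energy is \<open>x powr (2 * (2 * \<nu> + 1)) * (jp x)^2\<close>,
  and it increases. The power bound keeps the growth of the normalising constants \<open>cn\<close>
  polynomial.\<close>

lemma jp_lam_lower:
  assumes "n \<ge> 1"
  shows "\<bar>jp (lam n)\<bar> \<ge> (lam 1 / lam n) powr (2 * \<nu> + 1) * \<bar>jp (lam 1)\<bar>"
proof -
  have l: "lam 1 > 0" "lam n > 0" "lam 1 \<le> lam n"
    using assms strict_mono_lam by (auto simp: lam_pos strict_mono_less_eq)
  let ?a = "2 * \<nu> + 1"
  have "lam 1 powr (2 * ?a) * (jp (lam 1))^2 \<le> lam n powr (2 * ?a) * (jp (lam n))^2"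
    using jj_energy_increasing[OF l(1,3)] assms jj_lam[of 1] by (simp)
  hence "(lam 1 powr ?a * \<bar>jp (lam 1)\<bar>)^2 \<le> (lam n powr ?a * \<bar>jp (lam n)\<bar>)^2"
    using powr_add[of "lam 1" ?a ?a] powr_add[of "lam n" ?a ?a]
    by (simp add: power_mult_distrib) (simp add: power2_eq_square)
  hence "lam 1 powr ?a * \<bar>jp (lam 1)\<bar> \<le> lam n powr ?a * \<bar>jp (lam n)\<bar>"
    by (rule power2_le_imp_le) simp
  thus ?thesis using l by (simp add: powr_divide field_simps)
qed

lemma jp_lam_nz: "n \<ge> 1 ==> jp (lam n) \<noteq> 0"
  using jj_energy_pos[of "lam n"] lam_pos[of n] by auto

end

section \<open>The ground state\<close>

lemma MVT_interior:
  fixes f f' :: "real \<Rightarrow> real"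
  assumes st: "s < t" and cont: "continuous_on {s..t} f" and deriv: "\<And>x. s < x ==> x < t ==> DERIV f x :> f' x"
  obtains z where "s < z" "z < t" "f t - f s = (t - s) * f' z"
proof -
  obtain l z where "s < z" "z < t" "DERIV f z :> l" "f t - f s = (t - s) * l"
    using MVT[OF st cont] deriv by (auto simp: real_differentiable_def)
  with deriv[of z] show ?thesis using that DERIV_unique by metis
qed

text \<open>Since \<open>k\<close> is nondecreasing, \<open>N\<close> first decreases and then
  increases, so its maximum is attained at an end point.\<close>

lemma unimodal_nonpos:
  fixes N k P :: "real \<Rightarrow> real"
  assumes cont: "continuous_on {0..1} N" and ends: "N 0 = 0" "N 1 = 0"
    and deriv: "\<And>x. 0 < x ==> x < 1 ==> DERIV N x :> P x * k x"
    and P: "\<And>x. 0 < x ==> x < 1 ==> P x > 0"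
    and k: "\<And>x y. 0 < x ==> x \<le> y ==> y < 1 ==> k x \<le> k y"
    and x: "0 < x" "x < 1"
  shows "N x \<le> 0"
proof (rule ccontr)
  assume "\<not> N x \<le> 0"
  hence pos: "N x > 0" by simp
  have mvt: "\<exists>q. s < q \<and> q < t \<and> N t - N s = (t - s) * (P q * k q)" if "0 \<le> s" "s < t" "t \<le> 1" for s t
    by (rule MVT_interior[OF that(2) continuous_on_subset[OF cont] deriv]) (use that in auto)
  obtain q where q: "0 < q" "q < x" "N x - N 0 = (x - 0) * (P q * k q)"
    using mvt[of 0 x] x by auto
  hence "k q > 0" using pos ends P[of q] x by (auto simp: zero_less_mult_iff)
  obtain v where v: "x < v" "v < 1" "N 1 - N x = (1 - x) * (P v * k v)"
    using mvt[of x 1] x by auto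
  have "k v > 0" using k[of q v] \<open>k q > 0\<close> q v x by simp
  hence "(1 - x) * (P v * k v) > 0" using P[of v] v x by simp
  thus False using v ends pos by simp
qed

section \<open>The eigenfunctions \<open>U n\<close> and bounds for the ground state
  \<open>U 1\<close>\<close>

context bessel
begin

definition a0 :: real where "a0 = 2 * \<nu> + 1"

lemma a0: "a0 > 0" using nu by (simp add: a0_def)

lemmas reg_p_deriv' = reg_p_deriv[folded a0_def]

lemma continuous_on_powr_a0: "S \<subseteq> {0..} ==> continuous_on S (\<lambda>x. x powr a0)"
  using a0 by (intro continuous_on_powr' continuous_intros) auto

lemma powr_a0_deriv: "x > 0 ==> DERIV (\<lambda>x. x powr a0) x :> a0 / x * x powr a0"
  using has_real_derivative_powr[of x a0] by (simp add: powr_diff powr_add)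

definition U :: "nat \<Rightarrow> real \<Rightarrow> real" where "U n x = jj (lam n * x)"
definition U1 :: "nat \<Rightarrow> real \<Rightarrow> real" where "U1 n x = - lam n * jp (lam n * x)"

lemma U_deriv: "DERIV (U n) x :> U1 n x"
proof -
  have "DERIV (\<lambda>x. lam n * x) x :> lam n"
    by (auto intro!: derivative_eq_intros)
  from DERIV_chain2[OF jj_deriv this] show ?thesis
    by (simp add: U_def[abs_def] U1_def mult_ac)
qed

lemma U1_deriv:
  assumes "x > 0" "n \<ge> 1"
  shows "DERIV (U1 n) x :> - (a0 / x) * U1 n x - (lam n)^2 * U n x"
proof -
  have l: "lam n > 0" using lam_pos assms by simp
  have "DERIV (\<lambda>x. lam n * x) x :> lam n"
    by (auto intro!: derivative_eq_intros)
  from DERIV_cmult[OF DERIV_chain2[OF reg_p_deriv'[of "lam n * x" 1] this], of "- lam n"]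
  have "DERIV (U1 n) x :> - lam n * ((jj (lam n * x) - a0 / (lam n * x) * jp (lam n * x)) * lam n)"
    using assms l by (simp add: U1_def[abs_def])
  moreover have "- lam n * ((jj (lam n * x) - a0 / (lam n * x) * jp (lam n * x)) * lam n)
      = - (a0 / x) * U1 n x - (lam n)^2 * U n x"
    using l assms unfolding U_def U1_def by (simp add: field_simps power2_eq_square)
  ultimately show ?thesis by simp
qed

lemma U_0 [simp]: "U n 0 = 1" and U_1 [simp]: "n \<ge> 1 ==> U n 1 = 0"
  by (auto simp: U_def)

lemma U_le_1: "0 \<le> x ==> \<bar>U n x\<bar> \<le> 1"
  unfolding U_def by (intro jj_le_1 mult_nonneg_nonneg lam_Suc)

lemma U1_le: "0 \<le> x ==> \<bar>U1 n x\<bar> \<le> lam n"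
  using mult_left_mono[OF jp_le_1[of "lam n * x"], of "lam n"] lam_Suc(1)[of n]
  by (simp add: U1_def abs_mult)

lemma continuous_on_U [continuous_intros]: "continuous_on S (U n)"
  by (rule continuous_at_imp_continuous_on) (use U_deriv DERIV_isCont in blast)

lemma continuous_on_U1 [continuous_intros]: "continuous_on S (U1 n)"
  unfolding U1_def by (intro continuous_intros continuous_on_compose2[OF continuous_on_reg_p]) auto

lemma U_le_linear: "n \<ge> 1 ==> 0 \<le> x ==> x \<le> 1 ==> \<bar>U n x\<bar> \<le> lam n * (1 - x)"
proof (cases "x = 1")
  assume x: "n \<ge> 1" "0 \<le> x" "x \<le> 1" "x \<noteq> 1"
  then obtain z where "x < z" "z < 1" "U n 1 - U n x = (1 - x) * U1 n z"
    using MVT2[of x 1 "U n" "U1 n"] U_deriv by auto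
  hence "\<bar>U n x\<bar> = \<bar>(1 - x) * U1 n z\<bar>" using x by simp
  also have "... = (1 - x) * \<bar>U1 n z\<bar>" using x by (simp add: abs_mult)
  also have "... \<le> (1 - x) * lam n" using x \<open>x < z\<close> by (intro mult_left_mono U1_le) auto
  finally show ?thesis by (simp add: mult_ac)
qed auto

lemma U_ground_pos: "0 \<le> x ==> x < 1 ==> U 1 x > 0"
  unfolding U_def using lam_pos[of 1] by (intro jj_pos) auto

text \<open>\<open>x powr a0 * jp x\<close> has derivative \<open>x powr a0 * jj x\<close>, which is
  nonnegative up to the first zero.\<close>

lemma jp_nonneg:
  assumes "0 \<le> s" "s \<le> lam 1"
  shows "jp s \<ge> 0"
proof (cases "s = 0")
  case False
  hence s: "s > 0" using assms by simp
  have "0 powr a0 * jp 0 \<le> s powr a0 * jp s"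
  proof (rule DERIV_nonneg_imp_increasing_open[of 0 s "\<lambda>x. x powr a0 * jp x"])
    show "0 \<le> s" by fact
    show "continuous_on {0..s} (\<lambda>x. x powr a0 * jp x)"
      by (intro continuous_intros continuous_on_powr_a0) auto
    fix x assume x: "0 < x" "x < s"
    have "DERIV (\<lambda>x. x powr a0 * jp x) x :> x powr a0 * jj x"
      using DERIV_mult[OF powr_a0_deriv reg_p_deriv', of x 1] x
      by (simp add: algebra_simps)
    moreover have "x powr a0 * jj x \<ge> 0"
      using jj_pos[of x] x assms by (intro mult_nonneg_nonneg) auto
    ultimately show "\<exists>y. DERIV (\<lambda>x. x powr a0 * jp x) x :> y \<and> 0 \<le> y" by blast
  qed
  thus ?thesis using s by (simp add: zero_le_mult_iff)
qed auto

lemma U1_ground_nonpos: "0 \<le> x ==> x \<le> 1 ==> U1 1 x \<le> 0"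
  unfolding U1_def using lam_pos[of 1]
  by (simp add: mult_nonneg_nonneg jp_nonneg mult_left_le)

text \<open>With \<open>\<phi> = U 1 / (1 - x)\<close> the function below is \<open>w e\<^sup>2\<^sup>s\<^sup>x (\<phi> e\<^sup>-\<^sup>s\<^sup>x)'\<close>, where
  \<open>w = x\<^sup>a (1 - x)\<^sup>2\<close> is the density of \<open>rho\<close>; it vanishes at both end points.\<close>

lemma ground_log_deriv_aux:
  assumes x: "0 < x" "x < 1"
  shows "DERIV (\<lambda>x. exp (s * x) * x powr a0 * ((1 - x) * U1 1 x + U 1 x - s * (1 - x) * U 1 x)) x :> (exp (s * x) * x powr a0 * U 1 x * (1 - x)) *
        ((2 * s + a0) / (1 - x) + a0 * (1 - s) / x - s^2 - (lam 1)^2)"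
proof -
  define B where "B = (\<lambda>x. (1 - x) * U1 1 x + U 1 x - s * (1 - x) * U 1 x)"
  have "DERIV B x :> (1 - x) * (- (a0 / x) * U1 1 x - (lam 1)^2 * U 1 x) - U1 1 x + U1 1 x
      - (s * (1 - x) * U1 1 x - s * U 1 x)"
    unfolding B_def by (rule derivative_eq_intros U_deriv U1_deriv refl | use x in \<open>force simp: algebra_simps\<close>)+
  moreover have "DERIV (\<lambda>x. exp (s * x) * x powr a0) x :> exp (s * x) * x powr a0 * (s + a0 / x)"
  proof -
    have "DERIV (\<lambda>x. exp (s * x)) x :> exp (s * x) * s"
      by (auto intro!: derivative_eq_intros)
    from DERIV_mult[OF this powr_a0_deriv[OF x(1)]] show ?thesis
      by (rule DERIV_cong) (simp add: algebra_simps)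
  qed
  ultimately have "DERIV (\<lambda>x. exp (s * x) * x powr a0 * B x) x :>
      exp (s * x) * x powr a0 * (s + a0 / x) * B x + ((1 - x) * (- (a0 / x) * U1 1 x - (lam 1)^2 * U 1 x)
      - U1 1 x + U1 1 x - (s * (1 - x) * U1 1 x - s * U 1 x)) * (exp (s * x) * x powr a0)"
    by (intro DERIV_mult)
  moreover have "exp (s * x) * x powr a0 * (s + a0 / x) * B x + ((1 - x) * (- (a0 / x) * U1 1 x - (lam 1)^2 * U 1 x)
      - U1 1 x + U1 1 x - (s * (1 - x) * U1 1 x - s * U 1 x)) * (exp (s * x) * x powr a0)
      = (exp (s * x) * x powr a0 * U 1 x * (1 - x)) *
        ((2 * s + a0) / (1 - x) + a0 * (1 - s) / x - s^2 - (lam 1)^2)"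
  proof -
    define E u u1 y A where "E = exp (s * x) * x powr a0" and "u = U 1 x" and "u1 = U1 1 x" and "y = 1 - x" and "A = a0"
    have y: "y \<noteq> 0" "x \<noteq> 0" "x = 1 - y" using x by (auto simp: y_def)
    have "(s + A / x) * (y * u1 + u - s * y * u) + (y * (- (A / x) * u1 - (lam 1)^2 * u)
      - u1 + u1 - (s * y * u1 - s * u))
      = u * y * ((2 * s + A) / y + A * (1 - s) / x - s^2 - (lam 1)^2)"
      using y(1,2) by (simp add: field_simps power2_eq_square) (simp add: y(3) algebra_simps)
    hence "E * ((s + A / x) * (y * u1 + u - s * y * u) + (y * (- (A / x) * u1 - (lam 1)^2 * u)
      - u1 + u1 - (s * y * u1 - s * u)))
      = E * (u * y * ((2 * s + A) / y + A * (1 - s) / x - s^2 - (lam 1)^2))" by (rule arg_cong)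
    thus ?thesis unfolding B_def E_def[symmetric] unfolding u_def[symmetric] u1_def[symmetric] y_def[symmetric] A_def[symmetric]
      by (simp only: distrib_left distrib_right mult_ac)
  qed
  ultimately show ?thesis by (simp add: B_def)
qed

lemma ground_log_deriv_cont:
  "continuous_on {0..1} (\<lambda>x. exp (s * x) * x powr a0 * ((1 - x) * U1 1 x + U 1 x - s * (1 - x) * U 1 x))"
  by (intro continuous_intros continuous_on_powr_a0) auto

text \<open>The choice \<open>s = 1\<close> removes the term in \<open>1/x\<close> from the last
  factor of \<open>ground_log_deriv_aux\<close>; what remains increases, so
  \<open>unimodal_nonpos\<close> applies. For \<open>\<phi> = U 1 / (1 - x)\<close> the result means
  \<open>\<phi>' \<le> \<phi>\<close>.\<close>

lemma ground_log_deriv_lower: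
  assumes x: "0 < x" "x < 1"
  shows "(1 - x) * U1 1 x + U 1 x \<le> (1 - x) * U 1 x"
proof -
  have "exp (1 * x) * x powr a0 * ((1 - x) * U1 1 x + U 1 x - 1 * (1 - x) * U 1 x) \<le> 0"
  proof (rule unimodal_nonpos[OF ground_log_deriv_cont _ _ ground_log_deriv_aux _ _ x])
    fix y z :: real assume yz: "0 < y" "y \<le> z" "z < 1"
    have "(2 + a0) / (1 - y) \<le> (2 + a0) / (1 - z)"
      using yz a0 by (intro divide_left_mono) auto
    thus "(2 * 1 + a0) / (1 - y) + a0 * (1 - 1) / y - 1^2 - (lam 1)^2
        \<le> (2 * 1 + a0) / (1 - z) + a0 * (1 - 1) / z - 1^2 - (lam 1)^2" by simp
  qed (use U_ground_pos nu in \<open>auto simp: less_imp_le\<close>)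
  thus ?thesis using x by (simp add: mult_le_0_iff)
qed

text \<open>The choice \<open>s = - a0/2\<close> removes the term in \<open>1/(1 - x)\<close>. The
  remaining factor decreases, so \<open>unimodal_nonpos\<close> is applied to the negative. For
  \<open>\<phi> = U 1 / (1 - x)\<close> the result means
  \<open>\<phi>' \<ge> - (a0/2) \<phi>\<close>.\<close>

lemma ground_log_deriv_upper:
  assumes x: "0 < x" "x < 1"
  shows "0 \<le> (1 - x) * U1 1 x + U 1 x + (a0 / 2) * (1 - x) * U 1 x"
proof -
  let ?s = "- (a0 / 2)"
  have "- (exp (?s * x) * x powr a0 * ((1 - x) * U1 1 x + U 1 x - ?s * (1 - x) * U 1 x)) \<le> 0"
  proof (rule unimodal_nonpos[where N = "\<lambda>x. - (exp (?s * x) * x powr a0 * ((1 - x) * U1 1 x + U 1 x - ?s * (1 - x) * U 1 x))"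
      and P = "\<lambda>x. exp (?s * x) * x powr a0 * U 1 x * (1 - x)" and
      k = "\<lambda>x. - ((2 * ?s + a0) / (1 - x) + a0 * (1 - ?s) / x - ?s^2 - (lam 1)^2)", OF _ _ _ _ _ _ x])
    fix y z :: real assume yz: "0 < y" "y \<le> z" "z < 1"
    have "a0 * (1 - ?s) / z \<le> a0 * (1 - ?s) / y"
      using yz a0 by (intro divide_left_mono) auto
    thus "- ((2 * ?s + a0) / (1 - y) + a0 * (1 - ?s) / y - ?s^2 - (lam 1)^2)
        \<le> - ((2 * ?s + a0) / (1 - z) + a0 * (1 - ?s) / z - ?s^2 - (lam 1)^2)"
      by (simp add: diff_divide_distrib add_divide_distrib)
  next
    fix x :: real assume x: "0 < x" "x < 1"
    from DERIV_minus[OF ground_log_deriv_aux[OF x, of ?s]]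
    show "DERIV (\<lambda>x. - (exp (?s * x) * x powr a0 * ((1 - x) * U1 1 x + U 1 x - ?s * (1 - x) * U 1 x))) x :>
      exp (?s * x) * x powr a0 * U 1 x * (1 - x) * (- ((2 * ?s + a0) / (1 - x) + a0 * (1 - ?s) / x - ?s^2 - (lam 1)^2))"
      by (simp only: mult_minus_right)
  next
    show "continuous_on {0..1} (\<lambda>x. - (exp (?s * x) * x powr a0 * ((1 - x) * U1 1 x + U 1 x - ?s * (1 - x) * U 1 x)))"
      by (intro continuous_on_minus ground_log_deriv_cont)
  qed (use U_ground_pos nu in \<open>auto simp: less_imp_le\<close>)
  hence "0 \<le> (exp (?s * x) * x powr a0) * ((1 - x) * U1 1 x + U 1 x - ?s * (1 - x) * U 1 x)" by simp
  moreover have "exp (?s * x) * x powr a0 > 0" using x by simp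
  ultimately have "0 \<le> (1 - x) * U1 1 x + U 1 x - ?s * (1 - x) * U 1 x"
    by (simp only: zero_le_mult_iff) linarith
  thus ?thesis by simp
qed

text \<open>By the bound on the logarithmic derivative,
  \<open>U 1 x / (1 - x) * exp (a0/2 * x)\<close> is nondecreasing, and it equals 1 at 0.\<close>

lemma U_ground_lower:
  assumes x: "0 \<le> x" "x < 1"
  shows "U 1 x \<ge> exp (- (a0 / 2)) * (1 - x)"
proof -
  have "U 1 0 / (1 - 0) * exp (a0 / 2 * 0) \<le> U 1 x / (1 - x) * exp (a0 / 2 * x)"
  proof (rule DERIV_nonneg_imp_increasing_open[of 0 x "\<lambda>x. U 1 x / (1 - x) * exp (a0 / 2 * x)"])
    fix y assume y: "0 < y" "y < x"
    have "DERIV (\<lambda>x. U 1 x / (1 - x) * exp (a0 / 2 * x)) y :>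
      exp (a0 / 2 * y) / (1 - y)^2 * ((1 - y) * U1 1 y + U 1 y + (a0 / 2) * (1 - y) * U 1 y)"
    proof -
      have "DERIV (\<lambda>x. U 1 x / (1 - x)) y :> (U1 1 y * (1 - y) - U 1 y * (0 - 1)) / ((1 - y) * (1 - y))"
        by (intro DERIV_divide U_deriv DERIV_diff DERIV_const DERIV_ident) (use x y in auto)
      moreover have "DERIV (\<lambda>x. exp (a0 / 2 * x)) y :> exp (a0 / 2 * y) * (a0 / 2)"
        using DERIV_chain2[OF DERIV_exp DERIV_cmult_Id[of "a0 / 2"]] by simp
      ultimately show ?thesis
      proof (rule DERIV_cong[OF DERIV_mult])
        define t where "t = 1 - y"
        have t: "t \<noteq> 0" using x y by (simp add: t_def)
        show "(U1 1 y * (1 - y) - U 1 y * (0 - 1)) / ((1 - y) * (1 - y)) * exp (a0 / 2 * y) +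
            exp (a0 / 2 * y) * (a0 / 2) * (U 1 y / (1 - y)) =
            exp (a0 / 2 * y) / (1 - y)^2 * ((1 - y) * U1 1 y + U 1 y + a0 / 2 * (1 - y) * U 1 y)"
          unfolding t_def[symmetric] using t by (simp add: field_simps power2_eq_square)
      qed
    qed
    moreover have "exp (a0 / 2 * y) / (1 - y)^2 * ((1 - y) * U1 1 y + U 1 y + (a0 / 2) * (1 - y) * U 1 y) \<ge> 0"
      using ground_log_deriv_upper[of y] x y by (intro mult_nonneg_nonneg) auto
    ultimately show "\<exists>d. DERIV (\<lambda>x. U 1 x / (1 - x) * exp (a0 / 2 * x)) y :> d \<and> 0 \<le> d"
      by blast
  next
    show "continuous_on {0..x} (\<lambda>x. U 1 x / (1 - x) * exp (a0 / 2 * x))"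
      by (intro continuous_intros) (use x in auto)
  qed (use x in auto)
  hence "1 \<le> U 1 x / (1 - x) * exp (a0 / 2 * x)" by simp
  also have "... \<le> U 1 x / (1 - x) * exp (a0 / 2)"
    using x a0 U_ground_pos[of x] by (intro mult_left_mono) (auto simp: mult_left_le)
  finally show ?thesis using x by (simp add: exp_minus field_simps)
qed

section \<open>The logarithmic derivative \<open>R\<close> of the ground state\<close>

definition R :: "real \<Rightarrow> real" where "R x = - U1 1 x / U 1 x"
text \<open>The right-hand side of the Riccati equation of \<open>R\<close>, hence its derivative by
  \<open>R_deriv\<close>.\<close>

definition R1 :: "real \<Rightarrow> real" where "R1 x = (lam 1)^2 - a0 / x * R x + (R x)^2"

lemma Gamma_nu: "Gamma (\<nu> + 2) = (\<nu> + 1) * Gamma (\<nu> + 1)" "Gamma (\<nu> + 1) > 0"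
proof -
  have "\<nu> + 1 \<notin> \<int>\<^sub>\<le>\<^sub>0" using nu by (auto elim!: nonpos_Ints_cases)
  thus "Gamma (\<nu> + 2) = (\<nu> + 1) * Gamma (\<nu> + 1)" using Gamma_plus1[of "\<nu> + 1"] by (simp add: add.assoc)
qed (use nu in \<open>auto intro!: Gamma_real_pos\<close>)

lemma R_fun_eq:
  assumes x: "0 < x" "x < 1"
  shows "R_fun \<nu> x = R x"
proof -
  define s where "s = lam 1 * x"
  have s: "s > 0" using lam_pos[of 1] x by (simp add: s_def)
  have nu1: "\<nu> + 1 > -1/2" using nu by auto
  have "bessel_J (\<nu> + 1) s / bessel_J \<nu> s = jp s / jj s"
    unfolding bessel_J_eq[OF nu s] bessel_J_eq[OF nu1 s] reg_u_def reg_p_def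
    using s nu Gamma_nu less_imp_neq[OF Gamma_nu(2)] by (simp add: powr_add add.assoc)
  thus ?thesis using U_ground_pos[of x] x
    by (simp add: R_fun_def R_def U_def U1_def s_def)
qed

lemma R_deriv:
  assumes x: "0 < x" "x < 1"
  shows "DERIV R x :> R1 x"
proof -
  have u: "U 1 x > 0" using x by (intro U_ground_pos) auto
  have "DERIV R x :> (- (- (a0 / x) * U1 1 x - (lam 1)^2 * U 1 x) * U 1 x - (- U1 1 x) * U1 1 x) / (U 1 x * U 1 x)"
    unfolding R_def[abs_def]
    by (intro DERIV_divide DERIV_minus U1_deriv U_deriv) (use x u in auto)
  moreover have "(- (- (a0 / x) * U1 1 x - (lam 1)^2 * U 1 x) * U 1 x - (- U1 1 x) * U1 1 x) / (U 1 x * U 1 x) = R1 x"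
    using u x unfolding R1_def R_def by (simp add: field_simps power2_eq_square)
  ultimately show ?thesis by simp
qed

lemma R_nonneg: "0 < x ==> x < 1 ==> R x \<ge> 0"
  unfolding R_def using U1_ground_nonpos[of x] U_ground_pos[of x] by (intro divide_nonneg_nonneg) auto

text \<open>The quantity is minus the logarithmic derivative of \<open>U 1 x / (1 - x)\<close>, so
  both bounds on that derivative transfer.\<close>

lemma q_bounds:
  assumes x: "0 < x" "x < 1"
  shows "R x - 1 / (1 - x) \<ge> -1" "R x - 1 / (1 - x) \<le> a0 / 2"
proof -
  have u: "U 1 x > 0" using x by (intro U_ground_pos) auto
  have *: "R x - 1 / (1 - x) = - ((1 - x) * U1 1 x + U 1 x) / ((1 - x) * U 1 x)"
    unfolding R_def using u x by (simp add: field_simps)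
  have p: "(1 - x) * U 1 x > 0" using u x by simp
  show "R x - 1 / (1 - x) \<ge> -1" unfolding * using ground_log_deriv_lower[OF x] p
    by (simp add: pos_le_divide_eq)
  have "- ((1 - x) * U1 1 x + U 1 x) \<le> a0 / 2 * ((1 - x) * U 1 x)"
    using ground_log_deriv_upper[OF x] by (simp add: mult.assoc)
  thus "R x - 1 / (1 - x) \<le> a0 / 2" unfolding * using p by (subst pos_divide_le_eq) auto
qed

text \<open>\<open>x powr a0 * (U 1 x)^2 * R1 x\<close> vanishes at 0, and its derivative is
  \<open>- a0 * x powr (a0 - 2) * U 1 x * U1 1 x\<close>, which is nonnegative because the ground
  state is positive and decreasing.\<close>

lemma R1_nonneg:
  assumes x: "0 < x" "x < 1"
  shows "R1 x \<ge> 0"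
proof -
  define l where "l = lam 1"
  \<comment> \<open>\<open>U1 1 y / y\<close> is expressed through \<open>b\<close>, which is
    continuous at 0, so that \<open>Y\<close> is continuous on the closed interval.\<close>
  define b where "b = (\<lambda>x. bessel_A (\<nu> + 1) ((l * x)^2) / (2 * (\<nu> + 1)))"
  have U1b: "U1 1 y = - (l^2) * y * b y" for y
    unfolding U1_def reg_p_def b_def l_def by (simp add: power2_eq_square)
  define Y where "Y = (\<lambda>x. x powr a0 * (l^2 * (U 1 x)^2 - a0 * l^2 * U 1 x * b x + (U1 1 x)^2))"
  have Y: "Y y = y powr a0 * (l^2 * (U 1 y)^2 + (a0 / y) * U 1 y * U1 1 y + (U1 1 y)^2)" if "y > 0" for y
    unfolding Y_def U1b using that by (simp add: field_simps)
  have "Y 0 \<le> Y x"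
  proof (rule DERIV_nonneg_imp_increasing_open[of 0 x Y])
    have "continuous_on UNIV (bessel_A (\<nu> + 1))"
      using nu by (intro continuous_at_imp_continuous_on ballI isCont_bessel_A) auto
    hence "continuous_on {0..x} (\<lambda>x. bessel_A (\<nu> + 1) ((l * x)^2))"
      by (rule continuous_on_compose2) (auto intro!: continuous_intros)
    thus "continuous_on {0..x} Y" unfolding Y_def b_def
      by (intro continuous_intros continuous_on_powr_a0) (use nu in auto)
    fix y assume y: "0 < y" "y < x"
    define u u1 where "u = U 1 y" and "u1 = U1 1 y"
    define A where "A = a0"
    define P where "P = y powr A / y"
    have P: "y powr A = y * P" using y by (auto simp: P_def)
    have *: "DERIV (\<lambda>y. y powr a0 * (l^2 * (U 1 y)^2 + (a0 / y) * U 1 y * U1 1 y + (U1 1 y)^2)) y :> - (A * (P / y) * u * u1)"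
    proof -
      have d: "DERIV (\<lambda>y. l^2 * (U 1 y)^2 + (a0 / y) * U 1 y * U1 1 y + (U1 1 y)^2) y :>
        l^2 * (2 * u * u1) + ((- A / y^2) * u * u1 + (A / y) * (u1 * u1 + u * (- (A / y) * u1 - l^2 * u)))
          + 2 * u1 * (- (A / y) * u1 - l^2 * u)"
        unfolding u_def u1_def l_def A_def
        by (rule derivative_eq_intros U_deriv U1_deriv refl | use y in \<open>force simp: field_simps power2_eq_square\<close>)+
      have p: "DERIV (\<lambda>y. y powr a0) y :> A * P"
        using powr_a0_deriv[OF y(1)] by (simp add: A_def P_def)
      have eq: "A * P * (l^2 * u^2 + (A / y) * u * u1 + u1^2) +
          (l^2 * (2 * u * u1) + ((- A / y^2) * u * u1 + (A / y) * (u1 * u1 + u * (- (A / y) * u1 - l^2 * u)))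
          + 2 * u1 * (- (A / y) * u1 - l^2 * u)) * (y * P) = - (A * (P / y) * u * u1)"
      proof -
        define i where "i = inverse y"
        have i: "i * y = 1" using y by (simp add: i_def)
        have "A * P * (l^2 * u^2 + (A * i) * u * u1 + u1^2) +
          (l^2 * (2 * u * u1) + ((- A * i^2) * u * u1 + (A * i) * (u1 * u1 + u * (- (A * i) * u1 - l^2 * u)))
          + 2 * u1 * (- (A * i) * u1 - l^2 * u)) * (y * P) = - (A * (P * i) * u * u1)"
          using i by algebra
        thus ?thesis by (simp add: i_def divide_inverse power_inverse)
      qed
      from DERIV_mult[OF p d] show ?thesis
        by (rule DERIV_cong) (simp only: P u_def[symmetric] u1_def[symmetric] A_def[symmetric] eq)
    qed
    have "eventually (\<lambda>z. z \<in> {0<..}) (nhds y)"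
      using y by (intro eventually_nhds_in_open) auto
    hence ev: "eventually (\<lambda>z. Y z = z powr a0 * (l^2 * (U 1 z)^2 + (a0 / z) * U 1 z * U1 1 z + (U1 1 z)^2)) (nhds y)"
      by eventually_elim (use Y in auto)
    have "DERIV Y y :> - (A * (P / y) * u * u1)"
      using * DERIV_cong_ev[OF refl ev refl] by simp
    moreover have "- (A * (P / y) * u * u1) \<ge> 0"
    proof -
      have "u \<ge> 0" "u1 \<le> 0" using U_ground_pos[of y] U1_ground_nonpos[of y] y x by (auto simp: u_def u1_def)
      moreover have "A * (P / y) \<ge> 0" using a0 y by (auto simp: A_def P_def)
      ultimately have "A * (P / y) * u * u1 \<le> 0"
        by (intro mult_nonneg_nonpos[OF mult_nonneg_nonneg[of "A * (P / y)"]])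
      thus ?thesis by simp
    qed
    ultimately show "\<exists>d. DERIV Y y :> d \<and> 0 \<le> d" by blast
  qed (use x in auto)
  moreover have "Y 0 = 0" by (simp add: Y_def)
  moreover have "Y x = x powr a0 * (U 1 x)^2 * R1 x"
  proof -
    have "U 1 x \<noteq> 0" using U_ground_pos[of x] x by auto
    thus ?thesis unfolding Y[OF x(1)] R1_def R_def l_def using x
      by (simp add: field_simps power2_eq_square)
  qed
  ultimately have "0 \<le> (x powr a0 * (U 1 x)^2) * R1 x" by simp
  moreover have "x powr a0 * (U 1 x)^2 > 0" using U_ground_pos[of x] x by (intro mult_pos_pos) auto
  ultimately show ?thesis by (simp only: zero_le_mult_iff) linarith
qed

end

lemmas bint_cong = Bochner_Integration.integral_cong
  and bint_bound = Bochner_Integration.integrable_bound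
  and bint_diff = Bochner_Integration.integral_diff
  and bint_add = Bochner_Integration.integral_add
  and bint_sum = Bochner_Integration.integral_sum
  and bintegrable_cong = Bochner_Integration.integrable_cong
  and bintegrable_add = Bochner_Integration.integrable_add


section \<open>The two orthonormal systems\<close>

text \<open>The integrands are bounded but controlled on the open interval only, and several
  antiderivatives merely have limits at the ends; hence the one-sided limits in place of end
  values.\<close>

lemma FTC_unit_interval:
  fixes G g :: "real \<Rightarrow> real"
  assumes deriv: "\<And>x. 0 < x ==> x < 1 ==> DERIV G x :> g x"
    and cont: "continuous_on {0<..<1} g"
    and bound: "\<And>x. 0 < x ==> x < 1 ==> \<bar>g x\<bar> \<le> M"
    and lim: "(G \<longlongrightarrow> A) (at_right 0)" "(G \<longlongrightarrow> B) (at_left 1)"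
  shows "set_integrable lborel {0<..<1} g" "(LINT x:{0<..<1}|lborel. g x) = B - A"
proof -
  have e: "einterval 0 1 = {0<..<1::real}"
    by (auto simp: einterval_def zero_ereal_def one_ereal_def)
  show int: "set_integrable lborel {0<..<1} g"
    unfolding set_integrable_def
  proof (rule bint_bound[where f = "\<lambda>x. M * indicator {0<..<1::real} x"])
    show "integrable lborel (\<lambda>x. M * indicator {0<..<1::real} x)"
      by (intro integrable_mult_right integrable_real_indicator) auto
    show "(\<lambda>x. indicator {0<..<1} x *\<^sub>R g x) \<in> borel_measurable lborel"
      using borel_measurable_continuous_on_indicator[OF _ cont] by simp
    show "AE x in lborel. norm (indicator {0<..<1} x *\<^sub>R g x) \<le> norm (M * indicator {0<..<1::real} x)"
    proof (rule AE_I2)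
      fix x :: real
      show "norm (indicator {0<..<1} x *\<^sub>R g x) \<le> norm (M * indicator {0<..<1::real} x)"
        using bound[of x] by (auto simp: indicator_def)
    qed
  qed
  have "(LBINT x=0..1. g x) = B - A"
  proof (rule interval_integral_FTC_integrable[of 0 1 G])
    show "(G has_vector_derivative g x) (at x)" if "0 < ereal x" "ereal x < 1" for x
      using deriv[of x] that by (simp add: has_real_derivative_iff_has_vector_derivative)
    show "isCont g x" if "0 < ereal x" "ereal x < 1" for x
      using cont that by (simp add: continuous_on_eq_continuous_at)
    show "set_integrable lborel (einterval 0 1) g" using int by (simp only: e)
    show "((G \<circ> real_of_ereal) \<longlongrightarrow> A) (at_right 0)" "((G \<circ> real_of_ereal) \<longlongrightarrow> B) (at_left 1)"
      using lim by (simp_all add: zero_ereal_def one_ereal_def ereal_tendsto_simps)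
  qed auto
  thus "(LINT x:{0<..<1}|lborel. g x) = B - A"
    by (simp add: interval_lebesgue_integral_def e)
qed

text \<open>Division by \<open>1 - x\<close> changes the drift from \<open>a/x\<close> to
  \<open>a/x - 2/(1 - x)\<close> and adds the potential \<open>a/(x (1 - x))\<close>. The number
  \<open>k\<close> belongs to the single point \<open>x\<close>, so the lemma also covers the
  variable potential in the equation of \<open>Z n\<close>.\<close>

lemma deriv_div_one_minus:
  fixes F F1 :: "real \<Rightarrow> real"
  assumes x: "0 < x" "x < 1"
    and F: "DERIV F x :> F1 x"
    and F1: "DERIV F1 x :> - (a / x) * F1 x + k * F x"
  shows "DERIV (\<lambda>x. F x / (1 - x)) x :> F1 x / (1 - x) + F x / (1 - x)^2"
    and "DERIV (\<lambda>x. F1 x / (1 - x) + F x / (1 - x)^2) x :>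
      - (a / x - 2 / (1 - x)) * (F1 x / (1 - x) + F x / (1 - x)^2)
        + (a / (x * (1 - x)) + k) * (F x / (1 - x))"
proof -
  define i where "i = inverse (1 - x)"
  define j where "j = inverse x"
  have i: "i * (1 - x) = 1" and j: "j * x = 1" using x by (auto simp: i_def j_def)
  have d: "DERIV (\<lambda>x. inverse (1 - x)) x :> i^2"
    by (rule derivative_eq_intros refl | use x in \<open>force simp: i_def power2_eq_square\<close>)+
  have p: "DERIV (\<lambda>x. F x * inverse (1 - x)) x :> F1 x * i + i^2 * F x"
    using DERIV_mult[OF F d] by (simp add: i_def)
  thus "DERIV (\<lambda>x. F x / (1 - x)) x :> F1 x / (1 - x) + F x / (1 - x)^2"
    by (simp add: i_def divide_inverse power_inverse mult_ac)
  have "DERIV (\<lambda>x. F1 x * inverse (1 - x) + F x * inverse (1 - x) * inverse (1 - x)) x :>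
      ((- (a / x) * F1 x + k * F x) * i + i^2 * F1 x) + ((F1 x * i + i^2 * F x) * i + i^2 * (F x * i))"
    using DERIV_add[OF DERIV_mult[OF F1 d] DERIV_mult[OF p d]] by (simp add: i_def)
  moreover have "((- (a * j) * F1 x + k * F x) * i + i^2 * F1 x) + ((F1 x * i + i^2 * F x) * i + i^2 * (F x * i))
      = - (a * j - 2 * i) * (F1 x * i + F x * i^2) + (a * (j * i) + k) * (F x * i)"
    by (simp add: algebra_simps power2_eq_square)
  ultimately show "DERIV (\<lambda>x. F1 x / (1 - x) + F x / (1 - x)^2) x :>
      - (a / x - 2 / (1 - x)) * (F1 x / (1 - x) + F x / (1 - x)^2)
        + (a / (x * (1 - x)) + k) * (F x / (1 - x))"
    by (simp add: i_def j_def divide_inverse power_inverse mult_ac power2_eq_square)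
qed

context bessel
begin

section \<open>The Darboux transforms \<open>Z n\<close> of the \<open>U n\<close>\<close>

definition mu :: "nat \<Rightarrow> real" where "mu n = (lam n)^2 - (lam 1)^2"

lemma lam_mono: "m \<le> n ==> lam m \<le> lam n"
  using strict_mono_lam by (simp add: strict_mono_less_eq)

lemma mu_nonneg: "n \<ge> 1 ==> mu n \<ge> 0"
  unfolding mu_def using lam_mono[of 1 n] lam_pos[of 1] by (auto intro!: power_mono)

lemma mu_pos: "n \<ge> 2 ==> mu n > 0"
  unfolding mu_def using strict_monoD[OF strict_mono_lam, of 1 n] lam_pos[of 1]
  by (auto intro!: power_strict_mono)

lemma mu_le: "mu n \<le> (lam n)^2"
  by (simp add: mu_def)

text \<open>\<open>Z n\<close> is the image of \<open>U n\<close> under \<open>d/dx + R\<close>, the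
  operator that annihilates \<open>U 1\<close>. That \<open>Z1\<close> is its derivative is the
  second half of the factorisation: \<open>- d/dx - a0/x + R\<close> maps \<open>Z n\<close> back to
  \<open>mu n * U n\<close>.\<close>

definition Z :: "nat \<Rightarrow> real \<Rightarrow> real" where "Z n x = U1 n x + R x * U n x"
definition Z1 :: "nat \<Rightarrow> real \<Rightarrow> real" where "Z1 n x = (R x - a0 / x) * Z n x - mu n * U n x"
definition vv :: "real \<Rightarrow> real" where "vv x = 2 * R1 x + a0 / x^2"

lemma vv_nonneg: "0 < x ==> x < 1 ==> vv x \<ge> 0"
  using R1_nonneg[of x] a0 by (simp add: vv_def)

lemma Z_deriv:
  assumes "n \<ge> 1" "0 < x" "x < 1"
  shows "DERIV (Z n) x :> Z1 n x"
proof -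
  have "DERIV (Z n) x :> (- (a0 / x) * U1 n x - (lam n)^2 * U n x) + (R1 x * U n x + U1 n x * R x)"
    unfolding Z_def[abs_def] using assms
    by (intro DERIV_add DERIV_mult R_deriv U_deriv U1_deriv) auto
  moreover have "(- (a0 / x) * U1 n x - (lam n)^2 * U n x) + (R1 x * U n x + U1 n x * R x) = Z1 n x"
    by (simp add: Z1_def Z_def R1_def mu_def algebra_simps power2_eq_square)
  ultimately show ?thesis by simp
qed

lemma Z1_deriv:
  assumes "n \<ge> 1" "0 < x" "x < 1"
  shows "DERIV (Z1 n) x :> - (a0 / x) * Z1 n x + (vv x - (lam n)^2) * Z n x"
proof -
  have "DERIV (\<lambda>x. a0 / x) x :> - a0 / x^2"
    using assms by (auto intro!: derivative_eq_intros simp: power2_eq_square)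
  hence "DERIV (Z1 n) x :> ((R1 x - (- a0 / x^2)) * Z n x + Z1 n x * (R x - a0 / x)) - mu n * U1 n x"
    unfolding Z1_def[abs_def] using assms
    by (intro DERIV_diff DERIV_mult R_deriv Z_deriv[unfolded Z1_def] DERIV_cmult U_deriv) auto
  moreover have "((R1 x - (- a0 / x^2)) * Z n x + Z1 n x * (R x - a0 / x)) - mu n * U1 n x
      = - (a0 / x) * Z1 n x + (vv x - (lam n)^2) * Z n x"
  proof -
    have "mu n * U1 n x = mu n * Z n x - R x * (mu n * U n x)"
      by (simp add: Z_def algebra_simps)
    also have "mu n * U n x = (R x - a0 / x) * Z n x - Z1 n x" by (simp add: Z1_def)
    finally show ?thesis
      by (simp add: vv_def R1_def mu_def algebra_simps power2_eq_square)
  qed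
  ultimately show ?thesis by simp
qed

lemma continuous_on_Z: "n \<ge> 1 ==> S \<subseteq> {0<..<1} ==> continuous_on S (Z n)"
  by (intro continuous_at_imp_continuous_on ballI, rule DERIV_isCont, rule Z_deriv) auto

text \<open>Pointwise bounds for \<open>Z n\<close> come from here: \<open>Z n\<close> is the
  Wronskian divided by \<open>x powr a0 * U 1\<close>, and for \<open>n \<ge> 1\<close> the
  Wronskian vanishes at both ends and has the explicit derivative of
  \<open>wronski_deriv\<close>.\<close>

definition wronski :: "nat \<Rightarrow> real \<Rightarrow> real" where
  "wronski n x = x powr a0 * (U 1 x * U1 n x - U1 1 x * U n x)"

lemma wronski_eq: "0 < x ==> x < 1 ==> wronski n x = x powr a0 * U 1 x * Z n x"
  using U_ground_pos[of x] by (simp add: wronski_def Z_def R_def field_simps)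

lemma wronski_deriv:
  assumes "n \<ge> 1" "0 < x"
  shows "DERIV (wronski n) x :> - mu n * (x powr a0 * U 1 x * U n x)"
proof -
  have "DERIV (wronski n) x :> a0 / x * x powr a0 * (U 1 x * U1 n x - U1 1 x * U n x) +
     ((U1 1 x * U1 n x + (- (a0 / x) * U1 n x - (lam n)^2 * U n x) * U 1 x)
      - ((- (a0 / x) * U1 1 x - (lam 1)^2 * U 1 x) * U n x + U1 n x * U1 1 x)) * x powr a0"
    unfolding wronski_def[abs_def] using assms
    by (intro DERIV_mult powr_a0_deriv DERIV_diff U_deriv U1_deriv) auto
  thus ?thesis
    by (rule DERIV_cong) (simp add: mu_def algebra_simps power2_eq_square)
qed

lemma wronski_cont: "continuous_on {0..1} (wronski n)"
  unfolding wronski_def[abs_def] by (intro continuous_intros continuous_on_powr_a0) auto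

lemma wronski_mvt:
  assumes n: "n \<ge> 1" "0 \<le> s" "s < t" "t \<le> 1"
  obtains z where "s < z" "z < t"
    "\<bar>wronski n t - wronski n s\<bar> = (t - s) * (mu n * \<bar>z powr a0 * U 1 z * U n z\<bar>)"
proof -
  obtain z where z: "s < z" "z < t" "wronski n t - wronski n s = (t - s) * (- mu n * (z powr a0 * U 1 z * U n z))"
    by (rule MVT_interior[OF n(3) continuous_on_subset[OF wronski_cont] wronski_deriv]) (use n in auto)
  thus ?thesis using mu_nonneg[OF n(1)] n(3) by (intro that) (auto simp: abs_mult)
qed

lemma wronski_bound_left:
  assumes "n \<ge> 1" "0 < x" "x < 1"
  shows "\<bar>wronski n x\<bar> \<le> mu n * (x powr a0 * x)"
proof -
  obtain z where z: "0 < z" "z < x" "\<bar>wronski n x - wronski n 0\<bar> = (x - 0) * (mu n * \<bar>z powr a0 * U 1 z * U n z\<bar>)"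
    using wronski_mvt[of n 0 x] assms by auto
  have "\<bar>z powr a0 * U 1 z * U n z\<bar> \<le> x powr a0 * 1 * 1"
    unfolding abs_mult using z assms a0 U_le_1[of z] powr_mono2[of a0 z x]
    by (intro mult_mono) auto
  hence "x * (mu n * \<bar>z powr a0 * U 1 z * U n z\<bar>) \<le> x * (mu n * (x powr a0 * 1 * 1))"
    using mu_nonneg[of n] assms by (intro mult_left_mono) auto
  thus ?thesis using z(3) by (simp add: wronski_def mult_ac)
qed

text \<open>Near 1 the derivative carries the factor \<open>U 1 z \<le> lam 1 * (1 - z)\<close>,
  which yields the second power of \<open>1 - x\<close>; one power is lost again when dividing by
  \<open>U 1\<close>.\<close>

lemma wronski_bound_right:
  assumes "n \<ge> 1" "0 < x" "x < 1"
  shows "\<bar>wronski n x\<bar> \<le> mu n * lam 1 * (1 - x)^2"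
proof -
  obtain z where z: "x < z" "z < 1" "\<bar>wronski n 1 - wronski n x\<bar> = (1 - x) * (mu n * \<bar>z powr a0 * U 1 z * U n z\<bar>)"
    using wronski_mvt[of n x 1] assms by auto
  have "\<bar>U 1 z\<bar> \<le> lam 1 * (1 - z)" using z assms by (intro U_le_linear) auto
  also have "... \<le> lam 1 * (1 - x)" using z lam_pos[of 1] by (intro mult_left_mono) auto
  finally have "\<bar>z powr a0 * U 1 z * U n z\<bar> \<le> 1 * (lam 1 * (1 - x)) * 1"
    unfolding abs_mult using z assms a0 U_le_1[of z] lam_pos[of 1]
    by (intro mult_mono) (auto simp: powr_le1)
  hence "(1 - x) * (mu n * \<bar>z powr a0 * U 1 z * U n z\<bar>) \<le> (1 - x) * (mu n * (1 * (lam 1 * (1 - x)) * 1))"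
    using mu_nonneg[of n] assms by (intro mult_left_mono) auto
  moreover have "wronski n 1 = 0" using assms(1) by (simp add: wronski_def)
  ultimately show ?thesis using z(3) by (simp add: mult_ac power2_eq_square)
qed

text \<open>The constants of the two halves in \<open>Z_bound\<close>: \<open>4\<close> for
  \<open>x \<le> 1/2\<close> and \<open>2 * lam 1 * 2 powr a0\<close> for \<open>x > 1/2\<close>,
  both times the \<open>exp (a0/2)\<close> from \<open>U_ground_lower\<close>.\<close>

definition CZ :: real where
  "CZ = exp (a0 / 2) * (4 + 2 * lam 1 * 2 powr a0)"

lemma CZ_pos: "CZ > 0"
  using lam_pos[of 1] unfolding CZ_def by (intro mult_pos_pos add_pos_nonneg) auto

text \<open>In each half of the interval the Wronskian bound at the nearer end is divided by
  \<open>x powr a0 * U 1 x\<close>. The linear decay at both ends is used for orthonormality and for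
  the boundary terms.\<close>

lemma Z_bound:
  assumes n: "n \<ge> 1" and x: "0 < x" "x < 1"
  shows "\<bar>Z n x\<bar> \<le> CZ * mu n * (x * (1 - x))"
proof -
  define e where "e = exp (a0 / 2)"
  have e: "e > 0" by (simp add: e_def)
  have Ul: "1 - x \<le> e * U 1 x"
    using U_ground_lower[of x] x by (simp add: exp_minus e_def field_simps)
  have xp: "x powr a0 > 0" and up: "U 1 x > 0" using x U_ground_pos[of x] by auto
  have w: "\<bar>wronski n x\<bar> = x powr a0 * U 1 x * \<bar>Z n x\<bar>"
    unfolding wronski_eq[OF x] using xp up by (simp add: abs_mult)
  have m: "mu n \<ge> 0" by (rule mu_nonneg[OF n])
  have l: "lam 1 > 0" by (rule lam_pos) simp
  show ?thesis
  proof (cases "x \<le> 1/2")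
    case True
    have "U 1 x * \<bar>Z n x\<bar> \<le> mu n * x"
      using wronski_bound_left[OF n x] xp unfolding w by (simp add: mult_ac)
    have "(1 - x) * \<bar>Z n x\<bar> \<le> e * U 1 x * \<bar>Z n x\<bar>"
      using Ul by (intro mult_right_mono) auto
    also have "... \<le> e * (mu n * x)"
      using \<open>U 1 x * \<bar>Z n x\<bar> \<le> mu n * x\<close> e by simp
    finally have "(1 - x) * \<bar>Z n x\<bar> \<le> e * (mu n * x)" .
    moreover have "1/2 * \<bar>Z n x\<bar> \<le> (1 - x) * \<bar>Z n x\<bar>"
      using True by (intro mult_right_mono) auto
    ultimately have "\<bar>Z n x\<bar> \<le> 2 * (e * (mu n * x))" by linarith
    also have "... = 2 * e * (mu n * x) * 1" by simp
    also have "... \<le> 2 * e * (mu n * x) * (2 * (1 - x))"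
      using True e m x by (intro mult_left_mono) auto
    also have "... = e * 4 * mu n * (x * (1 - x))" by simp
    also have "... \<le> CZ * mu n * (x * (1 - x))"
      unfolding CZ_def e_def[symmetric] using e m x l
      by (intro mult_right_mono mult_left_mono) auto
    finally show ?thesis .
  next
    case False
    have "x powr a0 * (U 1 x * \<bar>Z n x\<bar>) \<le> mu n * lam 1 * (1 - x)^2"
      using wronski_bound_right[OF n x] unfolding w by (simp add: mult_ac)
    have "(1/2) powr a0 \<le> x powr a0" using False a0 by (intro powr_mono2) auto
    hence "(1/2) powr a0 * (1 - x) * \<bar>Z n x\<bar> \<le> x powr a0 * (e * U 1 x) * \<bar>Z n x\<bar>"
      using Ul x by (intro mult_right_mono mult_mono) auto
    also have "... = e * (x powr a0 * (U 1 x * \<bar>Z n x\<bar>))" by simp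
    also have "... \<le> e * (mu n * lam 1 * (1 - x)^2)"
      using \<open>x powr a0 * (U 1 x * \<bar>Z n x\<bar>) \<le> _\<close> e by (intro mult_left_mono) auto
    finally have "(1 - x) * ((1/2) powr a0 * \<bar>Z n x\<bar>) \<le> (1 - x) * (e * (mu n * lam 1 * (1 - x)))"
      by (simp add: power2_eq_square mult_ac)
    hence "(1/2) powr a0 * \<bar>Z n x\<bar> \<le> e * (mu n * lam 1 * (1 - x))"
      using x by simp
    hence "\<bar>Z n x\<bar> \<le> 2 powr a0 * e * (mu n * lam 1 * (1 - x)) * 1"
      by (simp add: powr_divide field_simps)
    also have "... \<le> 2 powr a0 * e * (mu n * lam 1 * (1 - x)) * (2 * x)"
      using False e m l x by (intro mult_left_mono) auto
    also have "... = e * (2 * lam 1 * 2 powr a0) * mu n * (x * (1 - x))" by simp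
    also have "... \<le> CZ * mu n * (x * (1 - x))"
      unfolding CZ_def e_def[symmetric] using e m x l
      by (intro mult_right_mono mult_left_mono) auto
    finally show ?thesis .
  qed
qed

section \<open>The normalised systems \<open>phi n\<close>, \<open>chi n\<close> and their
  equations\<close>

definition cn :: "nat \<Rightarrow> real" where "cn n = sqrt 2 / \<bar>jp (lam n)\<bar>"
text \<open>For \<open>n = 1\<close> this is a division by \<open>0\<close> with value
  \<open>0\<close>; the functions \<open>chi n\<close> form a system from \<open>n = 2\<close>
  on.\<close>

definition dn :: "nat \<Rightarrow> real" where "dn n = cn n / sqrt (mu n)"

definition phi :: "nat \<Rightarrow> real \<Rightarrow> real" where "phi n x = cn n * (U n x / (1 - x))"
definition phid :: "nat \<Rightarrow> real \<Rightarrow> real" where "phid n x = cn n * (U1 n x / (1 - x) + U n x / (1 - x)^2)"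
definition chi :: "nat \<Rightarrow> real \<Rightarrow> real" where "chi n x = dn n * (Z n x / (1 - x))"
definition chid :: "nat \<Rightarrow> real \<Rightarrow> real" where "chid n x = dn n * (Z1 n x / (1 - x) + Z n x / (1 - x)^2)"

definition ww :: "real \<Rightarrow> real" where "ww x = x powr a0 * (1 - x)^2"
text \<open>The logarithmic derivative of \<open>ww\<close>, so that
  \<open>ww * (u'' + drift * u')\<close> is the exact derivative of \<open>ww * u'\<close>.\<close>

definition drift :: "real \<Rightarrow> real" where "drift x = a0 / x - 2 / (1 - x)"
definition rr :: "real \<Rightarrow> real" where "rr x = a0 / (x * (1 - x))"
definition qq :: "real \<Rightarrow> real" where "qq x = R x - 1 / (1 - x)"

lemma cn_pos: "n \<ge> 1 ==> cn n > 0"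
  using jp_lam_nz[of n] by (simp add: cn_def)

text \<open>The factor \<open>(lam n / 2) powr \<nu> / Gamma (\<nu> + 1)\<close> relating
  \<open>bessel_J\<close> to \<open>jj\<close> and \<open>jp\<close> occurs in numerator and
  denominator and cancels.\<close>

lemma phi_check_eq:
  assumes "n \<ge> 1" "0 < x"
  shows "phi_check \<nu> n x = phi n x"
proof -
  define l where "l = lam n"
  have l: "l > 0" using lam_pos assms by (simp add: l_def)
  have nu1: "\<nu> + 1 > -1/2" using nu by auto
  define g where "g = (l / 2) powr \<nu> / Gamma (\<nu> + 1)"
  have g: "g > 0" using l Gamma_nu by (simp add: g_def)
  have 1: "bessel_J (\<nu> + 1) l = g * jp l"
    unfolding bessel_J_eq[OF nu1 l] reg_p_def g_def using l nu Gamma_nu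
    by (simp add: powr_add add.assoc) (simp add: algebra_simps)
  have 2: "x powr (- \<nu>) * bessel_J \<nu> (l * x) = g * U n x"
    unfolding bessel_J_eq[OF nu mult_pos_pos[OF l assms(2)]] g_def U_def reg_u_def l_def[symmetric]
    using l assms by (simp add: powr_mult powr_divide powr_minus field_simps)
  show ?thesis unfolding phi_check_def l_def[symmetric] 1 2
    using g by (simp add: phi_def cn_def l_def abs_mult)
qed

lemma phi_deriv: "0 < x ==> x < 1 ==> n \<ge> 1 ==> DERIV (phi n) x :> phid n x"
  and phid_deriv: "0 < x ==> x < 1 ==> n \<ge> 1 ==>
    DERIV (phid n) x :> - drift x * phid n x + (rr x - (lam n)^2) * phi n x"
proof -
  assume x: "0 < x" "x < 1" "n \<ge> 1"
  have d: "DERIV (U1 n) x :> - (a0 / x) * U1 n x + (- ((lam n)^2)) * U n x"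
    using U1_deriv[of x n] x by simp
  note D = deriv_div_one_minus[OF x(1,2) U_deriv d]
  from DERIV_cmult[OF D(1), of "cn n"]
  show "DERIV (phi n) x :> phid n x" by (simp add: phi_def[abs_def] phid_def)
  from DERIV_cmult[OF D(2), of "cn n"]
  show "DERIV (phid n) x :> - drift x * phid n x + (rr x - (lam n)^2) * phi n x"
    unfolding phid_def[abs_def] phi_def
    by (rule DERIV_cong) (unfold drift_def rr_def, simp only: algebra_simps)
qed

lemma chi_deriv: "0 < x ==> x < 1 ==> n \<ge> 1 ==> DERIV (chi n) x :> chid n x"
  and chid_deriv: "0 < x ==> x < 1 ==> n \<ge> 1 ==>
    DERIV (chid n) x :> - drift x * chid n x + (rr x + vv x - (lam n)^2) * chi n x"
proof -
  assume x: "0 < x" "x < 1" "n \<ge> 1"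
  note D = deriv_div_one_minus[OF x(1,2) Z_deriv[OF x(3,1,2)] Z1_deriv[OF x(3,1,2)]]
  from DERIV_cmult[OF D(1), of "dn n"]
  show "DERIV (chi n) x :> chid n x" by (simp add: chi_def[abs_def] chid_def)
  from DERIV_cmult[OF D(2), of "dn n"]
  show "DERIV (chid n) x :> - drift x * chid n x + (rr x + vv x - (lam n)^2) * chi n x"
    unfolding chid_def[abs_def] chi_def
    by (rule DERIV_cong) (unfold drift_def rr_def, simp only: algebra_simps)
qed

lemma d_phi:
  assumes "n \<ge> 2" "0 < x" "x < 1"
  shows "phid n x + qq x * phi n x = sqrt (mu n) * chi n x"
proof -
  have "sqrt (mu n) * dn n = cn n" using mu_pos[OF assms(1)] by (simp add: dn_def)
  hence *: "sqrt (mu n) * chi n x = cn n * (Z n x / (1 - x))" by (simp add: chi_def)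
  define i where "i = inverse (1 - x)"
  show ?thesis unfolding * unfolding phid_def phi_def qq_def Z_def divide_inverse power_inverse[symmetric] i_def[symmetric]
    by (simp add: algebra_simps power2_eq_square)
qed

lemma d_check_phi_check:
  assumes "n \<ge> 2" "0 < x" "x < 1"
  shows "d_check \<nu> (phi_check \<nu> n) x = sqrt (mu n) * chi n x"
proof -
  have "eventually (\<lambda>y. y \<in> {0<..}) (nhds x)"
    using assms by (intro eventually_nhds_in_open) auto
  hence ev: "eventually (\<lambda>y. phi_check \<nu> n y = phi n y) (nhds x)"
    by eventually_elim (use phi_check_eq assms in auto)
  have "DERIV (phi_check \<nu> n) x :> phid n x"
    using phi_deriv[of x n] DERIV_cong_ev[OF refl ev refl] assms by simp
  hence "deriv (phi_check \<nu> n) x = phid n x" by (rule DERIV_imp_deriv)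
  thus ?thesis unfolding d_phi[OF assms, symmetric]
    using assms R_fun_eq[of x] phi_check_eq[of n x] by (simp add: d_check_def qq_def algebra_simps)
qed

lemma rr_pos: "0 < x ==> x < 1 ==> rr x > 0"
  using a0 by (simp add: rr_def)

text \<open>With \<open>a = \<nu> + 1/2\<close> the bounds on \<open>qq\<close> give
  \<open>|qq| \<le> max 1 a\<close>, and \<open>(max 1 a)^2 = a * max a (1/a)\<close>. Since
  \<open>x (1 - x) \<le> 1/4\<close>, one has \<open>rr \<ge> 4 * a0 = 8 * a\<close>, which accounts
  for the \<open>1/8\<close>.\<close>

lemma qq_squared_le:
  assumes x: "0 < x" "x < 1"
  shows "(qq x)^2 \<le> (1/8 * max (\<nu> + 1/2) (1 / (\<nu> + 1/2))) * rr x"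
proof -
  define a where "a = \<nu> + 1/2"
  have a: "a > 0" "a0 = 2 * a" using nu by (auto simp: a_def a0_def)
  have "-1 \<le> qq x" "qq x \<le> a" using q_bounds[OF x] a by (auto simp: qq_def)
  hence "\<bar>qq x\<bar> \<le> max 1 a" by auto
  hence "(qq x)^2 \<le> (max 1 a)^2" using power_mono[of "\<bar>qq x\<bar>" "max 1 a" 2] by simp
  also have "... = max a (1 / a) * a"
  proof (cases "a \<le> 1")
    case True
    hence "a \<le> 1 / a" using a mult_le_one[of a a] by (simp add: field_simps)
    thus ?thesis using a True by (simp add: max_def)
  next
    case False
    hence "1 / a \<le> a" using a mult_mono[of 1 a 1 a] by (simp add: field_simps)
    thus ?thesis using a False by (simp add: max_def power2_eq_square)
  qed
  also have "... \<le> max a (1 / a) * (1/8 * rr x)"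
  proof (intro mult_left_mono)
    have "0 \<le> (2 * x - 1)^2" by simp
    hence "4 * (x * (1 - x)) \<le> 1" by (simp add: power2_eq_square algebra_simps)
    hence "a * (4 * (x * (1 - x))) \<le> a * 1" using a by (intro mult_left_mono) auto
    thus "a \<le> 1/8 * rr x" using x a by (simp add: rr_def field_simps)
    show "0 \<le> max a (1 / a)" using a by auto
  qed
  finally show ?thesis by (simp add: a_def mult_ac)
qed

lemma phi_bound:
  assumes "n \<ge> 1" "0 < x" "x < 1"
  shows "\<bar>phi n x\<bar> \<le> cn n * lam n"
proof -
  have "\<bar>U n x\<bar> / (1 - x) \<le> lam n"
    using U_le_linear[of n x] assms by (simp add: field_simps)
  hence "cn n * (\<bar>U n x\<bar> / (1 - x)) \<le> cn n * lam n"
    using cn_pos[OF assms(1)] by (intro mult_left_mono) auto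
  moreover have "\<bar>phi n x\<bar> = cn n * (\<bar>U n x\<bar> / (1 - x))"
    unfolding phi_def abs_mult abs_divide using cn_pos[OF assms(1)] assms by simp
  ultimately show ?thesis by simp
qed

lemma dn_pos: "n \<ge> 2 ==> dn n > 0"
  using cn_pos[of n] mu_pos[of n] by (simp add: dn_def)

lemma chi_bound:
  assumes "n \<ge> 2" "0 < x" "x < 1"
  shows "\<bar>chi n x\<bar> \<le> dn n * (CZ * mu n)"
proof -
  have m: "CZ * mu n \<ge> 0" using CZ_pos mu_nonneg[of n] assms by simp
  have "\<bar>Z n x\<bar> \<le> CZ * mu n * (x * (1 - x))" using Z_bound[of n x] assms by simp
  also have "... \<le> CZ * mu n * (1 - x)" using m assms by (intro mult_left_mono) auto
  finally have "\<bar>Z n x\<bar> / (1 - x) \<le> CZ * mu n"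
    using assms by (simp add: field_simps)
  hence "dn n * (\<bar>Z n x\<bar> / (1 - x)) \<le> dn n * (CZ * mu n)"
    using dn_pos[OF assms(1)] by (intro mult_left_mono) auto
  moreover have "\<bar>chi n x\<bar> = dn n * (\<bar>Z n x\<bar> / (1 - x))"
    unfolding chi_def abs_mult abs_divide using dn_pos[OF assms(1)] assms by simp
  ultimately show ?thesis by simp
qed

lemma ww_mult_quotient: "x < 1 ==> ww x * (c * (u / (1 - x) + v / (1 - x)^2)) = c * (x powr a0 * ((1 - x) * u + v))"
  by (simp add: ww_def distrib_left mult_ac power2_eq_square)

text \<open>The bound tends to 0 at both ends. It disposes of the boundary terms when the energy is
  integrated by parts in \<open>x\<close>.\<close>

lemma ww_phid_bound:
  assumes "n \<ge> 1"
  shows "\<exists>M. \<forall>x. 0 < x \<longrightarrow> x < 1 \<longrightarrow> \<bar>ww x * phid n x\<bar> \<le> M * (x powr a0 * (1 - x))"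
proof (intro exI allI impI)
  fix x :: real assume x: "0 < x" "x < 1"
  have "\<bar>ww x * phid n x\<bar> = cn n * (x powr a0 * \<bar>(1 - x) * U1 n x + U n x\<bar>)"
    unfolding phid_def ww_mult_quotient[OF x(2)] using cn_pos[OF assms] by (simp add: abs_mult)
  also have "... \<le> cn n * (x powr a0 * (2 * lam n * (1 - x)))"
  proof (intro mult_left_mono)
    have "\<bar>(1 - x) * U1 n x + U n x\<bar> \<le> (1 - x) * \<bar>U1 n x\<bar> + \<bar>U n x\<bar>"
      using abs_triangle_ineq[of "(1 - x) * U1 n x" "U n x"] x by (simp add: abs_mult)
    also have "... \<le> (1 - x) * lam n + lam n * (1 - x)"
      using x assms by (intro add_mono mult_left_mono U1_le U_le_linear) auto
    finally show "\<bar>(1 - x) * U1 n x + U n x\<bar> \<le> 2 * lam n * (1 - x)" by (simp add: algebra_simps)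
  qed (use cn_pos[OF assms] in auto)
  finally show "\<bar>ww x * phid n x\<bar> \<le> (cn n * (2 * lam n)) * (x powr a0 * (1 - x))" by (simp only: mult_ac)
qed

lemma R_le: "0 < x ==> x < 1 ==> R x * (1 - x) \<le> a0 / 2 + 1"
proof -
  assume x: "0 < x" "x < 1"
  have "R x \<le> a0 / 2 + 1 / (1 - x)" using q_bounds(2)[OF x] by linarith
  hence "R x * (1 - x) \<le> (a0 / 2 + 1 / (1 - x)) * (1 - x)" using x by (intro mult_right_mono) auto
  also have "... = a0 / 2 * (1 - x) + 1" using x by (simp add: distrib_right)
  also have "... \<le> a0 / 2 * 1 + 1" using x a0 by (intro add_mono mult_left_mono) auto
  finally show ?thesis by simp
qed

text \<open>\<open>Z1\<close> contains \<open>a0/x * Z\<close> and \<open>R * Z\<close>: the linear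
  decay of \<open>Z\<close> at 0 absorbs the \<open>1/x\<close>, and the factor \<open>1 - x\<close>
  absorbs the pole of \<open>R\<close> at 1 by \<open>R_le\<close>.\<close>

lemma ww_chid_bound:
  assumes "n \<ge> 2"
  shows "\<exists>M. \<forall>x. 0 < x \<longrightarrow> x < 1 \<longrightarrow> \<bar>ww x * chid n x\<bar> \<le> M * (x powr a0 * (1 - x))"
proof (intro exI allI impI)
  fix x :: real assume x: "0 < x" "x < 1"
  define m where "m = CZ * mu n"
  have m: "m \<ge> 0" using CZ_pos mu_nonneg[of n] assms by (simp add: m_def)
  have Zb: "\<bar>Z n x\<bar> \<le> m * (x * (1 - x))" using Z_bound[of n x] assms x by (simp add: m_def)
  also have "m * (x * (1 - x)) \<le> m * (1 - x)" using m x by (intro mult_left_mono) auto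
  finally have Zb': "\<bar>Z n x\<bar> \<le> m * (1 - x)" .
  have "\<bar>ww x * chid n x\<bar> = dn n * (x powr a0 * \<bar>(1 - x) * Z1 n x + Z n x\<bar>)"
    unfolding chid_def ww_mult_quotient[OF x(2)] using dn_pos[OF assms] by (simp add: abs_mult)
  also have "... \<le> dn n * (x powr a0 * (((a0 / 2 + 1) * m + a0 * m + mu n * lam n + m) * (1 - x)))"
  proof (intro mult_left_mono)
    have "(1 - x) * Z1 n x + Z n x = (R x * (1 - x)) * Z n x - (a0 / x) * Z n x * (1 - x) - mu n * U n x * (1 - x) + Z n x"
      unfolding Z1_def by (simp add: algebra_simps)
    also have "\<bar>...\<bar> \<le> \<bar>(R x * (1 - x)) * Z n x\<bar> + \<bar>(a0 / x) * Z n x * (1 - x)\<bar> + \<bar>mu n * U n x * (1 - x)\<bar> + \<bar>Z n x\<bar>"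
    proof -
      have "\<bar>a - b - c + d\<bar> \<le> \<bar>a\<bar> + \<bar>b\<bar> + \<bar>c\<bar> + \<bar>d\<bar>" for a b c d :: real by linarith
      thus ?thesis .
    qed
    also have "... \<le> (a0 / 2 + 1) * (m * (1 - x)) + a0 * (m * (1 - x)) + mu n * (lam n * (1 - x)) + m * (1 - x)"
    proof (intro add_mono Zb')
      show "\<bar>(R x * (1 - x)) * Z n x\<bar> \<le> (a0 / 2 + 1) * (m * (1 - x))"
        unfolding abs_mult[of "R x * (1 - x)"] using R_nonneg[OF x] R_le[OF x] x a0
        by (intro mult_mono Zb') auto
      have "\<bar>(a0 / x) * Z n x * (1 - x)\<bar> = (a0 / x) * \<bar>Z n x\<bar> * (1 - x)"
        using a0 x by (simp add: abs_mult)
      also have "... \<le> (a0 / x) * (m * (x * (1 - x))) * (1 - x)"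
        using a0 x Zb by (intro mult_right_mono mult_left_mono) auto
      also have "... = a0 * (m * (1 - x)) * (1 - x)" using x by simp
      also have "... \<le> a0 * (m * (1 - x)) * 1" using x m a0 by (intro mult_left_mono) auto
      finally show "\<bar>(a0 / x) * Z n x * (1 - x)\<bar> \<le> a0 * (m * (1 - x))" by simp
      have "\<bar>mu n * U n x * (1 - x)\<bar> = mu n * (\<bar>U n x\<bar> * (1 - x))"
        using mu_nonneg[of n] assms x by (simp add: abs_mult)
      also have "... \<le> mu n * (lam n * (1 - x) * 1)"
        using mu_nonneg[of n] assms x lam_Suc(1)[of n] by (intro mult_left_mono mult_mono U_le_linear) auto
      finally show "\<bar>mu n * U n x * (1 - x)\<bar> \<le> mu n * (lam n * (1 - x))" by simp
    qed
    finally show "\<bar>(1 - x) * Z1 n x + Z n x\<bar> \<le> ((a0 / 2 + 1) * m + a0 * m + mu n * lam n + m) * (1 - x)"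
      by (simp only: distrib_right mult.assoc)
  qed (use dn_pos[OF assms] in auto)
  finally show "\<bar>ww x * chid n x\<bar> \<le> (dn n * ((a0 / 2 + 1) * m + a0 * m + mu n * lam n + m)) * (x powr a0 * (1 - x))"
    by (simp only: mult_ac)
qed


section \<open>The measure \<open>rho \<nu>\<close> and orthonormality\<close>

abbreviation "rh \<equiv> rho \<nu>"

lemma space_rho [simp]: "space rh = {0<..<1}"
  by (simp add: rho_def space_restrict_space)

lemma ww_measurable [measurable]: "ww \<in> borel_measurable borel"
  unfolding ww_def by measurable

lemma ww_nonneg: "ww x \<ge> 0" by (simp add: ww_def)

lemma ww_pos: "0 < x ==> x < 1 ==> ww x > 0" by (simp add: ww_def)

lemma rho_eq: "rho \<nu> = density (restrict_space lborel {0<..<1}) (\<lambda>x. ennreal (ww x))"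
  by (simp add: rho_def ww_def[abs_def] a0_def)

lemma sets_rho: "sets rh = sets (restrict_space borel {0<..<1})"
  unfolding rho_eq by (simp add: sets_restrict_space)

lemma measurable_rho:
  fixes f :: "real \<Rightarrow> 'b::{banach, second_countable_topology}"
  shows "f \<in> borel_measurable rh \<longleftrightarrow> (\<lambda>x. indicator {0<..<1} x *\<^sub>R f x) \<in> borel_measurable borel"
proof -
  have "f \<in> borel_measurable rh \<longleftrightarrow> f \<in> borel_measurable (restrict_space borel {0<..<1})"
    by (simp add: measurable_cong_sets[OF sets_rho refl])
  thus ?thesis by (simp add: borel_measurable_restrict_space_iff)
qed

lemma measurable_rho_borel [measurable (raw)]:
  "f \<in> borel_measurable borel ==> f \<in> borel_measurable rh"
  unfolding measurable_cong_sets[OF sets_rho refl] by (rule measurable_restrict_space1)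

lemma integral_rho:
  fixes f :: "real \<Rightarrow> 'b::{banach, second_countable_topology}"
  assumes "f \<in> borel_measurable rh"
  shows "(LINT x|rh. f x) = (LINT x:{0<..<1}|lborel. ww x *\<^sub>R f x)"
    and "integrable rh f \<longleftrightarrow> set_integrable lborel {0<..<1} (\<lambda>x. ww x *\<^sub>R f x)"
proof -
  let ?N = "restrict_space lborel {0<..<1::real}"
  have f: "f \<in> borel_measurable ?N"
    using assms unfolding rho_eq by simp
  have w: "ww \<in> borel_measurable ?N"
    by (rule measurable_restrict_space1) simp
  show "(LINT x|rh. f x) = (LINT x:{0<..<1}|lborel. ww x *\<^sub>R f x)"
    unfolding rho_eq using integral_density[OF f w] ww_nonneg
    by (simp add: integral_restrict_space set_lebesgue_integral_def)
  show "integrable rh f \<longleftrightarrow> set_integrable lborel {0<..<1} (\<lambda>x. ww x *\<^sub>R f x)"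
    unfolding rho_eq using integrable_density[OF f w] ww_nonneg
    by (simp add: integrable_restrict_space set_integrable_def)
qed

lemma AE_rho: "(AE x in rh. P x) \<longleftrightarrow> (AE x in lborel. 0 < x \<and> x < 1 \<longrightarrow> P x)"
proof -
  have "(\<lambda>x. ennreal (ww x)) \<in> borel_measurable (restrict_space lborel {0<..<1::real})"
    by (rule measurable_restrict_space1) simp
  hence "(AE x in rh. P x) \<longleftrightarrow> (AE x in restrict_space lborel {0<..<1}. 0 < ww x \<longrightarrow> P x)"
    unfolding rho_eq by (subst AE_density) auto
  also have "... \<longleftrightarrow> (AE x in lborel. x \<in> {0<..<1} \<longrightarrow> 0 < ww x \<longrightarrow> P x)"
    by (subst AE_restrict_space_iff) auto
  also have "... \<longleftrightarrow> (AE x in lborel. 0 < x \<and> x < 1 \<longrightarrow> P x)"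
    by (rule AE_cong) (auto simp: ww_pos)
  finally show ?thesis .
qed

lemma finite_measure_rho: "finite_measure rh"
proof (rule finite_measureI)
  have w: "(\<lambda>x. ennreal (ww x)) \<in> borel_measurable (restrict_space lborel {0<..<1::real})"
    by (rule measurable_restrict_space1) simp
  have "emeasure rh (space rh) = (\<integral>\<^sup>+x. ennreal (ww x) * indicator {0<..<1} x \<partial>restrict_space lborel {0<..<1})"
    unfolding rho_eq by (subst emeasure_density[OF w]) (auto simp: sets_restrict_space space_restrict_space)
  also have "... \<le> (\<integral>\<^sup>+x. 1 \<partial>restrict_space lborel {0<..<1::real})"
  proof (rule nn_integral_mono)
    fix x :: real assume "x \<in> space (restrict_space lborel {0<..<1})"
    hence x: "0 < x" "x < 1" by (auto simp: space_restrict_space)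
    have "ww x \<le> 1 * 1"
      unfolding ww_def using x a0 by (intro mult_mono) (auto simp: powr_le1 power_le_one)
    thus "ennreal (ww x) * indicator {0<..<1} x \<le> 1" by (auto simp: indicator_def)
  qed
  also have "... = emeasure lborel {0<..<1::real}"
    by (simp add: emeasure_restrict_space space_restrict_space)
  also have "... < \<infinity>" by simp
  finally show "emeasure rh (space rh) \<noteq> \<infinity>" by simp
qed

lemma continuous_measurable_rho:
  fixes f :: "real \<Rightarrow> real"
  shows "continuous_on {0<..<1} f ==> f \<in> borel_measurable rh"
  unfolding measurable_rho by (rule borel_measurable_continuous_on_indicator) auto

lemma phi_cont: "n \<ge> 1 ==> continuous_on {0<..<1} (phi n)"
  by (intro continuous_at_imp_continuous_on ballI, rule DERIV_isCont, rule phi_deriv) auto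

lemma chi_cont: "n \<ge> 1 ==> continuous_on {0<..<1} (chi n)"
  by (intro continuous_at_imp_continuous_on ballI, rule DERIV_isCont, rule chi_deriv) auto

lemma tendsto_ends:
  assumes "continuous_on {0..1::real} (G :: real \<Rightarrow> real)"
  shows "(G \<longlongrightarrow> G 0) (at_right 0)" "(G \<longlongrightarrow> G 1) (at_left 1)"
proof -
  have "(G \<longlongrightarrow> G 0) (at 0 within {0..1})" "(G \<longlongrightarrow> G 1) (at 1 within {0..1})"
    using assms by (auto simp: continuous_on_def)
  thus "(G \<longlongrightarrow> G 0) (at_right 0)" "(G \<longlongrightarrow> G 1) (at_left 1)"
    by (simp_all add: at_within_Icc_at_right at_within_Icc_at_left)
qed

definition m_UU :: "nat \<Rightarrow> nat \<Rightarrow> real" where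
  "m_UU n m = (LINT x:{0<..<1}|lborel. x powr a0 * (U n x * U m x))"

lemma powr_a0_le_1: "0 < x ==> x < 1 ==> x powr a0 \<le> 1"
  using a0 by (simp add: powr_le1)

lemma UU_bound: "0 < x ==> x < 1 ==> \<bar>x powr a0 * (U n x * U m x)\<bar> \<le> 1"
  using mult_mono[OF powr_a0_le_1 mult_mono[OF U_le_1[of x n] U_le_1[of x m]], of x]
  by (simp add: abs_mult)

text \<open>Lagrange's identity: the weighted Wronskian \<open>G\<close> of \<open>U n\<close> and
  \<open>U m\<close> vanishes at both ends, and its derivative is the integrand times the difference
  of the eigenvalues.\<close>

lemma m_UU_orth:
  assumes "n \<ge> 1" "m \<ge> 1" "n \<noteq> m"
  shows "m_UU n m = 0"
proof -
  define D where "D = (lam n)^2 - (lam m)^2"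
  have "lam n \<noteq> lam m" using strict_mono_eq[OF strict_mono_lam] assms by blast
  hence D: "D \<noteq> 0" using lam_pos[of n] lam_pos[of m] assms
    by (auto simp: D_def power2_eq_iff)
  define G where "G = (\<lambda>x. x powr a0 * (U n x * U1 m x - U1 n x * U m x))"
  have "continuous_on {0..1} G"
    unfolding G_def by (intro continuous_intros continuous_on_powr_a0) auto
  note E = tendsto_ends[OF this]
  have d: "DERIV G x :> D * (x powr a0 * (U n x * U m x))" if "0 < x" "x < 1" for x
  proof -
    have "DERIV G x :> a0 / x * x powr a0 * (U n x * U1 m x - U1 n x * U m x) +
      ((U1 n x * U1 m x + (- (a0 / x) * U1 m x - (lam m)^2 * U m x) * U n x)
       - ((- (a0 / x) * U1 n x - (lam n)^2 * U n x) * U m x + U1 m x * U1 n x)) * x powr a0"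
      unfolding G_def using that assms
      by (intro DERIV_mult powr_a0_deriv DERIV_diff U_deriv U1_deriv) auto
    thus ?thesis by (rule DERIV_cong) (simp add: D_def algebra_simps)
  qed
  have "(LINT x:{0<..<1}|lborel. D * (x powr a0 * (U n x * U m x))) = G 1 - G 0"
  proof (rule FTC_unit_interval(2)[OF d _ _ E])
    show "continuous_on {0<..<1} (\<lambda>x. D * (x powr a0 * (U n x * U m x)))"
      by (intro continuous_intros continuous_on_powr_a0) auto
    show "\<bar>D * (x powr a0 * (U n x * U m x))\<bar> \<le> \<bar>D\<bar> * 1" if "0 < x" "x < 1" for x
      unfolding abs_mult[of D] using UU_bound[OF that] by (intro mult_left_mono) auto
  qed auto
  moreover have "G 1 = 0" "G 0 = 0" using assms a0 by (auto simp: G_def)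
  ultimately show ?thesis using D by (simp add: m_UU_def)
qed

text \<open>The antiderivative is a Pohozaev-type combination of \<open>x\<^sup>a\<^sup>+\<^sup>1(u'\<^sup>2 + \<lambda>\<^sup>2u\<^sup>2)\<close> and \<open>x\<^sup>a u u'\<close>.\<close>

lemma m_UU_norm:
  assumes "n \<ge> 1"
  shows "m_UU n n = (jp (lam n))^2 / 2" "set_integrable lborel {0<..<1} (\<lambda>x. x powr a0 * (U n x * U n x))"
proof -
  have l: "lam n > 0" using lam_pos assms by simp
  define G where "G = (\<lambda>x. x powr a0 * (x * ((U1 n x)^2 + (lam n)^2 * (U n x)^2) + (a0 - 1) * (U n x * U1 n x)))"
  have "continuous_on {0..1} G"
    unfolding G_def by (intro continuous_intros continuous_on_powr_a0) auto
  note E = tendsto_ends[OF this]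
  have d: "DERIV G x :> 2 * (lam n)^2 * (x powr a0 * (U n x * U n x))" if "0 < x" "x < 1" for x
  proof -
    define u2 where "u2 = - (a0 / x) * U1 n x - (lam n)^2 * U n x"
    have u2: "DERIV (U1 n) x :> u2" unfolding u2_def using that assms by (intro U1_deriv) auto
    have "DERIV (\<lambda>x. x * ((U1 n x)^2 + (lam n)^2 * (U n x)^2) + (a0 - 1) * (U n x * U1 n x)) x :>
       ((U1 n x)^2 + (lam n)^2 * (U n x)^2) + x * (2 * U1 n x * u2 + (lam n)^2 * (2 * U n x * U1 n x))
       + (a0 - 1) * (U1 n x * U1 n x + U n x * u2)"
      by (auto intro!: derivative_eq_intros U_deriv u2 simp: algebra_simps)
    from DERIV_mult[OF powr_a0_deriv[OF that(1)] this] have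
      "DERIV G x :> a0 / x * x powr a0 * (x * ((U1 n x)^2 + (lam n)^2 * (U n x)^2) + (a0 - 1) * (U n x * U1 n x))
        + (((U1 n x)^2 + (lam n)^2 * (U n x)^2) + x * (2 * U1 n x * u2 + (lam n)^2 * (2 * U n x * U1 n x))
       + (a0 - 1) * (U1 n x * U1 n x + U n x * u2)) * x powr a0" by (simp add: G_def)
    thus ?thesis
    proof (rule DERIV_cong)
      define i where "i = inverse x"
      have i: "i * x = 1" using that by (simp add: i_def)
      have u2i: "u2 = - (a0 * i) * U1 n x - (lam n)^2 * U n x" by (simp add: u2_def i_def divide_inverse)
      define A X u u1 L where "A = a0" and "X = x powr a0" and "u = U n x" and "u1 = U1 n x" and "L = (lam n)^2"
      have "A * i * X * (x * (u1^2 + L * u^2) + (A - 1) * (u * u1))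
        + ((u1^2 + L * u^2) + x * (2 * u1 * (- (A * i) * u1 - L * u) + L * (2 * u * u1))
       + (A - 1) * (u1 * u1 + u * (- (A * i) * u1 - L * u))) * X = 2 * L * (X * (u * u))"
        using i by algebra
      thus "a0 / x * x powr a0 * (x * ((U1 n x)^2 + (lam n)^2 * (U n x)^2) + (a0 - 1) * (U n x * U1 n x))
        + (((U1 n x)^2 + (lam n)^2 * (U n x)^2) + x * (2 * U1 n x * u2 + (lam n)^2 * (2 * U n x * U1 n x))
       + (a0 - 1) * (U1 n x * U1 n x + U n x * u2)) * x powr a0 = 2 * (lam n)^2 * (x powr a0 * (U n x * U n x))"
        unfolding u2i A_def X_def u_def u1_def L_def by (simp add: i_def divide_inverse)
    qed
  qed
  have c: "continuous_on {0<..<1} (\<lambda>x. 2 * (lam n)^2 * (x powr a0 * (U n x * U n x)))"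
    by (intro continuous_intros continuous_on_powr_a0) auto
  have b: "\<bar>2 * (lam n)^2 * (x powr a0 * (U n x * U n x))\<bar> \<le> 2 * (lam n)^2 * 1" if "0 < x" "x < 1" for x
    unfolding abs_mult[of "2 * (lam n)^2"] using UU_bound[OF that, of n n] by (intro mult_mono) auto
  have "(LINT x:{0<..<1}|lborel. 2 * (lam n)^2 * (x powr a0 * (U n x * U n x))) = G 1 - G 0"
    by (rule FTC_unit_interval(2)[OF d c b E]) auto
  moreover have "G 1 = (lam n)^2 * (jp (lam n))^2" "G 0 = 0"
    using assms a0 by (auto simp: G_def U1_def power_mult_distrib)
  ultimately show "m_UU n n = (jp (lam n))^2 / 2" using l by (simp add: m_UU_def)
  have "set_integrable lborel {0<..<1} (\<lambda>x. 2 * (lam n)^2 * (x powr a0 * (U n x * U n x)))"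
    by (rule FTC_unit_interval(1)[OF d c b E]) auto
  thus "set_integrable lborel {0<..<1} (\<lambda>x. x powr a0 * (U n x * U n x))"
    using l by simp
qed

lemma phi_orthonormal:
  assumes "n \<ge> 1" "m \<ge> 1"
  shows "(LINT x|rh. phi n x * phi m x) = (if n = m then 1 else 0)"
proof -
  have "(\<lambda>x. phi n x * phi m x) \<in> borel_measurable rh"
    by (intro continuous_measurable_rho continuous_intros phi_cont assms)
  hence "(LINT x|rh. phi n x * phi m x) = (LINT x:{0<..<1}|lborel. ww x *\<^sub>R (phi n x * phi m x))"
    by (rule integral_rho)
  also have "... = (LINT x:{0<..<1}|lborel. (cn n * cn m) * (x powr a0 * (U n x * U m x)))"
  proof (rule set_lebesgue_integral_cong)
    show "\<forall>x. x \<in> {0<..<1} \<longrightarrow> ww x *\<^sub>R (phi n x * phi m x) = (cn n * cn m) * (x powr a0 * (U n x * U m x))"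
    proof (intro allI impI)
      fix x :: real assume x: "x \<in> {0<..<1}"
      define t where "t = 1 - x"
      have "t \<noteq> 0" using x by (simp add: t_def)
      thus "ww x *\<^sub>R (phi n x * phi m x) = (cn n * cn m) * (x powr a0 * (U n x * U m x))"
        unfolding ww_def phi_def t_def[symmetric] by (simp add: field_simps power2_eq_square)
    qed
  qed auto
  also have "... = cn n * cn m * m_UU n m" by (simp add: m_UU_def)
  also have "... = (if n = m then 1 else 0)"
    using m_UU_orth[OF assms] m_UU_norm[OF assms(1)] jp_lam_nz[OF assms(1)]
    by (auto simp: cn_def power2_eq_square field_simps)
  finally show ?thesis .
qed

text \<open>Integration by parts: \<open>x powr a0 * Z n * U m\<close> vanishes at both ends and has
  derivative \<open>x powr a0 * (Z n * Z m - mu n * U n * U m)\<close>. So the inner products of the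
  \<open>Z n\<close> are \<open>mu n\<close> times those of the \<open>U n\<close>.\<close>

lemma chi_orthonormal:
  assumes "n \<ge> 2" "m \<ge> 2"
  shows "(LINT x|rh. chi n x * chi m x) = (if n = m then 1 else 0)"
proof -
  have nm: "n \<ge> 1" "m \<ge> 1" using assms by auto
  define G where "G = (\<lambda>x. x powr a0 * (Z n x * U m x))"
  have Zc: "CZ * mu k \<ge> 0" if "k \<ge> 2" for k using CZ_pos mu_pos[OF that] by simp
  have Zb: "\<bar>Z k x\<bar> \<le> CZ * mu k" if "0 < x" "x < 1" "k \<ge> 2" for x k
  proof -
    have "\<bar>Z k x\<bar> \<le> CZ * mu k * (x * (1 - x))" using Z_bound[of k x] that by simp
    also have "... \<le> CZ * mu k * 1" using that Zc by (intro mult_left_mono) (auto intro: mult_le_one)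
    finally show ?thesis by simp
  qed
  have Gb: "\<bar>G x\<bar> \<le> CZ * mu n * (x * (1 - x))" if "0 < x" "x < 1" for x
  proof -
    have "\<bar>G x\<bar> \<le> 1 * ((CZ * mu n * (x * (1 - x))) * 1)"
      unfolding G_def abs_mult using that U_le_1[of x m] powr_a0_le_1[of x] Zc[OF assms(1)] Z_bound[OF nm(1) that]
      by (intro mult_mono) auto
    thus ?thesis by simp
  qed
  have G0: "(G \<longlongrightarrow> 0) (at_right 0)"
  proof (rule Lim_null_comparison)
    show "eventually (\<lambda>x. norm (G x) \<le> CZ * mu n * (x * (1 - x))) (at_right 0)"
      using Gb by (intro eventually_at_rightI[of 0 1]) auto
    show "((\<lambda>x. CZ * mu n * (x * (1 - x))) \<longlongrightarrow> 0) (at_right 0)"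
      by (rule tendsto_eq_intros refl | simp)+
  qed
  have G1: "(G \<longlongrightarrow> 0) (at_left 1)"
  proof (rule Lim_null_comparison)
    show "eventually (\<lambda>x. norm (G x) \<le> CZ * mu n * (x * (1 - x))) (at_left 1)"
      using Gb by (intro eventually_at_leftI[of 0 1]) auto
    show "((\<lambda>x. CZ * mu n * (x * (1 - x))) \<longlongrightarrow> 0) (at_left 1)"
      by (rule tendsto_eq_intros refl | simp)+
  qed
  define g where "g = (\<lambda>x. x powr a0 * (Z n x * Z m x) - mu n * (x powr a0 * (U n x * U m x)))"
  have d: "DERIV G x :> g x" if "0 < x" "x < 1" for x
  proof -
    have "DERIV G x :> a0 / x * x powr a0 * (Z n x * U m x) + (Z1 n x * U m x + U1 m x * Z n x) * x powr a0"
      unfolding G_def using that nm by (intro DERIV_mult powr_a0_deriv Z_deriv U_deriv) auto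
    thus ?thesis
      by (rule DERIV_cong) (simp add: g_def Z1_def Z_def[of m] algebra_simps)
  qed
  have c1: "continuous_on {0<..<1} (\<lambda>x. x powr a0 * (Z n x * Z m x))"
    using nm by (intro continuous_intros continuous_on_powr_a0 continuous_on_Z) auto
  have c: "continuous_on {0<..<1} g"
    unfolding g_def by (intro continuous_intros c1 continuous_on_powr_a0) auto
  have b: "\<bar>g x\<bar> \<le> (CZ * mu n) * (CZ * mu m) + mu n" if "0 < x" "x < 1" for x
  proof -
    have "\<bar>x powr a0 * (Z n x * Z m x)\<bar> \<le> 1 * ((CZ * mu n) * (CZ * mu m))"
      unfolding abs_mult using that Zb assms Zc powr_a0_le_1[of x] by (intro mult_mono) auto
    moreover have "\<bar>mu n * (x powr a0 * (U n x * U m x))\<bar> \<le> mu n * 1"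
      unfolding abs_mult[of "mu n"] using UU_bound[OF that, of n m] mu_pos[OF assms(1)] by (intro mult_mono) auto
    ultimately show ?thesis unfolding g_def by linarith
  qed
  have I: "set_integrable lborel {0<..<1} g" "(LINT x:{0<..<1}|lborel. g x) = 0"
    using FTC_unit_interval[OF d c b G0 G1] by auto
  have ui: "set_integrable lborel {0<..<1} (\<lambda>x. x powr a0 * (U n x * U m x))"
    unfolding set_integrable_def
  proof (rule bint_bound[where f = "\<lambda>x. indicator {0<..<1::real} x"])
    show "(\<lambda>x. indicator {0<..<1} x *\<^sub>R (x powr a0 * (U n x * U m x))) \<in> borel_measurable lborel"
    proof -
      have "continuous_on {0<..<1} (\<lambda>x. x powr a0 * (U n x * U m x))"
        by (intro continuous_intros continuous_on_powr_a0) auto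
      from borel_measurable_continuous_on_indicator[OF _ this] show ?thesis by simp
    qed
    show "AE x in lborel. norm (indicator {0<..<1} x *\<^sub>R (x powr a0 * (U n x * U m x))) \<le> norm (indicator {0<..<1::real} x :: real)"
    proof (rule AE_I2)
      fix x :: real
      show "norm (indicator {0<..<1} x *\<^sub>R (x powr a0 * (U n x * U m x))) \<le> norm (indicator {0<..<1::real} x :: real)"
        using UU_bound[of x n m] by (auto simp: indicator_def)
    qed
  qed (auto intro!: integrable_real_indicator)
  have "(\<lambda>x. chi n x * chi m x) \<in> borel_measurable rh"
    by (intro continuous_measurable_rho continuous_intros chi_cont nm)
  hence "(LINT x|rh. chi n x * chi m x) = (LINT x:{0<..<1}|lborel. ww x *\<^sub>R (chi n x * chi m x))"
    by (rule integral_rho)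
  also have "... = (LINT x:{0<..<1}|lborel. (dn n * dn m) * (g x + mu n * (x powr a0 * (U n x * U m x))))"
  proof (rule set_lebesgue_integral_cong)
    show "\<forall>x. x \<in> {0<..<1} \<longrightarrow> ww x *\<^sub>R (chi n x * chi m x) = (dn n * dn m) * (g x + mu n * (x powr a0 * (U n x * U m x)))"
    proof (intro allI impI)
      fix x :: real assume x: "x \<in> {0<..<1}"
      define t where "t = 1 - x"
      have "t \<noteq> 0" using x by (simp add: t_def)
      thus "ww x *\<^sub>R (chi n x * chi m x) = (dn n * dn m) * (g x + mu n * (x powr a0 * (U n x * U m x)))"
        unfolding ww_def chi_def g_def t_def[symmetric] by (simp add: field_simps power2_eq_square)
    qed
  qed auto
  also have "... = dn n * dn m * (mu n * m_UU n m)"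
    using I ui by (simp add: m_UU_def set_integral_add)
  also have "... = (if n = m then 1 else 0)"
  proof (cases "n = m")
    case True
    have "dn n * dn n = cn n * cn n / mu n" using mu_pos[OF assms(1)] by (simp add: dn_def)
    hence "dn n * dn m * (mu n * m_UU n m) = cn n * cn n * m_UU n n"
      using True mu_pos[OF assms(1)] by simp
    also have "... = 1" using m_UU_norm[OF nm(1)] jp_lam_nz[OF nm(1)]
      by (auto simp: cn_def power2_eq_square field_simps)
    finally show ?thesis using True by simp
  qed (use m_UU_orth[OF nm] in auto)
  finally show ?thesis .
qed

end

section \<open>Functions with integrable \<open>p\<close>-th power\<close>

text \<open>The spaces \<open>Lp\<close> with a general range, so that real-valued and
  complex-valued functions share one theory.\<close>

definition LpS :: "'a measure \<Rightarrow> real \<Rightarrow> ('a \<Rightarrow> 'b::{banach, second_countable_topology}) set" where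
  "LpS M p = {f \<in> borel_measurable M. integrable M (\<lambda>x. norm (f x) powr p)}"

definition LpN :: "'a measure \<Rightarrow> real \<Rightarrow> ('a \<Rightarrow> 'b::{banach, second_countable_topology}) \<Rightarrow> real" where
  "LpN M p f = (LINT x|M. norm (f x) powr p) powr (1 / p)"

abbreviation LpD :: "'a measure \<Rightarrow> real \<Rightarrow> ('a \<Rightarrow> 'b) \<Rightarrow> ('a \<Rightarrow> 'b::{banach, second_countable_topology}) \<Rightarrow> real" where
  "LpD M p f g \<equiv> LpN M p (\<lambda>x. f x - g x)"

abbreviation "Lp_lim M p F f \<equiv> (\<lambda>n. LpD M p (F n) f) \<longlonglongrightarrow> 0"

lemma Lp_eq_LpS: "Lp M p = LpS M p" and Lp_norm_eq_LpN: "Lp_norm M p f = LpN M p f"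
  by (simp_all add: Lp_def LpS_def Lp_norm_def LpN_def)

lemma LpS_D:
  assumes "f \<in> LpS M p"
  shows LpS_measurable: "f \<in> borel_measurable M" and LpS_integrable: "integrable M (\<lambda>x. norm (f x) powr p)"
  using assms by (auto simp: LpS_def)

lemma LpN_nonneg [simp]: "LpN M p f \<ge> 0"
  by (simp add: LpN_def)

lemma LpN_powr: "p > 0 ==> LpN M p f powr p = (LINT x|M. norm (f x) powr p)"
  by (simp add: LpN_def powr_powr)

lemma LpN_le_iff:
  assumes "p > 0" "C \<ge> 0"
  shows "LpN M p f \<le> C \<longleftrightarrow> (LINT x|M. norm (f x) powr p) \<le> C powr p"
proof -
  have "LpN M p f \<le> C \<longleftrightarrow> LpN M p f powr p \<le> C powr p"
    using assms by (metis LpN_nonneg not_le powr_less_mono2 powr_mono2 order_less_imp_le)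
  thus ?thesis using assms by (simp add: LpN_powr)
qed

lemma LpS_mono:
  assumes f: "f \<in> LpS M p" and g: "g \<in> borel_measurable M" and p: "p \<ge> 0"
    and le: "AE x in M. norm (g x) \<le> norm (f x)"
  shows "g \<in> LpS M p" "LpN M p g \<le> LpN M p f"
proof -
  have ae: "AE x in M. norm (g x) powr p \<le> norm (f x) powr p"
    using le by eventually_elim (use p in \<open>auto intro: powr_mono2\<close>)
  have "integrable M (\<lambda>x. norm (g x) powr p)"
    by (rule bint_bound[OF LpS_integrable[OF f]]) (use g ae in auto)
  thus "g \<in> LpS M p" using g by (simp add: LpS_def)
  have "(LINT x|M. norm (g x) powr p) \<le> (LINT x|M. norm (f x) powr p)"
    by (intro integral_mono_AE LpS_integrable[OF f] \<open>integrable M (\<lambda>x. norm (g x) powr p)\<close> ae)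
  thus "LpN M p g \<le> LpN M p f" unfolding LpN_def using p by (intro powr_mono2) auto
qed

lemma LpN_scale:
  assumes "\<And>x. norm (g x) = k * norm (f x)" "k \<ge> 0" "p > 0"
  shows "LpN M p g = k * LpN M p f"
proof -
  have "(LINT x|M. norm (g x) powr p) = (LINT x|M. k powr p * norm (f x) powr p)"
    using assms by (simp add: powr_mult)
  thus ?thesis using assms by (simp add: LpN_def powr_mult powr_powr)
qed

lemma LpS_scale:
  assumes "f \<in> LpS M p" "g \<in> borel_measurable M" "\<And>x. norm (g x) = k * norm (f x)" "k \<ge> 0"
  shows "g \<in> LpS M p"
proof -
  have "(\<lambda>x. norm (g x) powr p) = (\<lambda>x. k powr p * norm (f x) powr p)"
    using assms by (auto simp: powr_mult)
  thus ?thesis using assms by (simp add: LpS_def)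
qed

lemma LpS_0 [simp]: "(\<lambda>x. 0) \<in> LpS M p" and LpN_0 [simp]: "p > 0 ==> LpN M p (\<lambda>x. 0) = 0"
  by (simp_all add: LpS_def LpN_def)

lemma LpS_add:
  assumes f: "f \<in> LpS M p" and g: "g \<in> LpS M p" and p: "p > 0"
  shows "(\<lambda>x. f x + g x) \<in> LpS M p"
proof -
  note [measurable] = LpS_measurable[OF f] LpS_measurable[OF g]
  have "integrable M (\<lambda>x. norm (f x + g x) powr p)"
  proof (rule bint_bound)
    show "integrable M (\<lambda>x. 2 powr p * (norm (f x) powr p + norm (g x) powr p))"
      using LpS_integrable[OF f] LpS_integrable[OF g] by simp
    show "AE x in M. norm (norm (f x + g x) powr p) \<le> norm (2 powr p * (norm (f x) powr p + norm (g x) powr p))"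
    proof (rule AE_I2)
      fix x
      have "norm (f x + g x) \<le> 2 * max (norm (f x)) (norm (g x))"
        using norm_triangle_ineq[of "f x" "g x"] by linarith
      hence "norm (f x + g x) powr p \<le> (2 * max (norm (f x)) (norm (g x))) powr p"
        using p by (intro powr_mono2) auto
      also have "... = 2 powr p * (max (norm (f x)) (norm (g x))) powr p"
        by (subst powr_mult) (auto simp: le_max_iff_disj)
      also have "... \<le> 2 powr p * (norm (f x) powr p + norm (g x) powr p)"
        by (intro mult_left_mono) (auto simp: max_def)
      finally show "norm (norm (f x + g x) powr p) \<le> norm (2 powr p * (norm (f x) powr p + norm (g x) powr p))"
        by simp
    qed
  qed simp
  thus ?thesis by (simp add: LpS_def)
qed

lemma LpS_uminus:
  assumes "f \<in> LpS M p"
  shows "(\<lambda>x. - f x) \<in> LpS M p"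
  using assms by (simp add: LpS_def)

lemma LpS_diff: "f \<in> LpS M p ==> g \<in> LpS M p ==> p > 0 ==> (\<lambda>x. f x - g x) \<in> LpS M p"
  using LpS_add[OF _ LpS_uminus] by fastforce

lemma LpN_diff_commute: "LpD M p f g = LpD M p g f"
  by (simp add: LpN_def norm_minus_commute)

lemma LpN_eq_0_iff:
  assumes "f \<in> LpS M p" "p > 0"
  shows "LpN M p f = 0 \<longleftrightarrow> (AE x in M. f x = 0)"
proof -
  have "LpN M p f = 0 \<longleftrightarrow> (LINT x|M. norm (f x) powr p) = 0" by (simp add: LpN_def)
  also have "... \<longleftrightarrow> (AE x in M. norm (f x) powr p = 0)"
    by (intro integral_nonneg_eq_0_iff_AE LpS_integrable[OF assms(1)]) auto
  also have "... \<longleftrightarrow> (AE x in M. f x = 0)" by simp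
  finally show ?thesis .
qed

lemma LpN_cong_AE:
  assumes "f \<in> borel_measurable M" "g \<in> borel_measurable M" "AE x in M. f x = g x"
  shows "LpN M p f = LpN M p g"
proof -
  have "(LINT x|M. norm (f x) powr p) = (LINT x|M. norm (g x) powr p)"
    by (rule integral_cong_AE) (use assms in \<open>auto elim!: eventually_mono\<close>)
  thus ?thesis by (simp add: LpN_def)
qed

text \<open>If \<open>s\<close> or \<open>t\<close> is 0, the claim reduces to
  \<open>y powr p \<le> y\<close> on \<open>[0, 1]\<close>; otherwise it is convexity of the power
  on the positive half-line.\<close>

lemma powr_convex_combination:
  fixes s t r :: real
  assumes "0 \<le> s" "0 \<le> t" "0 \<le> r" "r \<le> 1" "p \<ge> 1"
  shows "(r * s + (1 - r) * t) powr p \<le> r * s powr p + (1 - r) * t powr p"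
proof -
  have le: "y powr p \<le> y" if "0 \<le> y" "y \<le> 1" for y :: real
    using that assms powr_mono'[of 1 p y] by simp
  consider "s = 0" | "t = 0" | "s > 0" "t > 0" using assms by linarith
  thus ?thesis
  proof cases
    case 1
    thus ?thesis using le[of "1 - r"] assms by (auto simp: powr_mult intro!: mult_right_mono)
  next
    case 2
    thus ?thesis using le[of r] assms by (auto simp: powr_mult intro!: mult_right_mono)
  next
    case 3
    thus ?thesis using convex_onD[OF powr_convex[OF assms(5)], of "1 - r" s t] assms by simp
  qed
qed

text \<open>With \<open>r = A / (A + B)\<close>, \<open>|f| + |g|\<close> is \<open>A + B\<close>
  times a convex combination of \<open>|f| / A\<close> and \<open>|g| / B\<close>, whose
  \<open>p\<close>-th powers have integral 1.\<close>

lemma Minkowski: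
  assumes f: "f \<in> LpS M p" and g: "g \<in> LpS M p" and p: "p \<ge> 1"
  shows "LpN M p (\<lambda>x. f x + g x) \<le> LpN M p f + LpN M p g"
proof -
  have p0: "p > 0" using p by simp
  note [measurable] = LpS_measurable[OF f] LpS_measurable[OF g]
  define A B where "A = LpN M p f" and "B = LpN M p g"
  have AB: "A \<ge> 0" "B \<ge> 0" by (auto simp: A_def B_def)
  consider "A = 0" | "B = 0" | "A > 0" "B > 0" using AB by linarith
  thus ?thesis
  proof cases
    case 1
    hence "AE x in M. f x = 0" using LpN_eq_0_iff[OF f p0] by (simp add: A_def)
    hence "LpN M p (\<lambda>x. f x + g x) = LpN M p g" by (intro LpN_cong_AE) auto
    thus ?thesis using AB A_def by simp
  next
    case 2
    hence "AE x in M. g x = 0" using LpN_eq_0_iff[OF g p0] by (simp add: B_def)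
    hence "LpN M p (\<lambda>x. f x + g x) = LpN M p f" by (intro LpN_cong_AE) auto
    thus ?thesis using AB B_def by simp
  next
    case 3
    define r where "r = A / (A + B)"
    have r: "0 \<le> r" "r \<le> 1" "1 - r = B / (A + B)" using 3 by (auto simp: r_def field_simps)
    have pt: "norm (f x + g x) powr p \<le> (A + B) powr p * (r * (norm (f x) powr p / A powr p)
        + (1 - r) * (norm (g x) powr p / B powr p))" for x
    proof -
      have "norm (f x + g x) \<le> norm (f x) + norm (g x)" by (rule norm_triangle_ineq)
      also have "... = (A + B) * (r * (norm (f x) / A) + (1 - r) * (norm (g x) / B))"
      proof -
        define s where "s = A + B"
        have "s \<noteq> 0" using 3 by (simp add: s_def)
        thus ?thesis unfolding r(3) unfolding r_def s_def[symmetric] using 3 by (simp add: distrib_left)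
      qed
      finally have "norm (f x + g x) powr p \<le> ((A + B) * (r * (norm (f x) / A) + (1 - r) * (norm (g x) / B))) powr p"
        using p by (intro powr_mono2) auto
      also have "... = (A + B) powr p * (r * (norm (f x) / A) + (1 - r) * (norm (g x) / B)) powr p"
        using 3 r by (subst powr_mult) auto
      also have "... \<le> (A + B) powr p * (r * (norm (f x) / A) powr p + (1 - r) * (norm (g x) / B) powr p)"
        using 3 r p by (intro mult_left_mono powr_convex_combination) auto
      finally show ?thesis using 3 by (simp add: powr_divide)
    qed
    have I: "(LINT x|M. norm (f x) powr p) = A powr p" "(LINT x|M. norm (g x) powr p) = B powr p"
      using p0 by (auto simp: A_def B_def LpN_powr)
    have "(LINT x|M. norm (f x + g x) powr p) \<le> (LINT x|M. (A + B) powr p * (r * (norm (f x) powr p / A powr p)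
        + (1 - r) * (norm (g x) powr p / B powr p)))"
      using LpS_integrable[OF f] LpS_integrable[OF g]
      by (intro integral_mono pt LpS_integrable[OF LpS_add[OF f g p0]]) auto
    also have "... = (A + B) powr p"
      using LpS_integrable[OF f] LpS_integrable[OF g] 3 by (simp add: I)
    finally show ?thesis using 3 p0 by (subst LpN_le_iff) (auto simp: A_def B_def)
  qed
qed

lemma Minkowski_diff:
  assumes f: "f \<in> LpS M p" and g: "g \<in> LpS M p" and h: "h \<in> LpS M p" and p: "p \<ge> 1"
  shows "LpD M p f h \<le> LpD M p f g + LpD M p g h"
  using Minkowski[OF LpS_diff[OF f g] LpS_diff[OF g h] p] p by simp

lemma LpN_diff_abs:
  assumes f: "f \<in> LpS M p" and g: "g \<in> LpS M p" and p: "p \<ge> 1"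
  shows "\<bar>LpN M p f - LpN M p g\<bar> \<le> LpD M p f g"
  using Minkowski_diff[OF f g LpS_0 p] Minkowski_diff[OF g f LpS_0 p] LpN_diff_commute[of M p f g]
  by (auto simp: abs_le_iff)

lemma LpN_tendsto:
  assumes f: "\<And>n. f n \<in> LpS M p" and g: "g \<in> LpS M p" and p: "p \<ge> 1"
    and lim: "Lp_lim M p f g"
  shows "(\<lambda>n. LpN M p (f n)) \<longlonglongrightarrow> LpN M p g"
proof (rule LIM_zero_cancel, rule Lim_null_comparison[OF _ lim])
  show "\<forall>\<^sub>F n in sequentially. norm (LpN M p (f n) - LpN M p g) \<le> LpD M p (f n) g"
    using LpN_diff_abs[OF f g p] by auto
qed

lemma Hoelder:
  fixes f g :: "'a \<Rightarrow> real"
  assumes f: "f \<in> LpS M p" and g: "g \<in> LpS M q" and pq: "p > 1" "q > 1" "1 / p + 1 / q = 1"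
  shows "integrable M (\<lambda>x. f x * g x)" "(LINT x|M. \<bar>f x * g x\<bar>) \<le> LpN M p f * LpN M q g"
    "\<bar>LINT x|M. f x * g x\<bar> \<le> LpN M p f * LpN M q g"
proof -
  note [measurable] = LpS_measurable[OF f] LpS_measurable[OF g]
  have Y: "\<bar>a * b\<bar> \<le> \<bar>a\<bar> powr p / p + \<bar>b\<bar> powr q / q" for a b :: real
    using Youngs_inequality[OF pq, of "\<bar>a\<bar>" "\<bar>b\<bar>"] by (simp add: abs_mult)
  note If = LpS_integrable[OF f, unfolded real_norm_def] and Ig = LpS_integrable[OF g, unfolded real_norm_def]
  show int: "integrable M (\<lambda>x. f x * g x)"
  proof (rule bint_bound)
    show "integrable M (\<lambda>x. \<bar>f x\<bar> powr p / p + \<bar>g x\<bar> powr q / q)"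
      using If Ig by simp
    show "AE x in M. norm (f x * g x) \<le> norm (\<bar>f x\<bar> powr p / p + \<bar>g x\<bar> powr q / q)"
    proof (rule AE_I2)
      fix x show "norm (f x * g x) \<le> norm (\<bar>f x\<bar> powr p / p + \<bar>g x\<bar> powr q / q)"
        using Y[of "f x" "g x"] unfolding real_norm_def by (rule order_trans) simp
    qed
  qed simp
  define A B where "A = LpN M p f" and "B = LpN M q g"
  have AB: "A \<ge> 0" "B \<ge> 0" by (auto simp: A_def B_def)
  show 2: "(LINT x|M. \<bar>f x * g x\<bar>) \<le> LpN M p f * LpN M q g"
  proof (cases "A = 0 \<or> B = 0")
    case True
    hence "AE x in M. \<bar>f x * g x\<bar> = 0"
      using LpN_eq_0_iff[OF f] LpN_eq_0_iff[OF g] pq by (auto simp: A_def B_def elim: eventually_mono)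
    hence "(LINT x|M. \<bar>f x * g x\<bar>) = (LINT x|M. 0)" by (intro integral_cong_AE) auto
    thus ?thesis by simp
  next
    case False
    hence AB: "A > 0" "B > 0" using AB by auto
    have pt: "\<bar>f x * g x\<bar> \<le> A * B * (\<bar>f x\<bar> powr p / A powr p / p + \<bar>g x\<bar> powr q / B powr q / q)" for x
    proof -
      have "\<bar>f x * g x\<bar> = A * B * \<bar>(f x / A) * (g x / B)\<bar>" using AB by (simp add: abs_mult)
      also have "... \<le> A * B * (\<bar>f x / A\<bar> powr p / p + \<bar>g x / B\<bar> powr q / q)"
        using AB by (intro mult_left_mono Y) auto
      finally show ?thesis using AB by (simp add: powr_divide)
    qed
    have I: "(LINT x|M. \<bar>f x\<bar> powr p) = A powr p" "(LINT x|M. \<bar>g x\<bar> powr q) = B powr q"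
      using pq LpN_powr[of p M f] LpN_powr[of q M g] by (auto simp: A_def B_def)
    have "(LINT x|M. \<bar>f x * g x\<bar>) \<le> (LINT x|M. A * B * (\<bar>f x\<bar> powr p / A powr p / p + \<bar>g x\<bar> powr q / B powr q / q))"
      using If Ig int by (intro integral_mono pt) auto
    also have "... = A * B * (1 / p + 1 / q)"
      using If Ig AB by (simp add: I)
    finally show ?thesis using pq by (simp add: A_def B_def)
  qed
  show "\<bar>LINT x|M. f x * g x\<bar> \<le> LpN M p f * LpN M q g"
    using integral_abs_bound[of M "\<lambda>x. f x * g x"] 2 by linarith
qed

lemma LpS_Fatou:
  assumes f: "\<And>n. f n \<in> LpS M p" and g: "g \<in> borel_measurable M" and p: "p > 0" and C: "C \<ge> 0"
    and bound: "\<And>n. LpN M p (f n) \<le> C"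
    and lim: "AE x in M. (\<lambda>n. f n x) \<longlonglongrightarrow> g x"
  shows "g \<in> LpS M p" "LpN M p g \<le> C"
proof -
  note [measurable] = LpS_measurable[OF f] g
  have "(\<integral>\<^sup>+x. ennreal (norm (g x) powr p) \<partial>M) = (\<integral>\<^sup>+x. liminf (\<lambda>n. ennreal (norm (f n x) powr p)) \<partial>M)"
  proof (rule nn_integral_cong_AE)
    show "AE x in M. ennreal (norm (g x) powr p) = liminf (\<lambda>n. ennreal (norm (f n x) powr p))"
      using lim
    proof eventually_elim
      fix x assume "(\<lambda>n. f n x) \<longlonglongrightarrow> g x"
      hence "(\<lambda>n. norm (f n x) powr p) \<longlonglongrightarrow> norm (g x) powr p"
        using p by (intro tendsto_powr' tendsto_norm tendsto_const) auto
      hence "(\<lambda>n. ennreal (norm (f n x) powr p)) \<longlonglongrightarrow> ennreal (norm (g x) powr p)"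
        by (intro tendsto_ennrealI)
      thus "ennreal (norm (g x) powr p) = liminf (\<lambda>n. ennreal (norm (f n x) powr p))"
        by (intro lim_imp_Liminf[symmetric]) auto
    qed
  qed
  also have "... \<le> liminf (\<lambda>n. \<integral>\<^sup>+x. ennreal (norm (f n x) powr p) \<partial>M)"
    by (rule nn_integral_liminf) simp
  also have "... \<le> ennreal (C powr p)"
  proof (rule Liminf_le)
    have "(\<integral>\<^sup>+x. ennreal (norm (f n x) powr p) \<partial>M) \<le> ennreal (C powr p)" for n
      using bound[of n] p C LpS_integrable[OF f, of n]
      by (simp add: LpN_le_iff nn_integral_eq_integral)
    thus "\<forall>\<^sub>F n in sequentially. (\<integral>\<^sup>+x. ennreal (norm (f n x) powr p) \<partial>M) \<le> ennreal (C powr p)" by simp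
  qed simp
  finally have *: "(\<integral>\<^sup>+x. ennreal (norm (g x) powr p) \<partial>M) \<le> ennreal (C powr p)" .
  have "integrable M (\<lambda>x. norm (g x) powr p)"
    by (rule integrableI_nonneg) (use * le_less_trans[OF * ennreal_less_top] in auto)
  thus "g \<in> LpS M p" by (simp add: LpS_def)
  have "(LINT x|M. norm (g x) powr p) \<le> C powr p"
    using * \<open>integrable M (\<lambda>x. norm (g x) powr p)\<close> by (simp add: nn_integral_eq_integral)
  thus "LpN M p g \<le> C" using p C by (simp add: LpN_le_iff)
qed

lemma LpN_tendsto_0_AE_subseq:
  assumes f: "\<And>n. f n \<in> LpS M p" and p: "p > 0" and lim: "(\<lambda>n. LpN M p (f n)) \<longlonglongrightarrow> 0"
  obtains r where "strict_mono (r :: nat \<Rightarrow> nat)" "AE x in M. (\<lambda>n. f (r n) x) \<longlonglongrightarrow> 0"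
proof -
  have "(\<lambda>n. LpN M p (f n) powr p) \<longlonglongrightarrow> 0 powr p"
    using p by (intro tendsto_powr' lim tendsto_const) auto
  hence "(\<lambda>n. LINT x|M. norm (norm (f n x) powr p)) \<longlonglongrightarrow> 0"
    using p by (simp add: LpN_powr)
  from tendsto_L1_AE_subseq[OF LpS_integrable[OF f] this]
  obtain r where r: "strict_mono (r :: nat \<Rightarrow> nat)" "AE x in M. (\<lambda>n. norm (f (r n) x) powr p) \<longlonglongrightarrow> 0"
    by auto
  have "AE x in M. (\<lambda>n. f (r n) x) \<longlonglongrightarrow> 0"
    using r(2)
  proof eventually_elim
    fix x assume "(\<lambda>n. norm (f (r n) x) powr p) \<longlonglongrightarrow> 0"
    hence "(\<lambda>n. (norm (f (r n) x) powr p) powr (1 / p)) \<longlonglongrightarrow> 0 powr (1 / p)"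
      using p by (intro tendsto_powr' tendsto_const) auto
    thus "(\<lambda>n. f (r n) x) \<longlonglongrightarrow> 0" using p by (simp add: powr_powr tendsto_norm_zero_iff)
  qed
  with r(1) show ?thesis by (rule that)
qed

lemma LpN_tendsto_AE_subseq:
  assumes f: "\<And>n. f n \<in> LpS M p" "g \<in> LpS M p" and p: "p > 0"
    and lim: "Lp_lim M p f g"
  obtains r where "strict_mono (r :: nat \<Rightarrow> nat)" "AE x in M. (\<lambda>n. f (r n) x) \<longlonglongrightarrow> g x"
proof -
  obtain r where "strict_mono (r :: nat \<Rightarrow> nat)" "AE x in M. (\<lambda>n. f (r n) x - g x) \<longlonglongrightarrow> 0"
    using LpN_tendsto_0_AE_subseq[OF LpS_diff[OF f p] p lim] by blast
  thus ?thesis using that by (auto simp: LIM_zero_iff)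
qed

lemma LpS_bounded:
  assumes "finite_measure M" "f \<in> borel_measurable M" "AE x in M. norm (f x) \<le> C" "p \<ge> 0"
  shows "f \<in> LpS M p"
proof -
  interpret finite_measure M by fact
  have "integrable M (\<lambda>x. norm (f x) powr p)"
  proof (rule integrable_const_bound[of _ "C powr p"])
    show "AE x in M. norm (norm (f x) powr p) \<le> C powr p"
      using assms(3) by eventually_elim (use assms(4) in \<open>auto intro: powr_mono2\<close>)
  qed (use assms in auto)
  thus ?thesis using assms by (simp add: LpS_def)
qed

lemma LpS_subset:
  assumes "finite_measure M" "f \<in> LpS M p" "0 \<le> r" "r \<le> p"
  shows "f \<in> LpS M r"
proof -
  interpret finite_measure M by fact
  note [measurable] = LpS_measurable[OF assms(2)]
  have "integrable M (\<lambda>x. norm (f x) powr r)"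
  proof (rule bint_bound)
    show "integrable M (\<lambda>x. 1 + norm (f x) powr p)" using LpS_integrable[OF assms(2)] by simp
    show "AE x in M. norm (norm (f x) powr r) \<le> norm (1 + norm (f x) powr p)"
    proof (rule AE_I2)
      fix x
      show "norm (norm (f x) powr r) \<le> norm (1 + norm (f x) powr p)"
      proof (cases "norm (f x) \<le> 1")
        case True
        hence "norm (f x) powr r \<le> 1" using assms by (intro powr_le1) auto
        moreover have "norm (f x) powr p \<ge> 0" "norm (f x) powr r \<ge> 0" by simp_all
        ultimately show ?thesis unfolding real_norm_def by linarith
      next
        case False
        hence "norm (f x) powr r \<le> norm (f x) powr p" using assms by (intro powr_mono) auto
        thus ?thesis by simp
      qed
    qed
  qed simp
  thus ?thesis by (simp add: LpS_def)
qed

section \<open>Truncation and completeness of \<open>L^p\<close>\<close>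

definition trunc :: "nat \<Rightarrow> ('a \<Rightarrow> 'b::real_normed_vector) \<Rightarrow> 'a \<Rightarrow> 'b" where
  "trunc k f x = (if norm (f x) \<le> real k then f x else 0)"

lemma trunc_measurable [measurable]:
  fixes f :: "'a \<Rightarrow> 'b::{banach, second_countable_topology}"
  assumes [measurable]: "f \<in> borel_measurable M"
  shows "trunc k f \<in> borel_measurable M"
  unfolding trunc_def[abs_def] by measurable

lemma norm_trunc_le: "norm (trunc k f x) \<le> norm (f x)" "norm (trunc k f x) \<le> real k"
  by (auto simp: trunc_def)

lemma trunc_LpS:
  assumes f: "f \<in> LpS M p" and p: "p > 0"
  shows "trunc k f \<in> LpS M p" "LpN M p (trunc k f) \<le> LpN M p f"
  using LpS_mono[OF f trunc_measurable[OF LpS_measurable[OF f]]] p norm_trunc_le(1)[of k f] by auto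

lemma trunc_tendsto:
  assumes f: "f \<in> LpS M p" and p: "p > 0"
  shows "Lp_lim M p (\<lambda>k. trunc k f) f"
proof -
  note [measurable] = LpS_measurable[OF f]
  have "(\<lambda>k. LINT x|M. norm (trunc k f x - f x) powr p) \<longlonglongrightarrow> (LINT x|M. 0)"
  proof (rule integral_dominated_convergence[where w = "\<lambda>x. norm (f x) powr p"])
    show "AE x in M. (\<lambda>k. norm (trunc k f x - f x) powr p) \<longlonglongrightarrow> 0"
    proof (rule AE_I2, rule tendsto_eventually)
      fix x
      obtain K where "norm (f x) \<le> real K" using real_arch_simple by blast
      hence "\<forall>k\<ge>K. norm (trunc k f x - f x) powr p = 0" by (auto simp: trunc_def)
      thus "\<forall>\<^sub>F k in sequentially. norm (trunc k f x - f x) powr p = 0"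
        by (auto simp: eventually_sequentially)
    qed
    show "AE x in M. norm (norm (trunc k f x - f x) powr p) \<le> norm (f x) powr p" for k
      using p by (intro AE_I2) (auto simp: trunc_def)
  qed (use LpS_integrable[OF f] in auto)
  hence "(\<lambda>k. (LINT x|M. norm (trunc k f x - f x) powr p) powr (1 / p)) \<longlonglongrightarrow> 0 powr (1 / p)"
    using p by (intro tendsto_powr' tendsto_const) auto
  thus ?thesis using p by (simp add: LpN_def)
qed

lemma L1_le_Lp:
  fixes h :: "'a \<Rightarrow> 'b::{banach, second_countable_topology}"
  assumes M: "finite_measure M" and h: "h \<in> LpS M p" and p: "p > 1"
  shows "integrable M h" "(LINT x|M. norm (h x)) \<le> LpN M p h * LpN M (p / (p - 1)) (\<lambda>x. 1 :: real)"
proof -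
  define q where "q = p / (p - 1)"
  have q: "q > 1" "1 / p + 1 / q = 1" using p by (auto simp: q_def field_simps)
  have 1: "(\<lambda>x. 1 :: real) \<in> LpS M q" by (rule LpS_bounded[OF M, of _ 1]) (use q in auto)
  have n: "(\<lambda>x. norm (h x)) \<in> LpS M p" "LpN M p (\<lambda>x. norm (h x)) = LpN M p h"
    using LpS_D[OF h] by (auto simp: LpS_def LpN_def)
  show "integrable M h" "(LINT x|M. norm (h x)) \<le> LpN M p h * LpN M (p / (p - 1)) (\<lambda>x. 1 :: real)"
    using Hoelder(1,2)[OF n(1) 1 p q] LpS_measurable[OF h] by (auto simp: n(2) q_def integrable_norm_iff)
qed

text \<open>On a finite measure space the sequence is Cauchy in \<open>L^1\<close>, hence has an
  almost everywhere convergent subsequence; Fatou's lemma bounds the \<open>L^p\<close> distance to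
  its limit.\<close>

lemma LpS_complete:
  assumes M: "finite_measure M" and f: "\<And>n. f n \<in> LpS M p" and p: "p > 1"
    and cauchy: "\<And>e. e > 0 ==> \<exists>N. \<forall>m\<ge>N. \<forall>n\<ge>N. LpD M p (f m) (f n) < e"
  obtains g where "g \<in> LpS M p" "Lp_lim M p f g"
proof -
  have p0: "p > 0" using p by simp
  note [measurable] = LpS_measurable[OF f]
  define c where "c = LpN M (p / (p - 1)) (\<lambda>x. 1 :: real) + 1"
  have c: "c > 0" by (simp add: c_def add_nonneg_pos)
  obtain r where r: "strict_mono r" "AE x in M. Cauchy (\<lambda>i. f (r i) x)"
  proof (rule cauchy_L1_AE_cauchy_subseq)
    show "integrable M (f n)" for n by (rule L1_le_Lp(1)[OF M f p])
    fix e :: real assume "e > 0"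
    then obtain N where N: "\<forall>m\<ge>N. \<forall>n\<ge>N. LpD M p (f m) (f n) < e / c" using cauchy[of "e / c"] c by auto
    have "(LINT x|M. norm (f m x - f n x)) < e" if "m \<ge> N" "n \<ge> N" for m n
    proof -
      have "(LINT x|M. norm (f m x - f n x)) \<le> LpD M p (f m) (f n) * (c - 1)"
        using L1_le_Lp(2)[OF M LpS_diff[OF f f p0] p] by (simp add: c_def)
      also have "... \<le> LpD M p (f m) (f n) * c" by (intro mult_left_mono) auto
      also have "... < e" using N that c by (simp add: pos_less_divide_eq)
      finally show ?thesis .
    qed
    thus "\<exists>N. \<forall>m\<ge>N. \<forall>n\<ge>N. (LINT x|M. norm (f m x - f n x)) < e" by blast
  qed
  define g where "g = (\<lambda>x. lim (\<lambda>k. f (r k) x))"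
  have [measurable]: "g \<in> borel_measurable M" unfolding g_def by simp
  have glim: "AE x in M. (\<lambda>k. f (r k) x) \<longlonglongrightarrow> g x"
    using r(2) by eventually_elim (simp add: g_def Cauchy_convergent_iff convergent_LIMSEQ_iff)
  have close: "(\<lambda>x. f n x - g x) \<in> LpS M p" "LpD M p (f n) g \<le> e"
    if N: "\<forall>m\<ge>N. \<forall>n\<ge>N. LpD M p (f m) (f n) < e" "n \<ge> N" and e: "e > 0" for n N e
  proof -
    have b: "LpN M p (\<lambda>x. f n x - f (r (j + N)) x) \<le> e" for j
      using N seq_suble[OF r(1), of "j + N"] by (intro less_imp_le) auto
    have "AE x in M. (\<lambda>j. f n x - f (r (j + N)) x) \<longlonglongrightarrow> f n x - g x"
      using glim by eventually_elim (intro tendsto_diff tendsto_const LIMSEQ_ignore_initial_segment)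
    from LpS_Fatou[OF LpS_diff[OF f f p0] _ p0 less_imp_le[OF e] b this]
    show "(\<lambda>x. f n x - g x) \<in> LpS M p" "LpD M p (f n) g \<le> e" by auto
  qed
  obtain N where "\<forall>m\<ge>N. \<forall>n\<ge>N. LpD M p (f m) (f n) < 1" using cauchy[of 1] by auto
  from LpS_diff[OF f close(1)[OF this order_refl] p0, of N] have g: "g \<in> LpS M p" by simp
  have "Lp_lim M p f g"
  proof (rule LIMSEQ_I)
    fix e :: real assume e: "e > 0"
    then obtain N where "\<forall>m\<ge>N. \<forall>n\<ge>N. LpD M p (f m) (f n) < e / 2" using cauchy[of "e / 2"] by auto
    from close(2)[OF this] have "\<forall>n\<ge>N. LpD M p (f n) g \<le> e / 2" using e by simp
    thus "\<exists>N. \<forall>n\<ge>N. norm (LpD M p (f n) g - 0) < e" using e by fastforce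
  qed
  with g show ?thesis by (rule that)
qed

lemma tendsto_0_le:
  fixes a b :: "nat \<Rightarrow> real"
  assumes "b \<longlonglongrightarrow> 0" "\<And>n. 0 \<le> a n" "\<And>n. a n \<le> b n"
  shows "a \<longlonglongrightarrow> 0"
  by (rule Lim_null_comparison[OF _ assms(1)]) (use assms in auto)

lemma Lp_lim_add:
  assumes "\<And>n. F n \<in> LpS M p" "\<And>n. G n \<in> LpS M p" "f \<in> LpS M p" "g \<in> LpS M p" "p \<ge> 1"
    and lim: "Lp_lim M p F f" "Lp_lim M p G g"
  shows "Lp_lim M p (\<lambda>n x. F n x + G n x) (\<lambda>x. f x + g x)"
proof (rule tendsto_0_le)
  show "(\<lambda>n. LpD M p (F n) f + LpD M p (G n) g) \<longlonglongrightarrow> 0" using tendsto_add[OF lim] by simp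
  show "LpN M p (\<lambda>x. F n x + G n x - (f x + g x)) \<le> LpD M p (F n) f + LpD M p (G n) g" for n
    using Minkowski[OF LpS_diff[OF assms(1,3)] LpS_diff[OF assms(2,4)] assms(5), of n n] assms(5)
    by (simp add: add_diff_add)
qed simp

section \<open>Orthonormal systems and Poisson smoothing\<close>

lemma LpN_2: "LpN M 2 (f :: 'a \<Rightarrow> real) = sqrt (LINT x|M. (f x)^2)"
  by (simp add: LpN_def powr_half_sqrt)

lemma LpS_2: "f \<in> LpS M 2 \<longleftrightarrow> f \<in> borel_measurable M \<and> integrable M (\<lambda>x. (f x :: real)^2)"
  by (simp add: LpS_def)

lemma L2_inner_integrable:
  fixes f g :: "'a \<Rightarrow> real"
  assumes "f \<in> LpS M 2" "g \<in> LpS M 2"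
  shows "integrable M (\<lambda>x. f x * g x)"
  by (rule Hoelder(1)[OF assms]) auto

lemma L2_Cauchy_Schwarz:
  fixes f g :: "'a \<Rightarrow> real"
  assumes "f \<in> LpS M 2" "g \<in> LpS M 2"
  shows "\<bar>LINT x|M. f x * g x\<bar> \<le> LpN M 2 f * LpN M 2 g"
  by (rule Hoelder(3)[OF assms]) auto

lemma L2_inner_tendsto:
  fixes f :: "nat \<Rightarrow> 'a \<Rightarrow> real"
  assumes f: "\<And>n. f n \<in> LpS M 2" and f': "f' \<in> LpS M 2" and g: "\<And>n. g n \<in> LpS M 2" and g': "g' \<in> LpS M 2"
    and lim: "Lp_lim M 2 f f'" "Lp_lim M 2 g g'"
  shows "(\<lambda>n. LINT x|M. f n x * g n x) \<longlonglongrightarrow> (LINT x|M. f' x * g' x)"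
proof (rule LIM_zero_cancel, rule Lim_null_comparison)
  have gl: "(\<lambda>n. LpN M 2 (g n)) \<longlonglongrightarrow> LpN M 2 g'" by (rule LpN_tendsto[OF g g' _ lim(2)]) simp
  show "(\<lambda>n. LpD M 2 (f n) f' * LpN M 2 (g n) + LpN M 2 f' * LpD M 2 (g n) g') \<longlonglongrightarrow> 0"
    using tendsto_add[OF tendsto_mult[OF lim(1) gl] tendsto_mult[OF tendsto_const[of "LpN M 2 f'"] lim(2)]] by simp
  show "\<forall>\<^sub>F n in sequentially. norm ((LINT x|M. f n x * g n x) - (LINT x|M. f' x * g' x)) \<le>
      LpD M 2 (f n) f' * LpN M 2 (g n) + LpN M 2 f' * LpD M 2 (g n) g'"
  proof (rule always_eventually, rule allI)
    fix n
    have d1: "(\<lambda>x. f n x - f' x) \<in> LpS M 2" and d2: "(\<lambda>x. g n x - g' x) \<in> LpS M 2"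
      using f f' g g' by (auto intro: LpS_diff)
    have "(LINT x|M. f n x * g n x) - (LINT x|M. f' x * g' x) = (LINT x|M. f n x * g n x - f' x * g' x)"
      by (intro bint_diff[symmetric] L2_inner_integrable f g f' g')
    also have "... = (LINT x|M. (f n x - f' x) * g n x + f' x * (g n x - g' x))"
      by (simp add: algebra_simps)
    also have "... = (LINT x|M. (f n x - f' x) * g n x) + (LINT x|M. f' x * (g n x - g' x))"
      by (intro bint_add L2_inner_integrable d1 d2 g f')
    finally show "norm ((LINT x|M. f n x * g n x) - (LINT x|M. f' x * g' x)) \<le>
      LpD M 2 (f n) f' * LpN M 2 (g n) + LpN M 2 f' * LpD M 2 (g n) g'"
      using L2_Cauchy_Schwarz[OF d1 g, of n] L2_Cauchy_Schwarz[OF f' d2] by simp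
  qed
qed

lemma LpN_zero_seq: "(\<lambda>n. LpN M 2 (\<lambda>x. f x - f x :: real)) \<longlonglongrightarrow> 0"
  by simp

text \<open>The index starts at \<open>n0\<close> because \<open>phi\<close> is a system from 1 and
  \<open>chi\<close> from 2. The bounds \<open>bd n\<close> make finite sums bounded, hence members
  of every \<open>L^p\<close>.\<close>

locale orthonormal_system = finite_measure M for M :: "'a measure" +
  fixes e :: "nat \<Rightarrow> 'a \<Rightarrow> real" and n0 :: nat and bd :: "nat \<Rightarrow> real"
  assumes e_meas: "n \<ge> n0 ==> e n \<in> borel_measurable M"
    and e_bdd: "n \<ge> n0 ==> x \<in> space M ==> \<bar>e n x\<bar> \<le> bd n"
    and e_orth: "n \<ge> n0 ==> m \<ge> n0 ==> (LINT x|M. e n x * e m x) = (if n = m then 1 else 0)"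
    and e_complete: "f \<in> LpS M 2 ==> (\<And>n. n \<ge> n0 ==> (LINT x|M. f x * e n x) = 0) ==> AE x in M. f x = 0"
begin

definition coef :: "('a \<Rightarrow> real) \<Rightarrow> nat \<Rightarrow> real" where "coef f n = (LINT x|M. f x * e n x)"
definition fsum :: "(nat \<Rightarrow> real) \<Rightarrow> nat \<Rightarrow> 'a \<Rightarrow> real" where "fsum c N x = (\<Sum>n=n0..N. c n * e n x)"

lemma bounded_LpS:
  assumes "f \<in> borel_measurable M" "\<And>x. x \<in> space M ==> \<bar>f x\<bar> \<le> (K::real)" "p \<ge> 0"
  shows "f \<in> LpS M p"
  by (rule LpS_bounded[OF finite_measure_axioms assms(1)]) (use assms(2,3) in \<open>auto intro!: AE_I2\<close>)

lemma e_L2: "n \<ge> n0 ==> e n \<in> LpS M 2"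
  by (rule bounded_LpS[OF e_meas e_bdd]) auto

lemma fsum_measurable: "fsum c N \<in> borel_measurable M"
  unfolding fsum_def by (auto intro!: borel_measurable_sum borel_measurable_times e_meas)

lemma fsum_bdd: "x \<in> space M ==> \<bar>fsum c N x\<bar> \<le> (\<Sum>n=n0..N. \<bar>c n\<bar> * bd n)"
proof -
  assume x: "x \<in> space M"
  have "\<bar>fsum c N x\<bar> \<le> (\<Sum>n=n0..N. \<bar>c n * e n x\<bar>)" unfolding fsum_def by (rule sum_abs)
  also have "... \<le> (\<Sum>n=n0..N. \<bar>c n\<bar> * bd n)"
    by (intro sum_mono) (auto simp: abs_mult intro!: mult_left_mono e_bdd x)
  finally show ?thesis .
qed

lemma fsum_LpS: "p \<ge> 0 ==> fsum c N \<in> LpS M p"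
  by (rule bounded_LpS[OF fsum_measurable fsum_bdd])

lemma inner_fsum:
  assumes "f \<in> LpS M 2"
  shows "(LINT x|M. f x * fsum c N x) = (\<Sum>n=n0..N. c n * coef f n)"
proof -
  have "(LINT x|M. f x * fsum c N x) = (LINT x|M. (\<Sum>n=n0..N. c n * (f x * e n x)))"
    by (simp add: fsum_def sum_distrib_left mult_ac)
  also have "... = (\<Sum>n=n0..N. LINT x|M. c n * (f x * e n x))"
    by (intro bint_sum integrable_mult_right L2_inner_integrable assms e_L2) auto
  finally show ?thesis by (simp add: coef_def)
qed

lemma coef_fsum:
  assumes "m \<ge> n0"
  shows "coef (fsum c N) m = (if m \<le> N then c m else 0)"
proof -
  have "coef (fsum c N) m = (LINT x|M. e m x * fsum c N x)" by (simp add: coef_def mult_ac)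
  also have "... = (\<Sum>n=n0..N. c n * coef (e m) n)" by (rule inner_fsum[OF e_L2[OF assms]])
  also have "... = (\<Sum>n=n0..N. if n = m then c m else 0)"
    by (intro sum.cong) (auto simp: coef_def e_orth assms)
  also have "... = (if m \<le> N then c m else 0)" using assms by (simp add: sum.delta')
  finally show ?thesis .
qed

lemma inner_fsum_fsum: "(LINT x|M. fsum c N x * fsum d N x) = (\<Sum>n=n0..N. c n * d n)"
  by (subst inner_fsum[OF fsum_LpS]) (auto simp: coef_fsum mult_ac intro!: sum.cong)

text \<open>The coefficients \<open>c\<close> are arbitrary: \<open>c = coef f\<close> gives
  Bessel's inequality and Parseval's identity, damped coefficients give the error of Poisson
  means.\<close>

lemma fsum_diff_norm:
  assumes f: "f \<in> LpS M 2"
  shows "(LpD M 2 (fsum c N) f)^2 = (LINT x|M. (f x)^2) - (\<Sum>n=n0..N. (coef f n)^2 - (coef f n - c n)^2)"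
proof -
  have F: "fsum c N \<in> LpS M 2" by (rule fsum_LpS) simp
  have "(LpD M 2 (fsum c N) f)^2 = (LINT x|M. (fsum c N x - f x)^2)"
    unfolding LpN_2 by (simp add: integral_nonneg_AE)
  also have "... = (LINT x|M. fsum c N x * fsum c N x - 2 * (f x * fsum c N x) + f x * f x)"
    by (simp add: power2_eq_square algebra_simps)
  also have "... = (\<Sum>n=n0..N. c n * c n) - 2 * (\<Sum>n=n0..N. c n * coef f n) + (LINT x|M. f x * f x)"
    using L2_inner_integrable[OF F F] L2_inner_integrable[OF f F] L2_inner_integrable[OF f f]
    by (simp add: inner_fsum_fsum inner_fsum[OF f])
  also have "... = (LINT x|M. (f x)^2) - (\<Sum>n=n0..N. (coef f n)^2 - (coef f n - c n)^2)"
    by (simp add: power2_eq_square algebra_simps sum.distrib sum_subtractf sum_distrib_left)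
  finally show ?thesis .
qed

lemma Bessel:
  assumes f: "f \<in> LpS M 2"
  shows "(\<Sum>n=n0..N. (coef f n)^2) \<le> (LINT x|M. (f x)^2)"
  using fsum_diff_norm[OF f, of "coef f" N] zero_le_power2[of "LpD M 2 (fsum (coef f) N) f"]
  by simp

lemma coef_le:
  assumes f: "f \<in> LpS M 2" and n: "n \<ge> n0"
  shows "\<bar>coef f n\<bar> \<le> LpN M 2 f"
proof -
  have "LpN M 2 (e n) = 1" using e_orth[OF n n] by (simp add: LpN_2 power2_eq_square)
  thus ?thesis using L2_Cauchy_Schwarz[OF f e_L2[OF n]] by (simp add: coef_def)
qed

text \<open>The Riesz--Fischer theorem: squared distances of partial sums are differences of the
  bounded monotone sums \<open>S\<close>.\<close>

lemma fsum_converges: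
  assumes bound: "\<And>N. (\<Sum>n=n0..N. (c n)^2) \<le> C"
  obtains g where "g \<in> LpS M 2" "Lp_lim M 2 (fsum c) g" "\<And>n. n \<ge> n0 ==> coef g n = c n"
proof -
  define S where "S = (\<lambda>N. \<Sum>n=n0..N. (c n)^2)"
  have mono: "mono S" unfolding S_def by (intro monoI sum_mono2) auto
  have "Bseq S"
    using bound by (intro BseqI'[of _ C]) (auto simp: S_def sum_nonneg)
  hence "Cauchy S" using mono by (intro convergent_Cauchy Bseq_mono_convergent) (auto dest: monoD)
  have diff: "(LpD M 2 (fsum c m) (fsum c n))^2 = \<bar>S m - S n\<bar>" for m n
  proof -
    have le: "(LpD M 2 (fsum c m) (fsum c n))^2 = S n - S m" if "m \<le> n" for m n
    proof -
      have "(LpD M 2 (fsum c m) (fsum c n))^2 = (LINT x|M. (fsum c n x)^2) - (\<Sum>k=n0..m. (coef (fsum c n) k)^2 - (coef (fsum c n) k - c k)^2)"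
        by (rule fsum_diff_norm[OF fsum_LpS]) simp
      also have "(LINT x|M. (fsum c n x)^2) = S n"
        using inner_fsum_fsum[of c n c] by (simp add: S_def power2_eq_square)
      also have "(\<Sum>k=n0..m. (coef (fsum c n) k)^2 - (coef (fsum c n) k - c k)^2) = S m"
        unfolding S_def using that by (intro sum.cong) (auto simp: coef_fsum)
      finally show ?thesis .
    qed
    show ?thesis
    proof (cases "m \<le> n")
      case True thus ?thesis using le[OF True] monoD[OF mono True] by simp
    next
      case False
      hence nm: "n \<le> m" by simp
      show ?thesis using le[OF nm] monoD[OF mono nm] by (simp add: LpN_diff_commute[of M 2 "fsum c m"])
    qed
  qed
  have c: "\<exists>N. \<forall>m\<ge>N. \<forall>n\<ge>N. LpD M 2 (fsum c m) (fsum c n) < d" if "d > 0" for d :: real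
  proof -
    have "\<exists>N. \<forall>m\<ge>N. \<forall>n\<ge>N. norm (S m - S n) < d^2"
      using that by (intro CauchyD[OF \<open>Cauchy S\<close>]) simp
    then obtain N where N: "\<And>m n. m \<ge> N ==> n \<ge> N ==> \<bar>S m - S n\<bar> < d^2"
      by auto
    have "LpD M 2 (fsum c m) (fsum c n) < d" if "m \<ge> N" "n \<ge> N" for m n
      using N[OF that] \<open>d > 0\<close> unfolding diff[symmetric] by (intro power2_less_imp_less[of _ d]) auto
    thus ?thesis by blast
  qed
  obtain g where g: "g \<in> LpS M 2" "Lp_lim M 2 (fsum c) g"
    by (rule LpS_complete[OF finite_measure_axioms fsum_LpS _ c]) auto
  moreover have "coef g n = c n" if n: "n \<ge> n0" for n
  proof (rule LIMSEQ_unique)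
    show "(\<lambda>N. coef (fsum c N) n) \<longlonglongrightarrow> coef g n"
      unfolding coef_def by (rule L2_inner_tendsto[OF fsum_LpS g(1) e_L2 e_L2 g(2) LpN_zero_seq]) (use n in auto)
    have "eventually (\<lambda>N. coef (fsum c N) n = c n) sequentially"
      using eventually_ge_at_top[of n] by eventually_elim (use n in \<open>auto simp: coef_fsum\<close>)
    thus "(\<lambda>N. coef (fsum c N) n) \<longlonglongrightarrow> c n" by (rule tendsto_eventually)
  qed
  ultimately show ?thesis by (rule that)
qed

text \<open>The Riesz--Fischer limit has the coefficients of \<open>f\<close>, so completeness
  identifies the two.\<close>

lemma fourier_tendsto:
  assumes f: "f \<in> LpS M 2"
  shows "Lp_lim M 2 (fsum (coef f)) f"
proof -
  obtain g where g: "g \<in> LpS M 2" "Lp_lim M 2 (fsum (coef f)) g"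
      "\<And>n. n \<ge> n0 ==> coef g n = coef f n"
    using fsum_converges[OF Bessel[OF f]] by blast
  have "AE x in M. f x - g x = 0"
  proof (rule e_complete)
    show "(\<lambda>x. f x - g x) \<in> LpS M 2" using f g by (intro LpS_diff) auto
    fix n assume n: "n \<ge> n0"
    have "(LINT x|M. (f x - g x) * e n x) = (LINT x|M. f x * e n x - g x * e n x)"
      by (simp add: algebra_simps)
    also have "... = coef f n - coef g n"
      unfolding coef_def using f g n by (intro bint_diff L2_inner_integrable e_L2)
    finally show "(LINT x|M. (f x - g x) * e n x) = 0" using g(3)[OF n] by simp
  qed
  hence "LpD M 2 (fsum (coef f) N) f = LpD M 2 (fsum (coef f) N) g" for N
    using LpS_measurable[OF f] LpS_measurable[OF g(1)] fsum_measurable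
    by (intro LpN_cong_AE) (auto elim: eventually_mono)
  thus ?thesis using g(2) by simp
qed

lemma Parseval:
  assumes f: "f \<in> LpS M 2"
  shows "(\<lambda>N. \<Sum>n=n0..N. (coef f n)^2) \<longlonglongrightarrow> (LINT x|M. (f x)^2)"
proof -
  have "(\<lambda>N. (LpD M 2 (fsum (coef f) N) f)^2) \<longlonglongrightarrow> 0^2"
    by (intro tendsto_power fourier_tendsto f)
  hence "(\<lambda>N. (LINT x|M. (f x)^2) - (LINT x|M. (f x)^2) + (\<Sum>n=n0..N. (coef f n)^2)) \<longlonglongrightarrow> (LINT x|M. (f x)^2) - 0"
    unfolding fsum_diff_norm[OF f] using tendsto_diff[OF tendsto_const[of "LINT x|M. (f x)^2"]] by fastforce
  thus ?thesis by simp
qed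

end

section \<open>Poisson means and approximation by bounded finite sums\<close>

lemma L1_le_L2:
  fixes h :: "'a \<Rightarrow> real"
  assumes "finite_measure M" "h \<in> LpS M 2"
  shows "integrable M h" "(LINT x|M. \<bar>h x\<bar>) \<le> LpN M 2 h * LpN M 2 (\<lambda>x. 1 :: real)"
  using L1_le_Lp[OF assms] by auto

lemma uniform_imp_L2_lim:
  fixes F :: "nat \<Rightarrow> 'a \<Rightarrow> real"
  assumes M: "finite_measure M" and m: "\<And>n. F n \<in> borel_measurable M" "f \<in> borel_measurable M"
    and u: "\<And>e. e > 0 ==> \<exists>N. \<forall>n\<ge>N. \<forall>x\<in>space M. \<bar>F n x - f x\<bar> \<le> e"
  shows "Lp_lim M 2 F f"
proof (rule LIMSEQ_I)
  fix e :: real assume e: "e > 0"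
  define k where "k = LpN M 2 (\<lambda>x. 1 :: real) + 1"
  have k: "k > 0" by (simp add: k_def add_nonneg_pos)
  obtain N where N: "\<forall>n\<ge>N. \<forall>x\<in>space M. \<bar>F n x - f x\<bar> \<le> e / k" using u[of "e / k"] e k by auto
  have "LpD M 2 (F n) f < e" if "n \<ge> N" for n
  proof -
    have c: "(\<lambda>x. e / k) \<in> LpS M 2" by (rule LpS_bounded[OF M, of _ "\<bar>e / k\<bar>"]) auto
    have "LpD M 2 (F n) f \<le> LpN M 2 (\<lambda>x. e / k)"
      using N that e k m by (intro LpS_mono(2)[OF c]) (auto intro!: AE_I2)
    also have "... = e / k * LpN M 2 (\<lambda>x. 1 :: real)" by (rule LpN_scale) (use e k in auto)
    also have "... < e / k * k" using e k by (intro mult_strict_left_mono) (auto simp: k_def)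
    finally show ?thesis using k by simp
  qed
  thus "\<exists>N. \<forall>n\<ge>N. norm (LpD M 2 (F n) f - 0) < e" by auto
qed

text \<open>The \<open>L\<^sup>1\<close> contractivity assumed here is inherited by \<open>L\<^sup>\<infinity>\<close> by duality.\<close>

locale poisson_system = orthonormal_system +
  fixes l :: "nat \<Rightarrow> real"
  assumes l_nonneg: "l n \<ge> 0"
    and l_summable: "s > 0 ==> summable (\<lambda>n. exp (- s * l n) * bd n)"
    and contr: "s \<ge> 0 ==> (LINT x|M. \<bar>fsum (\<lambda>n. exp (- s * l n) * c n) N x\<bar>) \<le> (LINT x|M. \<bar>fsum c N x\<bar>)"
begin

definition pois :: "real \<Rightarrow> ('a \<Rightarrow> real) \<Rightarrow> 'a \<Rightarrow> real" where
  "pois s f x = (\<Sum>n. if n \<ge> n0 then exp (- s * l n) * coef f n * e n x else 0)"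

definition pois_sum :: "real \<Rightarrow> ('a \<Rightarrow> real) \<Rightarrow> nat \<Rightarrow> 'a \<Rightarrow> real" where
  "pois_sum s f N = fsum (\<lambda>n. exp (- s * l n) * coef f n) N"

lemma pois_term_bound:
  assumes f: "f \<in> LpS M 2" and x: "x \<in> space M" and n: "n \<ge> n0"
  shows "\<bar>exp (- s * l n) * coef f n * e n x\<bar> \<le> LpN M 2 f * (exp (- s * l n) * bd n)"
proof -
  have "\<bar>exp (- s * l n) * coef f n * e n x\<bar> = exp (- s * l n) * (\<bar>coef f n\<bar> * \<bar>e n x\<bar>)"
    by (simp add: abs_mult)
  also have "... \<le> exp (- s * l n) * (LpN M 2 f * bd n)"
    using coef_le[OF f n] e_bdd[OF n x] by (intro mult_left_mono mult_mono) auto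
  finally show ?thesis by (simp add: mult_ac)
qed

lemma pois_summable:
  assumes f: "f \<in> LpS M 2" and x: "x \<in> space M" and s: "s > 0"
  shows "summable (\<lambda>n. if n \<ge> n0 then exp (- s * l n) * coef f n * e n x else 0)"
proof (rule summable_comparison_test)
  show "summable (\<lambda>n. LpN M 2 f * (exp (- s * l n) * bd n))"
    by (intro summable_mult l_summable s)
  show "\<exists>N. \<forall>n\<ge>N. norm (if n \<ge> n0 then exp (- s * l n) * coef f n * e n x else 0) \<le> LpN M 2 f * (exp (- s * l n) * bd n)"
    using pois_term_bound[OF f x, of _ s] by (intro exI[of _ n0]) auto
qed

lemma pois_uniform:
  assumes f: "f \<in> LpS M 2" and s: "s > 0" and d: "d > 0"
  shows "\<exists>N1. \<forall>N\<ge>N1. \<forall>x\<in>space M. \<bar>pois_sum s f N x - pois s f x\<bar> \<le> d"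
proof -
  define b where "b = (\<lambda>n. if n \<ge> n0 then LpN M 2 f * (exp (- s * l n) * bd n) else 0)"
  have sb0: "summable (\<lambda>n. LpN M 2 f * (exp (- s * l n) * bd n))"
    by (intro summable_mult l_summable s)
  have sb: "summable b"
    by (rule summable_cong[THEN iffD1, OF _ sb0], rule eventually_mono[OF eventually_ge_at_top[of n0]])
       (simp add: b_def)
  obtain N1 where N1: "\<And>n. n \<ge> N1 ==> norm (\<Sum>i. b (i + n)) < d"
    using suminf_exist_split[OF d sb] by blast
  have "\<bar>pois_sum s f N x - pois s f x\<bar> \<le> d" if N: "N \<ge> N1" and x: "x \<in> space M" for N x
  proof -
    define t where "t = (\<lambda>n. if n \<ge> n0 then exp (- s * l n) * coef f n * e n x else 0)"
    have tb: "\<bar>t n\<bar> \<le> b n" for n using pois_term_bound[OF f x, of n s] by (auto simp: t_def b_def)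
    have st: "summable t" by (rule summable_comparison_test[OF _ sb]) (use tb in auto)
    have sta: "summable (\<lambda>n. \<bar>t n\<bar>)" by (rule summable_comparison_test[OF _ sb]) (use tb in auto)
    have "pois_sum s f N x = (\<Sum>n<Suc N. t n)"
      unfolding pois_sum_def fsum_def t_def
      by (rule sum.mono_neutral_cong_left) auto
    hence "pois s f x - pois_sum s f N x = (\<Sum>i. t (i + Suc N))"
      using suminf_minus_initial_segment[OF st, of "Suc N"] by (simp add: pois_def t_def)
    also have "\<bar>...\<bar> \<le> (\<Sum>i. \<bar>t (i + Suc N)\<bar>)"
      using sta by (intro summable_rabs summable_ignore_initial_segment)
    also have "... \<le> (\<Sum>i. b (i + Suc N))"
      using sb sta tb by (intro suminf_le summable_ignore_initial_segment)
    also have "... \<le> d" using N1[of "Suc N"] N by auto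
    finally show ?thesis by (simp add: abs_minus_commute)
  qed
  thus ?thesis by blast
qed

lemma pois_measurable [measurable]: "pois s f \<in> borel_measurable M"
proof -
  have "(\<lambda>x. if n \<ge> n0 then exp (- s * l n) * coef f n * e n x else 0) \<in> borel_measurable M" for n
    by (cases "n \<ge> n0") (auto intro!: borel_measurable_times e_meas)
  thus ?thesis unfolding pois_def[abs_def] by (rule borel_measurable_suminf)
qed

text \<open>Duality with \<open>g\<close> the indicator of the set where
  \<open>pois s f > K\<close>. Damping is symmetric, so it can be moved to the expansion of
  \<open>g\<close>, where \<open>L^1\<close> contractivity bounds the pairing, in the limit, by
  \<open>K\<close> times the integral of \<open>g\<close>. Hence \<open>(pois s f - K) * g\<close>,
  which is nonnegative by the choice of \<open>g\<close>, has integral at most 0.\<close>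

lemma pois_le:
  assumes f: "f \<in> borel_measurable M" "\<And>x. x \<in> space M ==> \<bar>f x\<bar> \<le> K" and s: "s > 0"
  shows "AE x in M. pois s f x \<le> K"
proof -
  have fL: "f \<in> LpS M 2" by (rule bounded_LpS[OF f]) auto
  define A where "A = {x \<in> space M. pois s f x > K}"
  have A: "A \<in> sets M" unfolding A_def by measurable
  define g where "g = (indicator A :: 'a \<Rightarrow> real)"
  have g: "g \<in> borel_measurable M" using A by (simp add: g_def)
  have gL: "g \<in> LpS M 2" by (rule LpS_bounded[OF finite_measure_axioms g, of 1]) (auto simp: g_def indicator_def)
  obtain N1 where N1: "\<And>N x. N \<ge> N1 ==> x \<in> space M ==> \<bar>pois_sum s f N x - pois s f x\<bar> \<le> 1"
    using pois_uniform[OF fL s, of 1] by auto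
  have pL: "pois_sum s f N \<in> LpS M 2" for N unfolding pois_sum_def by (rule fsum_LpS) simp
  have "\<exists>C. \<forall>x\<in>space M. \<bar>pois s f x\<bar> \<le> C"
  proof (intro exI ballI)
    fix x assume x: "x \<in> space M"
    show "\<bar>pois s f x\<bar> \<le> (\<Sum>n=n0..N1. \<bar>exp (- s * l n) * coef f n\<bar> * bd n) + 1"
      using N1[OF order_refl x] fsum_bdd[OF x, of "\<lambda>n. exp (- s * l n) * coef f n" N1]
      unfolding pois_sum_def by linarith
  qed
  then obtain C where C: "\<And>x. x \<in> space M ==> \<bar>pois s f x\<bar> \<le> C" by blast
  have PL: "pois s f \<in> LpS M 2" by (rule bounded_LpS[OF pois_measurable C]) auto
  have lim: "Lp_lim M 2 (pois_sum s f) (pois s f)"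
    by (rule uniform_imp_L2_lim[OF finite_measure_axioms LpS_measurable[OF pL] pois_measurable pois_uniform[OF fL s]])
  have L1: "(\<lambda>N. LINT x|M. pois_sum s f N x * g x) \<longlonglongrightarrow> (LINT x|M. pois s f x * g x)"
    by (rule L2_inner_tendsto[OF pL PL gL gL lim LpN_zero_seq])
  have b: "(LINT x|M. pois_sum s f N x * g x) \<le> K * (LINT x|M. \<bar>fsum (coef g) N x\<bar>)" for N
  proof -
    have "(LINT x|M. pois_sum s f N x * g x) = (LINT x|M. g x * fsum (\<lambda>n. exp (- s * l n) * coef f n) N x)"
      by (simp add: pois_sum_def mult_ac)
    also have "... = (LINT x|M. f x * pois_sum s g N x)"
      unfolding pois_sum_def inner_fsum[OF gL] inner_fsum[OF fL] by (simp add: mult_ac)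
    also have "... \<le> (LINT x|M. K * \<bar>pois_sum s g N x\<bar>)"
    proof (rule integral_mono_AE)
      have gs: "pois_sum s g N \<in> LpS M 2" unfolding pois_sum_def by (rule fsum_LpS) simp
      show "integrable M (\<lambda>x. f x * pois_sum s g N x)" by (rule L2_inner_integrable[OF fL gs])
      show "integrable M (\<lambda>x. K * \<bar>pois_sum s g N x\<bar>)" using L1_le_L2(1)[OF finite_measure_axioms gs] by simp
      show "AE x in M. f x * pois_sum s g N x \<le> K * \<bar>pois_sum s g N x\<bar>"
      proof (rule AE_I2)
        fix x assume x: "x \<in> space M"
        have "f x * pois_sum s g N x \<le> \<bar>f x\<bar> * \<bar>pois_sum s g N x\<bar>" by (simp flip: abs_mult)
        also have "... \<le> K * \<bar>pois_sum s g N x\<bar>" using f(2)[OF x] by (intro mult_right_mono) auto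
        finally show "f x * pois_sum s g N x \<le> K * \<bar>pois_sum s g N x\<bar>" .
      qed
    qed
    also have "... = K * (LINT x|M. \<bar>pois_sum s g N x\<bar>)" by simp
    also have "... \<le> K * (LINT x|M. \<bar>fsum (coef g) N x\<bar>)"
    \<comment> \<open>On an empty space \<open>K\<close> may be negative, but then all integrals
      vanish.\<close>
    proof (cases "space M = {}")
      case True
      have "(LINT x|M. h x) = (LINT x|M. 0)" for h :: "'a \<Rightarrow> real"
        by (rule bint_cong) (simp_all add: True)
      thus ?thesis by simp
    next
      case False
      then obtain x where "x \<in> space M" by auto
      hence "K \<ge> 0" using f(2)[of x] by linarith
      thus ?thesis unfolding pois_sum_def using contr[of s] s by (intro mult_left_mono) auto
    qed
    finally show ?thesis .
  qed
  have L2: "(\<lambda>N. LINT x|M. \<bar>fsum (coef g) N x\<bar>) \<longlonglongrightarrow> (LINT x|M. \<bar>g x\<bar>)"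
  proof (rule LIM_zero_cancel, rule tendsto_rabs_zero_cancel, rule tendsto_0_le)
    show "(\<lambda>N. LpD M 2 (fsum (coef g) N) g * LpN M 2 (\<lambda>x. 1 :: real)) \<longlonglongrightarrow> 0"
      by (rule tendsto_mult_left_zero[OF fourier_tendsto[OF gL]])
    fix N
    have F: "fsum (coef g) N \<in> LpS M 2" by (rule fsum_LpS) simp
    note I = L1_le_L2[OF finite_measure_axioms F] L1_le_L2[OF finite_measure_axioms gL]
      L1_le_L2[OF finite_measure_axioms LpS_diff[OF F gL]]
    have "\<bar>(LINT x|M. \<bar>fsum (coef g) N x\<bar>) - (LINT x|M. \<bar>g x\<bar>)\<bar> = \<bar>LINT x|M. \<bar>fsum (coef g) N x\<bar> - \<bar>g x\<bar>\<bar>"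
      using I by simp
    also have "... \<le> (LINT x|M. \<bar>\<bar>fsum (coef g) N x\<bar> - \<bar>g x\<bar>\<bar>)" by (rule integral_abs_bound)
    also have "... \<le> (LINT x|M. \<bar>fsum (coef g) N x - g x\<bar>)" using I by (intro integral_mono) auto
    also have "... \<le> LpD M 2 (fsum (coef g) N) g * LpN M 2 (\<lambda>x. 1 :: real)" using I(6) by simp
    finally show "\<bar>(LINT x|M. \<bar>fsum (coef g) N x\<bar>) - (LINT x|M. \<bar>g x\<bar>)\<bar> \<le> ..." .
  qed simp
  have "(LINT x|M. pois s f x * g x) \<le> K * (LINT x|M. \<bar>g x\<bar>)"
    by (rule LIMSEQ_le[OF L1 tendsto_mult[OF tendsto_const L2]]) (use b in auto)
  moreover have "(LINT x|M. pois s f x * g x - K * g x) = (LINT x|M. pois s f x * g x) - K * (LINT x|M. \<bar>g x\<bar>)"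
  proof -
    have "\<bar>g x\<bar> = g x" for x by (simp add: g_def)
    thus ?thesis using L2_inner_integrable[OF PL gL] L1_le_L2(1)[OF finite_measure_axioms gL] by simp
  qed
  moreover have nn: "AE x in M. 0 \<le> pois s f x * g x - K * g x"
    by (intro AE_I2) (auto simp: g_def indicator_def A_def)
  moreover have "(LINT x|M. pois s f x * g x - K * g x) \<ge> 0" using nn by (rule integral_nonneg_AE)
  ultimately have "(LINT x|M. pois s f x * g x - K * g x) = 0" by linarith
  hence "AE x in M. pois s f x * g x - K * g x = 0"
    using integral_nonneg_eq_0_iff_AE[OF _ nn] L2_inner_integrable[OF PL gL] L1_le_L2(1)[OF finite_measure_axioms gL]
    by simp
  with AE_space show ?thesis
    by eventually_elim (auto simp: g_def indicator_def A_def split: if_splits)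
qed

lemma pois_uminus:
  assumes f: "f \<in> LpS M 2" and x: "x \<in> space M" and s: "s > 0"
  shows "pois s (\<lambda>x. - f x) x = - pois s f x"
proof -
  have "coef (\<lambda>x. - f x) n = - coef f n" for n by (simp add: coef_def)
  hence "(\<lambda>n. if n \<ge> n0 then exp (- s * l n) * coef (\<lambda>x. - f x) n * e n x else 0)
      = (\<lambda>n. - (if n \<ge> n0 then exp (- s * l n) * coef f n * e n x else 0))" by auto
  thus ?thesis unfolding pois_def using suminf_minus[OF pois_summable[OF f x s]] by simp
qed

lemma pois_abs_le:
  assumes f: "f \<in> borel_measurable M" "\<And>x. x \<in> space M ==> \<bar>f x\<bar> \<le> K" and s: "s > 0"
  shows "AE x in M. \<bar>pois s f x\<bar> \<le> K"
proof -
  have fL: "f \<in> LpS M 2" by (rule bounded_LpS[OF f]) auto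
  have "AE x in M. pois s (\<lambda>x. - f x) x \<le> K"
    using f by (intro pois_le s) auto
  moreover have "AE x in M. pois s f x \<le> K" by (intro pois_le f s)
  ultimately show ?thesis
    using AE_space by eventually_elim (auto simp: pois_uminus[OF fL _ s])
qed

text \<open>\<open>N2\<close> makes the tail of \<open>f\<close> small, then \<open>s\<close> makes
  the damping of the first \<open>N2\<close> coefficients small, then \<open>N1\<close> brings the
  partial sum uniformly within 1 of \<open>pois s f\<close>, whose modulus is at most
  \<open>K\<close>. Passing to \<open>max N1 N2\<close> does not spoil the \<open>L^2\<close> error
  because every summand in \<open>fsum_diff_norm\<close> is nonnegative.\<close>

lemma smoothing_aux:
  assumes f: "f \<in> borel_measurable M" "\<And>x. x \<in> space M ==> \<bar>f x\<bar> \<le> K" and d: "d > 0"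
  shows "\<exists>c N. (LpD M 2 (fsum c N) f)^2 \<le> d \<and> (AE x in M. \<bar>fsum c N x\<bar> \<le> K + 1)"
proof -
  have fL: "f \<in> LpS M 2" by (rule bounded_LpS[OF f]) auto
  define E where "E = (LINT x|M. (f x)^2)"
  have "eventually (\<lambda>N. (\<Sum>n=n0..N. (coef f n)^2) > E - d / 2) sequentially"
    using d by (intro order_tendstoD(1)[OF Parseval[OF fL]]) (simp add: E_def)
  then obtain N2 where N2: "(\<Sum>n=n0..N2. (coef f n)^2) > E - d / 2"
    using eventually_happens'[OF sequentially_bot] by blast
  have "((\<lambda>s. \<Sum>n=n0..N2. (1 - exp (- s * l n))^2 * (coef f n)^2) \<longlongrightarrow> (\<Sum>n=n0..N2. (1 - exp (- 0 * l n))^2 * (coef f n)^2)) (at_right 0)"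
    by (intro tendsto_intros)
  hence "((\<lambda>s. \<Sum>n=n0..N2. (1 - exp (- s * l n))^2 * (coef f n)^2) \<longlongrightarrow> 0) (at_right 0)" by simp
  hence "eventually (\<lambda>s. (\<Sum>n=n0..N2. (1 - exp (- s * l n))^2 * (coef f n)^2) < d / 2) (at_right 0)"
    using d by (intro order_tendstoD(2)) auto
  moreover have "eventually (\<lambda>s::real. s > 0) (at_right 0)" by (simp add: eventually_at_right_less)
  ultimately have "eventually (\<lambda>s. (\<Sum>n=n0..N2. (1 - exp (- s * l n))^2 * (coef f n)^2) < d / 2 \<and> s > 0) (at_right 0)"
    by eventually_elim auto
  then obtain s where s: "(\<Sum>n=n0..N2. (1 - exp (- s * l n))^2 * (coef f n)^2) < d / 2" "s > 0"
    using eventually_happens'[OF trivial_limit_at_right_real] by blast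
  obtain N1 where N1: "\<And>N x. N \<ge> N1 ==> x \<in> space M ==> \<bar>pois_sum s f N x - pois s f x\<bar> \<le> 1"
    using pois_uniform[OF fL s(2), of 1] by auto
  define N where "N = max N1 N2"
  define c where "c = (\<lambda>n. exp (- s * l n) * coef f n)"
  have t: "(coef f n)^2 - (coef f n - c n)^2 = (coef f n)^2 - (1 - exp (- s * l n))^2 * (coef f n)^2" for n
  proof -
    have "coef f n - c n = (1 - exp (- s * l n)) * coef f n" by (simp add: c_def algebra_simps)
    thus ?thesis by (simp add: power_mult_distrib)
  qed
  have t0: "(coef f n)^2 - (coef f n - c n)^2 \<ge> 0" for n
  proof -
    have "(1 - exp (- s * l n))^2 \<le> 1" using s l_nonneg[of n] by (intro power_le_one) auto
    hence "(1 - exp (- s * l n))^2 * (coef f n)^2 \<le> 1 * (coef f n)^2" by (intro mult_right_mono) auto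
    thus ?thesis unfolding t by simp
  qed
  have "(\<Sum>n=n0..N2. (coef f n)^2 - (coef f n - c n)^2) \<le> (\<Sum>n=n0..N. (coef f n)^2 - (coef f n - c n)^2)"
    using t0 by (intro sum_mono2) (auto simp: N_def)
  moreover have "(\<Sum>n=n0..N2. (coef f n)^2 - (coef f n - c n)^2) > E - d"
    unfolding t sum_subtractf using N2 s by linarith
  ultimately have "(LpD M 2 (fsum c N) f)^2 \<le> d"
    unfolding fsum_diff_norm[OF fL] E_def by linarith
  moreover have "AE x in M. \<bar>pois s f x\<bar> \<le> K" by (intro pois_abs_le f s)
  hence "AE x in M. \<bar>fsum c N x\<bar> \<le> K + 1" using AE_space
  proof eventually_elim
    fix x assume "\<bar>pois s f x\<bar> \<le> K" "x \<in> space M"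
    thus "\<bar>fsum c N x\<bar> \<le> K + 1" using N1[of N x] by (simp add: N_def pois_sum_def c_def)
  qed
  ultimately show ?thesis by blast
qed

lemma smoothing:
  assumes f: "f \<in> borel_measurable M" "\<And>x. x \<in> space M ==> \<bar>f x\<bar> \<le> K"
  obtains c N where "Lp_lim M 2 (\<lambda>k. fsum (c k) (N k)) f"
    "\<And>k :: nat. AE x in M. \<bar>fsum (c k) (N k) x\<bar> \<le> K + 1"
proof -
  define P where "P = (\<lambda>(k::nat) c N. (LpD M 2 (fsum c N) f)^2 \<le> ((1/2) ^ k)^2 \<and> (AE x in M. \<bar>fsum c N x\<bar> \<le> K + 1))"
  have "\<forall>k. \<exists>c N. P k c N"
    unfolding P_def by (intro allI smoothing_aux f) auto
  then obtain c where "\<forall>k. \<exists>N. P k (c k) N"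
    by (rule exE[OF choice])
  then obtain N where "\<forall>k. P k (c k) (N k)"
    by (rule exE[OF choice])
  hence cN: "\<And>k. (LpD M 2 (fsum (c k) (N k)) f)^2 \<le> ((1/2) ^ k)^2"
      "\<And>k. AE x in M. \<bar>fsum (c k) (N k) x\<bar> \<le> K + 1" unfolding P_def by blast+
  have "LpD M 2 (fsum (c k) (N k)) f \<le> (1/2) ^ k" for k
    by (rule power2_le_imp_le[OF cN(1)]) simp
  hence "Lp_lim M 2 (\<lambda>k. fsum (c k) (N k)) f"
    by (intro tendsto_0_le[OF LIMSEQ_power_zero[of "1/2::real"]]) auto
  thus ?thesis using cN(2) by (rule that)
qed

text \<open>Boundedness upgrades \<open>L\<^sup>2\<close>-convergence to \<open>L\<^sup>p\<close>-convergence.\<close>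

lemma smoothing_Lp:
  assumes f: "f \<in> borel_measurable M" "\<And>x. x \<in> space M ==> \<bar>f x\<bar> \<le> K"
  obtains c N where "Lp_lim M 2 (\<lambda>k. fsum (c k) (N k)) f"
    "\<And>p. p \<ge> 1 ==> (\<lambda>k::nat. LpN M p (fsum (c k) (N k))) \<longlonglongrightarrow> LpN M p f"
proof -
  obtain c N where cN: "Lp_lim M 2 (\<lambda>k. fsum (c k) (N k)) f"
    "\<And>k :: nat. AE x in M. \<bar>fsum (c k) (N k) x\<bar> \<le> K + 1" using smoothing[of f K, OF f] by auto
  have fS: "p \<ge> 0 ==> f \<in> LpS M p" for p by (rule bounded_LpS[OF f])
  define h where "h = (\<lambda>k x. fsum (c k) (N k) x - f x)"
  have hS: "h k \<in> LpS M 2" for k unfolding h_def by (intro LpS_diff fsum_LpS fS) auto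
  obtain r where r: "strict_mono (r :: nat \<Rightarrow> nat)" "AE x in M. (\<lambda>k. h (r k) x) \<longlonglongrightarrow> 0"
    using LpN_tendsto_0_AE_subseq[of h M 2] hS cN(1) by (auto simp: h_def)
  have "(\<lambda>k. LpN M p (fsum (c (r k)) (N (r k)))) \<longlonglongrightarrow> LpN M p f" if p: "p \<ge> 1" for p
  proof (rule LpN_tendsto[OF fsum_LpS fS p])
    have "(\<lambda>k. LINT x|M. norm (h (r k) x) powr p) \<longlonglongrightarrow> (LINT x|M. 0)"
    proof (rule integral_dominated_convergence[where w = "\<lambda>x. (2 * K + 1) powr p"])
      show "AE x in M. (\<lambda>k. norm (h (r k) x) powr p) \<longlonglongrightarrow> 0"
        using r(2)
      proof eventually_elim
        fix x assume "(\<lambda>k. h (r k) x) \<longlonglongrightarrow> 0"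
        hence "(\<lambda>k. norm (h (r k) x) powr p) \<longlonglongrightarrow> norm (0::real) powr p"
          using p by (intro tendsto_powr' tendsto_norm tendsto_const) auto
        thus "(\<lambda>k. norm (h (r k) x) powr p) \<longlonglongrightarrow> 0" using p by simp
      qed
      show "AE x in M. norm (norm (h (r k) x) powr p) \<le> (2 * K + 1) powr p" for k
        using cN(2)[of "r k"] AE_space
      proof eventually_elim
        fix x assume "\<bar>fsum (c (r k)) (N (r k)) x\<bar> \<le> K + 1" "x \<in> space M"
        hence "\<bar>h (r k) x\<bar> \<le> 2 * K + 1" using f(2)[of x] unfolding h_def by linarith
        thus "norm (norm (h (r k) x) powr p) \<le> (2 * K + 1) powr p" using p by (auto intro!: powr_mono2)
      qed
    qed (use LpS_measurable[OF hS] in auto)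
    hence "(\<lambda>k. (LINT x|M. norm (h (r k) x) powr p) powr (1 / p)) \<longlonglongrightarrow> 0 powr (1 / p)"
      using p by (intro tendsto_powr' tendsto_const) auto
    thus "Lp_lim M p (\<lambda>k. fsum (c (r k)) (N (r k))) f" using p by (simp add: LpN_def h_def)
  qed (use p in auto)
  moreover have "Lp_lim M 2 (\<lambda>k. fsum (c (r k)) (N (r k))) f"
    using LIMSEQ_subseq_LIMSEQ[OF cN(1) r(1)] by (simp add: o_def)
  ultimately show ?thesis by (intro that[of "\<lambda>k. c (r k)" "\<lambda>k. N (r k)"])
qed

end

section \<open>Bellman functions\<close>

text \<open>In the last assumption \<open>A\<close> and \<open>A'\<close> may depend on \<open>a\<close> and \<open>b\<close>; by the arithmetic-geometric mean
  inequality \<open>A p\<^sup>2 + A' q\<^sup>2\<close> dominates \<open>2 c |p q|\<close>, with a constant \<open>c\<close> that does not.\<close>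

locale bellman =
  fixes B B1 B2 H11 H12 H22 :: "real \<Rightarrow> real \<Rightarrow> real" and c :: real
  assumes B_chain: "\<And>f g f' g' s. DERIV f s :> f' ==> DERIV g s :> g' ==>
      DERIV (\<lambda>s. B (f s) (g s)) s :> B1 (f s) (g s) * f' + B2 (f s) (g s) * g'"
    and B1_chain: "\<And>f g f' g' s. DERIV f s :> f' ==> DERIV g s :> g' ==>
      DERIV (\<lambda>s. B1 (f s) (g s)) s :> H11 (f s) (g s) * f' + H12 (f s) (g s) * g'"
    and B2_chain: "\<And>f g f' g' s. DERIV f s :> f' ==> DERIV g s :> g' ==>
      DERIV (\<lambda>s. B2 (f s) (g s)) s :> H12 (f s) (g s) * f' + H22 (f s) (g s) * g'"
    and B_cont: "continuous_on UNIV (\<lambda>z. B (fst z) (snd z))"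
    and B1_cont: "continuous_on UNIV (\<lambda>z. B1 (fst z) (snd z))"
    and B2_cont: "continuous_on UNIV (\<lambda>z. B2 (fst z) (snd z))"
    and H11_cont: "continuous_on UNIV (\<lambda>z. H11 (fst z) (snd z))"
    and H12_cont: "continuous_on UNIV (\<lambda>z. H12 (fst z) (snd z))"
    and H22_cont: "continuous_on UNIV (\<lambda>z. H22 (fst z) (snd z))"
    and B_nonneg: "B a b \<ge> 0"
    and c_nonneg: "c \<ge> 0"
    and convexity: "\<exists>A A'. 0 \<le> A \<and> 0 \<le> A' \<and> c^2 \<le> A * A' \<and>
      (\<forall>p q. A * p^2 + A' * q^2 \<le> H11 a b * p^2 + 2 * H12 a b * (p * q) + H22 a b * q^2) \<and>
      A * a^2 \<le> B1 a b * a \<and> A' * b^2 \<le> B2 a b * b"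

text \<open>The Nazarov--Treil function treats its arguments asymmetrically, with exponents
  \<open>P \<ge> 2\<close> and \<open>Q \<le> 2\<close>. The exchange covers \<open>p < 2\<close>,
  and it carries results about the first argument to the second.\<close>

lemma bellman_swap:
  assumes "bellman B B1 B2 H11 H12 H22 c"
  shows "bellman (\<lambda>a b. B b a) (\<lambda>a b. B2 b a) (\<lambda>a b. B1 b a) (\<lambda>a b. H22 b a) (\<lambda>a b. H12 b a) (\<lambda>a b. H11 b a) c"
proof -
  interpret bellman B B1 B2 H11 H12 H22 c by fact
  have sw: "continuous_on UNIV (\<lambda>z. F (snd z) (fst z))" if "continuous_on UNIV (\<lambda>z. F (fst z) (snd z))" for F :: "real \<Rightarrow> real \<Rightarrow> real"
  proof -
    have "continuous_on UNIV (\<lambda>z::real \<times> real. (snd z, fst z))" by (intro continuous_intros)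
    from continuous_on_compose2[OF that this] show ?thesis by simp
  qed
  show ?thesis
  proof
    fix f g :: "real \<Rightarrow> real" and f' g' s
    assume d: "DERIV f s :> f'" "DERIV g s :> g'"
    show "DERIV (\<lambda>s. B (g s) (f s)) s :> B2 (g s) (f s) * f' + B1 (g s) (f s) * g'"
      using B_chain[OF d(2,1)] by (simp add: add.commute)
    show "DERIV (\<lambda>s. B2 (g s) (f s)) s :> H22 (g s) (f s) * f' + H12 (g s) (f s) * g'"
      using B2_chain[OF d(2,1)] by (simp add: add.commute)
    show "DERIV (\<lambda>s. B1 (g s) (f s)) s :> H12 (g s) (f s) * f' + H11 (g s) (f s) * g'"
      using B1_chain[OF d(2,1)] by (simp add: add.commute)
  next
    fix a b
    obtain A A' where A: "0 \<le> A" "0 \<le> A'" "c^2 \<le> A * A'"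
      "\<And>p q. A * p^2 + A' * q^2 \<le> H11 b a * p^2 + 2 * H12 b a * (p * q) + H22 b a * q^2"
      "A * b^2 \<le> B1 b a * b" "A' * a^2 \<le> B2 b a * a"
      using convexity[of b a] by blast
    show "\<exists>A A'. 0 \<le> A \<and> 0 \<le> A' \<and> c^2 \<le> A * A' \<and>
      (\<forall>p q. A * p^2 + A' * q^2 \<le> H22 b a * p^2 + 2 * H12 b a * (p * q) + H11 b a * q^2) \<and>
      A * a^2 \<le> B2 b a * a \<and> A' * b^2 \<le> B1 b a * b"
    proof (rule exI[of _ A'], rule exI[of _ A], intro conjI allI)
      fix p q
      show "A' * p^2 + A * q^2 \<le> H22 b a * p^2 + 2 * H12 b a * (p * q) + H11 b a * q^2"
        using A(4)[of q p] by (simp add: mult.commute[of q p])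
    qed (use A in \<open>auto simp: mult.commute\<close>)
  qed (rule sw[OF B_cont] sw[OF B1_cont] sw[OF B2_cont] sw[OF H11_cont] sw[OF H12_cont] sw[OF H22_cont]
       B_nonneg c_nonneg)+
qed

text \<open>A smooth substitute for \<open>|a|\<close> that is merely convex, whence
  \<open>c = 0\<close> with \<open>A = A' = 0\<close>. It makes the energy decrease, which is all
  that \<open>L^1\<close> contractivity asks for.\<close>

lemma bellman_abs:
  assumes \<epsilon>: "\<epsilon> > 0"
  shows "bellman (\<lambda>a b. sqrt (a^2 + \<epsilon>^2)) (\<lambda>a b. a / sqrt (a^2 + \<epsilon>^2)) (\<lambda>a b. 0)
    (\<lambda>a b. \<epsilon>^2 / sqrt (a^2 + \<epsilon>^2) ^ 3) (\<lambda>a b. 0) (\<lambda>a b. 0) 0"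
proof -
  have pos: "a^2 + \<epsilon>^2 > 0" for a using \<epsilon> by (intro add_nonneg_pos) auto
  have nz: "sqrt (a^2 + \<epsilon>^2) \<noteq> 0" for a using real_sqrt_gt_zero[OF pos[of a]] by linarith
  have d: "DERIV (\<lambda>s. sqrt ((f s)^2 + \<epsilon>^2)) s :> f s / sqrt ((f s)^2 + \<epsilon>^2) * f'"
    if "DERIV f s :> f'" for f f' and s :: real
    by (rule derivative_eq_intros that refl | use pos[of "f s"] in \<open>force simp: field_simps\<close>)+
  show ?thesis
  proof
    fix f g :: "real \<Rightarrow> real" and f' g' s
    assume f: "DERIV f s :> f'"
    show "DERIV (\<lambda>s. sqrt ((f s)^2 + \<epsilon>^2)) s :> f s / sqrt ((f s)^2 + \<epsilon>^2) * f' + 0 * g'"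
      using d[OF f] by simp
    define r where "r = sqrt ((f s)^2 + \<epsilon>^2)"
    have r: "r \<noteq> 0" "r^2 = (f s)^2 + \<epsilon>^2" using nz[of "f s"] pos[of "f s"] by (auto simp: r_def)
    have "DERIV (\<lambda>s. f s / sqrt ((f s)^2 + \<epsilon>^2)) s :> (f' * r - f s * (f s / r * f')) / (r * r)"
      unfolding r_def by (rule DERIV_divide[OF f d[OF f] nz])
    moreover have "(f' * r - f s * (f s / r * f')) / (r * r) = \<epsilon>^2 / r ^ 3 * f'"
    proof -
      have "(f' * r - f s * (f s / r * f')) / (r * r) = (r^2 - (f s)^2) / r ^ 3 * f'"
        using r(1) by (simp add: field_simps power2_eq_square power3_eq_cube)
      thus ?thesis using r(2) by simp
    qed
    ultimately show "DERIV (\<lambda>s. f s / sqrt ((f s)^2 + \<epsilon>^2)) s :> \<epsilon>^2 / sqrt ((f s)^2 + \<epsilon>^2) ^ 3 * f' + 0 * g'"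
      by (simp add: r_def)
  next
    fix a :: real
    show "\<exists>A A'. 0 \<le> A \<and> 0 \<le> A' \<and> 0^2 \<le> A * A' \<and>
      (\<forall>p q. A * p^2 + A' * q^2 \<le> \<epsilon>^2 / sqrt (a^2 + \<epsilon>^2) ^ 3 * p^2 + 2 * 0 * (p * q) + 0 * q^2) \<and>
      A * a^2 \<le> a / sqrt (a^2 + \<epsilon>^2) * a \<and> A' * b^2 \<le> 0 * b" for b
      using pos[of a] by (intro exI[of _ 0]) (auto simp: divide_nonneg_nonneg)
  qed (use nz in \<open>auto intro!: continuous_intros\<close>)
qed

text \<open>A smooth variant of the Nazarov--Treil function: with \<open>u = \<surd>(a\<^sup>2 + \<epsilon>\<^sup>2)\<close>, \<open>v = \<surd>(b\<^sup>2 + \<epsilon>\<^sup>2)\<close> it is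
  \<open>v\<^sup>Q + \<delta> u\<^sup>2 (u\<^sup>P + v\<^sup>Q)\<^sup>\<theta>\<close>, where \<open>\<theta> = 1 - 2/P\<close> and \<open>\<delta> = (Q - 1)/8\<close>.\<close>

locale nazarov_treil =
  fixes P Q \<epsilon> :: real
  assumes P: "P \<ge> 2" and Q: "1 < Q" "1 / P + 1 / Q = 1" and eps: "\<epsilon> > 0"
begin

definition \<theta> where "\<theta> = 1 - 2 / P"
definition \<delta> where "\<delta> = (Q - 1) / 8"
definition UU where "UU a = a^2 + \<epsilon>^2" for a
definition X where "X a = UU a powr (P / 2)" for a
definition Y where "Y b = UU b powr (Q / 2)" for b
definition S where "S a b = X a + Y b" for a b
definition T where "T a b = S a b powr \<theta>" for a b

definition B where "B a b = Y b + \<delta> * UU a * T a b" for a b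
text \<open>The gradient of \<open>B\<close> is \<open>(a * m1, b * m2)\<close>; the gradients of
  \<open>m1\<close> and \<open>m2\<close> are \<open>(a * k11, b * k12)\<close> and
  \<open>(a * k12, b * k22)\<close>. Splitting off \<open>a\<close> and \<open>b\<close> makes
  \<open>B1 * a\<close> and \<open>B2 * b\<close> equal to \<open>a^2 * m1\<close> and
  \<open>b^2 * m2\<close>, as the last Bellman assumption wants.\<close>

definition m1 where "m1 a b = \<delta> * T a b * (2 + (P - 2) * (X a / S a b))" for a b
definition m2 where "m2 a b = Y b / UU b * (Q + \<delta> * (2 - Q) * (UU a * T a b / S a b))" for a b
definition k11 where "k11 a b = \<delta> * (P * X a / UU a) * (T a b / S a b) * (2 * \<theta> + (P - 2) - 2 * \<theta> * (X a / S a b))" for a b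
definition k12 where "k12 a b = 2 * (2 - Q) * \<delta> * (Y b / UU b) * (T a b / S a b) * (Y b / S a b)" for a b
definition k22 where "k22 a b = Y b / (UU b)^2 * ((Q - 2) * (Q + \<delta> * (2 - Q) * (UU a * T a b / S a b))
    - \<delta> * (2 - Q) * (UU a * T a b / S a b) * (2 * (Q - 1)) * (Y b / S a b))" for a b

lemma PQ: "P > 0" "Q \<le> 2" "P * (Q - 1) = Q" "\<theta> * P = P - 2" "\<theta> * Q = 2 - Q" "0 \<le> \<theta>" "\<theta> \<le> 1" "\<delta> > 0" "\<delta> \<le> 1/8"
proof -
  show P0: "P > 0" using P by simp
  have "Q + P = P * Q" using Q P0 by (simp add: field_simps)
  thus e: "P * (Q - 1) = Q" by (simp add: algebra_simps)
  have "2 * (Q - 1) \<le> P * (Q - 1)" using P Q by (intro mult_right_mono) auto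
  thus Q2: "Q \<le> 2" using e by simp
  show "\<theta> * P = P - 2" using P0 by (simp add: \<theta>_def field_simps)
  show "\<theta> * Q = 2 - Q" using P0 \<open>Q + P = P * Q\<close> by (simp add: \<theta>_def field_simps)
  show "0 \<le> \<theta>" "\<theta> \<le> 1" using P by (auto simp: \<theta>_def field_simps)
  show "\<delta> > 0" "\<delta> \<le> 1/8" using Q Q2 by (auto simp: \<delta>_def)
qed

lemma UU_pos: "UU a > 0" unfolding UU_def using eps by (intro add_nonneg_pos) auto
lemma X_pos: "X a > 0" using UU_pos[of a] by (simp add: X_def)
lemma Y_pos: "Y a > 0" using UU_pos[of a] by (simp add: Y_def)
lemma S_pos: "S a b > 0" using X_pos[of a] Y_pos[of b] by (simp add: S_def)
lemma T_pos: "T a b > 0" using S_pos[of a b] by (simp add: T_def)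

lemma UU_deriv: "DERIV f s :> f' ==> DERIV (\<lambda>s. UU (f s)) s :> 2 * f s * f'"
  unfolding UU_def by (auto intro!: derivative_eq_intros)

lemma powr_const_deriv:
  fixes F :: "real \<Rightarrow> real"
  assumes "DERIV F s :> F'" "F s > 0"
  shows "DERIV (\<lambda>s. F s powr c) s :> c * (F s powr c / F s) * F'"
  using DERIV_chain2[OF has_real_derivative_powr[OF assms(2), of c] assms(1)] assms(2)
  by (simp add: powr_diff)

lemma X_deriv: "DERIV f s :> f' ==> DERIV (\<lambda>s. X (f s)) s :> P * X (f s) / UU (f s) * (f s * f')"
  using powr_const_deriv[OF UU_deriv UU_pos, of f f' s "P / 2"] by (simp add: X_def mult_ac)

lemma Y_deriv: "DERIV f s :> f' ==> DERIV (\<lambda>s. Y (f s)) s :> Q * Y (f s) / UU (f s) * (f s * f')"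
  using powr_const_deriv[OF UU_deriv UU_pos, of f f' s "Q / 2"] by (simp add: Y_def mult_ac)

context
  fixes f g :: "real \<Rightarrow> real" and f' g' s
  assumes f: "DERIV f s :> f'" and g: "DERIV g s :> g'"
begin

abbreviation "dS \<equiv> P * X (f s) / UU (f s) * (f s * f') + Q * Y (g s) / UU (g s) * (g s * g')"

lemma S_deriv: "DERIV (\<lambda>s. S (f s) (g s)) s :> dS"
  unfolding S_def by (intro DERIV_add X_deriv Y_deriv f g)

lemma T_deriv: "DERIV (\<lambda>s. T (f s) (g s)) s :> \<theta> * (T (f s) (g s) / S (f s) (g s)) * dS"
  unfolding T_def by (rule powr_const_deriv[OF S_deriv S_pos])

lemma B_deriv: "DERIV (\<lambda>s. B (f s) (g s)) s :> f s * m1 (f s) (g s) * f' + g s * m2 (f s) (g s) * g'"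
proof -
  define x y u v t r where "x = X (f s)" and "y = Y (g s)" and "u = UU (f s)" and "v = UU (g s)"
    and "t = T (f s) (g s)" and "r = S (f s) (g s)"
  have nz: "u \<noteq> 0" "v \<noteq> 0" "r \<noteq> 0" using UU_pos[of "f s"] UU_pos[of "g s"] S_pos[of "f s" "g s"]
    by (auto simp: u_def v_def r_def)
  have "DERIV (\<lambda>s. B (f s) (g s)) s :> Q * y / v * (g s * g') +
    ((\<delta> * (2 * f s * f')) * t + \<theta> * (t / r) * (P * x / u * (f s * f') + Q * y / v * (g s * g')) * (\<delta> * u))"
    unfolding B_def x_def y_def u_def v_def t_def r_def
    by (intro DERIV_add DERIV_mult DERIV_cmult Y_deriv UU_deriv T_deriv f g)
  moreover have "Q * y / v * (g s * g') +
    ((\<delta> * (2 * f s * f')) * t + \<theta> * (t / r) * (P * x / u * (f s * f') + Q * y / v * (g s * g')) * (\<delta> * u))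
    = f s * (\<delta> * t * (2 + (\<theta> * P) * (x / r))) * f' + g s * (y / v * (Q + \<delta> * (\<theta> * Q) * (u * t / r))) * g'"
    using nz by (simp add: field_simps)
  ultimately show ?thesis
    by (simp add: m1_def m2_def x_def y_def u_def v_def t_def r_def PQ(4,5))
qed

lemma m1_deriv: "DERIV (\<lambda>s. m1 (f s) (g s)) s :> f s * k11 (f s) (g s) * f' + g s * k12 (f s) (g s) * g'"
  and m2_deriv: "DERIV (\<lambda>s. m2 (f s) (g s)) s :> f s * k12 (f s) (g s) * f' + g s * k22 (f s) (g s) * g'"
proof -
  define x y u v t r where "x = X (f s)" and "y = Y (g s)" and "u = UU (f s)" and "v = UU (g s)"
    and "t = T (f s) (g s)" and "r = S (f s) (g s)"
  \<comment> \<open>With named inverses the derivative identities become polynomial, modulo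
    \<open>u * iu = 1\<close>, \<open>v * iv = 1\<close>, \<open>x * ir + y * ir = 1\<close> and the
    exponent relations in \<open>PQ\<close>.\<close>
  define iu iv ir where "iu = inverse u" and "iv = inverse v" and "ir = inverse r"
  define dx dy where "dx = P * x * iu * (f s * f')" and "dy = Q * y * iv * (g s * g')"
  note ds = x_def y_def u_def v_def t_def r_def iu_def iv_def ir_def
  have uv: "u * iu = 1" "v * iv = 1" "r * ir = 1"
    using UU_pos[of "f s"] UU_pos[of "g s"] S_pos[of "f s" "g s"] by (auto simp: ds)
  have xy: "x * ir + y * ir = 1" using uv(3) by (simp add: x_def y_def r_def S_def distrib_right)
  have dS: "DERIV (\<lambda>s. S (f s) (g s)) s :> dx + dy"
    and dT: "DERIV (\<lambda>s. T (f s) (g s)) s :> \<theta> * (t * ir) * (dx + dy)"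
    using S_deriv T_deriv by (simp_all add: dx_def dy_def ds divide_inverse)
  have quot: "DERIV (\<lambda>s. F s / G s) s :> F' * inverse (G s) - F s * inverse (G s) * inverse (G s) * G'"
    if "DERIV F s :> F'" "DERIV G s :> G'" "G s > 0" for F G :: "real \<Rightarrow> real" and F' G'
    by (rule DERIV_cong[OF DERIV_divide[OF that(1,2)]]) (use that(3) in \<open>auto simp: field_simps\<close>)
  have "DERIV (\<lambda>s. m1 (f s) (g s)) s :>
      (\<delta> * (\<theta> * (t * ir) * (dx + dy))) * (2 + (P - 2) * (x * ir)) + ((P - 2) * (dx * ir - x * ir * ir * (dx + dy))) * (\<delta> * t)"
    using DERIV_mult[OF DERIV_cmult[OF dT, of \<delta>] DERIV_add[OF DERIV_const[of 2]
        DERIV_cmult[OF quot[OF X_deriv[OF f] dS S_pos], of "P - 2"]]]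
    by (simp add: m1_def dx_def ds divide_inverse)
  moreover have "(\<delta> * (\<theta> * (t * ir) * (dx + dy))) * (2 + (P - 2) * (x * ir)) + ((P - 2) * (dx * ir - x * ir * ir * (dx + dy))) * (\<delta> * t)
      = f s * (\<delta> * (P * x * iu) * (t * ir) * (2 * \<theta> + (P - 2) - 2 * \<theta> * (x * ir))) * f'
        + g s * (2 * (2 - Q) * \<delta> * (y * iv) * (t * ir) * (y * ir)) * g'"
    unfolding dx_def dy_def using xy PQ(4,5) by algebra
  ultimately show "DERIV (\<lambda>s. m1 (f s) (g s)) s :> f s * k11 (f s) (g s) * f' + g s * k12 (f s) (g s) * g'"
    by (simp add: k11_def k12_def ds divide_inverse)
  let ?e = "(dy * iv - y * iv * iv * (2 * g s * g')) * (Q + \<delta> * (2 - Q) * (u * t * ir)) + (\<delta> * (2 - Q) *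
      (((2 * f s * f') * t + \<theta> * (t * ir) * (dx + dy) * u) * ir - u * t * ir * ir * (dx + dy))) * (y * iv)"
  have "DERIV (\<lambda>s. m2 (f s) (g s)) s :> ?e"
    using DERIV_mult[OF quot[OF Y_deriv[OF g] UU_deriv[OF g] UU_pos] DERIV_add[OF DERIV_const[of Q]
        DERIV_cmult[OF quot[OF DERIV_mult[OF UU_deriv[OF f] dT] dS S_pos], of "\<delta> * (2 - Q)"]]]
    by (simp add: m2_def dy_def ds divide_inverse)
  moreover have "?e = f s * (2 * (2 - Q) * \<delta> * (y * iv) * (t * ir) * (y * ir)) * f' +
        g s * (y * (iv * iv) * ((Q - 2) * (Q + \<delta> * (2 - Q) * (u * t * ir))
          - \<delta> * (2 - Q) * (u * t * ir) * (2 * (Q - 1)) * (y * ir))) * g'"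
    unfolding dx_def dy_def using xy uv(1,2) PQ(4,5) by algebra
  ultimately show "DERIV (\<lambda>s. m2 (f s) (g s)) s :> f s * k12 (f s) (g s) * f' + g s * k22 (f s) (g s) * g'"
    by (simp add: k22_def k12_def ds divide_inverse power2_eq_square)
qed

end

text \<open>\<open>T\<close> is at least \<open>Y b powr \<theta>\<close>, and
  \<open>Y b powr \<theta> * Y b = UU b\<close> because \<open>Q/2 * \<theta> + Q/2 = 1\<close>.
  This product bound is what makes the convexity constant independent of \<open>a\<close> and
  \<open>b\<close>.\<close>

lemma T_Y: "T a b * (Y b / UU b) \<ge> 1"
proof -
  have "Y b powr \<theta> \<le> T a b"
    unfolding T_def S_def using PQ X_pos[of a] Y_pos[of b] by (intro powr_mono2) auto
  hence "Y b powr \<theta> * (Y b / UU b) \<le> T a b * (Y b / UU b)"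
    using Y_pos[of b] UU_pos[of b] by (intro mult_right_mono) auto
  moreover have "Y b powr \<theta> * (Y b / UU b) = 1"
  proof -
    have "Y b powr \<theta> * Y b = UU b powr (Q / 2 * \<theta> + Q / 2)"
      by (simp add: Y_def powr_powr powr_add)
    also have "Q / 2 * \<theta> + Q / 2 = 1" using PQ(5) by (simp add: field_simps)
    finally show ?thesis using UU_pos[of b] by simp
  qed
  ultimately show ?thesis by linarith
qed

text \<open>\<open>UU a = X a powr (2/P)\<close> is at most \<open>S a b powr (2/P)\<close>, and
  \<open>T\<close> is \<open>S a b powr (1 - 2/P)\<close>.\<close>

lemma G_bounds: "0 \<le> UU a * T a b / S a b" "UU a * T a b / S a b \<le> 1"
proof -
  show "0 \<le> UU a * T a b / S a b" using UU_pos[of a] T_pos[of a b] S_pos[of a b] by (auto intro!: divide_nonneg_nonneg mult_nonneg_nonneg less_imp_le)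
  have "UU a = X a powr (2 / P)" using UU_pos[of a] PQ(1) by (simp add: X_def powr_powr)
  also have "... \<le> S a b powr (2 / P)" using X_pos[of a] Y_pos[of b] PQ(1) by (intro powr_mono2) (auto simp: S_def)
  finally have "UU a * T a b \<le> S a b powr (2 / P) * T a b" using T_pos[of a b] by (intro mult_right_mono) auto
  also have "... = S a b" using S_pos[of a b] by (simp add: T_def powr_add[symmetric] \<theta>_def)
  finally show "UU a * T a b / S a b \<le> 1" using S_pos[of a b] by simp
qed

lemma ratio_bounds: "0 \<le> X a / S a b" "X a / S a b \<le> 1" "0 \<le> Y b / S a b" "Y b / S a b \<le> 1"
  using X_pos[of a] Y_pos[of b] by (auto simp: S_def)

lemma square_le_UU: "a^2 \<le> UU a" by (simp add: UU_def)

lemma quadratic_form_nonneg: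
  fixes p q h11 h12 h22 :: real
  assumes "h11 \<ge> 0" "h22 \<ge> 0" "h12^2 \<le> h11 * h22"
  shows "0 \<le> h11 * p^2 + 2 * h12 * (p * q) + h22 * q^2"
proof (cases "h11 = 0")
  case True
  thus ?thesis using assms by simp
next
  case False
  hence h: "h11 > 0" using assms by simp
  have "h11 * (h11 * p^2 + 2 * h12 * (p * q) + h22 * q^2) = (h11 * p + h12 * q)^2 + (h11 * h22 - h12^2) * q^2"
    by (simp add: power2_eq_square algebra_simps)
  also have "... \<ge> 0" using assms by auto
  finally show ?thesis using h by (simp add: zero_le_mult_iff)
qed

text \<open>\<open>k11\<close> is nonnegative because \<open>X a / S a b \<le> 1\<close>, so the
  bound for \<open>m1\<close> suffices.\<close>

lemma h11_lower: "m1 a b + a^2 * k11 a b \<ge> 2 * (\<delta> * T a b)" and m1_lower: "m1 a b \<ge> 2 * (\<delta> * T a b)"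
proof -
  have d: "\<delta> * T a b \<ge> 0" using PQ(8) T_pos[of a b] by simp
  have "0 \<le> (P - 2) * (X a / S a b)" using P ratio_bounds by (intro mult_nonneg_nonneg) auto
  hence "\<delta> * T a b * 2 \<le> \<delta> * T a b * (2 + (P - 2) * (X a / S a b))"
    using d by (intro mult_left_mono) auto
  thus m: "m1 a b \<ge> 2 * (\<delta> * T a b)" by (simp add: m1_def mult_ac)
  have "2 * \<theta> * (X a / S a b) \<le> 2 * \<theta> * 1" using ratio_bounds PQ(6) by (intro mult_left_mono) auto
  hence "0 \<le> 2 * \<theta> + (P - 2) - 2 * \<theta> * (X a / S a b)" using P by simp
  hence "0 \<le> k11 a b" unfolding k11_def using PQ(1,8) X_pos[of a] UU_pos[of a] T_pos[of a b] S_pos[of a b]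
    by (intro mult_nonneg_nonneg divide_nonneg_nonneg) auto
  hence "0 \<le> a^2 * k11 a b" by simp
  thus "m1 a b + a^2 * k11 a b \<ge> 2 * (\<delta> * T a b)" using m by linarith
qed

text \<open>\<open>k22\<close> is nonpositive and \<open>b^2 \<le> UU b\<close>, so the worst case
  is \<open>b^2 = UU b\<close>. There the main terms combine to
  \<open>Q - (2 - Q) * Q = (Q - 1) * Q\<close>, and the rest is estimated by
  \<open>1 - 2 * \<eta> \<ge> -1\<close>.\<close>

lemma h22_lower: "m2 a b + b^2 * k22 a b \<ge> Y b / UU b * ((Q - 1) * (Q - \<delta> * (2 - Q)))"
  and m2_lower: "m2 a b \<ge> Y b / UU b * Q"
proof -
  define G \<eta> w where "G = UU a * T a b / S a b" and "\<eta> = Y b / S a b" and "w = Y b / UU b"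
  have G: "0 \<le> G" "G \<le> 1" using G_bounds by (auto simp: G_def)
  have \<eta>: "0 \<le> \<eta>" "\<eta> \<le> 1" using ratio_bounds by (auto simp: \<eta>_def)
  have w: "w > 0" using Y_pos[of b] UU_pos[of b] by (simp add: w_def)
  have m2: "m2 a b = w * (Q + \<delta> * (2 - Q) * G)" by (simp add: m2_def w_def G_def)
  have dQ: "\<delta> * (2 - Q) \<ge> 0" using PQ by simp
  have "w * Q \<le> m2 a b" unfolding m2 using w dQ G by (intro mult_left_mono) auto
  thus "m2 a b \<ge> Y b / UU b * Q" by (simp add: w_def)
  define k where "k = (2 - Q) * (Q + \<delta> * (2 - Q) * G) + \<delta> * (2 - Q) * G * (2 * (Q - 1)) * \<eta>"
  have k: "k \<ge> 0" unfolding k_def using dQ G \<eta> Q PQ(2,8)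
    by (intro add_nonneg_nonneg mult_nonneg_nonneg) auto
  have "(Q - 2) * (Q + \<delta> * (2 - Q) * G) - \<delta> * (2 - Q) * G * (2 * (Q - 1)) * \<eta> = - k"
    by (simp add: k_def algebra_simps)
  hence "k22 a b = - (w / UU b * k)"
    unfolding k22_def G_def[symmetric] \<eta>_def[symmetric] by (simp add: w_def power2_eq_square)
  hence "b^2 * k22 a b = - (b^2 / UU b * (w * k))" by simp
  moreover have "b^2 / UU b * (w * k) \<le> 1 * (w * k)"
    using w k UU_pos[of b] square_le_UU[of b] by (intro mult_right_mono) auto
  ultimately have "m2 a b + b^2 * k22 a b \<ge> w * (Q + \<delta> * (2 - Q) * G) - w * k" by (simp add: m2)
  also have "w * (Q + \<delta> * (2 - Q) * G) - w * k = w * ((Q - 1) * (Q + \<delta> * (2 - Q) * G * (1 - 2 * \<eta>)))"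
    by (simp add: k_def algebra_simps)
  finally have 1: "m2 a b + b^2 * k22 a b \<ge> w * ((Q - 1) * (Q + \<delta> * (2 - Q) * G * (1 - 2 * \<eta>)))" .
  have "G * (1 - 2 * \<eta>) \<ge> G * (-1)" using G \<eta> by (intro mult_left_mono) auto
  hence "G * (1 - 2 * \<eta>) \<ge> -1" using G by simp
  hence "\<delta> * (2 - Q) * (G * (1 - 2 * \<eta>)) \<ge> \<delta> * (2 - Q) * (-1)" using dQ by (intro mult_left_mono) auto
  hence "w * ((Q - 1) * (Q - \<delta> * (2 - Q))) \<le> w * ((Q - 1) * (Q + \<delta> * (2 - Q) * G * (1 - 2 * \<eta>)))"
    using w Q by (intro mult_left_mono) (auto simp: mult.assoc)
  thus "m2 a b + b^2 * k22 a b \<ge> Y b / UU b * ((Q - 1) * (Q - \<delta> * (2 - Q)))" using 1 by (simp add: w_def)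
qed

lemma h12_upper: "(a * b * k12 a b)^2 \<le> 4 * (2 - Q)^2 * \<delta>^2 * (T a b * (Y b / UU b))"
proof -
  define G \<eta> w where "G = UU a * T a b / S a b" and "\<eta> = Y b / S a b" and "w = Y b / UU b"
  have G: "0 \<le> G" "G \<le> 1" using G_bounds by (auto simp: G_def)
  have \<eta>: "0 \<le> \<eta>" "\<eta> \<le> 1" using ratio_bounds by (auto simp: \<eta>_def)
  have w: "w > 0" using Y_pos[of b] UU_pos[of b] by (simp add: w_def)
  have pos: "UU a > 0" "UU b > 0" "S a b > 0" "T a b > 0" by (auto simp: UU_pos S_pos T_pos)
  have "(a * b * k12 a b)^2 = a^2 * b^2 * (k12 a b)^2" by (simp add: power_mult_distrib)
  also have "... \<le> UU a * UU b * (k12 a b)^2"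
    using square_le_UU[of a] square_le_UU[of b] pos by (intro mult_right_mono mult_mono) auto
  also have "... = 4 * (2 - Q)^2 * \<delta>^2 * (T a b * w) * (G * (\<eta> * \<eta> * \<eta>))"
    unfolding k12_def G_def \<eta>_def w_def using pos by (simp add: power2_eq_square field_simps)
  also have "... \<le> 4 * (2 - Q)^2 * \<delta>^2 * (T a b * w) * 1"
    using G \<eta> pos w by (intro mult_left_mono mult_le_one mult_nonneg_nonneg) auto
  finally show ?thesis by (simp add: w_def)
qed

text \<open>\<open>A = \<delta> * T\<close> is half of the lower bound for the first diagonal entry.
  With \<open>\<delta> = (Q - 1)/8\<close> the product \<open>A * A'\<close> is
  \<open>((Q - 1)/4)^2 * T * Y / UU\<close>, at least \<open>((Q - 1)/4)^2\<close> by
  \<open>T_Y\<close>. What remains of the diagonal must dominate the off-diagonal entry.\<close>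

lemma convexity_aux:
  "\<exists>A A'. 0 \<le> A \<and> 0 \<le> A' \<and> ((Q - 1) / 4)^2 \<le> A * A' \<and>
      (\<forall>p q. A * p^2 + A' * q^2 \<le> (m1 a b + a^2 * k11 a b) * p^2 + 2 * (a * b * k12 a b) * (p * q) + (m2 a b + b^2 * k22 a b) * q^2) \<and>
      A * a^2 \<le> a * m1 a b * a \<and> A' * b^2 \<le> b * m2 a b * b"
proof (rule exI[of _ "\<delta> * T a b"], rule exI[of _ "(Q - 1) / 2 * (Y b / UU b)"], intro conjI allI)
  have pos: "UU b > 0" "Y b > 0" "T a b > 0" by (auto simp: UU_pos Y_pos T_pos)
  define w where "w = Y b / UU b"
  have w: "w > 0" using pos by (simp add: w_def)
  show A: "0 \<le> \<delta> * T a b" using PQ pos by simp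
  show A': "0 \<le> (Q - 1) / 2 * (Y b / UU b)" using Q pos by simp
  have "\<delta> * T a b * ((Q - 1) / 2 * (Y b / UU b)) = ((Q - 1) / 4)^2 * (T a b * (Y b / UU b))"
    by (simp add: \<delta>_def power2_eq_square)
  also have "... \<ge> ((Q - 1) / 4)^2 * 1" using T_Y by (intro mult_left_mono) auto
  finally show "((Q - 1) / 4)^2 \<le> \<delta> * T a b * ((Q - 1) / 2 * (Y b / UU b))" by simp
  show "\<delta> * T a b * a^2 \<le> a * m1 a b * a"
  proof -
    have "\<delta> * T a b \<le> m1 a b" using m1_lower[of a b] A by linarith
    hence "\<delta> * T a b * a^2 \<le> m1 a b * a^2" by (intro mult_right_mono) auto
    thus ?thesis by (simp add: power2_eq_square mult_ac)
  qed
  show "(Q - 1) / 2 * (Y b / UU b) * b^2 \<le> b * m2 a b * b"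
  proof -
    have "(Q - 1) / 2 * w \<le> Q * w" using Q w by (intro mult_right_mono) auto
    hence "(Q - 1) / 2 * w \<le> m2 a b" using m2_lower[of b a] by (simp add: w_def mult_ac)
    hence "(Q - 1) / 2 * w * b^2 \<le> m2 a b * b^2" by (intro mult_right_mono) auto
    thus ?thesis by (simp add: power2_eq_square mult_ac w_def)
  qed
  fix p q
  define h11 h22 h12 where "h11 = m1 a b + a^2 * k11 a b - \<delta> * T a b"
    and "h22 = m2 a b + b^2 * k22 a b - (Q - 1) / 2 * w" and "h12 = a * b * k12 a b"
  have 1: "h11 \<ge> \<delta> * T a b" using h11_lower[of a b] by (simp add: h11_def)
  have 2: "h22 \<ge> w * ((Q - 1) * (Q - 1/2 - \<delta> * (2 - Q)))"
    using h22_lower[of b a] by (simp add: h22_def w_def[symmetric] algebra_simps)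
  \<comment> \<open>Dividing by \<open>Q - 1\<close> and writing \<open>h = Q - 1\<close>, this is
    \<open>3 h^2 \<le> 15 h\<close> on \<open>[0, 1]\<close>.\<close>
  have num: "4 * (2 - Q)^2 * \<delta> \<le> (Q - 1) * (Q - 1/2 - \<delta> * (2 - Q))"
  proof -
    define h where "h = Q - 1"
    have h: "0 \<le> h" "h \<le> 1" using Q PQ(2) by (auto simp: h_def)
    have "(Q - 1/2 - \<delta> * (2 - Q)) - (2 - Q)^2 / 2 = 15 * h / 8 - 3 * (h * h) / 8"
      by (simp add: \<delta>_def h_def power2_eq_square field_simps)
    also have "h * h \<le> h * 1" using h by (intro mult_left_mono) auto
    hence "15 * h / 8 - 3 * (h * h) / 8 \<ge> 0" using h by simp
    finally have "(2 - Q)^2 / 2 \<le> Q - 1/2 - \<delta> * (2 - Q)" by simp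
    hence "(Q - 1) * ((2 - Q)^2 / 2) \<le> (Q - 1) * (Q - 1/2 - \<delta> * (2 - Q))"
      using Q by (intro mult_left_mono) auto
    thus ?thesis by (simp add: \<delta>_def mult_ac)
  qed
  have n0: "0 \<le> (Q - 1) * (Q - 1/2 - \<delta> * (2 - Q))"
    by (rule order_trans[OF _ num]) (use PQ in auto)
  have "h12^2 \<le> 4 * (2 - Q)^2 * \<delta>^2 * (T a b * w)" using h12_upper[of a b] by (simp add: h12_def w_def)
  also have "... = (\<delta> * T a b) * (w * (4 * (2 - Q)^2 * \<delta>))" by (simp add: power2_eq_square mult_ac)
  also have "... \<le> (\<delta> * T a b) * (w * ((Q - 1) * (Q - 1/2 - \<delta> * (2 - Q))))"
    using num w A by (intro mult_left_mono) auto
  also have "... \<le> h11 * h22" using 1 2 A w n0 by (intro mult_mono) auto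
  finally have 3: "h12^2 \<le> h11 * h22" .
  have "h11 \<ge> 0" using 1 A by linarith
  moreover have "h22 \<ge> 0" using 2 n0 w by (meson mult_nonneg_nonneg order_trans less_imp_le)
  ultimately have "0 \<le> h11 * p^2 + 2 * h12 * (p * q) + h22 * q^2" using 3 by (rule quadratic_form_nonneg)
  thus "\<delta> * T a b * p^2 + (Q - 1) / 2 * (Y b / UU b) * q^2
     \<le> (m1 a b + a^2 * k11 a b) * p^2 + 2 * (a * b * k12 a b) * (p * q) + (m2 a b + b^2 * k22 a b) * q^2"
    by (simp add: h11_def h22_def h12_def w_def algebra_simps)
qed

lemma cont_UU: "continuous_on A f ==> continuous_on A (\<lambda>z. UU (f z))"
  unfolding UU_def by (intro continuous_intros)

lemma cont_X: "continuous_on A f ==> continuous_on A (\<lambda>z. X (f z))"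
  and cont_Y: "continuous_on A f ==> continuous_on A (\<lambda>z. Y (f z))"
  unfolding X_def Y_def by (intro continuous_intros cont_UU; use UU_pos in \<open>auto simp: less_imp_neq[symmetric]\<close>)+

lemma cont_S: "continuous_on A f ==> continuous_on A g ==> continuous_on A (\<lambda>z. S (f z) (g z))"
  unfolding S_def by (intro continuous_intros cont_X cont_Y)

lemma cont_T: "continuous_on A f ==> continuous_on A g ==> continuous_on A (\<lambda>z. T (f z) (g z))"
  unfolding T_def by (intro continuous_intros cont_S; use S_pos in \<open>auto simp: less_imp_neq[symmetric]\<close>)

lemma UU_nz: "UU a \<noteq> 0" and S_nz: "S a b \<noteq> 0"
  using UU_pos[of a] S_pos[of a b] by auto

lemmas cont_all = continuous_intros cont_UU cont_X cont_Y cont_S cont_T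

lemma bellman_NT: "bellman B (\<lambda>a b. a * m1 a b) (\<lambda>a b. b * m2 a b)
   (\<lambda>a b. m1 a b + a^2 * k11 a b) (\<lambda>a b. a * b * k12 a b) (\<lambda>a b. m2 a b + b^2 * k22 a b) ((Q - 1) / 4)"
proof
  fix f g :: "real \<Rightarrow> real" and f' g' s
  assume d: "DERIV f s :> f'" "DERIV g s :> g'"
  show "DERIV (\<lambda>s. B (f s) (g s)) s :> f s * m1 (f s) (g s) * f' + g s * m2 (f s) (g s) * g'"
    by (rule B_deriv[OF d])
  show "DERIV (\<lambda>s. f s * m1 (f s) (g s)) s :>
      (m1 (f s) (g s) + (f s)^2 * k11 (f s) (g s)) * f' + f s * g s * k12 (f s) (g s) * g'"
    by (rule DERIV_cong[OF DERIV_mult[OF d(1) m1_deriv[OF d]]]) (simp add: algebra_simps power2_eq_square)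
  show "DERIV (\<lambda>s. g s * m2 (f s) (g s)) s :>
      f s * g s * k12 (f s) (g s) * f' + (m2 (f s) (g s) + (g s)^2 * k22 (f s) (g s)) * g'"
    by (rule DERIV_cong[OF DERIV_mult[OF d(2) m2_deriv[OF d]]]) (simp add: algebra_simps power2_eq_square)
next
  show "B a b \<ge> 0" for a b
    unfolding B_def using Y_pos[of b] PQ(8) UU_pos[of a] T_pos[of a b] by simp
  show "0 \<le> (Q - 1) / 4" using Q by simp
qed (unfold B_def m1_def m2_def k11_def k12_def k22_def,
     (rule convexity_aux[unfolded m1_def m2_def k11_def k12_def k22_def] | (intro cont_all; simp add: UU_nz S_nz))+)

text \<open>Young's inequality for
  \<open>UU a * T = X powr (1 - \<theta>) * S powr \<theta>\<close>, together with
  \<open>\<delta> \<le> 1/8\<close>. For normalised functions the two coefficients add up to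
  \<open>10/8\<close>.\<close>

lemma B_le: "B a b \<le> 1/8 * X a + 9/8 * Y b"
proof -
  have "UU a * T a b \<le> (1 - \<theta>) * X a + \<theta> * S a b"
  proof -
    have U: "UU a = X a powr (1 - \<theta>)" using UU_pos[of a] PQ(1) by (simp add: X_def powr_powr \<theta>_def)
    show ?thesis
    proof (cases "\<theta> = 0")
      case True
      thus ?thesis using U X_pos[of a] S_pos[of a b] by (simp add: T_def)
    next
      case False
      have "\<theta> < 1" using PQ(1) by (simp add: \<theta>_def)
      thus ?thesis unfolding U T_def
        using Youngs_inequality_0[of "1 - \<theta>" \<theta> "X a" "S a b"] False PQ(6) X_pos[of a] S_pos[of a b] by simp
    qed
  qed
  also have "... = X a + \<theta> * Y b" by (simp add: S_def algebra_simps)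
  also have "... \<le> X a + 1 * Y b" using PQ(7) Y_pos[of b] by (intro add_mono mult_right_mono) auto
  finally have "\<delta> * (UU a * T a b) \<le> 1/8 * (X a + 1 * Y b)"
    using PQ(8,9) UU_pos[of a] T_pos[of a b] by (intro mult_mono) auto
  thus ?thesis by (simp add: B_def mult.assoc)
qed

end

section \<open>Convexity of the Bellman energy\<close>

text \<open>\<open>t\<close> is the convex combination of \<open>0\<close> and \<open>t / r\<close>
  with weight \<open>r\<close> on the latter; as \<open>r\<close> tends to 0 the bounded value at
  \<open>t / r\<close> loses its influence.\<close>

lemma convex_bounded_imp_le:
  fixes h :: "real \<Rightarrow> real"
  assumes h: "convex_on {0..} h" and C: "\<And>t. t \<ge> 0 ==> h t \<le> C" and t: "t \<ge> 0"
  shows "h t \<le> h 0"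
proof (rule field_le_epsilon)
  fix e :: real assume e: "e > 0"
  show "h t \<le> h 0 + e"
  proof (cases "t = 0")
    case False
    hence t: "t > 0" using t by simp
    define D where "D = max 1 (C - h 0)"
    define r where "r = min 1 (e / D)"
    have D: "D > 0" by (simp add: D_def)
    have r: "0 < r" "r \<le> 1" "r * D \<le> e" using e D by (auto simp: r_def min_def field_simps)
    have "h ((1 - r) *\<^sub>R 0 + r *\<^sub>R (t / r)) \<le> (1 - r) * h 0 + r * h (t / r)"
      by (rule convex_onD[OF h]) (use r t in auto)
    also have "(1 - r) *\<^sub>R 0 + r *\<^sub>R (t / r) = t" using r by simp
    also have "(1 - r) * h 0 + r * h (t / r) \<le> (1 - r) * h 0 + r * C"
      using C[of "t / r"] r t by (intro add_left_mono mult_left_mono) auto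
    also have "... = h 0 + r * (C - h 0)" by (simp add: algebra_simps)
    also have "... \<le> h 0 + r * D" using r by (intro add_left_mono mult_left_mono) (auto simp: D_def)
    finally show ?thesis using r by linarith
  qed (use e in auto)
qed

lemma convex_on_limit:
  fixes h :: "nat \<Rightarrow> real \<Rightarrow> real"
  assumes h: "\<And>k. convex_on S (h k)" and S: "convex S" and lim: "\<And>t. t \<in> S ==> (\<lambda>k. h k t) \<longlonglongrightarrow> h' t"
  shows "convex_on S h'"
proof (rule convex_onI[OF _ S])
  fix t x y :: real assume t: "0 < t" "t < 1" and xy: "x \<in> S" "y \<in> S"
  have z: "(1 - t) *\<^sub>R x + t *\<^sub>R y \<in> S" using S xy t by (auto simp: convex_alt)
  show "h' ((1 - t) *\<^sub>R x + t *\<^sub>R y) \<le> (1 - t) * h' x + t * h' y"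
  proof (rule LIMSEQ_le)
    show "(\<lambda>k. h k ((1 - t) *\<^sub>R x + t *\<^sub>R y)) \<longlonglongrightarrow> h' ((1 - t) *\<^sub>R x + t *\<^sub>R y)" by (rule lim[OF z])
    show "(\<lambda>k. (1 - t) * h k x + t * h k y) \<longlonglongrightarrow> (1 - t) * h' x + t * h' y"
      by (intro tendsto_intros lim xy)
    show "\<exists>N. \<forall>k\<ge>N. h k ((1 - t) *\<^sub>R x + t *\<^sub>R y) \<le> (1 - t) * h k x + t * h k y"
      using convex_onD[OF h] t xy by (intro exI[of _ 0]) auto
  qed
qed

context bessel
begin

definition KK :: real where "KK = 1/8 * max (\<nu> + 1/2) (1 / (\<nu> + 1/2))"

lemma KK_nonneg: "KK \<ge> 0" using nu by (simp add: KK_def)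

lemma qq_le:
  assumes "0 < x" "x < 1"
  shows "\<bar>qq x\<bar> \<le> sqrt KK * sqrt (rr x)"
proof -
  have "sqrt ((qq x)^2) \<le> sqrt (KK * rr x)"
    using qq_squared_le[OF assms] by (intro real_sqrt_le_mono) (simp add: KK_def)
  thus ?thesis by (simp add: real_sqrt_mult)
qed

lemma d_phi_1: "0 < x ==> x < 1 ==> phid 1 x + qq x * phi 1 x = 0"
proof -
  assume x: "0 < x" "x < 1"
  have u: "U 1 x \<noteq> 0" using U_ground_pos[of x] x by auto
  define i where "i = inverse (1 - x)"
  have "R x * U 1 x = - U1 1 x" using u by (simp add: R_def)
  thus ?thesis unfolding phid_def phi_def qq_def divide_inverse power_inverse[symmetric] i_def[symmetric]
    by (simp add: algebra_simps power2_eq_square)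
qed

lemma ww_deriv:
  assumes "0 < x" "x < 1"
  shows "DERIV ww x :> ww x * drift x"
proof -
  have "DERIV (\<lambda>x. (1 - x)^2) x :> - (2 * (1 - x))"
    by (auto intro!: derivative_eq_intros)
  from DERIV_mult[OF powr_a0_deriv[OF assms(1)] this] have
    "DERIV ww x :> a0 / x * x powr a0 * (1 - x)^2 + - (2 * (1 - x)) * x powr a0"
    by (simp add: ww_def[abs_def])
  thus ?thesis
  proof (rule DERIV_cong)
    define t where "t = 1 - x"
    have "t \<noteq> 0" using assms by (simp add: t_def)
    thus "a0 / x * x powr a0 * (1 - x)^2 + - (2 * (1 - x)) * x powr a0 = ww x * drift x"
      unfolding ww_def drift_def t_def[symmetric] using assms by (simp add: field_simps power2_eq_square)
  qed
qed

end

text \<open>\<open>F\<close> and \<open>G\<close> are harmonic: their second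
  \<open>t\<close>-derivatives cancel the second-order operators in \<open>x\<close>
  (\<open>Fx_dx\<close>, \<open>Gx_dx\<close>). Finite sums keep them smooth in \<open>t\<close> and
  bounded in \<open>x\<close>.\<close>

locale bellman_energy = bessel \<nu> + bellman B B1 B2 H11 H12 H22 c
  for \<nu> B B1 B2 H11 H12 H22 c +
  fixes f g :: "nat \<Rightarrow> real" and N :: nat
begin

definition F where "F t x = (\<Sum>n=1..N. exp (- (lam n * t)) * f n * phi n x)" for t x
definition Ft where "Ft t x = (\<Sum>n=1..N. - lam n * (exp (- (lam n * t)) * f n * phi n x))" for t x
definition Ftt where "Ftt t x = (\<Sum>n=1..N. (lam n)^2 * (exp (- (lam n * t)) * f n * phi n x))" for t x
definition Fx where "Fx t x = (\<Sum>n=1..N. exp (- (lam n * t)) * f n * phid n x)" for t x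
definition G where "G t x = (\<Sum>n=2..N. exp (- (lam n * t)) * g n * chi n x)" for t x
definition Gt where "Gt t x = (\<Sum>n=2..N. - lam n * (exp (- (lam n * t)) * g n * chi n x))" for t x
definition Gtt where "Gtt t x = (\<Sum>n=2..N. (lam n)^2 * (exp (- (lam n * t)) * g n * chi n x))" for t x
definition Gx where "Gx t x = (\<Sum>n=2..N. exp (- (lam n * t)) * g n * chid n x)" for t x
definition dF where "dF t x = (\<Sum>n=2..N. exp (- (lam n * t)) * f n * (sqrt (mu n) * chi n x))" for t x

lemma exp_dt: "DERIV (\<lambda>t. k * (exp (- (lam n * t)) * a * b)) t :> k * (- lam n * (exp (- (lam n * t)) * a * b))"
  by (auto intro!: derivative_eq_intros)

lemma F_dt: "DERIV (\<lambda>t. F t x) t :> Ft t x"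
  unfolding F_def Ft_def using exp_dt[of 1] by (intro DERIV_sum) simp
lemma Ft_dt: "DERIV (\<lambda>t. Ft t x) t :> Ftt t x"
  unfolding Ft_def Ftt_def by (intro DERIV_sum DERIV_cong[OF exp_dt]) (simp add: power2_eq_square)
lemma G_dt: "DERIV (\<lambda>t. G t x) t :> Gt t x"
  unfolding G_def Gt_def using exp_dt[of 1] by (intro DERIV_sum) simp
lemma Gt_dt: "DERIV (\<lambda>t. Gt t x) t :> Gtt t x"
  unfolding Gt_def Gtt_def by (intro DERIV_sum DERIV_cong[OF exp_dt]) (simp add: power2_eq_square)

lemma F_dx: "0 < x ==> x < 1 ==> DERIV (F t) x :> Fx t x"
  unfolding F_def[abs_def] Fx_def by (intro DERIV_sum DERIV_cmult phi_deriv) auto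
lemma G_dx: "0 < x ==> x < 1 ==> DERIV (G t) x :> Gx t x"
  unfolding G_def[abs_def] Gx_def by (intro DERIV_sum DERIV_cmult chi_deriv) auto
lemma Fx_dx:
  assumes "0 < x" "x < 1"
  shows "DERIV (Fx t) x :> - drift x * Fx t x + rr x * F t x - Ftt t x"
proof -
  have "DERIV (Fx t) x :> (\<Sum>n=1..N. exp (- (lam n * t)) * f n * (- drift x * phid n x + (rr x - (lam n)^2) * phi n x))"
    unfolding Fx_def[abs_def] by (intro DERIV_sum DERIV_cmult phid_deriv assms) auto
  thus ?thesis
    by (rule DERIV_cong)
       (simp add: Fx_def F_def Ftt_def algebra_simps sum.distrib sum_subtractf sum_distrib_left sum_negf)
qed
lemma Gx_dx:
  assumes "0 < x" "x < 1"
  shows "DERIV (Gx t) x :> - drift x * Gx t x + (rr x + vv x) * G t x - Gtt t x"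
proof -
  have "DERIV (Gx t) x :> (\<Sum>n=2..N. exp (- (lam n * t)) * g n * (- drift x * chid n x + (rr x + vv x - (lam n)^2) * chi n x))"
    unfolding Gx_def[abs_def] by (intro DERIV_sum DERIV_cmult chid_deriv assms) auto
  thus ?thesis
    by (rule DERIV_cong)
       (simp add: Gx_def G_def Gtt_def algebra_simps sum.distrib sum_subtractf sum_distrib_left sum_negf)
qed

lemma dF_eq:
  assumes "0 < x" "x < 1"
  shows "dF t x = Fx t x + qq x * F t x"
proof (cases "N \<ge> 1")
  case False thus ?thesis by (simp add: dF_def Fx_def F_def)
next
  case True
  have s: "{1..N} = insert 1 {2..N}" using True by auto
  have "Fx t x + qq x * F t x = (\<Sum>n=1..N. exp (- (lam n * t)) * f n * (phid n x + qq x * phi n x))"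
    by (simp add: Fx_def F_def sum_distrib_left sum.distrib algebra_simps)
  also have "... = exp (- (lam 1 * t)) * f 1 * (phid 1 x + qq x * phi 1 x)
      + (\<Sum>n=2..N. exp (- (lam n * t)) * f n * (phid n x + qq x * phi n x))"
    unfolding s by (subst sum.insert) auto
  also have "... = dF t x" unfolding dF_def d_phi_1[OF assms]
    using assms by (simp add: d_phi)
  finally show ?thesis by simp
qed

text \<open>\<open>kk\<close> is a second antiderivative of \<open>dF \<cdot> \<partial>G/\<partial>t\<close> in \<open>t\<close>. Its integral is a multiple of the
  pairing to be estimated, and adding \<open>s kk\<close> for \<open>|s| \<le> \<kappa>\<close> does not destroy the convexity of the energy.\<close>

definition kk where "kk t x = (\<Sum>n=2..N. \<Sum>m=2..N. - (f n * sqrt (mu n) * lam m * g m / (lam n + lam m)^2)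
    * exp (- ((lam n + lam m) * t)) * (chi n x * chi m x))" for t x
definition kkt where "kkt t x = (\<Sum>n=2..N. \<Sum>m=2..N. (f n * sqrt (mu n) * lam m * g m / (lam n + lam m))
    * exp (- ((lam n + lam m) * t)) * (chi n x * chi m x))" for t x

lemma kk_dt: "DERIV (\<lambda>t. kk t x) t :> kkt t x"
  unfolding kk_def kkt_def
proof (intro DERIV_sum)
  fix n m assume "n \<in> {2..N}" "m \<in> {2..N}"
  hence nz: "lam n + lam m \<noteq> 0" using lam_pos[of n] lam_pos[of m] by auto
  show "DERIV (\<lambda>t. - (f n * sqrt (mu n) * lam m * g m / (lam n + lam m)^2) * exp (- ((lam n + lam m) * t)) * (chi n x * chi m x)) t :> f n * sqrt (mu n) * lam m * g m / (lam n + lam m) * exp (- ((lam n + lam m) * t)) * (chi n x * chi m x)"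
  proof -
    define L where "L = lam n + lam m"
    have "L \<noteq> 0" using nz by (simp add: L_def)
    thus ?thesis unfolding L_def[symmetric]
      by (auto intro!: derivative_eq_intros simp: power2_eq_square)
  qed
qed

lemma kkt_dt: "DERIV (\<lambda>t. kkt t x) t :> dF t x * Gt t x"
proof -
  have "DERIV (\<lambda>t. kkt t x) t :> (\<Sum>n=2..N. \<Sum>m=2..N. - (f n * sqrt (mu n) * lam m * g m)
    * exp (- ((lam n + lam m) * t)) * (chi n x * chi m x))"
    unfolding kkt_def
  proof (intro DERIV_sum)
    fix n m assume "n \<in> {2..N}" "m \<in> {2..N}"
    hence nz: "lam n + lam m \<noteq> 0" using lam_pos[of n] lam_pos[of m] by auto
    show "DERIV (\<lambda>t. f n * sqrt (mu n) * lam m * g m / (lam n + lam m) * exp (- ((lam n + lam m) * t)) * (chi n x * chi m x)) t :> - (f n * sqrt (mu n) * lam m * g m) * exp (- ((lam n + lam m) * t)) * (chi n x * chi m x)"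
    proof -
      define L where "L = lam n + lam m"
      have "L \<noteq> 0" using nz by (simp add: L_def)
      thus ?thesis unfolding L_def[symmetric]
        by (auto intro!: derivative_eq_intros)
    qed
  qed
  moreover have "(\<Sum>n=2..N. \<Sum>m=2..N. - (f n * sqrt (mu n) * lam m * g m)
    * exp (- ((lam n + lam m) * t)) * (chi n x * chi m x)) = dF t x * Gt t x"
    unfolding dF_def Gt_def sum_product
  proof (intro sum.cong refl)
    fix n m
    have "exp (- ((lam n + lam m) * t)) = exp (- (lam n * t)) * exp (- (lam m * t))"
      by (simp add: distrib_right flip: exp_add)
    thus "- (f n * sqrt (mu n) * lam m * g m) * exp (- ((lam n + lam m) * t)) * (chi n x * chi m x) =
       exp (- (lam n * t)) * f n * (sqrt (mu n) * chi n x) * (- lam m * (exp (- (lam m * t)) * g m * chi m x))"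
      by simp
  qed
  ultimately show ?thesis by simp
qed

section \<open>Derivatives of the Bellman function along \<open>F\<close> and
  \<open>G\<close>\<close>

definition Bt where "Bt t x = B1 (F t x) (G t x) * Ft t x + B2 (F t x) (G t x) * Gt t x" for t x
definition Btt where "Btt t x = (H11 (F t x) (G t x) * Ft t x + H12 (F t x) (G t x) * Gt t x) * Ft t x + Ftt t x * B1 (F t x) (G t x)
    + ((H12 (F t x) (G t x) * Ft t x + H22 (F t x) (G t x) * Gt t x) * Gt t x + Gtt t x * B2 (F t x) (G t x))" for t x
definition Bx where "Bx t x = B1 (F t x) (G t x) * Fx t x + B2 (F t x) (G t x) * Gx t x" for t x
definition Bxx where "Bxx t x = (H11 (F t x) (G t x) * Fx t x + H12 (F t x) (G t x) * Gx t x) * Fx t x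
    + (- drift x * Fx t x + rr x * F t x - Ftt t x) * B1 (F t x) (G t x)
    + ((H12 (F t x) (G t x) * Fx t x + H22 (F t x) (G t x) * Gx t x) * Gx t x
    + (- drift x * Gx t x + (rr x + vv x) * G t x - Gtt t x) * B2 (F t x) (G t x))" for t x

lemma B_dt: "DERIV (\<lambda>t. B (F t x) (G t x)) t :> Bt t x"
  unfolding Bt_def by (rule B_chain[OF F_dt G_dt])

lemma Bt_dt: "DERIV (\<lambda>t. Bt t x) t :> Btt t x"
  unfolding Bt_def Btt_def
  by (intro DERIV_add DERIV_mult B1_chain[OF F_dt G_dt] B2_chain[OF F_dt G_dt] Ft_dt Gt_dt)

lemma Bx_dx: "0 < x ==> x < 1 ==> DERIV (Bx t) x :> Bxx t x"
  unfolding Bx_def[abs_def] Bxx_def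
  by (intro DERIV_add DERIV_mult B1_chain[OF F_dx G_dx] B2_chain[OF F_dx G_dx] Fx_dx Gx_dx)

lemma wBx_dx:
  assumes "0 < x" "x < 1"
  shows "DERIV (\<lambda>x. ww x * Bx t x) x :> ww x * (Bxx t x + drift x * Bx t x)"
  using DERIV_mult[OF ww_deriv[OF assms] Bx_dx[OF assms]] by (rule DERIV_cong) (simp add: algebra_simps)

definition \<kappa> where "\<kappa> = 2 * c / (1 + sqrt KK)"

lemma \<kappa>_nonneg: "\<kappa> \<ge> 0" using c_nonneg KK_nonneg by (simp add: \<kappa>_def)

text \<open>Harmonicity cancels \<open>Ftt\<close> and \<open>Gtt\<close>; the Hessian form at
  \<open>(Ft, Gt)\<close> and at \<open>(Fx, Gx)\<close> and the potential terms remain. Of their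
  lower bounds only \<open>A * Fx^2\<close>, \<open>A * rr * F^2\<close> and
  \<open>A' * Gt^2\<close> are kept. The arithmetic-geometric mean turns them into
  \<open>2 * c * X * |Gt|\<close> with \<open>X^2 = Fx^2 + rr * F^2\<close>, and
  \<open>|dF| \<le> (1 + sqrt KK) * X\<close> by \<open>qq_le\<close>. This dictates the value of
  \<open>\<kappa>\<close>.\<close>

lemma core_inequality:
  assumes x: "0 < x" "x < 1"
  shows "Btt t x + (Bxx t x + drift x * Bx t x) \<ge> \<kappa> * \<bar>dF t x * Gt t x\<bar>"
proof -
  define a b where "a = F t x" and "b = G t x"
  obtain A A' where A: "0 \<le> A" "0 \<le> A'" "c^2 \<le> A * A'"
    "\<And>p q. A * p^2 + A' * q^2 \<le> H11 a b * p^2 + 2 * H12 a b * (p * q) + H22 a b * q^2"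
    "A * a^2 \<le> B1 a b * a" "A' * b^2 \<le> B2 a b * b"
    using convexity[of a b] by blast
  define ft fx gt gx r v where "ft = Ft t x" and "fx = Fx t x" and "gt = Gt t x" and "gx = Gx t x"
    and "r = rr x" and "v = vv x"
  have r: "r > 0" and v: "v \<ge> 0" using rr_pos[OF x] vv_nonneg[OF x] by (auto simp: r_def v_def)
  have e: "Btt t x + (Bxx t x + drift x * Bx t x) =
      (H11 a b * ft^2 + 2 * H12 a b * (ft * gt) + H22 a b * gt^2)
      + (H11 a b * fx^2 + 2 * H12 a b * (fx * gx) + H22 a b * gx^2) + r * (B1 a b * a) + (r + v) * (B2 a b * b)"
    unfolding Btt_def Bxx_def Bx_def a_def b_def ft_def fx_def gt_def gx_def r_def v_def
    by (simp add: algebra_simps power2_eq_square)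
  have "0 \<le> A' * b^2" using A by simp
  hence "0 \<le> B2 a b * b" using A(6) by linarith
  hence "0 \<le> (r + v) * (B2 a b * b)" using r v by simp
  moreover have "r * (A * a^2) \<le> r * (B1 a b * a)" using A(5) r by (intro mult_left_mono) auto
  moreover have "0 \<le> A * ft^2" "0 \<le> A' * gx^2" using A by auto
  ultimately have 1: "Btt t x + (Bxx t x + drift x * Bx t x) \<ge> A * (fx^2 + r * a^2) + A' * gt^2"
    unfolding e using A(4)[of ft gt] A(4)[of fx gx] by (simp add: algebra_simps)
  define X where "X = sqrt (fx^2 + r * a^2)"
  have X0: "fx^2 + r * a^2 \<ge> 0" using r by simp
  have X: "X^2 = fx^2 + r * a^2" "X \<ge> 0" using X0 by (auto simp: X_def)
  have "2 * c * (X * \<bar>gt\<bar>) \<le> A * X^2 + A' * \<bar>gt\<bar>^2"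
  proof -
    have "c \<le> sqrt (A * A')" using A(3) c_nonneg by (simp add: real_le_rsqrt)
    hence "2 * c * (X * \<bar>gt\<bar>) \<le> 2 * sqrt (A * A') * (X * \<bar>gt\<bar>)"
      using X by (intro mult_right_mono) auto
    also have "... \<le> (sqrt A * X)^2 + (sqrt A' * \<bar>gt\<bar>)^2"
      using sum_squares_bound[of "sqrt A * X" "sqrt A' * \<bar>gt\<bar>"] by (simp add: real_sqrt_mult mult_ac)
    also have "... = A * X^2 + A' * \<bar>gt\<bar>^2" using A by (simp add: power_mult_distrib)
    finally show ?thesis .
  qed
  hence 2: "Btt t x + (Bxx t x + drift x * Bx t x) \<ge> 2 * c * (X * \<bar>gt\<bar>)"
    using 1 X by simp
  have "\<bar>dF t x\<bar> \<le> (1 + sqrt KK) * X"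
  proof -
    have "\<bar>fx\<bar> \<le> X" unfolding X_def using r by (intro real_le_rsqrt) simp
    moreover have "sqrt r * \<bar>a\<bar> \<le> X" unfolding X_def using r by (intro real_le_rsqrt) (simp add: power_mult_distrib)
    hence "sqrt KK * (sqrt r * \<bar>a\<bar>) \<le> sqrt KK * X" using KK_nonneg by (intro mult_left_mono) auto
    moreover have "\<bar>qq x * a\<bar> \<le> sqrt KK * (sqrt r * \<bar>a\<bar>)"
      using mult_right_mono[OF qq_le[OF x], of "\<bar>a\<bar>"] by (simp add: abs_mult r_def mult_ac)
    moreover have "\<bar>dF t x\<bar> \<le> \<bar>fx\<bar> + \<bar>qq x * a\<bar>"
      unfolding dF_eq[OF x] fx_def a_def by (rule abs_triangle_ineq)
    ultimately have "\<bar>dF t x\<bar> \<le> X + sqrt KK * X" by linarith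
    thus ?thesis by (simp add: algebra_simps)
  qed
  hence "\<kappa> * (\<bar>dF t x\<bar> * \<bar>gt\<bar>) \<le> \<kappa> * (((1 + sqrt KK) * X) * \<bar>gt\<bar>)"
    using \<kappa>_nonneg by (intro mult_left_mono mult_right_mono) auto
  also have "... = 2 * c * (X * \<bar>gt\<bar>)"
  proof -
    have "\<kappa> * (1 + sqrt KK) = 2 * c" using KK_nonneg by (simp add: \<kappa>_def add_nonneg_eq_0_iff)
    thus ?thesis by (metis mult.assoc)
  qed
  finally show ?thesis using 2 by (simp add: abs_mult gt_def)
qed

lemma phi_cont2: "n \<ge> 1 ==> S \<subseteq> UNIV \<times> {0<..<1} ==> continuous_on S (\<lambda>z. phi n (snd z))"
  and chi_cont2: "n \<ge> 1 ==> S \<subseteq> UNIV \<times> {0<..<1} ==> continuous_on S (\<lambda>z. chi n (snd z))"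
  by (auto intro!: continuous_on_compose2[OF phi_cont] continuous_on_compose2[OF chi_cont] continuous_intros)

lemma cont2:
  assumes S: "S \<subseteq> UNIV \<times> {0<..<1}"
  shows "continuous_on S (\<lambda>z. F (fst z) (snd z))" "continuous_on S (\<lambda>z. Ft (fst z) (snd z))"
    "continuous_on S (\<lambda>z. Ftt (fst z) (snd z))" "continuous_on S (\<lambda>z. G (fst z) (snd z))"
    "continuous_on S (\<lambda>z. Gt (fst z) (snd z))" "continuous_on S (\<lambda>z. Gtt (fst z) (snd z))"
    "continuous_on S (\<lambda>z. dF (fst z) (snd z))" "continuous_on S (\<lambda>z. kk (fst z) (snd z))" "continuous_on S (\<lambda>z. kkt (fst z) (snd z))"
  unfolding F_def Ft_def Ftt_def G_def Gt_def Gtt_def dF_def kk_def kkt_def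
  by (intro continuous_intros phi_cont2 chi_cont2 S; force)+

lemma cont2_compose:
  assumes K: "continuous_on UNIV (\<lambda>z. K (fst z) (snd z) :: real)" and S: "S \<subseteq> UNIV \<times> {0<..<1}"
  shows "continuous_on S (\<lambda>z. K (F (fst z) (snd z)) (G (fst z) (snd z)))"
proof -
  have "continuous_on S (\<lambda>z. (F (fst z) (snd z), G (fst z) (snd z)))"
    by (intro continuous_on_Pair cont2 S)
  from continuous_on_compose2[OF K this] show ?thesis by simp
qed

lemma ww_cont2: "S \<subseteq> UNIV \<times> {0<..<1} ==> continuous_on S (\<lambda>z. ww (snd z))"
  unfolding ww_def by (intro continuous_intros) auto

section \<open>The energy on compact subintervals and its limit\<close>

definition en where "en s t x = ww x * (B (F t x) (G t x) + s * kk t x)" for s t x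
definition ent where "ent s t x = ww x * (Bt t x + s * kkt t x)" for s t x
definition entt where "entt s t x = ww x * (Btt t x + s * (dF t x * Gt t x))" for s t x

lemma en_dt: "DERIV (\<lambda>t. en s t x) t :> ent s t x"
  and ent_dt: "DERIV (\<lambda>t. ent s t x) t :> entt s t x"
  unfolding en_def ent_def entt_def
  by (intro DERIV_cmult DERIV_add B_dt Bt_dt kk_dt kkt_dt)+

lemma en_cont2:
  assumes S: "S \<subseteq> UNIV \<times> {0<..<1}"
  shows "continuous_on S (\<lambda>(t, x). en s t x)" "continuous_on S (\<lambda>(t, x). ent s t x)" "continuous_on S (\<lambda>(t, x). entt s t x)"
  unfolding en_def ent_def entt_def Bt_def Btt_def split_beta
  by (intro continuous_intros ww_cont2 cont2 S cont2_compose[OF B_cont] cont2_compose[OF B1_cont] cont2_compose[OF B2_cont]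
      cont2_compose[OF H11_cont] cont2_compose[OF H12_cont] cont2_compose[OF H22_cont])+

lemma cont_slice:
  fixes t :: real
  assumes "continuous_on (UNIV \<times> S) (\<lambda>(t, x). h t x :: real)"
  shows "continuous_on S (h t)"
proof -
  have "continuous_on S (\<lambda>x. (t :: real, x))" by (intro continuous_intros)
  from continuous_on_compose2[OF assms this] show ?thesis by auto
qed

lemma en_cont: "continuous_on {0<..<1} (en s t)" "continuous_on {0<..<1} (entt s t)"
  by (rule cont_slice[OF en_cont2(1)], simp, rule cont_slice[OF en_cont2(3)], simp)

lemma energy_second_deriv:
  assumes ab: "0 < a" "a \<le> b" "b < 1"
  shows "DERIV (\<lambda>t. integral {a..b} (en s t)) t :> integral {a..b} (ent s t)"
    and "DERIV (\<lambda>t. integral {a..b} (ent s t)) t :> integral {a..b} (entt s t)"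
proof -
  have sub: "UNIV \<times> {a..b} \<subseteq> UNIV \<times> {0<..<1}" using ab by auto
  note C = en_cont2[OF sub]
  have i: "en s t integrable_on cbox a b" "ent s t integrable_on cbox a b" for t
    unfolding cbox_interval by (intro integrable_continuous_interval cont_slice[OF C(1)] cont_slice[OF C(2)])+
  have "((\<lambda>t. integral (cbox a b) (en s t)) has_field_derivative integral (cbox a b) (ent s t)) (at t within UNIV)"
    by (rule leibniz_rule_field_derivative) (use C i en_dt in auto)
  thus "DERIV (\<lambda>t. integral {a..b} (en s t)) t :> integral {a..b} (ent s t)" by simp
  have "((\<lambda>t. integral (cbox a b) (ent s t)) has_field_derivative integral (cbox a b) (entt s t)) (at t within UNIV)"
    by (rule leibniz_rule_field_derivative) (use C i ent_dt in auto)
  thus "DERIV (\<lambda>t. integral {a..b} (ent s t)) t :> integral {a..b} (entt s t)" by simp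
qed

text \<open>The \<open>x\<close>-part of the core inequality, times \<open>ww\<close>, is the
  derivative of \<open>ww * Bx\<close>; integrating it leaves only the two boundary values.\<close>

lemma energy_second_deriv_lower:
  assumes ab: "0 < a" "a \<le> b" "b < 1" and s: "\<bar>s\<bar> \<le> \<kappa>"
  shows "integral {a..b} (entt s t) \<ge> ww a * Bx t a - ww b * Bx t b"
proof -
  have "((\<lambda>x. ww x * (Bxx t x + drift x * Bx t x)) has_integral (ww b * Bx t b - ww a * Bx t a)) {a..b}"
  proof (rule fundamental_theorem_of_calculus[OF ab(2)])
    fix x assume "x \<in> {a..b}"
    hence "DERIV (\<lambda>x. ww x * Bx t x) x :> ww x * (Bxx t x + drift x * Bx t x)"
      using ab by (intro wBx_dx) auto
    thus "((\<lambda>x. ww x * Bx t x) has_vector_derivative ww x * (Bxx t x + drift x * Bx t x)) (at x within {a..b})"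
      by (simp add: has_real_derivative_iff_has_vector_derivative has_vector_derivative_at_within)
  qed
  moreover have "entt s t integrable_on {a..b}"
    by (intro integrable_continuous_interval continuous_on_subset[OF en_cont(2)]) (use ab in auto)
  ultimately have "((\<lambda>x. entt s t x + ww x * (Bxx t x + drift x * Bx t x)) has_integral
      (integral {a..b} (entt s t) + (ww b * Bx t b - ww a * Bx t a))) {a..b}"
    by (intro has_integral_add integrable_integral)
  moreover have "0 \<le> entt s t x + ww x * (Bxx t x + drift x * Bx t x)" if "x \<in> {a..b}" for x
  proof -
    have x: "0 < x" "x < 1" using that ab by auto
    have "\<bar>s * (dF t x * Gt t x)\<bar> \<le> \<kappa> * \<bar>dF t x * Gt t x\<bar>"
      unfolding abs_mult[of s] using s by (intro mult_right_mono) auto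
    hence "0 \<le> Btt t x + s * (dF t x * Gt t x) + (Bxx t x + drift x * Bx t x)"
      using core_inequality[OF x, of t] by linarith
    hence "0 \<le> ww x * (Btt t x + s * (dF t x * Gt t x) + (Bxx t x + drift x * Bx t x))"
      using ww_nonneg[of x] by (rule mult_nonneg_nonneg[rotated])
    thus ?thesis by (simp add: entt_def algebra_simps)
  qed
  ultimately have "0 \<le> integral {a..b} (entt s t) + (ww b * Bx t b - ww a * Bx t a)"
    by (rule has_integral_nonneg)
  thus ?thesis by simp
qed

definition CF where "CF = (\<Sum>n=1..N. \<bar>f n\<bar> * (cn n * lam n))"
definition CG where "CG = (\<Sum>n=2..N. \<bar>g n\<bar> * (dn n * (CZ * mu n)))"

lemma exp_lam_le: "t \<ge> 0 ==> exp (- (lam n * t)) \<le> 1"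
  using lam_Suc(1)[of n] by simp

lemma damped_sum_bound:
  assumes e: "\<And>n. n \<in> S ==> \<bar>e n\<bar> \<le> b n" and t: "t \<ge> 0"
  shows "\<bar>\<Sum>n\<in>S. exp (- (lam n * t)) * h n * e n\<bar> \<le> (\<Sum>n\<in>S. \<bar>h n\<bar> * b n)"
proof (rule order_trans[OF sum_abs sum_mono])
  fix n assume "n \<in> S"
  thus "\<bar>exp (- (lam n * t)) * h n * e n\<bar> \<le> \<bar>h n\<bar> * b n"
    using mult_mono[OF mult_right_mono[OF exp_lam_le[OF t], of "\<bar>h n\<bar>" n] e] by (simp add: abs_mult)
qed

lemma F_bound: "t \<ge> 0 ==> 0 < x ==> x < 1 ==> \<bar>F t x\<bar> \<le> CF"
  unfolding F_def CF_def by (intro damped_sum_bound phi_bound) auto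

lemma G_bound: "t \<ge> 0 ==> 0 < x ==> x < 1 ==> \<bar>G t x\<bar> \<le> CG"
  unfolding G_def CG_def by (intro damped_sum_bound chi_bound) auto

lemma compose_bound:
  assumes "continuous_on UNIV (\<lambda>z. K (fst z) (snd z) :: real)"
  obtains C where "C \<ge> 0" "\<And>t x. t \<ge> 0 ==> 0 < x ==> x < 1 ==> \<bar>K (F t x) (G t x)\<bar> \<le> C"
proof -
  let ?S = "{-CF..CF} \<times> {-CG..CG}"
  have "compact ((\<lambda>z. K (fst z) (snd z)) ` ?S)"
    by (intro compact_continuous_image continuous_on_subset[OF assms] compact_Times compact_Icc) auto
  hence "bounded ((\<lambda>z. K (fst z) (snd z)) ` ?S)" by (rule compact_imp_bounded)
  then obtain C where "\<forall>y\<in>(\<lambda>z. K (fst z) (snd z)) ` ?S. norm y \<le> C" unfolding bounded_iff by blast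
  hence C: "\<bar>K (fst z) (snd z)\<bar> \<le> C" if "z \<in> ?S" for z using that by fastforce
  show ?thesis
  proof (rule that[of "max 0 C"])
    fix t x :: real assume "t \<ge> 0" "0 < x" "x < 1"
    hence "(F t x, G t x) \<in> ?S" using F_bound[of t x] G_bound[of t x] by (simp add: abs_le_iff minus_le_iff)
    from C[OF this] show "\<bar>K (F t x) (G t x)\<bar> \<le> max 0 C" by simp
  qed simp
qed

text \<open>One \<open>M\<close> serves all \<open>t \<ge> 0\<close>: the damping factors are at
  most 1, and \<open>(F, G)\<close> stays in a fixed rectangle on which \<open>B1\<close> and
  \<open>B2\<close> are bounded.\<close>

lemma wBx_bound:
  obtains M where "\<And>t x. t \<ge> 0 ==> 0 < x ==> x < 1 ==> \<bar>ww x * Bx t x\<bar> \<le> M * (x powr a0 * (1 - x))"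
proof -
  obtain C1 where C1: "C1 \<ge> 0" "\<And>t x. t \<ge> 0 ==> 0 < x ==> x < 1 ==> \<bar>B1 (F t x) (G t x)\<bar> \<le> C1"
    using compose_bound[OF B1_cont] by blast
  obtain C2 where C2: "C2 \<ge> 0" "\<And>t x. t \<ge> 0 ==> 0 < x ==> x < 1 ==> \<bar>B2 (F t x) (G t x)\<bar> \<le> C2"
    using compose_bound[OF B2_cont] by blast
  obtain M1 where M1: "\<And>n x. n \<ge> 1 ==> 0 < x ==> x < 1 ==> \<bar>ww x * phid n x\<bar> \<le> M1 n * (x powr a0 * (1 - x))"
    using ww_phid_bound by metis
  obtain M2 where M2: "\<And>n x. n \<ge> 2 ==> 0 < x ==> x < 1 ==> \<bar>ww x * chid n x\<bar> \<le> M2 n * (x powr a0 * (1 - x))"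
    using ww_chid_bound by metis
  define M where "M = C1 * (\<Sum>n=1..N. \<bar>f n\<bar> * M1 n) + C2 * (\<Sum>n=2..N. \<bar>g n\<bar> * M2 n)"
  have "\<bar>ww x * Bx t x\<bar> \<le> M * (x powr a0 * (1 - x))" if tx: "t \<ge> 0" "0 < x" "x < 1" for t x
  proof -
    define y where "y = x powr a0 * (1 - x)"
    have "ww x * Fx t x = (\<Sum>n=1..N. exp (- (lam n * t)) * f n * (ww x * phid n x))"
      by (simp add: Fx_def sum_distrib_left mult_ac)
    also have "\<bar>...\<bar> \<le> (\<Sum>n=1..N. \<bar>f n\<bar> * (M1 n * y))"
      unfolding y_def using tx by (intro damped_sum_bound M1) auto
    finally have "\<bar>ww x * Fx t x\<bar> \<le> (\<Sum>n=1..N. \<bar>f n\<bar> * M1 n) * y" unfolding sum_distrib_right by (simp only: mult.assoc)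
    hence 1: "\<bar>B1 (F t x) (G t x)\<bar> * \<bar>ww x * Fx t x\<bar> \<le> C1 * ((\<Sum>n=1..N. \<bar>f n\<bar> * M1 n) * y)"
      using C1 tx by (intro mult_mono) auto
    have "ww x * Gx t x = (\<Sum>n=2..N. exp (- (lam n * t)) * g n * (ww x * chid n x))"
      by (simp add: Gx_def sum_distrib_left mult_ac)
    also have "\<bar>...\<bar> \<le> (\<Sum>n=2..N. \<bar>g n\<bar> * (M2 n * y))"
      unfolding y_def using tx by (intro damped_sum_bound M2) auto
    finally have "\<bar>ww x * Gx t x\<bar> \<le> (\<Sum>n=2..N. \<bar>g n\<bar> * M2 n) * y" unfolding sum_distrib_right by (simp only: mult.assoc)
    hence 2: "\<bar>B2 (F t x) (G t x)\<bar> * \<bar>ww x * Gx t x\<bar> \<le> C2 * ((\<Sum>n=2..N. \<bar>g n\<bar> * M2 n) * y)"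
      using C2 tx by (intro mult_mono) auto
    have "ww x * Bx t x = B1 (F t x) (G t x) * (ww x * Fx t x) + B2 (F t x) (G t x) * (ww x * Gx t x)"
      by (simp add: Bx_def algebra_simps)
    also have "\<bar>...\<bar> \<le> \<bar>B1 (F t x) (G t x)\<bar> * \<bar>ww x * Fx t x\<bar> + \<bar>B2 (F t x) (G t x)\<bar> * \<bar>ww x * Gx t x\<bar>"
      unfolding abs_mult[symmetric] by (rule abs_triangle_ineq)
    also have "... \<le> M * y" using 1 2 by (simp add: M_def algebra_simps)
    finally show ?thesis by (simp add: y_def)
  qed
  thus ?thesis by (rule that)
qed

definition energy where "energy s t = (LINT x:{0<..<1}|lborel. en s t x)" for s t

lemma kk_bound:
  obtains C where "\<And>t x. t \<ge> 0 ==> 0 < x ==> x < 1 ==> \<bar>kk t x\<bar> \<le> C"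
proof -
  define b where "b = (\<lambda>n m. \<bar>f n * sqrt (mu n) * lam m * g m / (lam n + lam m)^2\<bar> * ((dn n * (CZ * mu n)) * (dn m * (CZ * mu m))))"
  have "\<bar>kk t x\<bar> \<le> (\<Sum>n=2..N. \<Sum>m=2..N. b n m)" if tx: "t \<ge> 0" "0 < x" "x < 1" for t x
    unfolding kk_def
  proof (intro order_trans[OF sum_abs sum_mono])
    fix n m assume nm: "n \<in> {2..N}" "m \<in> {2..N}"
    have "0 \<le> (lam n + lam m) * t" using lam_Suc(1)[of n] lam_Suc(1)[of m] tx by simp
    hence e: "exp (- ((lam n + lam m) * t)) \<le> 1" by simp
    have d: "0 \<le> dn n * (CZ * mu n)" "0 \<le> dn m * (CZ * mu m)"
      using nm dn_pos mu_pos CZ_pos by (auto intro!: mult_nonneg_nonneg less_imp_le)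
    have "\<bar>chi n x * chi m x\<bar> \<le> (dn n * (CZ * mu n)) * (dn m * (CZ * mu m))"
      unfolding abs_mult using chi_bound[of n x] chi_bound[of m x] nm tx d by (intro mult_mono) auto
    hence "exp (- ((lam n + lam m) * t)) * \<bar>chi n x * chi m x\<bar> \<le> 1 * ((dn n * (CZ * mu n)) * (dn m * (CZ * mu m)))"
      using e by (intro mult_mono) auto
    from mult_left_mono[OF this, of "\<bar>f n * sqrt (mu n) * lam m * g m / (lam n + lam m)^2\<bar>"]
    show "\<bar>- (f n * sqrt (mu n) * lam m * g m / (lam n + lam m)^2) * exp (- ((lam n + lam m) * t)) * (chi n x * chi m x)\<bar> \<le> b n m"
      unfolding b_def abs_mult abs_minus_cancel by (simp add: mult_ac)
  qed
  thus ?thesis by (rule that)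
qed

lemma en_bound:
  obtains C where "\<And>t x. t \<ge> 0 ==> 0 < x ==> x < 1 ==> \<bar>en s t x\<bar> \<le> C"
proof -
  obtain C1 where C1: "C1 \<ge> 0" "\<And>t x. t \<ge> 0 ==> 0 < x ==> x < 1 ==> \<bar>B (F t x) (G t x)\<bar> \<le> C1"
    using compose_bound[OF B_cont] by blast
  obtain C2 where C2: "\<And>t x. t \<ge> 0 ==> 0 < x ==> x < 1 ==> \<bar>kk t x\<bar> \<le> C2"
    using kk_bound by blast
  have "\<bar>en s t x\<bar> \<le> C1 + \<bar>s\<bar> * C2" if tx: "t \<ge> 0" "0 < x" "x < 1" for t x
  proof -
    have w: "ww x \<le> 1 * 1"
      unfolding ww_def using tx a0 by (intro mult_mono) (auto simp: powr_le1 power_le_one)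
    have "\<bar>en s t x\<bar> = ww x * \<bar>B (F t x) (G t x) + s * kk t x\<bar>"
      using ww_nonneg[of x] by (simp add: en_def abs_mult)
    also have "... \<le> 1 * \<bar>B (F t x) (G t x) + s * kk t x\<bar>" using w by (intro mult_right_mono) auto
    also have "... \<le> \<bar>B (F t x) (G t x)\<bar> + \<bar>s\<bar> * \<bar>kk t x\<bar>"
      using abs_triangle_ineq[of "B (F t x) (G t x)" "s * kk t x"] by (simp add: abs_mult)
    also have "... \<le> C1 + \<bar>s\<bar> * C2" using C1 C2 tx by (intro add_mono mult_left_mono) auto
    finally show ?thesis .
  qed
  thus ?thesis by (rule that)
qed

lemma energy_truncated_tendsto:
  assumes t: "t \<ge> 0"
  shows "(\<lambda>k. integral {1 / (real k + 2)..1 - 1 / (real k + 2)} (en s t)) \<longlonglongrightarrow> energy s t"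
    "set_integrable lborel {0<..<1} (en s t)"
proof -
  obtain C where C: "\<And>x. 0 < x ==> x < 1 ==> \<bar>en s t x\<bar> \<le> C" using en_bound[of s] t by metis
  define a b where "a = (\<lambda>k::nat. 1 / (real k + 2))" and "b = (\<lambda>k. 1 - a k)"
  have ab: "0 < a k" "b k < 1" for k by (auto simp: a_def b_def)
  have meas: "(\<lambda>x. indicator {0<..<1} x *\<^sub>R en s t x) \<in> borel_measurable borel"
    by (rule borel_measurable_continuous_on_indicator[OF _ en_cont(1)]) simp
  have eq: "integral {a k..b k} (en s t) = (LINT x|lborel. indicator {a k..b k} x *\<^sub>R (indicator {0<..<1} x *\<^sub>R en s t x))" for k
  proof -
    have "set_integrable lborel {a k..b k} (en s t)"
      by (rule borel_integrable_atLeastAtMost') (rule continuous_on_subset[OF en_cont(1)], use ab[of k] in auto)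
    from set_borel_integral_eq_integral(2)[OF this]
    have "integral {a k..b k} (en s t) = (LINT x|lborel. indicator {a k..b k} x *\<^sub>R en s t x)"
      by (simp add: set_lebesgue_integral_def)
    also have "... = (LINT x|lborel. indicator {a k..b k} x *\<^sub>R (indicator {0<..<1} x *\<^sub>R en s t x))"
      by (intro bint_cong refl) (use ab[of k] in \<open>auto simp: indicator_def\<close>)
    finally show ?thesis .
  qed
  have wint: "integrable lborel (\<lambda>x. C * indicator {0<..<1::real} x)"
    by (intro integrable_mult_right integrable_real_indicator) auto
  have bd: "norm (indicator {0<..<1} x *\<^sub>R en s t x) \<le> C * indicator {0<..<1::real} x" for x
    using C[of x] by (auto simp: indicator_def)
  have bd': "norm (indicator {a k..b k} x *\<^sub>R (indicator {0<..<1} x *\<^sub>R en s t x)) \<le> C * indicator {0<..<1::real} x" for k x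
    using bd[of x] by (auto simp: indicator_def)
  have "(\<lambda>k. LINT x|lborel. indicator {a k..b k} x *\<^sub>R (indicator {0<..<1} x *\<^sub>R en s t x))
      \<longlonglongrightarrow> (LINT x|lborel. indicator {0<..<1} x *\<^sub>R en s t x)"
  proof (rule integral_dominated_convergence[where w = "\<lambda>x. C * indicator {0<..<1::real} x"])
    show "AE x in lborel. (\<lambda>k. indicator {a k..b k} x *\<^sub>R (indicator {0<..<1} x *\<^sub>R en s t x)) \<longlonglongrightarrow> indicator {0<..<1} x *\<^sub>R en s t x"
    proof (rule AE_I2)
      fix x :: real
      show "(\<lambda>k. indicator {a k..b k} x *\<^sub>R (indicator {0<..<1} x *\<^sub>R en s t x)) \<longlonglongrightarrow> indicator {0<..<1} x *\<^sub>R en s t x"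
      proof (cases "x \<in> {0<..<1}")
        case True
        have "a \<longlonglongrightarrow> 0" unfolding a_def by real_asymp
        hence "eventually (\<lambda>k. a k < min x (1 - x)) sequentially" using True by (intro order_tendstoD(2)) auto
        hence "eventually (\<lambda>k. indicator {a k..b k} x *\<^sub>R (indicator {0<..<1} x *\<^sub>R en s t x) = indicator {0<..<1} x *\<^sub>R en s t x) sequentially"
          by eventually_elim (auto simp: b_def indicator_def)
        thus ?thesis by (rule tendsto_eventually)
      qed simp
    qed
    show "(\<lambda>x. indicator {a k..b k} x *\<^sub>R (indicator {0<..<1} x *\<^sub>R en s t x)) \<in> borel_measurable lborel" for k
      using meas by simp
  qed (use meas wint bd' in auto)
  thus "(\<lambda>k. integral {1 / (real k + 2)..1 - 1 / (real k + 2)} (en s t)) \<longlonglongrightarrow> energy s t"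
    unfolding eq[symmetric] by (simp add: energy_def set_lebesgue_integral_def a_def b_def)
  show "set_integrable lborel {0<..<1} (en s t)"
    unfolding set_integrable_def
    by (rule bint_bound[OF wint])
       (use meas in simp, rule AE_I2, rule order_trans[OF bd], simp)
qed

text \<open>On \<open>[a k, b k]\<close> the second derivative is at least \<open>- m k\<close>,
  where \<open>m k\<close> bounds the boundary terms. Adding \<open>m k * t^2 / 2\<close> makes the
  truncated energy convex. As \<open>m k\<close> tends to 0, convexity passes to the limit, and the
  energy over the whole interval is never differentiated.\<close>

lemma energy_convex:
  assumes s: "\<bar>s\<bar> \<le> \<kappa>"
  shows "convex_on {0..} (energy s)"
proof -
  obtain M where M: "\<And>t x. t \<ge> 0 ==> 0 < x ==> x < 1 ==> \<bar>ww x * Bx t x\<bar> \<le> M * (x powr a0 * (1 - x))"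
    using wBx_bound by blast
  define a b where "a = (\<lambda>k::nat. 1 / (real k + 2))" and "b = (\<lambda>k::nat. 1 - 1 / (real k + 2))"
  have ab: "0 < a k" "a k \<le> b k" "b k < 1" for k by (auto simp: a_def b_def field_simps)
  define m where "m = (\<lambda>k. M * (a k powr a0 * (1 - a k)) + M * (b k powr a0 * (1 - b k)))"
  define h where "h = (\<lambda>k t. integral {a k..b k} (en s t) + m k * t^2 / 2)"
  show ?thesis
  proof (rule convex_on_limit)
    fix k
    show "convex_on {0..} (h k)"
    proof (rule f''_ge0_imp_convex)
      fix t :: real assume t: "t \<in> {0..}"
      show "DERIV (h k) t :> integral {a k..b k} (ent s t) + m k * t"
        unfolding h_def by (auto intro!: derivative_eq_intros energy_second_deriv ab)
      show "DERIV (\<lambda>t. integral {a k..b k} (ent s t) + m k * t) t :> integral {a k..b k} (entt s t) + m k"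
        by (auto intro!: derivative_eq_intros energy_second_deriv ab)
      have "a k < 1" "0 < b k" using ab[of k] by linarith+
      hence "\<bar>ww (a k) * Bx t (a k)\<bar> \<le> M * (a k powr a0 * (1 - a k))" "\<bar>ww (b k) * Bx t (b k)\<bar> \<le> M * (b k powr a0 * (1 - b k))"
        using M[of t "a k"] M[of t "b k"] t ab[of k] by auto
      thus "0 \<le> integral {a k..b k} (entt s t) + m k"
        using energy_second_deriv_lower[OF ab s, of k t] by (auto simp: m_def)
    qed simp
  next
    fix t :: real assume t: "t \<in> {0..}"
    have a: "a \<longlonglongrightarrow> 0" and b: "b \<longlonglongrightarrow> 1" unfolding a_def b_def by real_asymp+
    have A: "(\<lambda>k. a k powr a0) \<longlonglongrightarrow> 0 powr a0"
      using a0 ab by (intro tendsto_powr' a tendsto_const) (auto intro!: always_eventually less_imp_le)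
    have B': "(\<lambda>k. b k powr a0) \<longlonglongrightarrow> 1 powr a0" by (intro tendsto_powr b tendsto_const) auto
    have "m \<longlonglongrightarrow> M * (0 powr a0 * (1 - 0)) + M * (1 powr a0 * (1 - 1))"
      unfolding m_def by (rule tendsto_add tendsto_mult tendsto_diff tendsto_const a b A B')+
    hence m: "m \<longlonglongrightarrow> 0" by simp
    have "(\<lambda>k. integral {a k..b k} (en s t) + m k * t^2 / 2) \<longlonglongrightarrow> energy s t + 0 * t^2 / 2"
      using energy_truncated_tendsto(1)[of t s] t by (intro tendsto_intros m) (auto simp: a_def b_def)
    thus "(\<lambda>k. h k t) \<longlonglongrightarrow> energy s t" by (simp add: h_def)
  qed simp
qed

lemma energy_decreasing:
  assumes s: "\<bar>s\<bar> \<le> \<kappa>" and t: "t \<ge> 0"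
  shows "energy s t \<le> energy s 0"
proof -
  obtain C where C: "\<And>t x. t \<ge> 0 ==> 0 < x ==> x < 1 ==> \<bar>en s t x\<bar> \<le> C" using en_bound[of s] by metis
  have "energy s t \<le> C" if t: "t \<ge> 0" for t
  proof -
    have "energy s t \<le> (LINT x:{0<..<1::real}|lborel. C)"
      unfolding energy_def
    proof (rule set_integral_mono[OF energy_truncated_tendsto(2)[OF t]])
      show "set_integrable lborel {0<..<1::real} (\<lambda>x. C)"
        by (simp add: set_integrable_def)
      show "en s t x \<le> C" if "x \<in> {0<..<1}" for x using C[OF t, of x] that by auto
    qed
    thus ?thesis by (simp add: set_lebesgue_integral_def)
  qed
  from convex_bounded_imp_le[OF energy_convex[OF s] this t] show ?thesis by simp
qed

end

section \<open>The integrated inequality and the pairing\<close>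

context bessel
begin

lemma integrable_rho_bounded:
  fixes h :: "real \<Rightarrow> real"
  assumes "h \<in> borel_measurable rh" "\<And>x. 0 < x ==> x < 1 ==> \<bar>h x\<bar> \<le> C"
  shows "integrable rh h"
proof -
  interpret finite_measure rh by (rule finite_measure_rho)
  show ?thesis by (rule integrable_const_bound[of _ C]) (use assms in \<open>auto intro!: AE_I2\<close>)
qed

definition Fs :: "(nat \<Rightarrow> real) \<Rightarrow> nat \<Rightarrow> real \<Rightarrow> real" where "Fs f N x = (\<Sum>n=1..N. f n * phi n x)"
definition Gs :: "(nat \<Rightarrow> real) \<Rightarrow> nat \<Rightarrow> real \<Rightarrow> real" where "Gs g N x = (\<Sum>n=2..N. g n * chi n x)"

definition pairing :: "(nat \<Rightarrow> real) \<Rightarrow> (nat \<Rightarrow> real) \<Rightarrow> nat \<Rightarrow> real" where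
  "pairing f g N = (\<Sum>n=2..N. f n * g n * sqrt (mu n) / lam n)"

end

context bellman_energy
begin

lemma F_eq: "F t = Fs (\<lambda>n. exp (- (lam n * t)) * f n) N" and G_eq: "G t = Gs (\<lambda>n. exp (- (lam n * t)) * g n) N"
  by (simp_all add: fun_eq_iff F_def G_def Fs_def Gs_def)

lemma F_0: "F 0 = Fs f N" and G_0: "G 0 = Gs g N"
  by (simp_all add: F_eq G_eq)

lemma cont_FG: "continuous_on {0<..<1} (F t)" "continuous_on {0<..<1} (G t)" "continuous_on {0<..<1} (kk t)"
  unfolding F_def[abs_def] G_def[abs_def] kk_def[abs_def]
  by (intro continuous_intros phi_cont chi_cont; force)+

lemma measurable_BFG: "(\<lambda>x. B (F t x) (G t x)) \<in> borel_measurable rh"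
proof (rule continuous_measurable_rho)
  have "continuous_on {0<..<1} (\<lambda>x. (F t x, G t x))" by (intro continuous_on_Pair cont_FG)
  from continuous_on_compose2[OF B_cont this] show "continuous_on {0<..<1} (\<lambda>x. B (F t x) (G t x))" by simp
qed

lemma integrable_BFG:
  assumes "t \<ge> 0"
  shows "integrable rh (\<lambda>x. B (F t x) (G t x))"
proof -
  obtain C where "C \<ge> 0" "\<And>t x. t \<ge> 0 ==> 0 < x ==> x < 1 ==> \<bar>B (F t x) (G t x)\<bar> \<le> C"
    by (rule compose_bound[OF B_cont], rule that)
  thus ?thesis using assms by (intro integrable_rho_bounded[OF measurable_BFG]) auto
qed

lemma integrable_chi_chi:
  assumes "n \<ge> 2" "m \<ge> 2"
  shows "integrable rh (\<lambda>x. chi n x * chi m x)"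
proof (rule integrable_rho_bounded)
  show "(\<lambda>x. chi n x * chi m x) \<in> borel_measurable rh"
    using assms by (intro continuous_measurable_rho continuous_intros chi_cont) auto
  fix x :: real assume x: "0 < x" "x < 1"
  have d: "0 \<le> dn n * (CZ * mu n)" "0 \<le> dn m * (CZ * mu m)"
    using assms dn_pos mu_pos CZ_pos by (auto intro!: mult_nonneg_nonneg less_imp_le)
  show "\<bar>chi n x * chi m x\<bar> \<le> (dn n * (CZ * mu n)) * (dn m * (CZ * mu m))"
    unfolding abs_mult using chi_bound[of n x] chi_bound[of m x] assms x d by (intro mult_mono) auto
qed

text \<open>The integral of \<open>kk t\<close>: by orthonormality only the terms
  \<open>n = m\<close> survive, where
  \<open>lam n / (2 * lam n)^2 = 1 / (4 * lam n)\<close>.\<close>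

definition KI where "KI t = - (\<Sum>n=2..N. f n * g n * sqrt (mu n) / (4 * lam n) * exp (- (2 * lam n * t)))" for t

lemma integral_kk: "integrable rh (kk t)" "(LINT x|rh. kk t x) = KI t"
proof -
  let ?c = "\<lambda>n m. - (f n * sqrt (mu n) * lam m * g m / (lam n + lam m)^2) * exp (- ((lam n + lam m) * t))"
  show "integrable rh (kk t)"
    unfolding kk_def[abs_def]
    by (intro Bochner_Integration.integrable_sum integrable_mult_right integrable_chi_chi) auto
  have "(LINT x|rh. kk t x) = (\<Sum>n=2..N. \<Sum>m=2..N. LINT x|rh. ?c n m * (chi n x * chi m x))"
    unfolding kk_def
    by (subst bint_sum, intro Bochner_Integration.integrable_sum integrable_mult_right integrable_chi_chi; force?)
       (intro sum.cong refl bint_sum integrable_mult_right integrable_chi_chi; force)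
  also have "... = (\<Sum>n=2..N. \<Sum>m=2..N. if n = m then ?c n n else 0)"
    by (intro sum.cong refl) (simp add: chi_orthonormal)
  also have "... = (\<Sum>n=2..N. ?c n n)" by (intro sum.cong refl) (simp add: sum.delta')
  also have "... = KI t"
    unfolding KI_def sum_negf[symmetric]
  proof (intro sum.cong refl)
    fix n assume "n \<in> {2..N}"
    hence "lam n > 0" using lam_pos by auto
    thus "?c n n = - (f n * g n * sqrt (mu n) / (4 * lam n) * exp (- (2 * lam n * t)))"
      by (simp add: power2_eq_square field_simps)
  qed
  finally show "(LINT x|rh. kk t x) = KI t" .
qed

lemma energy_eq:
  assumes "t \<ge> 0"
  shows "energy s t = (LINT x|rh. B (F t x) (G t x)) + s * KI t"
proof -
  have "energy s t = (LINT x|rh. B (F t x) (G t x) + s * kk t x)"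
  proof (subst integral_rho)
    show "(\<lambda>x. B (F t x) (G t x) + s * kk t x) \<in> borel_measurable rh"
      by (intro borel_measurable_add measurable_BFG borel_measurable_times borel_measurable_const
          continuous_measurable_rho[OF cont_FG(3)])
  qed (simp add: energy_def en_def)
  also have "... = (LINT x|rh. B (F t x) (G t x)) + s * KI t"
    using integral_kk integrable_BFG[OF assms] by simp
  finally show ?thesis .
qed

text \<open>Let \<open>t\<close> tend to infinity in \<open>energy s t \<le> energy s 0\<close>:
  \<open>KI t\<close> vanishes and the Bellman part is nonnegative. The two choices
  \<open>s = \<kappa>\<close> and \<open>s = - \<kappa>\<close> produce the absolute value.\<close>

lemma bellman_bilinear: "\<kappa> * \<bar>KI 0\<bar> \<le> (LINT x|rh. B (F 0 x) (G 0 x))"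
proof -
  have KI_lim: "(KI \<longlongrightarrow> - (\<Sum>n=2..N. f n * g n * sqrt (mu n) / (4 * lam n) * 0)) at_top"
    unfolding KI_def
  proof (intro tendsto_intros)
    fix n assume "n \<in> {2..N}"
    hence "lam n > 0" using lam_pos by auto
    thus "((\<lambda>t. exp (- (2 * lam n * t))) \<longlongrightarrow> 0) at_top" by real_asymp
  qed
  have ge: "0 \<le> (LINT x|rh. B (F 0 x) (G 0 x)) + s * KI 0" if s: "\<bar>s\<bar> \<le> \<kappa>" for s
  proof (rule tendsto_upperbound)
    show "((\<lambda>t. s * KI t) \<longlongrightarrow> 0) at_top" using tendsto_mult[OF tendsto_const[of s] KI_lim] by simp
    show "\<forall>\<^sub>F t in at_top. s * KI t \<le> (LINT x|rh. B (F 0 x) (G 0 x)) + s * KI 0"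
      using eventually_ge_at_top[of 0]
    proof eventually_elim
      fix t :: real assume t: "0 \<le> t"
      have "0 \<le> (LINT x|rh. B (F t x) (G t x))" by (intro integral_nonneg_AE AE_I2 B_nonneg)
      thus "s * KI t \<le> (LINT x|rh. B (F 0 x) (G 0 x)) + s * KI 0"
        using energy_decreasing[OF s t] energy_eq[OF t, of s] energy_eq[of 0 s] by simp
    qed
  qed simp
  show ?thesis using ge[of \<kappa>] ge[of "- \<kappa>"] \<kappa>_nonneg by (auto simp: abs_if)
qed

lemma B_energy_decreasing:
  assumes "t \<ge> 0"
  shows "(LINT x|rh. B (F t x) (G t x)) \<le> (LINT x|rh. B (F 0 x) (G 0 x))"
  using energy_decreasing[of 0 t] energy_eq[OF assms, of 0] energy_eq[of 0 0] \<kappa>_nonneg assms by simp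


lemma bilinear: "\<kappa> * (\<bar>pairing f g N\<bar> / 4) \<le> (LINT x|rh. B (Fs f N x) (Gs g N x))"
proof -
  have "KI 0 = - (pairing f g N / 4)"
    unfolding KI_def pairing_def sum_divide_distrib by (simp add: mult_ac)
  thus ?thesis using bellman_bilinear by (simp add: F_0 G_0)
qed

lemmas B_contraction = B_energy_decreasing[unfolded F_0 G_0, unfolded F_eq G_eq]
lemmas integrable_B = integrable_BFG[of 0, unfolded F_0 G_0, OF order_refl]

lemma FG_props:
  "Fs f N \<in> borel_measurable rh" "\<exists>C. \<forall>x. 0 < x \<longrightarrow> x < 1 \<longrightarrow> \<bar>Fs f N x\<bar> \<le> C"
  "Gs g N \<in> borel_measurable rh" "\<exists>C. \<forall>x. 0 < x \<longrightarrow> x < 1 \<longrightarrow> \<bar>Gs g N x\<bar> \<le> C"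
  using continuous_measurable_rho[OF cont_FG(1)[of 0]] continuous_measurable_rho[OF cont_FG(2)[of 0]]
    F_bound[of 0] G_bound[of 0] by (auto simp: F_0 G_0)

end

section \<open>Removal of the regularisation: contractivity and the bilinear bound\<close>

context bessel
begin

lemma bellman_energyI: "bellman B B1 B2 H11 H12 H22 c ==> bellman_energy \<nu> B B1 B2 H11 H12 H22 c"
  by (rule bellman_energy.intro[OF bessel_axioms])

lemma Fs_Gs_props:
  "Fs f N \<in> borel_measurable rh" "\<exists>C. \<forall>x. 0 < x \<longrightarrow> x < 1 \<longrightarrow> \<bar>Fs f N x\<bar> \<le> C" "integrable rh (Fs f N)"
  "Gs f N \<in> borel_measurable rh" "\<exists>C. \<forall>x. 0 < x \<longrightarrow> x < 1 \<longrightarrow> \<bar>Gs f N x\<bar> \<le> C" "integrable rh (Gs f N)"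
  using bellman_energy.FG_props[OF bellman_energyI[OF bellman_abs[OF zero_less_one]]] integrable_rho_bounded
  by blast+

lemma sqrt_eps_bounds: "d > 0 ==> \<bar>a\<bar> \<le> sqrt (a^2 + d^2)" "d > 0 ==> sqrt (a^2 + d^2) \<le> \<bar>a\<bar> + d" for a d :: real
  using sqrt_sum_squares_le_sum_abs[of a d] by (auto simp: real_le_rsqrt)

text \<open>The assumption is what \<open>bellman_abs\<close> delivers. Replacing \<open>|u|\<close>
  by \<open>sqrt (u^2 + d^2)\<close> costs at most \<open>d\<close> times the total mass, which is
  finite.\<close>

lemma L1_le_if_sqrt_le:
  fixes u v :: "real \<Rightarrow> real"
  assumes i: "integrable rh u" "integrable rh v"
    and le: "\<And>d. d > 0 ==> (LINT x|rh. sqrt ((u x)^2 + d^2)) \<le> (LINT x|rh. sqrt ((v x)^2 + d^2))"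
  shows "(LINT x|rh. \<bar>u x\<bar>) \<le> (LINT x|rh. \<bar>v x\<bar>)"
proof (rule field_le_epsilon)
  interpret finite_measure rh by (rule finite_measure_rho)
  fix e :: real assume e: "e > 0"
  define M where "M = measure rh (space rh)"
  define d where "d = e / (M + 1)"
  have M: "M \<ge> 0" by (simp add: M_def)
  hence d: "d > 0" "d * M \<le> e" using e by (auto simp: d_def field_simps)
  have int: "integrable rh (\<lambda>x. sqrt ((u x)^2 + d^2))" if "integrable rh u" for u
  proof (rule bint_bound)
    show "integrable rh (\<lambda>x. \<bar>u x\<bar> + d)" using that by simp
    show "AE x in rh. norm (sqrt ((u x)^2 + d^2)) \<le> norm (\<bar>u x\<bar> + d)"
      using sqrt_eps_bounds(2)[OF d(1)] d(1) by simp
  qed (use that in measurable)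
  have "(LINT x|rh. \<bar>u x\<bar>) \<le> (LINT x|rh. sqrt ((u x)^2 + d^2))"
    using i int sqrt_eps_bounds(1)[OF d(1)] by (intro integral_mono) auto
  also have "... \<le> (LINT x|rh. sqrt ((v x)^2 + d^2))" by (rule le[OF d(1)])
  also have "... \<le> (LINT x|rh. \<bar>v x\<bar> + d)"
    using i int sqrt_eps_bounds(2)[OF d(1)] by (intro integral_mono) auto
  also have "... = (LINT x|rh. \<bar>v x\<bar>) + d * M" using i by (simp add: M_def)
  finally show "(LINT x|rh. \<bar>u x\<bar>) \<le> (LINT x|rh. \<bar>v x\<bar>) + e" using d by linarith
qed

lemma phi_contraction:
  assumes t: "t \<ge> 0"
  shows "(LINT x|rh. \<bar>\<Sum>n=1..N. exp (- t * lam n) * f n * phi n x\<bar>) \<le> (LINT x|rh. \<bar>\<Sum>n=1..N. f n * phi n x\<bar>)"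
proof -
  have "(LINT x|rh. \<bar>Fs (\<lambda>n. exp (- (lam n * t)) * f n) N x\<bar>) \<le> (LINT x|rh. \<bar>Fs f N x\<bar>)"
    by (intro L1_le_if_sqrt_le Fs_Gs_props bellman_energy.B_contraction[OF bellman_energyI[OF bellman_abs] t])
  thus ?thesis by (simp add: Fs_def mult_ac)
qed

lemma chi_contraction:
  assumes t: "t \<ge> 0"
  shows "(LINT x|rh. \<bar>\<Sum>n=2..N. exp (- t * lam n) * g n * chi n x\<bar>) \<le> (LINT x|rh. \<bar>\<Sum>n=2..N. g n * chi n x\<bar>)"
proof -
  have "(LINT x|rh. \<bar>Gs (\<lambda>n. exp (- (lam n * t)) * g n) N x\<bar>) \<le> (LINT x|rh. \<bar>Gs g N x\<bar>)"
    by (intro L1_le_if_sqrt_le Fs_Gs_props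
        bellman_energy.B_contraction[OF bellman_energyI[OF bellman_swap[OF bellman_abs]] t])
  thus ?thesis by (simp add: Gs_def mult_ac)
qed

lemma eps_limit:
  fixes u :: "real \<Rightarrow> real"
  assumes m: "u \<in> borel_measurable rh" and b: "\<And>x. 0 < x ==> x < 1 ==> \<bar>u x\<bar> \<le> C" and r: "r > 0"
  shows "(\<lambda>k. LINT x|rh. ((u x)^2 + (1 / real (Suc k))^2) powr (r / 2)) \<longlonglongrightarrow> (LINT x|rh. \<bar>u x\<bar> powr r)"
    and "d > 0 ==> integrable rh (\<lambda>x. ((u x)^2 + d^2) powr (r / 2))"
proof -
  interpret finite_measure rh by (rule finite_measure_rho)
  note [measurable] = m
  have le: "((u x)^2 + d^2) powr (r / 2) \<le> (C^2 + d^2) powr (r / 2)" if "0 < x" "x < 1" for x d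
  proof -
    have "(u x)^2 \<le> C^2" using power_mono[OF b[OF that], of 2] by simp
    thus ?thesis using r by (intro powr_mono2) auto
  qed
  show "integrable rh (\<lambda>x. ((u x)^2 + d^2) powr (r / 2))" if "d > 0" for d
    by (rule integrable_const_bound[of _ "(C^2 + d^2) powr (r / 2)"]) (use le in \<open>auto intro!: AE_I2\<close>)
  show "(\<lambda>k. LINT x|rh. ((u x)^2 + (1 / real (Suc k))^2) powr (r / 2)) \<longlonglongrightarrow> (LINT x|rh. \<bar>u x\<bar> powr r)"
  proof (rule integral_dominated_convergence[where w = "\<lambda>x. (C^2 + 1) powr (r / 2)"])
    show "AE x in rh. (\<lambda>k. ((u x)^2 + (1 / real (Suc k))^2) powr (r / 2)) \<longlonglongrightarrow> \<bar>u x\<bar> powr r"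
    proof (rule AE_I2)
      fix x
      have "(\<lambda>k. 1 / real (Suc k)) \<longlonglongrightarrow> 0" by real_asymp
      hence "(\<lambda>k. (u x)^2 + (1 / real (Suc k))^2) \<longlonglongrightarrow> (u x)^2 + 0^2" by (intro tendsto_intros)
      hence "(\<lambda>k. ((u x)^2 + (1 / real (Suc k))^2) powr (r / 2)) \<longlonglongrightarrow> ((u x)^2 + 0^2) powr (r / 2)"
        using r by (intro tendsto_powr' tendsto_const) auto
      moreover have "((u x)^2 + 0^2) powr (r / 2) = \<bar>u x\<bar> powr r"
      proof -
        have "(u x)^2 = \<bar>u x\<bar> powr 2" by simp
        thus ?thesis using powr_powr[of "\<bar>u x\<bar>" 2 "r / 2"] by simp
      qed
      ultimately show "(\<lambda>k. ((u x)^2 + (1 / real (Suc k))^2) powr (r / 2)) \<longlonglongrightarrow> \<bar>u x\<bar> powr r" by simp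
    qed
    show "AE x in rh. norm (((u x)^2 + (1 / real (Suc k))^2) powr (r / 2)) \<le> (C^2 + 1) powr (r / 2)" for k
    proof (rule AE_I2)
      fix x assume "x \<in> space rh"
      hence "((u x)^2 + (1 / real (Suc k))^2) powr (r / 2) \<le> (C^2 + (1 / real (Suc k))^2) powr (r / 2)" by (intro le) auto
      also have "... \<le> (C^2 + 1) powr (r / 2)"
        using r by (intro powr_mono2 add_left_mono) (auto simp: power_le_one)
      finally show "norm (((u x)^2 + (1 / real (Suc k))^2) powr (r / 2)) \<le> (C^2 + 1) powr (r / 2)" by simp
    qed
  qed auto
qed

text \<open>Here \<open>h d\<close> stands for the Bellman function with regularisation
  \<open>d\<close>, composed with \<open>u\<close> and \<open>v\<close>. The lower bound
  \<open>A\<close> is the same for all \<open>d\<close>, so only the upper bound has to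
  converge.\<close>

lemma regularised_limit:
  fixes u v :: "real \<Rightarrow> real"
  assumes u: "u \<in> borel_measurable rh" "\<exists>C. \<forall>x. 0 < x \<longrightarrow> x < 1 \<longrightarrow> \<bar>u x\<bar> \<le> C"
    and v: "v \<in> borel_measurable rh" "\<exists>C. \<forall>x. 0 < x \<longrightarrow> x < 1 \<longrightarrow> \<bar>v x\<bar> \<le> C"
    and P: "P > 0" "Q > 0" "a \<ge> 0" "b \<ge> 0"
    and h: "\<And>d. d > 0 ==> integrable rh (h d)" "\<And>d. d > 0 ==> A \<le> (LINT x|rh. h d x)"
      "\<And>d x. d > 0 ==> h d x \<le> a * ((u x)^2 + d^2) powr (P / 2) + b * ((v x)^2 + d^2) powr (Q / 2)"
  shows "A \<le> a * (LINT x|rh. \<bar>u x\<bar> powr P) + b * (LINT x|rh. \<bar>v x\<bar> powr Q)"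
proof (rule tendsto_lowerbound)
  obtain C1 where C1: "\<And>x. 0 < x ==> x < 1 ==> \<bar>u x\<bar> \<le> C1" using u by blast
  obtain C2 where C2: "\<And>x. 0 < x ==> x < 1 ==> \<bar>v x\<bar> \<le> C2" using v by blast
  note U = eps_limit[OF u(1) C1] and V = eps_limit[OF v(1) C2]
  show "(\<lambda>k. a * (LINT x|rh. ((u x)^2 + (1 / real (Suc k))^2) powr (P / 2)) + b * (LINT x|rh. ((v x)^2 + (1 / real (Suc k))^2) powr (Q / 2)))
      \<longlonglongrightarrow> a * (LINT x|rh. \<bar>u x\<bar> powr P) + b * (LINT x|rh. \<bar>v x\<bar> powr Q)"
    by (intro tendsto_add tendsto_mult tendsto_const U(1)[OF _ _ P(1)] V(1)[OF _ _ P(2)])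
  have "A \<le> a * (LINT x|rh. ((u x)^2 + d^2) powr (P / 2)) + b * (LINT x|rh. ((v x)^2 + d^2) powr (Q / 2))" if d: "d > 0" for d
  proof -
    have i: "integrable rh (\<lambda>x. ((u x)^2 + d^2) powr (P / 2))" "integrable rh (\<lambda>x. ((v x)^2 + d^2) powr (Q / 2))"
      using U(2)[OF _ _ P(1) d] V(2)[OF _ _ P(2) d] by auto
    have "A \<le> (LINT x|rh. a * ((u x)^2 + d^2) powr (P / 2) + b * ((v x)^2 + d^2) powr (Q / 2))"
      by (rule order_trans[OF h(2)[OF d]], rule integral_mono) (use h(1,3)[OF d] i in auto)
    thus ?thesis using i by simp
  qed
  thus "\<forall>\<^sub>F k in sequentially. A \<le> a * (LINT x|rh. ((u x)^2 + (1 / real (Suc k))^2) powr (P / 2))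
      + b * (LINT x|rh. ((v x)^2 + (1 / real (Suc k))^2) powr (Q / 2))" by simp
qed simp

text \<open>The factor of the pairing is \<open>\<kappa> / 4\<close> for
  \<open>c = (Q - 1)/4\<close>. The two estimates differ in which finite sum takes the exponent
  \<open>P \<ge> 2\<close>; the second uses the swapped Bellman function.\<close>

lemma bilinear_aux:
  assumes P: "P \<ge> 2" and Q: "1 < Q" "1 / P + 1 / Q = 1"
  shows "(Q - 1) / (8 * (1 + sqrt KK)) * \<bar>pairing f g N\<bar>
      \<le> 1/8 * (LINT x|rh. \<bar>Fs f N x\<bar> powr P) + 9/8 * (LINT x|rh. \<bar>Gs g N x\<bar> powr Q)" (is ?A)
    and "(Q - 1) / (8 * (1 + sqrt KK)) * \<bar>pairing f g N\<bar>
      \<le> 1/8 * (LINT x|rh. \<bar>Gs g N x\<bar> powr P) + 9/8 * (LINT x|rh. \<bar>Fs f N x\<bar> powr Q)" (is ?B)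
proof -
  have NT: "nazarov_treil P Q d" if "d > 0" for d by unfold_locales (use P Q that in auto)
  note nt = nazarov_treil.bellman_NT[OF NT]
  note E = bellman_energyI[OF nt] and E' = bellman_energyI[OF bellman_swap[OF nt]]
  let ?h = "nazarov_treil.B P Q"
  have le: "?h d a b \<le> 1/8 * (a^2 + d^2) powr (P / 2) + 9/8 * (b^2 + d^2) powr (Q / 2)" if "d > 0" for d a b
    using nazarov_treil.B_le[OF NT[OF that], of a b] NT[OF that]
    by (simp add: nazarov_treil.X_def nazarov_treil.Y_def nazarov_treil.UU_def)
  have alg: "(Q - 1) / (8 * k) * x = 2 * ((Q - 1) / 4) / k * (x / 4)" for k x :: real
    by (cases "k = 0") (simp_all add: field_simps)
  have A: "(Q - 1) / (8 * (1 + sqrt KK)) * \<bar>pairing f g N\<bar> \<le> (LINT x|rh. ?h d (Fs f N x) (Gs g N x))" if "d > 0" for d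
    using bellman_energy.bilinear[OF E[OF that]] unfolding alg bellman_energy.\<kappa>_def[OF E[OF that]] .
  have B: "(Q - 1) / (8 * (1 + sqrt KK)) * \<bar>pairing f g N\<bar> \<le> (LINT x|rh. ?h d (Gs g N x) (Fs f N x))" if "d > 0" for d
    using bellman_energy.bilinear[OF E'[OF that]] unfolding alg bellman_energy.\<kappa>_def[OF E'[OF that]] .
  show ?A
    by (rule regularised_limit[OF Fs_Gs_props(1,2,4,5) _ _ _ _ bellman_energy.integrable_B[OF E] A le]) (use P Q in auto)
  show ?B
    by (rule regularised_limit[OF Fs_Gs_props(4,5,1,2) _ _ _ _ bellman_energy.integrable_B[OF E'] B le]) (use P Q in auto)
qed

text \<open>For norms at most 1 the right-hand sides of \<open>bilinear_aux\<close> are at most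
  \<open>1/8 + 9/8\<close>, and \<open>1/(Q - 1) = P - 1\<close>. The larger of the two exponents
  plays the role of \<open>P\<close>.\<close>

lemma pairing_bound:
  assumes p: "p > 1" "q > 1" "1 / p + 1 / q = 1"
    and F: "LpN rh p (Fs f N) \<le> 1" and G: "LpN rh q (Gs g N) \<le> 1"
  shows "\<bar>pairing f g N\<bar> \<le> 10 * (1 + sqrt KK) * (max p q - 1)"
proof -
  have k: "1 + sqrt KK > 0" using KK_nonneg by (simp add: add_pos_nonneg)
  have F1: "(LINT x|rh. \<bar>Fs f N x\<bar> powr p) \<le> 1" using F p by (simp add: LpN_le_iff)
  have G1: "(LINT x|rh. \<bar>Gs g N x\<bar> powr q) \<le> 1" using G p by (simp add: LpN_le_iff)
  have conj: "P = 1 / (Q - 1) + 1" if "P > 1" "Q > 1" "1 / P + 1 / Q = 1" for P Q :: real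
    using that by (simp add: field_simps)
  have fin: "\<bar>pairing f g N\<bar> \<le> 10 * (1 + sqrt KK) * (P - 1)"
    if PQ: "P > 1" "Q > 1" "1 / P + 1 / Q = 1" and le: "(Q - 1) / (8 * (1 + sqrt KK)) * \<bar>pairing f g N\<bar> \<le> 10/8" for P Q :: real
  proof -
    have "\<bar>pairing f g N\<bar> * (Q - 1) \<le> 10 * (1 + sqrt KK)"
      using le k by (simp add: field_simps)
    hence "\<bar>pairing f g N\<bar> \<le> 10 * (1 + sqrt KK) * (1 / (Q - 1))"
      using PQ by (simp add: field_simps)
    thus ?thesis using conj[OF PQ] by simp
  qed
  show ?thesis
  proof (cases "p \<ge> 2")
    case True
    have "(q - 1) / (8 * (1 + sqrt KK)) * \<bar>pairing f g N\<bar> \<le> 10/8"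
      using bilinear_aux(1)[OF True p(2,3), of f g N] F1 G1 by linarith
    from fin[OF p this] have "\<bar>pairing f g N\<bar> \<le> 10 * (1 + sqrt KK) * (p - 1)" .
    also have "... \<le> 10 * (1 + sqrt KK) * (max p q - 1)" using k by (intro mult_left_mono) auto
    finally show ?thesis .
  next
    case False
    have q: "q \<ge> 2"
    proof -
      have "1 / p \<ge> 1/2" using False p by (simp add: field_simps)
      hence "1 / q \<le> 1/2" using p(3) by linarith
      thus ?thesis using p by (simp add: field_simps)
    qed
    have s: "1 / q + 1 / p = 1" using p(3) by simp
    have "(p - 1) / (8 * (1 + sqrt KK)) * \<bar>pairing f g N\<bar> \<le> 10/8"
      using bilinear_aux(2)[OF q p(1) s, of f g N] F1 G1 by linarith
    from fin[OF p(2,1) s this] have "\<bar>pairing f g N\<bar> \<le> 10 * (1 + sqrt KK) * (q - 1)" .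
    also have "... \<le> 10 * (1 + sqrt KK) * (max p q - 1)" using k by (intro mult_left_mono) auto
    finally show ?thesis .
  qed
qed


end

section \<open>Completeness of the Bessel functions\<close>

text \<open>The positive and the negative part of \<open>h\<close> are densities of finite measures
  that agree on all half-lines, so the measures coincide and the densities agree almost
  everywhere.\<close>

lemma AE_eq_0_if_tails_0:
  fixes h :: "real \<Rightarrow> real"
  assumes h: "integrable lborel h" and tail: "\<And>x. (LINT t|lborel. indicator {x<..} t * h t) = 0"
  shows "AE x in lborel. h x = 0"
proof -
  have [measurable]: "h \<in> borel_measurable borel" using h by auto
  have pos: "emeasure (density lborel (\<lambda>t. ennreal (max 0 (u t)))) {x<..} = ennreal (LINT t|lborel. indicator {x<..} t * max 0 (u t))"
    if "integrable lborel u" for u :: "real \<Rightarrow> real" and x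
  proof -
    have [measurable]: "u \<in> borel_measurable borel" using that by auto
    have "integrable lborel (\<lambda>t. indicator {x<..} t * max 0 (u t))"
      by (rule bint_bound[OF that]) (auto simp: indicator_def)
    hence "(\<integral>\<^sup>+t. ennreal (indicator {x<..} t * max 0 (u t)) \<partial>lborel) = ennreal (LINT t|lborel. indicator {x<..} t * max 0 (u t))"
      by (rule nn_integral_eq_integral) auto
    moreover have "ennreal (indicator {x<..} t * max 0 (u t)) = ennreal (max 0 (u t)) * indicator {x<..} t" for t
      by (simp add: indicator_def)
    ultimately show ?thesis by (subst emeasure_density) auto
  qed
  have nh: "integrable lborel (\<lambda>t. - h t)" using h by simp
  have "density lborel (\<lambda>t. ennreal (max 0 (h t))) = density lborel (\<lambda>t. ennreal (max 0 (- h t)))"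
  proof (rule measure_eqI_lessThan)
    fix x
    show "emeasure (density lborel (\<lambda>t. ennreal (max 0 (h t)))) {x<..} < \<infinity>" unfolding pos[OF h] by simp
    have i: "integrable lborel (\<lambda>t. indicator {x<..} t * max 0 (h t))" "integrable lborel (\<lambda>t. indicator {x<..} t * max 0 (- h t))"
      by (rule bint_bound[OF h], simp, force simp: indicator_def)+
    have "(LINT t|lborel. indicator {x<..} t * max 0 (h t)) - (LINT t|lborel. indicator {x<..} t * max 0 (- h t))
      = (LINT t|lborel. indicator {x<..} t * h t)"
      unfolding bint_diff[OF i, symmetric]
      by (intro bint_cong) (auto simp: indicator_def)
    thus "emeasure (density lborel (\<lambda>t. ennreal (max 0 (h t)))) {x<..} = emeasure (density lborel (\<lambda>t. ennreal (max 0 (- h t)))) {x<..}"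
      unfolding pos[OF h] pos[OF nh] tail by simp
  qed auto
  hence "AE t in lborel. ennreal (max 0 (h t)) = ennreal (max 0 (- h t))"
    by (intro sigma_finite_measure.density_unique[OF sigma_finite_lborel]) auto
  thus ?thesis
  proof eventually_elim
    fix t assume "ennreal (max 0 (h t)) = ennreal (max 0 (- h t))"
    hence "max 0 (h t) = max 0 (- h t)" by (simp add: ennreal_inj)
    thus "h t = 0" by (auto simp: max_def split: if_splits)
  qed
qed

lemma AE_lborel_ex:
  assumes "AE x in lborel. P x" "a < (b::real)"
  obtains x where "a < x" "x < b" "P x"
proof -
  have "\<exists>x\<in>{a<..<b}. P x"
  proof (rule ccontr)
    assume n: "\<not> ?thesis"
    have "AE x in lborel. \<not> x \<in> {a<..<b}" using assms(1) by eventually_elim (use n in blast)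
    hence "emeasure lborel {a<..<b} = 0" using AE_iff_null_sets[of "{a<..<b}" lborel] by (simp add: null_sets_def)
    thus False using assms(2) by simp
  qed
  thus ?thesis using that by auto
qed

text \<open>The indefinite integral is continuous, so vanishing at almost every end point means
  vanishing at all; then all tails of \<open>h\<close> cut down to \<open>(a, b)\<close>
  vanish.\<close>

lemma AE_eq_0_if_integrals_0:
  fixes h :: "real \<Rightarrow> real"
  assumes h: "integrable lborel h"
    and int: "AE x in lborel. a < x \<and> x < b \<longrightarrow> (LINT t|lborel. indicator {a<..<x} t * h t) = 0"
  shows "AE x in lborel. a < x \<and> x < b \<longrightarrow> h x = 0"
proof (cases "a < b")
  case True
  have J: "(LINT t|lborel. indicator {c<..<d} t * h t) = integral {c..d} h" and hk: "h integrable_on {c..d}" for c d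
  proof -
    have i: "set_integrable lborel S h" if "S \<in> sets borel" for S
      unfolding set_integrable_def by (rule bint_bound[OF h]) (use h that in \<open>auto simp: indicator_def\<close>)
    show "(LINT t|lborel. indicator {c<..<d} t * h t) = integral {c..d} h"
      using set_borel_integral_eq_integral(2)[OF i[of "{c<..<d}"]]
      by (simp add: set_lebesgue_integral_def integral_open_interval_real)
    show "h integrable_on {c..d}" using set_borel_integral_eq_integral(1)[OF i] by simp
  qed
  have T0: "integral {a..x} h = 0" if x: "a < x" "x \<le> b" for x
  proof (rule ccontr)
    assume "integral {a..x} h \<noteq> 0"
    then obtain d where d: "d > 0" "\<forall>y\<in>{a..b}. dist x y < d \<longrightarrow> integral {a..y} h \<noteq> 0"
      using continuous_on_avoid[OF indefinite_integral_continuous_1[OF hk[of a b]], of x 0] x by auto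
    hence "max a (x - d) < x" using x by simp
    from AE_lborel_ex[OF int this] show False using d(2) x unfolding J by (auto simp: dist_real_def)
  qed
  define k where "k t = indicator {a<..<b} t * h t" for t
  have "AE x in lborel. k x = 0"
  proof (rule AE_eq_0_if_tails_0)
    show "integrable lborel k" unfolding k_def by (rule bint_bound[OF h]) (use h in \<open>auto simp: indicator_def\<close>)
    fix x
    have "(LINT t|lborel. indicator {x<..} t * k t) = (LINT t|lborel. indicator {max a x<..<b} t * h t)"
      unfolding k_def by (intro bint_cong) (auto simp: indicator_def)
    also have "... = integral {max a x..b} h" by (rule J)
    also have "... = 0"
    proof -
      consider "x \<le> a" | "a < x" "x < b" | "b \<le> x" by linarith
      thus ?thesis
      proof cases
        case 2
        thus ?thesis using Henstock_Kurzweil_Integration.integral_combine[OF _ _ hk, of a x b] T0[of x] T0[of b] by simp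
      next
        case 3
        thus ?thesis using True by (cases "x = b") auto
      qed (use T0[of b] True in auto)
    qed
    finally show "(LINT t|lborel. indicator {x<..} t * k t) = 0" .
  qed
  thus ?thesis by eventually_elim (auto simp: k_def)
qed auto

section \<open>Lebesgue measure on the unit interval\<close>

abbreviation "lu \<equiv> restrict_space lborel {0<..<1::real}"

lemma finite_measure_lu: "finite_measure lu"
proof (rule finite_measureI)
  have "emeasure lu (space lu) = emeasure lborel {0<..<1::real}"
    by (simp add: emeasure_restrict_space space_restrict_space)
  thus "emeasure lu (space lu) \<noteq> \<infinity>" by simp
qed

interpretation lu: finite_measure lu by (rule finite_measure_lu)

lemma space_lu [simp]: "space lu = {0<..<1}" by (simp add: space_restrict_space)

lemma measure_lu: "measure lu (space lu) = 1"
  by (simp add: measure_restrict_space)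

lemma measurable_lu [measurable (raw)]: "f \<in> borel_measurable borel ==> f \<in> borel_measurable lu"
  by (rule measurable_restrict_space1) simp

lemma integral_lu: "(LINT x|lu. f x) = (LINT x|lborel. indicator {0<..<1} x * (f x :: real))"
  by (subst integral_restrict_space) auto

lemma integrable_lu: "integrable lu f \<longleftrightarrow> integrable lborel (\<lambda>x. indicator {0<..<1} x * (f x :: real))"
  by (subst integrable_restrict_space) auto

lemma AE_lu: "(AE x in lu. P x) \<longleftrightarrow> (AE x in lborel. 0 < x \<and> x < 1 \<longrightarrow> P x)"
  by (subst AE_restrict_space_iff) auto

lemma integrable_lu_bounded:
  assumes "f \<in> borel_measurable lu" "\<And>x. 0 < x ==> x < 1 ==> \<bar>f x\<bar> \<le> (C::real)"
  shows "integrable lu f"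
  by (rule lu.integrable_const_bound[of _ C]) (use assms in \<open>auto intro!: AE_I2\<close>)

lemma continuous_measurable_lu:
  fixes f :: "real \<Rightarrow> real"
  assumes "continuous_on {0<..<1} f"
  shows "f \<in> borel_measurable lu"
proof -
  have "f \<in> borel_measurable (restrict_space borel {0<..<1})"
    by (rule borel_measurable_continuous_on_restrict[OF assms])
  moreover have "sets lu = sets (restrict_space borel {0<..<1})" by (simp add: sets_restrict_space)
  ultimately show ?thesis using measurable_cong_sets[of lu "restrict_space borel {0<..<1}" borel borel] by blast
qed

lemma integral_lu_Icc:
  assumes k: "continuous_on {a..b} k" and ab: "0 \<le> a" "b \<le> 1"
    and S: "{a<..<b} \<subseteq> S" "S \<subseteq> {a..b}" and [measurable]: "S \<in> sets borel"
  shows "(LINT s|lu. indicator S s * (k s :: real)) = integral {a..b} k"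
proof -
  have i: "set_integrable lborel {a..b} k" by (rule borel_integrable_atLeastAtMost'[OF k])
  have m: "(\<lambda>x. indicator {a..b} x * k x) \<in> borel_measurable borel"
    using borel_measurable_continuous_on_indicator[OF _ k] by simp
  have eq: "indicator {0<..<1} s * (indicator S s * k s) = indicator ({0<..<1} \<inter> S) s * (indicator {a..b} s * k s)" for s
    using S by (auto simp: indicator_def)
  have "(LINT s|lu. indicator S s * k s) = (LINT s|lborel. indicator ({0<..<1} \<inter> S) s * (indicator {a..b} s * k s))"
    unfolding integral_lu eq ..
  also have "... = (LINT s|lborel. indicator {a..b} s * k s)"
  proof (rule integral_cong_AE)
    show "AE s in lborel. indicator ({0<..<1} \<inter> S) s * (indicator {a..b} s * k s) = indicator {a..b} s * k s"
      using AE_lborel_singleton[of a] AE_lborel_singleton[of b]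
    proof eventually_elim
      fix s assume "s \<noteq> a" "s \<noteq> b"
      thus "indicator ({0<..<1} \<inter> S) s * (indicator {a..b} s * k s) = indicator {a..b} s * k s"
        using S(1) ab by (cases "s \<in> {a<..<b}") (auto simp: indicator_def)
    qed
  qed (use m in measurable)
  also have "... = integral {a..b} k"
    using set_borel_integral_eq_integral(2)[OF i] by (simp add: set_lebesgue_integral_def)
  finally show ?thesis .
qed

lemma integral_lu_indicator_le:
  assumes "s \<le> t"
  shows "(LINT x|lu. indicator {s..<t} x) \<le> t - (s::real)"
proof -
  have "(LINT x|lu. indicator {s..<t} x) = (LINT x|lborel. indicator ({0<..<1} \<inter> {s..<t}) x :: real)"
    unfolding integral_lu by (simp add: indicator_inter_arith)
  also have "... = measure lborel ({0<..<1} \<inter> {s..<t})" by simp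
  also have "... \<le> measure lborel {s..<t}"
    using assms by (intro measure_mono_fmeasurable) (auto simp: fmeasurable_def emeasure_lborel_Ico)
  finally show ?thesis using assms by simp
qed

section \<open>The inverse of the Bessel operator\<close>

context bessel
begin

definition al :: real where "al = a0 / 2"
text \<open>The order of decay of \<open>TT u\<close> at 0. The cap \<open>1/2\<close> is the power
  that Cauchy--Schwarz gains in \<open>W_bound\<close>.\<close>

definition be :: real where "be = min al (1/2)"

lemma al_pos: "al > 0" and be_pos: "be > 0" and be_le: "be \<le> 1/2" and a0_al: "a0 = 2 * al"
  using a0 by (auto simp: al_def be_def)

text \<open>The inverse consists of two integrations, \<open>W\<close> from the left and
  \<open>V\<close> from the right. For continuous \<open>u\<close>, \<open>V\<close> solves
  \<open>- (x powr a0 * V')' = x powr al * u\<close> with \<open>V 1 = 0\<close>.\<close>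

definition W :: "(real \<Rightarrow> real) \<Rightarrow> real \<Rightarrow> real" where
  "W u s = (LINT x|lu. indicator {..<s} x * (x powr al * u x))"
definition kV :: "(real \<Rightarrow> real) \<Rightarrow> real \<Rightarrow> real" where "kV u s = s powr (- a0) * W u s"
definition V :: "(real \<Rightarrow> real) \<Rightarrow> real \<Rightarrow> real" where
  "V u x = (LINT s|lu. indicator {x<..} s * kV u s)"

text \<open>\<open>TT\<close> is the inverse of \<open>- d\<^sup>2/dx\<^sup>2 + (\<nu>\<^sup>2 - 1/4)/x\<^sup>2\<close> on \<open>L\<^sup>2(0,1)\<close> with the eigenfunctions
  \<open>x\<^sup>1\<^sup>/\<^sup>2 J\<^sub>\<nu>(\<lambda>\<^sub>n x)\<close>.\<close>

definition TT :: "(real \<Rightarrow> real) \<Rightarrow> real \<Rightarrow> real" where "TT u x = x powr al * V u x"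

lemma powr_al_L2: 
  assumes [measurable]: "A \<in> sets borel"
  shows "(\<lambda>x. indicator A x * x powr al) \<in> LpS lu 2"
proof (rule LpS_bounded[OF finite_measure_lu])
  show "AE x in lu. norm (indicator A x * x powr al) \<le> 1"
    using al_pos by (intro AE_I2) (auto simp: indicator_def intro: powr_le1)
qed auto

lemma W_integrable:
  assumes "u \<in> LpS lu 2" and [measurable]: "A \<in> sets borel"
  shows "integrable lu (\<lambda>x. indicator A x * (x powr al * u x))"
  using L2_inner_integrable[OF powr_al_L2[OF assms(2)] assms(1)] by (simp add: mult_ac)

lemma W_CS:
  assumes psi: "u \<in> LpS lu 2" and A[measurable]: "A \<in> sets borel"
  shows "\<bar>LINT x|lu. indicator A x * (x powr al * u x)\<bar> \<le> sqrt (LINT x|lu. indicator A x * x powr a0) * LpN lu 2 u"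
proof -
  have "\<bar>LINT x|lu. (indicator A x * x powr al) * u x\<bar> \<le> LpN lu 2 (\<lambda>x. indicator A x * x powr al) * LpN lu 2 u"
    by (rule L2_Cauchy_Schwarz[OF powr_al_L2[OF A] psi])
  moreover have "LpN lu 2 (\<lambda>x. indicator A x * x powr al) = sqrt (LINT x|lu. indicator A x * x powr a0)"
    unfolding LpN_2 by (rule arg_cong[where f = sqrt], rule bint_cong)
      (auto simp: power2_eq_square a0_al indicator_def simp flip: powr_add)
  ultimately show ?thesis by (simp add: mult_ac)
qed

lemma integrable_ind_powr [simp]:
  assumes [measurable]: "A \<in> sets borel"
  shows "integrable lu (\<lambda>x. indicator A x * x powr a0)"
  by (rule integrable_lu_bounded[of _ 1]) (use a0 in \<open>auto simp: indicator_def intro: powr_le1\<close>)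

lemma W_Hoelder:
  assumes psi: "u \<in> LpS lu 2" and st: "s \<le> t"
  shows "\<bar>W u t - W u s\<bar> \<le> sqrt (t - s) * LpN lu 2 u"
proof -
  have "W u t - W u s = (LINT x|lu. indicator {..<t} x * (x powr al * u x) - indicator {..<s} x * (x powr al * u x))"
    unfolding W_def by (intro bint_diff[symmetric] W_integrable psi) auto
  also have "... = (LINT x|lu. indicator {s..<t} x * (x powr al * u x))"
    using st by (intro bint_cong) (auto simp: indicator_def)
  finally have "\<bar>W u t - W u s\<bar> \<le> sqrt (LINT x|lu. indicator {s..<t} x * x powr a0) * LpN lu 2 u"
    using W_CS[OF psi, of "{s..<t}"] by simp
  also have "... \<le> sqrt (t - s) * LpN lu 2 u"
  proof (intro mult_right_mono real_sqrt_le_mono)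
    have "(LINT x|lu. indicator {s..<t} x * x powr a0) \<le> (LINT x|lu. indicator {s..<t} x)"
    proof (rule integral_mono)
      show "integrable lu (\<lambda>x. indicator {s..<t} x * x powr a0)" by (rule integrable_ind_powr) simp
      show "integrable lu (\<lambda>x. indicator {s..<t} x :: real)" by (rule integrable_lu_bounded[of _ 1]) (auto simp: indicator_def)
      show "indicator {s..<t} x * x powr a0 \<le> (indicator {s..<t} x :: real)" if "x \<in> space lu" for x
        using that powr_a0_le_1[of x] by (auto simp: indicator_def)
    qed
    also have "... \<le> t - s" by (rule integral_lu_indicator_le[OF st])
    finally show "(LINT x|lu. indicator {s..<t} x * x powr a0) \<le> t - s" .
  qed simp
  finally show ?thesis .
qed

lemma W_0 [simp]: "s \<le> 0 ==> W u s = 0"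
proof -
  assume "s \<le> 0"
  hence "W u s = (LINT x|lu. 0)" unfolding W_def
    by (intro bint_cong) (auto simp: indicator_def)
  thus ?thesis by simp
qed

lemma W_cont: "u \<in> LpS lu 2 ==> continuous_on UNIV (W u)"
proof (rule continuous_at_imp_continuous_on, rule ballI)
  fix s assume psi: "u \<in> LpS lu 2"
  show "isCont (W u) s"
    unfolding isCont_def
  proof (rule LIM_zero_cancel, rule Lim_null_comparison)
    show "\<forall>\<^sub>F t in at s. norm (W u t - W u s) \<le> sqrt \<bar>t - s\<bar> * LpN lu 2 u"
    proof (rule always_eventually, rule allI)
      fix t
      show "norm (W u t - W u s) \<le> sqrt \<bar>t - s\<bar> * LpN lu 2 u"
        using W_Hoelder[OF psi, of s t] W_Hoelder[OF psi, of t s] by (cases "s \<le> t") (auto simp: abs_minus_commute)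
    qed
    have "((\<lambda>t. sqrt \<bar>t - s\<bar> * LpN lu 2 u) \<longlongrightarrow> sqrt \<bar>s - s\<bar> * LpN lu 2 u) (at s)"
      by (intro tendsto_intros)
    thus "((\<lambda>t. sqrt \<bar>t - s\<bar> * LpN lu 2 u) \<longlongrightarrow> 0) (at s)" by simp
  qed
qed

lemma W_bound:
  assumes psi: "u \<in> LpS lu 2" and s: "0 < s"
  shows "\<bar>W u s\<bar> \<le> s powr (al + 1/2) * LpN lu 2 u"
proof -
  have "\<bar>W u s\<bar> \<le> sqrt (LINT x|lu. indicator {..<s} x * x powr a0) * LpN lu 2 u"
    unfolding W_def by (rule W_CS[OF psi]) simp
  also have "... \<le> sqrt (s powr a0 * s) * LpN lu 2 u"
  proof (intro mult_right_mono real_sqrt_le_mono)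
    have "(LINT x|lu. indicator {..<s} x * x powr a0) \<le> (LINT x|lu. s powr a0 * indicator {0..<s} x)"
    proof (rule integral_mono)
      show "integrable lu (\<lambda>x. indicator {..<s} x * x powr a0)" by (rule integrable_ind_powr) simp
      show "integrable lu (\<lambda>x. s powr a0 * indicator {0..<s} x :: real)" 
        by (rule integrable_lu_bounded[of _ "s powr a0"]) (auto simp: indicator_def)
      show "indicator {..<s} x * x powr a0 \<le> s powr a0 * indicator {0..<s} x" if "x \<in> space lu" for x
        using that a0 by (auto simp: indicator_def intro: powr_mono2)
    qed
    also have "... = s powr a0 * (LINT x|lu. indicator {0..<s} x)" by simp
    also have "... \<le> s powr a0 * (s - 0)" using s by (intro mult_left_mono integral_lu_indicator_le) auto
    finally show "(LINT x|lu. indicator {..<s} x * x powr a0) \<le> s powr a0 * s" by simp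
  qed simp
  also have "sqrt (s powr a0 * s) = s powr (al + 1/2)"
  proof -
    have "s powr a0 * s = s powr (a0 + 1)" using s by (simp add: powr_add)
    also have "sqrt ... = s powr ((a0 + 1) / 2)" using s by (simp add: powr_half_sqrt[symmetric] powr_powr)
    also have "(a0 + 1) / 2 = al + 1/2" by (simp add: al_def add_divide_distrib)
    finally show ?thesis .
  qed
  finally show ?thesis .
qed

lemma powr_aux:
  assumes "0 < x" "x \<le> s" "s < 1"
  shows "s powr (1/2 - al) \<le> x powr (be - al)"
proof (cases "al \<ge> 1/2")
  case True
  thus ?thesis using assms powr_mono2'[of "1/2 - al" x s] by (simp add: be_def)
next
  case False
  thus ?thesis using assms by (simp add: be_def powr_le1)
qed

lemma kV_bound:
  assumes psi: "u \<in> LpS lu 2" and s: "0 < x" "x \<le> s" "s < 1"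
  shows "\<bar>kV u s\<bar> \<le> x powr (be - al) * LpN lu 2 u"
proof -
  have "\<bar>kV u s\<bar> \<le> s powr (- a0) * (s powr (al + 1/2) * LpN lu 2 u)"
    unfolding kV_def abs_mult using W_bound[OF psi, of s] s by (intro mult_mono) auto
  also have "... = s powr (1/2 - al) * LpN lu 2 u"
    by (simp add: mult.assoc[symmetric] powr_add[symmetric] a0_al)
  also have "... \<le> x powr (be - al) * LpN lu 2 u"
    by (intro mult_right_mono powr_aux s) simp
  finally show ?thesis .
qed

lemma kV_cont:
  assumes "u \<in> LpS lu 2"
  shows "continuous_on {0<..} (kV u)"
  unfolding kV_def by (intro continuous_intros continuous_on_subset[OF W_cont[OF assms]]) auto

lemma kV_measurable [measurable]:
  assumes "u \<in> LpS lu 2"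
  shows "kV u \<in> borel_measurable borel"
proof -
  have "W u \<in> borel_measurable borel" by (rule borel_measurable_continuous_onI[OF W_cont[OF assms]])
  thus ?thesis unfolding kV_def[abs_def] by measurable
qed

lemma V_integrable:
  assumes psi: "u \<in> LpS lu 2" and x: "0 < x" and A[measurable]: "A \<in> sets borel"
  shows "integrable lu (\<lambda>s. indicator (A \<inter> {x<..}) s * kV u s)"
proof (rule integrable_lu_bounded[of _ "x powr (be - al) * LpN lu 2 u"])
  note [measurable] = kV_measurable[OF psi]
  show "(\<lambda>s. indicator (A \<inter> {x<..}) s * kV u s) \<in> borel_measurable lu" by measurable
  show "\<bar>indicator (A \<inter> {x<..}) s * kV u s\<bar> \<le> x powr (be - al) * LpN lu 2 u" if "0 < s" "s < 1" for s
    using kV_bound[OF psi x, of s] that by (auto simp: indicator_def)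
qed

lemma V_bound:
  assumes psi: "u \<in> LpS lu 2" and x: "0 < x" "x < 1"
  shows "\<bar>V u x\<bar> \<le> x powr (be - al) * LpN lu 2 u * (1 - x)"
proof -
  let ?C = "x powr (be - al) * LpN lu 2 u"
  have "\<bar>V u x\<bar> \<le> (LINT s|lu. \<bar>indicator {x<..} s * kV u s\<bar>)" unfolding V_def by (rule integral_abs_bound)
  also have "... \<le> (LINT s|lu. ?C * indicator {x..<1} s)"
  proof (rule integral_mono)
    show "integrable lu (\<lambda>s. \<bar>indicator {x<..} s * kV u s\<bar>)" using V_integrable[OF psi x(1), of UNIV] by simp
    show "integrable lu (\<lambda>s. ?C * indicator {x..<1} s)"
      by (rule integrable_lu_bounded[of _ ?C]) (auto simp: indicator_def)
    show "\<bar>indicator {x<..} s * kV u s\<bar> \<le> ?C * indicator {x..<1} s" if "s \<in> space lu" for s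
      using kV_bound[OF psi x(1), of s] that by (auto simp: indicator_def)
  qed
  also have "... = ?C * (LINT s|lu. indicator {x..<1} s)" by simp
  also have "... \<le> ?C * (1 - x)" using x by (intro mult_left_mono integral_lu_indicator_le) auto
  finally show ?thesis .
qed

lemma TT_bound:
  assumes psi: "u \<in> LpS lu 2" and x: "0 < x" "x < 1"
  shows "\<bar>TT u x\<bar> \<le> x powr be * (1 - x) * LpN lu 2 u" "\<bar>TT u x\<bar> \<le> LpN lu 2 u"
proof -
  have "\<bar>TT u x\<bar> \<le> x powr al * (x powr (be - al) * LpN lu 2 u * (1 - x))"
    unfolding TT_def abs_mult using V_bound[OF psi x] by (intro mult_mono) auto
  also have "... = x powr be * (1 - x) * LpN lu 2 u"
    by (simp add: mult.assoc[symmetric] powr_add[symmetric])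
  finally show 1: "\<bar>TT u x\<bar> \<le> x powr be * (1 - x) * LpN lu 2 u" .
  have "x powr be * (1 - x) * LpN lu 2 u \<le> 1 * 1 * LpN lu 2 u"
    using x be_pos by (intro mult_mono) (auto simp: powr_le1)
  thus "\<bar>TT u x\<bar> \<le> LpN lu 2 u" using 1 by simp
qed

lemma TT_ends [simp]: "TT u 0 = 0" "TT u 1 = 0"
proof -
  have "V u 1 = (LINT s|lu. 0)" unfolding V_def
    by (intro bint_cong) (auto simp: indicator_def)
  thus "TT u 1 = 0" by (simp add: TT_def)
qed (simp add: TT_def)

lemma V_deriv:
  assumes psi: "u \<in> LpS lu 2" and x: "0 < x" "x < 1"
  shows "DERIV (V u) x :> - kV u x"
proof -
  obtain c d where cd: "0 < c" "c < x" "x < d" "d < 1"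
    using x dense[of 0 x] dense[of x 1] by blast
  have k: "continuous_on {c..y} (kV u)" for y by (rule continuous_on_subset[OF kV_cont[OF psi]]) (use cd in auto)
  have eq: "V u y = V u c - integral {c..y} (kV u)" if y: "y \<in> {c..d}" for y
  proof -
    have "V u c - V u y = (LINT s|lu. indicator (UNIV \<inter> {c<..}) s * kV u s - indicator (UNIV \<inter> {y<..}) s * kV u s)"
      unfolding V_def using y cd
      by (subst bint_diff) (auto intro!: V_integrable[OF psi, of _ UNIV, simplified])
    also have "... = (LINT s|lu. indicator {c<..y} s * kV u s)"
      using y by (intro bint_cong) (auto simp: indicator_def)
    also have "... = integral {c..y} (kV u)" using y cd by (intro integral_lu_Icc k) auto
    finally show ?thesis by simp
  qed
  have "((\<lambda>y. integral {c..y} (kV u)) has_real_derivative kV u x) (at x within {c..d})"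
    by (rule integral_has_real_derivative[OF k]) (use cd in auto)
  hence "((\<lambda>y. V u c - integral {c..y} (kV u)) has_real_derivative - kV u x) (at x within {c..d})"
    by (auto intro!: derivative_eq_intros)
  hence "(V u has_real_derivative - kV u x) (at x within {c..d})"
  proof (rule has_field_derivative_transform_within[where d = 1])
    show "x \<in> {c..d}" using cd by simp
    show "V u c - integral {c..y} (kV u) = V u y" if "y \<in> {c..d}" for y by (rule eq[OF that, symmetric])
  qed simp
  thus ?thesis using cd by (simp add: at_within_Icc_at)
qed

lemma V_cont: "u \<in> LpS lu 2 ==> continuous_on {0<..<1} (V u)"
  by (intro continuous_at_imp_continuous_on ballI, rule DERIV_isCont, rule V_deriv) auto

lemma TT_cont_open: "u \<in> LpS lu 2 ==> continuous_on {0<..<1} (TT u)"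
  unfolding TT_def
  by (intro continuous_on_mult continuous_on_powr continuous_on_id continuous_on_const V_cont) auto

lemma TT_cont:
  assumes psi: "u \<in> LpS lu 2"
  shows "continuous_on {0..1} (TT u)"
  unfolding continuous_on_eq_continuous_within
proof
  fix x :: real assume x: "x \<in> {0..1}"
  let ?n = "LpN lu 2 u"
  have be0: "((\<lambda>y. y powr be) \<longlongrightarrow> 0 powr be) (at 0 within {0..1})"
    using be_pos by (intro tendsto_powr' tendsto_intros) (auto simp: eventually_at_filter)
  have le: "\<bar>TT u y\<bar> \<le> y powr be * (1 - y) * ?n" if "y \<in> {0..1}" for y
    using TT_bound(1)[OF psi, of y] that by (cases "y = 0 \<or> y = 1") auto
  show "continuous (at x within {0..1}) (TT u)"
  proof (cases "x = 0 \<or> x = 1")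
    case False
    hence xi: "x \<in> {0<..<1}" using x by auto
    hence "isCont (TT u) x" using TT_cont_open[OF psi] by (simp add: continuous_on_eq_continuous_at)
    thus ?thesis by (rule continuous_at_imp_continuous_at_within)
  next
    case True
    have "((\<lambda>y. y powr be * (1 - y) * ?n) \<longlongrightarrow> 0) (at x within {0..1})"
    proof (cases "x = 0")
      case True
      have "((\<lambda>y. y powr be * (1 - y) * ?n) \<longlongrightarrow> 0 powr be * (1 - 0) * ?n) (at 0 within {0..1})"
        by (rule tendsto_mult tendsto_diff tendsto_const tendsto_ident_at be0)+
      thus ?thesis using True by simp
    next
      case False
      hence "x = 1" using \<open>x = 0 \<or> x = 1\<close> by simp
      have "((\<lambda>y. y powr be * (1 - y) * ?n) \<longlongrightarrow> 1 powr be * (1 - 1) * ?n) (at 1 within {0..1})"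
        by (intro tendsto_intros) auto
      thus ?thesis using \<open>x = 1\<close> by simp
    qed
    hence "(TT u \<longlongrightarrow> 0) (at x within {0..1})"
    proof (rule Lim_null_comparison[rotated])
      show "\<forall>\<^sub>F y in at x within {0..1}. norm (TT u y) \<le> y powr be * (1 - y) * ?n"
        unfolding eventually_at_filter by (rule always_eventually) (use le in auto)
    qed
    moreover have "TT u x = 0" using True by auto
    ultimately show ?thesis by (simp add: continuous_within)
  qed
qed

lemma TT_L2: "u \<in> LpS lu 2 ==> TT u \<in> LpS lu 2" and TT_norm: "u \<in> LpS lu 2 ==> LpN lu 2 (TT u) \<le> LpN lu 2 u"
proof -
  assume psi: "u \<in> LpS lu 2"
  have m: "TT u \<in> borel_measurable lu" by (rule continuous_measurable_lu[OF TT_cont_open[OF psi]])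
  show "TT u \<in> LpS lu 2"
    by (rule LpS_bounded[OF finite_measure_lu m, of "LpN lu 2 u"]) (use TT_bound(2)[OF psi] in \<open>auto intro!: AE_I2\<close>)
  have c: "(\<lambda>x. LpN lu 2 u) \<in> LpS lu 2" by (rule LpS_bounded[OF finite_measure_lu, of _ "LpN lu 2 u"]) auto
  have "LpN lu 2 (TT u) \<le> LpN lu 2 (\<lambda>x. LpN lu 2 u)"
    by (rule LpS_mono(2)[OF c m]) (use TT_bound(2)[OF psi] in \<open>auto intro!: AE_I2\<close>)
  also have "... = LpN lu 2 u" unfolding LpN_2[of lu "\<lambda>x. LpN lu 2 u"] using measure_lu by simp
  finally show "LpN lu 2 (TT u) \<le> LpN lu 2 u" .
qed

text \<open>Fubini's theorem. The right-hand side exhibits \<open>TT\<close> as an operator times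
  its adjoint, the operator being \<open>u \<mapsto> s powr (- al) * W u s\<close>. Symmetry,
  positivity and injectivity are read off from it.\<close>

lemma TT_inner:
  assumes psi: "u \<in> LpS lu 2" and phi: "v \<in> LpS lu 2"
  shows "(LINT x|lu. TT u x * v x) = (LINT s|lu. s powr (- a0) * (W u s * W v s))"
proof -
  interpret P: pair_sigma_finite lu lu ..
  note [measurable] = kV_measurable[OF psi] LpS_measurable[OF phi]
  define h where "h = (\<lambda>x s. (if x < s then 1 else 0) * (kV u s * (x powr al * v x)))"
  have hm: "case_prod h \<in> borel_measurable (lu \<Otimes>\<^sub>M lu)"
  proof -
    have k: "kV u \<in> borel_measurable lu" by (rule measurable_lu[OF kV_measurable[OF psi]])
    have i: "(\<lambda>x. x) \<in> borel_measurable lu" and p: "(\<lambda>x. x powr al) \<in> borel_measurable lu" by (rule measurable_lu, simp)+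
    have p': "(\<lambda>x. x powr al * v x) \<in> borel_measurable lu" by (rule borel_measurable_times[OF p LpS_measurable[OF phi]])
    have c: "{z \<in> space (lu \<Otimes>\<^sub>M lu). fst z < snd z} \<in> sets (lu \<Otimes>\<^sub>M lu)"
      by (rule borel_measurable_less[OF measurable_compose[OF measurable_fst i] measurable_compose[OF measurable_snd i]])
    show ?thesis unfolding h_def split_beta'
      by (intro borel_measurable_times measurable_If borel_measurable_const c
        measurable_compose[OF measurable_fst p'] measurable_compose[OF measurable_snd k])
  qed
  have hb: "\<bar>h x s\<bar> \<le> LpN lu 2 u * \<bar>v x\<bar>" if "x \<in> space lu" "s \<in> space lu" for x s
  proof (cases "x < s")
    case True
    have "\<bar>h x s\<bar> = \<bar>kV u s\<bar> * x powr al * \<bar>v x\<bar>" using True by (simp add: h_def abs_mult)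
    also have "... \<le> (x powr (be - al) * LpN lu 2 u) * x powr al * \<bar>v x\<bar>"
      using kV_bound[OF psi, of x s] that True by (intro mult_right_mono) auto
    also have "... = (x powr (be - al) * x powr al) * (LpN lu 2 u * \<bar>v x\<bar>)" by (simp only: mult_ac)
    also have "... = x powr be * (LpN lu 2 u * \<bar>v x\<bar>)" by (simp flip: powr_add)
    also have "... \<le> 1 * (LpN lu 2 u * \<bar>v x\<bar>)" using that be_pos by (intro mult_right_mono) (auto simp: powr_le1)
    finally show ?thesis by simp
  qed (simp add: h_def)
  have phi1: "integrable lu v" using L1_le_L2(1)[OF finite_measure_lu phi] .
  have dom: "integrable (lu \<Otimes>\<^sub>M lu) (\<lambda>(x, s). LpN lu 2 u * \<bar>v x\<bar>)"
    by (rule P.Fubini_integrable) (use phi1 in auto)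
  have hint: "integrable (lu \<Otimes>\<^sub>M lu) (case_prod h)"
  proof (rule bint_bound[OF dom hm])
    show "AE z in lu \<Otimes>\<^sub>M lu. norm (case_prod h z) \<le> norm (case z of (x, s) \<Rightarrow> LpN lu 2 u * \<bar>v x\<bar>)"
    proof (rule AE_I2)
      fix z assume "z \<in> space (lu \<Otimes>\<^sub>M lu)"
      then obtain x s where z: "z = (x, s)" "x \<in> space lu" "s \<in> space lu" by (auto simp: space_pair_measure)
      show "norm (case_prod h z) \<le> norm (case z of (x, s) \<Rightarrow> LpN lu 2 u * \<bar>v x\<bar>)"
        using hb[OF z(2,3)] unfolding z(1) by simp
    qed
  qed
  have "(LINT x|lu. TT u x * v x) = (LINT x|lu. (LINT s|lu. h x s))"
  proof (rule bint_cong[OF refl])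
    fix x
    have "TT u x * v x = (LINT s|lu. (indicator {x<..} s * kV u s) * (x powr al * v x))"
      unfolding TT_def V_def by (subst integral_mult_left_zero) (simp add: mult_ac)
    also have "... = (LINT s|lu. h x s)"
      by (intro bint_cong) (auto simp: h_def indicator_def)
    finally show "TT u x * v x = (LINT s|lu. h x s)" .
  qed
  also have "... = (LINT s|lu. (LINT x|lu. h x s))" by (rule P.Fubini_integral[OF hint, symmetric])
  also have "... = (LINT s|lu. s powr (- a0) * (W u s * W v s))"
  proof (rule bint_cong[OF refl])
    fix s
    have "(LINT x|lu. h x s) = (LINT x|lu. kV u s * (indicator {..<s} x * (x powr al * v x)))"
      by (intro bint_cong) (auto simp: h_def indicator_def)
    also have "... = kV u s * W v s" by (simp add: W_def)
    finally show "(LINT x|lu. h x s) = s powr (- a0) * (W u s * W v s)" by (simp add: kV_def)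
  qed
  finally show ?thesis .
qed

lemma TT_symmetric:
  assumes "u \<in> LpS lu 2" "v \<in> LpS lu 2"
  shows "(LINT x|lu. TT u x * v x) = (LINT x|lu. u x * TT v x)"
proof -
  have "(LINT x|lu. u x * TT v x) = (LINT x|lu. TT v x * u x)" by (simp add: mult_ac)
  thus ?thesis using TT_inner[OF assms] TT_inner[OF assms(2,1)] by (simp add: mult_ac)
qed

lemma TT_positive:
  assumes "u \<in> LpS lu 2"
  shows "(LINT x|lu. TT u x * u x) \<ge> 0"
  unfolding TT_inner[OF assms assms] by (intro integral_nonneg_AE AE_I2) auto

text \<open>The quadratic form vanishes, hence \<open>W u = 0\<close> almost everywhere; so the
  integrals of \<open>x powr al * u\<close> over almost all initial intervals vanish.\<close>

lemma TT_injective: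
  assumes psi: "u \<in> LpS lu 2" and TT0: "AE x in lu. TT u x = 0"
  shows "AE x in lu. u x = 0"
proof -
  note [measurable] = kV_measurable[OF psi] LpS_measurable[OF psi] borel_measurable_continuous_onI[OF W_cont[OF psi]]
  have "(LINT x|lu. TT u x * u x) = (LINT x|lu. 0)"
    using LpS_measurable[OF TT_L2[OF psi]] TT0 by (intro integral_cong_AE) (auto elim: eventually_mono)
  hence I0: "(LINT s|lu. s powr (- a0) * (W u s * W u s)) = 0" unfolding TT_inner[OF psi psi] by simp
  have int: "integrable lu (\<lambda>s. s powr (- a0) * (W u s * W u s))"
  proof (rule integrable_lu_bounded[of _ "(LpN lu 2 u)^2"])
    fix s :: real assume s: "0 < s" "s < 1"
    have "\<bar>W u s\<bar> * \<bar>W u s\<bar> \<le> (s powr (al + 1/2) * LpN lu 2 u) * (s powr (al + 1/2) * LpN lu 2 u)"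
      using W_bound[OF psi s(1)] by (intro mult_mono) auto
    hence "s powr (- a0) * (\<bar>W u s\<bar> * \<bar>W u s\<bar>) \<le> s powr (- a0) * ((s powr (al + 1/2) * LpN lu 2 u) * (s powr (al + 1/2) * LpN lu 2 u))"
      by (intro mult_left_mono) auto
    also have "... = s powr (- a0 + (al + 1/2) + (al + 1/2)) * (LpN lu 2 u)^2"
      by (simp only: powr_add power2_eq_square mult_ac)
    also have "- a0 + (al + 1/2) + (al + 1/2) = 1" by (simp add: a0_al)
    also have "s powr 1 * (LpN lu 2 u)^2 \<le> 1 * (LpN lu 2 u)^2" using s by (intro mult_right_mono) auto
    finally show "\<bar>s powr (- a0) * (W u s * W u s)\<bar> \<le> (LpN lu 2 u)^2" by (simp add: abs_mult)
  qed measurable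
  have "AE s in lu. s powr (- a0) * (W u s * W u s) = 0"
    using integral_nonneg_eq_0_iff_AE[OF int] I0 by auto
  hence ae: "AE s in lborel. 0 < s \<and> s < 1 \<longrightarrow> W u s = 0"
    unfolding AE_lu by eventually_elim auto
  define h where "h = (\<lambda>x. indicator {0<..<1} x * (x powr al * u x))"
  have hint: "integrable lborel h"
    using W_integrable[OF psi, of UNIV] unfolding integrable_lu h_def by simp
  have W_h: "W u s = (LINT t|lborel. indicator {0<..<s} t * h t)" for s
    unfolding W_def integral_lu h_def by (intro bint_cong) (auto simp: indicator_def)
  have "AE x in lborel. 0 < x \<and> x < 1 \<longrightarrow> h x = 0"
    by (rule AE_eq_0_if_integrals_0[OF hint]) (use ae in \<open>simp add: W_h\<close>)
  thus ?thesis unfolding AE_lu by eventually_elim (auto simp: h_def)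
qed

end

text \<open>The increasing weighted energy at \<open>x\<close> is at most that at 1, where the
  Cauchy data vanish. Data are prescribed at 1 because the equation is singular at 0.\<close>

lemma bessel_ode_unique:
  fixes y y1 :: "real \<Rightarrow> real"
  assumes a: "a \<ge> 0" "z > 0" and x: "0 < x" "x < 1"
    and y: "\<And>x. 0 < x ==> x < 1 ==> DERIV y x :> y1 x"
    and y1: "\<And>x. 0 < x ==> x < 1 ==> DERIV y1 x :> - (a / x) * y1 x - z * y x"
    and cont: "continuous_on {x..1} y" "continuous_on {x..1} y1" and y_1: "y 1 = 0" "y1 1 = 0"
  shows "y x = 0"
proof -
  have "x powr (2 * a) * ((y1 x)^2 + z * (y x)^2) \<le> 1 powr (2 * a) * ((y1 1)^2 + z * (y 1)^2)"
    by (rule bessel_energy_increasing[OF a(1) _ _ _ y y1 cont]) (use a x in auto)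
  hence "(y1 x)^2 + z * (y x)^2 \<le> 0" using x by (simp add: y_1 mult_le_0_iff)
  hence "z * (y x)^2 \<le> 0" using zero_le_power2[of "y1 x"] by linarith
  thus ?thesis using a by (simp add: mult_le_0_iff)
qed

section \<open>Eigenfunctions and compactness of the inverse\<close>

context bessel
begin

definition eU :: "nat \<Rightarrow> real \<Rightarrow> real" where "eU n x = x powr al * U n x"

lemma eU_measurable [measurable]: "eU n \<in> borel_measurable borel"
proof -
  have "U n \<in> borel_measurable borel" by (rule borel_measurable_continuous_onI[OF continuous_on_U])
  thus ?thesis unfolding eU_def[abs_def] by measurable
qed

text \<open>Defined for every \<open>z\<close>: \<open>no_orth_eigenfunction\<close> tests a
  hypothetical eigenfunction against \<open>wU z\<close> before \<open>z\<close> is known to be some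
  \<open>(lam n)^2\<close>.\<close>

definition wU :: "real \<Rightarrow> real \<Rightarrow> real" where "wU z x = x powr al * reg_u z x"

lemma eU_eq_wU: "eU n = wU ((lam n)^2)"
  by (simp add: fun_eq_iff eU_def wU_def U_def reg_u_scale)

lemma wU_L2: "wU z \<in> LpS lu 2"
proof -
  have "bounded (reg_u z ` {0..1})" by (intro compact_imp_bounded compact_continuous_image continuous_on_reg_u compact_Icc)
  then obtain B where B: "\<forall>x\<in>{0..1}. norm (reg_u z x) \<le> B" unfolding bounded_iff by blast
  have [measurable]: "reg_u z \<in> borel_measurable borel" by (rule borel_measurable_continuous_onI[OF continuous_on_reg_u])
  show ?thesis
  proof (rule LpS_bounded[OF finite_measure_lu])
    show "AE x in lu. norm (wU z x) \<le> 1 * B"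
    proof (rule AE_I2)
      fix x assume x: "x \<in> space lu"
      have "x powr al * \<bar>reg_u z x\<bar> \<le> 1 * B" using B x al_pos by (intro mult_mono) (auto simp: powr_le1)
      thus "norm (wU z x) \<le> 1 * B" by (simp add: wU_def abs_mult)
    qed
  qed (auto simp: wU_def[abs_def] intro!: measurable_lu)
qed

lemma W_wU:
  assumes s: "0 < s" "s \<le> 1"
  shows "W (wU z) s = s powr a0 * reg_p z s"
proof -
  have cp: "continuous_on {0..t} (\<lambda>x. x powr a0)" for t by (rule continuous_on_powr_a0) auto
  have "W (wU z) s = (LINT x|lu. indicator {0<..<s} x * (x powr a0 * reg_u z x))"
    unfolding W_def wU_def by (rule bint_cong) (auto simp: indicator_def a0_al simp flip: powr_add)
  also have "... = integral {0..s} (\<lambda>x. x powr a0 * reg_u z x)"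
    by (rule integral_lu_Icc) (use s in \<open>auto intro!: continuous_on_mult cp continuous_intros\<close>)
  also have "... = s powr a0 * reg_p z s - 0 powr a0 * reg_p z 0"
  proof (rule integral_unique, rule fundamental_theorem_of_calculus_interior)
    show "continuous_on {0..s} (\<lambda>x. x powr a0 * reg_p z x)" by (intro continuous_on_mult cp continuous_intros)
    fix x assume x: "x \<in> {0<..<s}"
    have "DERIV (\<lambda>x. x powr a0 * reg_p z x) x :> a0 / x * x powr a0 * reg_p z x + (reg_u z x - a0 / x * reg_p z x) * x powr a0"
      using x by (intro DERIV_mult powr_a0_deriv reg_p_deriv') auto
    thus "((\<lambda>x. x powr a0 * reg_p z x) has_vector_derivative x powr a0 * reg_u z x) (at x)"
      by (simp add: has_real_derivative_iff_has_vector_derivative algebra_simps)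
  qed (use s in auto)
  finally show ?thesis by simp
qed

text \<open>The term with \<open>reg_u z 1\<close> measures the failure of the boundary condition at
  1; for \<open>z > 0\<close> it vanishes exactly when \<open>sqrt z\<close> is a zero of
  \<open>jj\<close>.\<close>

lemma TT_wU:
  assumes z: "z \<noteq> 0" and x: "0 < x" "x < 1"
  shows "TT (wU z) x = (wU z x - x powr al * reg_u z 1) / z"
proof -
  have "V (wU z) x = (LINT s|lu. indicator {x<..<1} s * reg_p z s)"
    unfolding V_def
  proof (rule bint_cong[OF refl])
    fix s assume "s \<in> space lu"
    hence s: "0 < s" "s < 1" by auto
    have "kV (wU z) s = (s powr (- a0) * s powr a0) * reg_p z s"
      unfolding kV_def W_wU[OF s(1) less_imp_le[OF s(2)]] by simp
    also have "s powr (- a0) * s powr a0 = 1" using s by (simp flip: powr_add)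
    finally show "indicator {x<..} s * kV (wU z) s = indicator {x<..<1} s * reg_p z s"
      using s by (auto simp: indicator_def)
  qed
  also have "... = integral {x..1} (reg_p z)"
    by (rule integral_lu_Icc) (use x in \<open>auto intro: continuous_on_reg_p\<close>)
  also have "... = - reg_u z 1 / z - (- reg_u z x / z)"
  proof (rule integral_unique, rule fundamental_theorem_of_calculus)
    fix s
    have "DERIV (\<lambda>s. - reg_u z s / z) s :> - (- z * reg_p z s) / z"
      by (intro DERIV_cdivide DERIV_minus reg_u_deriv)
    thus "((\<lambda>s. - reg_u z s / z) has_vector_derivative reg_p z s) (at s within {x..1})"
      using z by (simp add: has_real_derivative_iff_has_vector_derivative has_vector_derivative_at_within)
  qed (use x in auto)
  finally show ?thesis using z by (simp add: TT_def wU_def diff_divide_distrib right_diff_distrib)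
qed

lemma TT_eU: "n \<ge> 1 ==> 0 < x ==> x < 1 ==> TT (eU n) x = eU n x / (lam n)^2"
  using TT_wU[of "(lam n)^2" x] lam_pos[of n] by (simp add: eU_eq_wU reg_u_scale)

lemma eU_L2: "eU n \<in> LpS lu 2" unfolding eU_eq_wU by (rule wU_L2)

definition orth :: "(real \<Rightarrow> real) \<Rightarrow> bool" where
  "orth u \<longleftrightarrow> u \<in> LpS lu 2 \<and> (\<forall>n\<ge>1. (LINT x|lu. u x * eU n x) = 0)"

lemma orth_L2: "orth u ==> u \<in> LpS lu 2" by (simp add: orth_def)

lemma orth_TT:
  assumes "orth u"
  shows "orth (TT u)"
  unfolding orth_def
proof (intro conjI allI impI)
  show "TT u \<in> LpS lu 2" by (rule TT_L2[OF orth_L2[OF assms]])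
  fix n :: nat assume n: "1 \<le> n"
  have "(LINT x|lu. TT u x * eU n x) = (LINT x|lu. u x * TT (eU n) x)"
    by (rule TT_symmetric[OF orth_L2[OF assms] eU_L2])
  also have "... = (LINT x|lu. (u x * eU n x) / (lam n)^2)"
    by (rule bint_cong) (auto simp: TT_eU[OF n])
  also have "... = 0" using assms n by (simp add: orth_def)
  finally show "(LINT x|lu. TT u x * eU n x) = 0" .
qed

lemma TT_scale: "TT (\<lambda>x. c * u x) = (\<lambda>x. c * TT u x)"
proof -
  have W: "W (\<lambda>x. c * u x) s = c * W u s" for s
  proof -
    have "W (\<lambda>x. c * u x) s = (LINT x|lu. c * (indicator {..<s} x * (x powr al * u x)))"
      unfolding W_def by (simp only: mult_ac)
    thus ?thesis by (simp add: W_def)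
  qed
  have k: "kV (\<lambda>x. c * u x) s = c * kV u s" for s by (simp add: kV_def W)
  have V: "V (\<lambda>x. c * u x) s = c * V u s" for s
  proof -
    have "V (\<lambda>x. c * u x) s = (LINT x|lu. c * (indicator {s<..} x * kV u x))"
      unfolding V_def k by (simp only: mult_ac)
    thus ?thesis by (simp add: V_def)
  qed
  show ?thesis by (simp add: TT_def V fun_eq_iff)
qed

lemma TT_add:
  assumes psi: "u \<in> LpS lu 2" and phi: "v \<in> LpS lu 2" and x: "0 < x"
  shows "TT (\<lambda>x. u x + v x) x = TT u x + TT v x"
proof -
  have W: "W (\<lambda>x. u x + v x) s = W u s + W v s" for s
  proof -
    have "W (\<lambda>x. u x + v x) s = (LINT x|lu. indicator {..<s} x * (x powr al * u x) + indicator {..<s} x * (x powr al * v x))"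
      unfolding W_def by (simp only: distrib_left)
    thus ?thesis unfolding W_def
      using bint_add[OF W_integrable[OF psi] W_integrable[OF phi], of "{..<s}" "{..<s}"] by simp
  qed
  have k: "kV (\<lambda>x. u x + v x) s = kV u s + kV v s" for s by (simp add: kV_def W distrib_left)
  have "V (\<lambda>x. u x + v x) x = (LINT s|lu. indicator (UNIV \<inter> {x<..}) s * kV u s + indicator (UNIV \<inter> {x<..}) s * kV v s)"
    unfolding V_def k by (simp only: distrib_left Int_UNIV_left)
  also have "... = V u x + V v x"
    unfolding V_def
    by (subst bint_add[OF V_integrable[OF psi x] V_integrable[OF phi x]]) auto
  finally show ?thesis by (simp add: TT_def distrib_left)
qed

lemma TT_diff:
  assumes psi: "u \<in> LpS lu 2" and phi: "v \<in> LpS lu 2" and x: "0 < x"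
  shows "TT (\<lambda>x. u x - v x) x = TT u x - TT v x"
proof -
  have m: "(\<lambda>x. (-1) * v x) \<in> LpS lu 2" using LpS_uminus[OF phi] by simp
  show ?thesis using TT_add[OF psi m x] TT_scale[of "-1" v] by simp
qed

lemma TT_cong:
  assumes "u \<in> borel_measurable lu" "v \<in> borel_measurable lu" "AE x in lu. u x = v x"
  shows "TT u = TT v"
proof -
  note [measurable] = assms(1,2)
  have W: "W u s = W v s" for s unfolding W_def
  proof (rule integral_cong_AE)
    show "AE x in lu. indicator {..<s} x * (x powr al * u x) = indicator {..<s} x * (x powr al * v x)"
      using assms(3) by eventually_elim simp
  qed measurable
  show ?thesis unfolding TT_def V_def kV_def W ..
qed

lemma TT_contraction:
  assumes psi: "u \<in> LpS lu 2" and phi: "v \<in> LpS lu 2"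
  shows "LpD lu 2 (TT u) (TT v) \<le> LpD lu 2 u v"
proof -
  have d: "(\<lambda>x. u x - v x) \<in> LpS lu 2" by (rule LpS_diff[OF psi phi]) simp
  have "LpD lu 2 (TT u) (TT v) = LpN lu 2 (TT (\<lambda>x. u x - v x))"
    unfolding LpN_def by (rule arg_cong[where f = "\<lambda>I. I powr _"], rule bint_cong) (auto simp: TT_diff[OF psi phi])
  also have "... \<le> LpD lu 2 u v" by (rule TT_norm[OF d])
  finally show ?thesis .
qed

lemma TT_deriv:
  assumes psi: "u \<in> LpS lu 2" and x: "0 < x" "x < 1"
  shows "\<exists>d. DERIV (TT u) x :> d \<and> \<bar>d\<bar> \<le> (al + 1) * LpN lu 2 u * x powr (be - 1)"
proof (intro exI conjI)
  show "DERIV (TT u) x :> al * x powr (al - 1) * V u x + (- kV u x) * x powr al"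
    unfolding TT_def[abs_def]
    by (intro DERIV_mult V_deriv[OF psi] x has_real_derivative_powr)
  have "\<bar>al * x powr (al - 1) * V u x\<bar> \<le> al * x powr (al - 1) * (x powr (be - al) * LpN lu 2 u)"
  proof -
    have "\<bar>V u x\<bar> \<le> x powr (be - al) * LpN lu 2 u * (1 - x)" by (rule V_bound[OF psi x])
    also have "... \<le> x powr (be - al) * LpN lu 2 u * 1" using x by (intro mult_left_mono) auto
    finally show ?thesis using al_pos by (simp add: abs_mult mult_left_mono)
  qed
  also have "... = al * LpN lu 2 u * (x powr (al - 1) * x powr (be - al))" by (simp only: mult_ac)
  also have "x powr (al - 1) * x powr (be - al) = x powr (be - 1)" by (simp flip: powr_add)
  finally have 1: "\<bar>al * x powr (al - 1) * V u x\<bar> \<le> al * LpN lu 2 u * x powr (be - 1)" .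
  have "\<bar>x powr al * (- kV u x)\<bar> \<le> x powr al * (x powr (be - al) * LpN lu 2 u)"
    using kV_bound[OF psi x(1) order_refl x(2)] by (simp add: abs_mult mult_left_mono)
  also have "... = x powr be * LpN lu 2 u" by (simp add: mult.assoc[symmetric] powr_add[symmetric])
  also have "... \<le> x powr (be - 1) * LpN lu 2 u"
    using x by (intro mult_right_mono powr_mono') auto
  finally have 2: "\<bar>x powr al * (- kV u x)\<bar> \<le> x powr (be - 1) * LpN lu 2 u" .
  have "\<bar>al * x powr (al - 1) * V u x + (- kV u x) * x powr al\<bar>
      \<le> al * LpN lu 2 u * x powr (be - 1) + x powr (be - 1) * LpN lu 2 u"
    using 1 2 by (intro order_trans[OF abs_triangle_ineq] add_mono) (simp_all only: mult.commute)
  thus "\<bar>al * x powr (al - 1) * V u x + (- kV u x) * x powr al\<bar> \<le> (al + 1) * LpN lu 2 u * x powr (be - 1)"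
    by (simp add: algebra_simps)
qed

text \<open>By \<open>TT_deriv\<close> the constant times \<open>x powr be\<close>, plus or minus
  \<open>TT u x\<close>, is nondecreasing. The modulus of continuity is uniform on the unit ball,
  which is the compactness of \<open>TT\<close>.\<close>

lemma TT_equicontinuous:
  assumes psi: "u \<in> LpS lu 2" and x: "x \<in> {0..1}" "y \<in> {0..1}"
  shows "\<bar>TT u x - TT u y\<bar> \<le> (al + 1) / be * LpN lu 2 u * \<bar>x powr be - y powr be\<bar>"
proof -
  let ?C = "(al + 1) / be * LpN lu 2 u"
  have cp: "continuous_on {a..b} (\<lambda>x. x powr be)" if "0 \<le> a" for a b :: real
    by (rule continuous_on_powr') (use that be_pos in \<open>auto intro: continuous_intros\<close>)
  have *: "\<bar>TT u x - TT u y\<bar> \<le> ?C * (y powr be - x powr be)" if xy: "0 \<le> x" "x \<le> y" "y \<le> 1" for x y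
  proof -
    have cT: "continuous_on {x..y} (TT u)" by (rule continuous_on_subset[OF TT_cont[OF psi]]) (use xy in auto)
    have m: "?C * x powr be + s * TT u x \<le> ?C * y powr be + s * TT u y" if s: "\<bar>s\<bar> = 1" for s :: real
    proof (rule DERIV_nonneg_imp_increasing_open[OF xy(2), of "\<lambda>x. ?C * x powr be + s * TT u x"])
      show "continuous_on {x..y} (\<lambda>x. ?C * x powr be + s * TT u x)"
        by (intro continuous_on_add continuous_on_mult continuous_on_const cp cT xy)
      fix t assume t: "x < t" "t < y"
      obtain d where d: "DERIV (TT u) t :> d" "\<bar>d\<bar> \<le> (al + 1) * LpN lu 2 u * t powr (be - 1)"
        using TT_deriv[OF psi, of t] t xy by auto
      show "\<exists>D. DERIV (\<lambda>x. ?C * x powr be + s * TT u x) t :> D \<and> 0 \<le> D"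
      proof (intro exI conjI)
        show "DERIV (\<lambda>x. ?C * x powr be + s * TT u x) t :> ?C * (be * t powr (be - 1)) + s * d"
          using t xy by (intro DERIV_add DERIV_cmult d(1) has_real_derivative_powr) auto
        have "?C * (be * t powr (be - 1)) = (al + 1) * LpN lu 2 u * t powr (be - 1)" using be_pos by simp
        moreover have "\<bar>s * d\<bar> \<le> (al + 1) * LpN lu 2 u * t powr (be - 1)" using d(2) s by (simp add: abs_mult)
        ultimately show "0 \<le> ?C * (be * t powr (be - 1)) + s * d" by linarith
      qed
    qed
    have "?C * x powr be + TT u x \<le> ?C * y powr be + TT u y" "?C * x powr be - TT u x \<le> ?C * y powr be - TT u y"
      using m[of 1] m[of "-1"] by simp_all
    thus ?thesis unfolding right_diff_distrib by linarith
  qed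
  show ?thesis
  proof (cases "x \<le> y")
    case True
    have "x powr be \<le> y powr be" using True x be_pos by (intro powr_mono2) auto
    thus ?thesis using *[OF _ True] x by simp
  next
    case False
    have "y powr be \<le> x powr be" using False x be_pos by (intro powr_mono2) auto
    thus ?thesis using *[of y x] False x by (simp add: abs_minus_commute)
  qed
qed

end

lemma LpN_2_squared: "(LpN M 2 (f :: 'a \<Rightarrow> real))^2 = (LINT x|M. f x * f x)"
  by (simp add: LpN_2 power2_eq_square)

context bessel
begin

lemma W_deriv:
  assumes psi: "continuous_on {0..1} u" and x: "0 < x" "x < 1"
  shows "DERIV (W u) x :> x powr al * u x"
proof -
  have c: "continuous_on {0..1} (\<lambda>x. x powr al * u x)"
    by (intro continuous_on_mult psi continuous_on_powr' continuous_on_id continuous_on_const) (use al_pos in auto)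
  have eq: "integral {0..s} (\<lambda>x. x powr al * u x) = W u s" if s: "s \<in> {0..1}" for s
  proof -
    have "W u s = (LINT x|lu. indicator {0<..<s} x * (x powr al * u x))"
      unfolding W_def by (rule bint_cong) (auto simp: indicator_def)
    also have "... = integral {0..s} (\<lambda>x. x powr al * u x)"
      by (rule integral_lu_Icc[OF continuous_on_subset[OF c]]) (use s in auto)
    finally show ?thesis by simp
  qed
  have "((\<lambda>s. integral {0..s} (\<lambda>x. x powr al * u x)) has_real_derivative x powr al * u x) (at x within {0..1})"
    by (rule integral_has_real_derivative[OF c]) (use x in auto)
  hence "(W u has_real_derivative x powr al * u x) (at x within {0..1})"
    by (rule has_field_derivative_transform_within[where d = 1]) (use x eq in auto)
  thus ?thesis using x by (simp add: at_within_Icc_at)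
qed

text \<open>For \<open>G = TT y\<close> the function \<open>V G\<close> solves the Bessel equation
  with \<open>z = 1/r\<close> and vanishes at 1. It is matched at 1 with a multiple
  \<open>c * reg_u z\<close>, so by uniqueness \<open>G\<close> is zero or a multiple of some
  \<open>eU n\<close>; orthogonality to \<open>eU n\<close> leaves only zero.\<close>

lemma no_orth_eigenfunction:
  assumes y: "orth y" and r: "r > 0" and eig: "AE x in lu. TT y x = r * y x"
  shows "AE x in lu. y x = 0"
proof -
  define G where "G = TT y"
  have G: "orth G" unfolding G_def by (rule orth_TT[OF y])
  note GL = orth_L2[OF G]
  have ym: "(\<lambda>x. r * y x) \<in> borel_measurable lu" using LpS_measurable[OF orth_L2[OF y]] by simp
  have TG: "TT G = (\<lambda>x. r * G x)"
    using TT_cong[OF LpS_measurable[OF GL] ym] eig unfolding G_def TT_scale by simp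
  have Gc: "continuous_on {0..1} G" unfolding G_def by (rule TT_cont[OF orth_L2[OF y]])
  let ?Y = "V G" and ?Y1 = "\<lambda>x. - kV G x"
  have GY: "G x = x powr al * ?Y x / r" for x using fun_cong[OF TG, of x] r by (simp add: TT_def field_simps)
  define z where "z = 1 / r"
  have z: "z > 0" using r by (simp add: z_def)
  have Yd: "DERIV ?Y x :> ?Y1 x" if "0 < x" "x < 1" for x by (rule V_deriv[OF GL that])
  have Y1d: "DERIV ?Y1 x :> - (a0 / x) * ?Y1 x - z * ?Y x" if x: "0 < x" "x < 1" for x
  proof -
    have "DERIV (kV G) x :> - a0 * x powr (- a0 - 1) * W G x + x powr al * G x * x powr (- a0)"
      unfolding kV_def[abs_def] by (intro DERIV_mult has_real_derivative_powr W_deriv[OF Gc x] x)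
    hence "DERIV ?Y1 x :> - (- a0 * x powr (- a0 - 1) * W G x + x powr al * G x * x powr (- a0))"
      by (rule DERIV_minus)
    moreover have "x powr al * G x * x powr (- a0) = z * ?Y x"
    proof -
      have "x powr al * G x * x powr (- a0) = (x powr al * x powr al * x powr (- a0)) * (z * ?Y x)"
        unfolding GY[of x] by (simp add: z_def)
      also have "x powr al * x powr al * x powr (- a0) = 1" using x by (simp add: a0_al flip: powr_add)
      finally show ?thesis by simp
    qed
    moreover have "- a0 * x powr (- a0 - 1) * W G x = (a0 / x) * ?Y1 x" using x by (simp add: kV_def powr_diff)
    ultimately show ?thesis by (simp add: algebra_simps)
  qed
  have zn: "z \<noteq> 0" using z by simp
  \<comment> \<open>Pairing \<open>TT (wU z)\<close> with \<open>G\<close> in two ways: symmetry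
    gives \<open>r\<close> times the inner product of \<open>wU z\<close> and \<open>G\<close>, and
    \<open>TT_wU\<close> gives the same plus a boundary term, which must therefore vanish.\<close>
  have 0: "reg_u z 1 * W G 1 = 0"
  proof -
    have WG: "W G 1 = (LINT x|lu. x powr al * G x)"
      unfolding W_def by (rule bint_cong) (auto simp: indicator_def)
    have i: "integrable lu (\<lambda>x. wU z x * G x)" "integrable lu (\<lambda>x. x powr al * G x)"
      using L2_inner_integrable[OF wU_L2 GL] W_integrable[OF GL, of UNIV] by auto
    have "r * (LINT x|lu. wU z x * G x) = (LINT x|lu. TT (wU z) x * G x)"
      unfolding TT_symmetric[OF wU_L2 GL] TG by (simp add: mult.left_commute)
    also have "... = (LINT x|lu. r * (wU z x * G x) - r * reg_u z 1 * (x powr al * G x))"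
    proof (rule bint_cong[OF refl])
      fix x assume "x \<in> space lu"
      hence e: "TT (wU z) x = r * (wU z x - x powr al * reg_u z 1)" using TT_wU[OF zn, of x] by (simp add: z_def)
      show "TT (wU z) x * G x = r * (wU z x * G x) - r * reg_u z 1 * (x powr al * G x)"
        unfolding e by (simp add: algebra_simps)
    qed
    also have "... = r * (LINT x|lu. wU z x * G x) - r * reg_u z 1 * W G 1"
      unfolding WG using i by simp
    finally show ?thesis using r by simp
  qed
  let ?u = "reg_u z" and ?u1 = "\<lambda>x. - z * reg_p z x"
  have zero: "\<exists>n\<ge>1. sqrt z = lam n" if "?u 1 = 0"
    using jj_zero_is_lam[of "sqrt z"] reg_u_scale[of "sqrt z" 1] that z by (metis mult_1_right real_sqrt_gt_0_iff real_sqrt_pow2 less_imp_le)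
  \<comment> \<open>If \<open>W G 1 = 0\<close> the data at 1 vanish and \<open>c = 0\<close>
    matches them. Otherwise \<open>reg_u z 1 = 0\<close>, so \<open>sqrt z\<close> is a zero and
    division by \<open>reg_p z 1\<close> is possible.\<close>
  obtain c where c: "c * ?u 1 = 0" "- W G 1 = c * ?u1 1"
  proof (cases "W G 1 = 0")
    case False
    hence u: "?u 1 = 0" using 0 by simp
    then obtain n where n: "n \<ge> 1" "sqrt z = lam n" using zero by blast
    have "sqrt z * reg_p z 1 = jp (sqrt z)" using reg_p_scale[of "sqrt z" 1] z by simp
    hence "reg_p z 1 \<noteq> 0" using jp_lam_nz[OF n(1)] n(2) by auto
    thus ?thesis using that[of "W G 1 / (z * reg_p z 1)"] u zn by simp
  qed (use that[of 0] in simp)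
  have D: "?Y x - c * ?u x = 0" if x: "0 < x" "x < 1" for x
  proof (rule bessel_ode_unique[where y = "\<lambda>x. ?Y x - c * ?u x" and x = x and a = a0 and z = z and ?y1.0 = "\<lambda>x. ?Y1 x - c * ?u1 x"])
    show "DERIV (\<lambda>x. ?Y x - c * ?u x) x :> ?Y1 x - c * ?u1 x" if "0 < x" "x < 1" for x
      by (intro DERIV_diff DERIV_cmult Yd reg_u_deriv that)
    show "DERIV (\<lambda>x. ?Y1 x - c * ?u1 x) x :> - (a0 / x) * (?Y1 x - c * ?u1 x) - z * (?Y x - c * ?u x)"
      if "0 < x" "x < 1" for x
    proof -
      have "DERIV (\<lambda>x. ?Y1 x - c * ?u1 x) x :> (- (a0 / x) * ?Y1 x - z * ?Y x) - c * (- z * (?u x - a0 / x * reg_p z x))"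
        using that by (intro DERIV_diff DERIV_cmult Y1d reg_p_deriv') auto
      thus ?thesis by (simp add: algebra_simps)
    qed
    have cT: "continuous_on {x..1} (\<lambda>y. y powr (- al) * TT G y)"
      by (intro continuous_on_mult continuous_on_powr continuous_on_id continuous_on_const continuous_on_subset[OF TT_cont[OF GL]])
         (use x in auto)
    have "y powr (- al) * TT G y = ?Y y" if "y \<in> {x..1}" for y
      using that x by (simp add: TT_def mult.assoc[symmetric] flip: powr_add)
    hence "continuous_on {x..1} ?Y" by (rule continuous_on_eq[OF cT])
    thus "continuous_on {x..1} (\<lambda>x. ?Y x - c * ?u x)"
      by (intro continuous_on_diff continuous_on_mult continuous_on_const continuous_on_reg_u)
    show "continuous_on {x..1} (\<lambda>x. ?Y1 x - c * ?u1 x)"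
      using x by (intro continuous_intros continuous_on_subset[OF kV_cont[OF GL]]) auto
    show "?Y 1 - c * ?u 1 = 0" using c TT_ends(2)[of G] by (simp add: TT_def)
    show "?Y1 1 - c * ?u1 1 = 0" using c by (simp add: kV_def)
  qed (use a0 z x in auto)
  have "AE x in lu. G x = 0"
  proof (cases "c = 0")
    case True
    thus ?thesis using D GY by (intro AE_I2) auto
  next
    case False
    then obtain n where n: "n \<ge> 1" "sqrt z = lam n" using zero c by auto
    have uU: "?u x = U n x" for x
    proof -
      have "z = (sqrt z)^2" using z by simp
      hence "z = (lam n)^2" unfolding n(2) .
      thus ?thesis using reg_u_scale[of "lam n" x] by (simp add: U_def)
    qed
    have GU: "G x = c / r * eU n x" if "0 < x" "x < 1" for x
    proof -
      have "?Y x = c * U n x" using D[OF that] by (simp add: uU)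
      thus ?thesis using GY[of x] by (simp add: eU_def)
    qed
    have "(LINT x|lu. G x * G x) = (LINT x|lu. c / r * (G x * eU n x))"
      by (rule bint_cong[OF refl]) (use GU in auto)
    also have "... = c / r * (LINT x|lu. G x * eU n x)" by (rule integral_mult_right_zero)
    also have "... = 0" using G n by (simp add: orth_def)
    finally have "LpN lu 2 G = 0" using LpN_2_squared[of lu G] by simp
    thus ?thesis using LpN_eq_0_iff[OF GL] by simp
  qed
  thus ?thesis unfolding G_def by (rule TT_injective[OF orth_L2[OF y]])
qed


lemma orth_lincomb:
  assumes f: "orth f" and g: "orth g"
  shows "orth (\<lambda>x. f x + c * g x)"
  unfolding orth_def
proof (intro conjI allI impI)
  have cg: "(\<lambda>x. c * g x) \<in> LpS lu 2"
    by (rule LpS_scale[OF orth_L2[OF g], of _ "\<bar>c\<bar>"]) (use LpS_measurable[OF orth_L2[OF g]] in \<open>auto simp: abs_mult\<close>)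
  show "(\<lambda>x. f x + c * g x) \<in> LpS lu 2" by (rule LpS_add[OF orth_L2[OF f] cg]) simp
  fix n :: nat assume n: "n \<ge> 1"
  have "(LINT x|lu. (f x + c * g x) * eU n x) = (LINT x|lu. f x * eU n x + c * (g x * eU n x))"
    by (simp add: algebra_simps)
  also have "... = (LINT x|lu. f x * eU n x) + (LINT x|lu. c * (g x * eU n x))"
    by (intro bint_add integrable_mult_right L2_inner_integrable eU_L2 orth_L2 f g)
  finally show "(LINT x|lu. (f x + c * g x) * eU n x) = 0"
    using f g n by (simp add: orth_def)
qed

lemma orth_zero: "orth (\<lambda>x. 0)" by (simp add: orth_def)

lemma orth_scale: "orth g ==> orth (\<lambda>x. c * g x)"
  using orth_lincomb[OF orth_zero, of g c] by simp

text \<open>Maximising \<open>\<parallel>TT f\<parallel> / \<parallel>f\<parallel>\<close> over the orthogonal complement of the \<open>eU n\<close> produces an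
  eigenfunction there.\<close>

lemma orth_imp_zero:
  assumes psi: "orth u"
  shows "AE x in lu. u x = 0"
proof (rule ccontr)
  assume nz: "\<not> (AE x in lu. u x = 0)"
  define N where "N f = LpN lu 2 f" for f :: "real \<Rightarrow> real"
  have N_scale: "N (\<lambda>x. c * f x) = \<bar>c\<bar> * N f" for c f
    unfolding N_def by (rule LpN_scale) (auto simp: abs_mult)
  have N_pos: "N f > 0" if "orth f" "\<not> (AE x in lu. f x = 0)" for f
    using that LpN_eq_0_iff[OF orth_L2[OF that(1)]] LpN_nonneg[of lu 2 f] unfolding N_def by (metis less_eq_real_def zero_less_numeral)
  define S where "S = {N (TT f) | f. orth f \<and> N f = 1}"
  have S_le: "s \<le> 1" if "s \<in> S" for s
  proof -
    obtain f where "s = N (TT f)" "orth f" "N f = 1" using \<open>s \<in> S\<close> by (auto simp: S_def)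
    thus ?thesis using TT_norm[OF orth_L2[of f]] by (simp add: N_def)
  qed
  hence bdd: "bdd_above S" by (meson bdd_above_def)
  define r where "r = Sup S"
  have unit: "\<exists>c>0. orth (\<lambda>x. c * f x) \<and> N (\<lambda>x. c * f x) = 1 \<and> c * N f = 1" if "orth f" "N f > 0" for f
  proof (intro exI[of _ "1 / N f"] conjI)
    show "orth (\<lambda>x. 1 / N f * f x)" by (rule orth_scale[OF that(1)])
    show "N (\<lambda>x. 1 / N f * f x) = 1" unfolding N_scale using that by simp
  qed (use that in auto)
  have S_ub: "N (TT f) \<le> r * N f" if f: "orth f" "N f > 0" for f
  proof -
    obtain c where c: "c > 0" "orth (\<lambda>x. c * f x)" "N (\<lambda>x. c * f x) = 1" "c * N f = 1" using unit[OF f] by blast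
    have "c * N (TT f) \<in> S" unfolding S_def using c by (auto intro!: exI[of _ "\<lambda>x. c * f x"] simp: TT_scale N_scale)
    hence "c * N (TT f) \<le> r" unfolding r_def by (rule cSup_upper[OF _ bdd])
    hence "N f * (c * N (TT f)) \<le> N f * r" using f by (intro mult_left_mono) auto
    thus ?thesis using c(4) by (simp add: mult.assoc[symmetric] mult.commute[of "N f"])
  qed
  have TT_nz: "N (TT f) > 0" if "orth f" "N f > 0" for f
    using that N_pos[OF orth_TT[OF that(1)]] TT_injective[OF orth_L2[OF that(1)]] LpN_eq_0_iff[OF orth_L2[OF that(1)]]
    unfolding N_def by force
  have psiN: "N u > 0" by (rule N_pos[OF psi nz])
  have r: "r > 0"
    using S_ub[OF psi psiN] TT_nz[OF psi psiN] psiN by (meson less_le_trans zero_less_mult_pos2)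
  obtain c where "orth (\<lambda>x. c * u x)" "N (\<lambda>x. c * u x) = 1" using unit[OF psi psiN] by blast
  hence ne: "S \<noteq> {}" unfolding S_def by blast
  have "\<exists>f. orth f \<and> N f = 1 \<and> r - inverse (real (Suc k)) < N (TT f)" for k
  proof -
    obtain s where "s \<in> S" "r - inverse (real (Suc k)) < s"
      using less_cSup_iff[OF ne bdd, of "r - inverse (real (Suc k))"] unfolding r_def by auto
    thus ?thesis unfolding S_def by auto
  qed
  then obtain g where g: "\<And>k. orth (g k)" "\<And>k. N (g k) = 1" "\<And>k. r - inverse (real (Suc k)) < N (TT (g k))" by metis
  note gL = orth_L2[OF g(1)]
  have TgL: "TT (g k) \<in> LpS lu 2" for k by (rule TT_L2[OF gL])
  have Tg_le: "N (TT (g k)) \<le> r" for k using S_ub[OF g(1)[of k]] g(2)[of k] by simp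
  have Tg_lim: "(\<lambda>k. N (TT (g k))) \<longlonglongrightarrow> r"
  proof (rule tendsto_sandwich[OF _ _ _ tendsto_const])
    show "(\<lambda>k. r - inverse (real (Suc k))) \<longlonglongrightarrow> r"
      using tendsto_diff[OF tendsto_const LIMSEQ_inverse_real_of_nat, of r] by simp
    show "\<forall>\<^sub>F k in sequentially. r - inverse (real (Suc k)) \<le> N (TT (g k))" "\<forall>\<^sub>F k in sequentially. N (TT (g k)) \<le> r"
      using g(3) Tg_le by (auto intro!: always_eventually less_imp_le simp del: of_nat_Suc)
  qed
  define sc where "sc c f = (\<lambda>x. c * f x :: real)" for c and f :: "real \<Rightarrow> real"
  have scL: "sc c f \<in> LpS lu 2" if "f \<in> LpS lu 2" for c f
    unfolding sc_def by (rule LpS_scale[OF that, of _ "\<bar>c\<bar>"]) (use LpS_measurable[OF that] in \<open>auto simp: abs_mult\<close>)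
  \<comment> \<open>A maximising sequence is asymptotically an eigenvector of the square of
    \<open>TT\<close>: expanding the squared norm and using
    \<open>N (TT (TT g)) \<le> r * N (TT g)\<close> and \<open>N g = 1\<close> leaves
    \<open>r^4 - r^2 * (N (TT g))^2\<close>.\<close>
  have b: "Lp_lim lu 2 (\<lambda>k x. TT (TT (g k)) x - sc (r^2) (g k) x) (\<lambda>x. 0)"
  proof -
    have sq: "(LpD lu 2 (TT (TT (g k))) (sc (r^2) (g k)))^2 \<le> r^4 - r^2 * (N (TT (g k)))^2" for k
    proof -
      let ?t = "TT (TT (g k))"
      have i: "integrable lu (\<lambda>x. ?t x * ?t x)" "integrable lu (\<lambda>x. g k x * ?t x)" "integrable lu (\<lambda>x. g k x * g k x)"
        by (intro L2_inner_integrable TT_L2 gL)+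
      have "(LpD lu 2 ?t (sc (r^2) (g k)))^2
        = (LINT x|lu. ?t x * ?t x - 2 * r^2 * (g k x * ?t x) + r^4 * (g k x * g k x))"
        unfolding LpN_2_squared sc_def by (rule bint_cong) (simp_all add: algebra_simps power2_eq_square power4_eq_xxxx)
      also have "... = (N ?t)^2 - 2 * r^2 * (N (TT (g k)))^2 + r^4 * (N (g k))^2"
        using i TT_symmetric[OF gL TgL, of k k] unfolding N_def LpN_2_squared by simp
      also have "(N ?t)^2 \<le> (r * N (TT (g k)))^2"
        by (intro power_mono S_ub orth_TT g(1) TT_nz) (auto simp: N_def g(2)[unfolded N_def])
      finally show ?thesis by (simp add: g(2) power_mult_distrib)
    qed
    have "(\<lambda>k. r^4 - r^2 * (N (TT (g k)))^2) \<longlonglongrightarrow> r^4 - r^2 * r^2" by (intro tendsto_intros Tg_lim)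
    hence l0: "(\<lambda>k. r^4 - r^2 * (N (TT (g k)))^2) \<longlonglongrightarrow> 0" by (simp add: power2_eq_square power4_eq_xxxx)
    have "(\<lambda>k. (LpD lu 2 (TT (TT (g k))) (sc (r^2) (g k)))^2) \<longlonglongrightarrow> 0"
      by (rule tendsto_0_le[OF l0 _ sq]) simp
    hence "(\<lambda>k. sqrt ((LpD lu 2 (TT (TT (g k))) (sc (r^2) (g k)))^2)) \<longlonglongrightarrow> sqrt 0" by (rule tendsto_real_sqrt)
    thus ?thesis by simp
  qed
  have "\<exists>h m. continuous_on {0..1} h \<and> strict_mono (m :: nat \<Rightarrow> nat) \<and>
      (\<forall>e>0. \<exists>M. \<forall>n x. n \<ge> M \<and> x \<in> {0..1} \<longrightarrow> norm (TT (g (m n)) x - h x) < e)"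
  proof (rule Arzela_Ascoli[of "{0..1::real}" "\<lambda>k. TT (g k)" 1])
    fix n x assume x: "x \<in> {0..1::real}"
    thus "norm (TT (g n) x) \<le> 1"
      using TT_bound(2)[OF gL, of x n] g(2)[of n] unfolding N_def by (cases "x = 0 \<or> x = 1") auto
  next
    fix x e :: real assume x: "x \<in> {0..1}" and e: "e > 0"
    let ?C = "(al + 1) / be"
    have C: "?C > 0" using al_pos be_pos by simp
    have "continuous_on {0..1} (\<lambda>x::real. x powr be)"
      by (intro continuous_on_powr' continuous_on_id continuous_on_const) (use be_pos in auto)
    then obtain d where d: "d > 0" "\<And>y. y \<in> {0..1} ==> dist y x < d ==> dist (y powr be) (x powr be) < e / ?C"
      using x e C unfolding continuous_on_iff by (metis zero_less_divide_iff)
    show "\<exists>d>0. \<forall>n y. y \<in> {0..1} \<and> norm (x - y) < d \<longrightarrow> norm (TT (g n) x - TT (g n) y) < e"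
    proof (intro exI[of _ d] conjI d(1) allI impI)
      fix n y assume y: "y \<in> {0..1} \<and> norm (x - y) < d"
      hence "\<bar>x powr be - y powr be\<bar> < e / ?C" using d(2)[of y] by (auto simp: dist_real_def abs_minus_commute)
      hence "?C * \<bar>x powr be - y powr be\<bar> < ?C * (e / ?C)" using C by (intro mult_strict_left_mono)
      also have "... = e" using C by (metis less_irrefl nonzero_mult_div_cancel_left times_divide_eq_right)
      finally show "norm (TT (g n) x - TT (g n) y) < e"
        using TT_equicontinuous[OF gL x conjunct1[OF y], of n] g(2)[of n] by (simp add: N_def)
    qed
  qed (auto intro: compact_Icc)
  then obtain h m where hc: "continuous_on {0..1} h" and km: "strict_mono (m :: nat \<Rightarrow> nat)"
    and hu: "\<And>e. e > 0 ==> \<exists>M. \<forall>n x. n \<ge> M \<and> x \<in> {0..1} \<longrightarrow> norm (TT (g (m n)) x - h x) < e" by blast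
  have hm: "h \<in> borel_measurable lu"
    by (rule continuous_measurable_lu[OF continuous_on_subset[OF hc]]) auto
  have "bounded (h ` {0..1})" by (intro compact_imp_bounded compact_continuous_image hc compact_Icc)
  then obtain B where "\<forall>x\<in>{0..1}. norm (h x) \<le> B" unfolding bounded_iff by blast
  hence hL: "h \<in> LpS lu 2" by (intro LpS_bounded[OF finite_measure_lu hm, of B]) (auto intro!: AE_I2)
  have a: "Lp_lim lu 2 (\<lambda>n. TT (g (m n))) h"
  proof (rule uniform_imp_L2_lim[OF finite_measure_lu LpS_measurable[OF TgL] hm])
    fix e :: real assume "e > 0"
    then obtain M where M: "\<forall>n x. n \<ge> M \<and> x \<in> {0..1} \<longrightarrow> norm (TT (g (m n)) x - h x) < e" using hu by blast
    thus "\<exists>N. \<forall>n\<ge>N. \<forall>x\<in>space lu. \<bar>TT (g (m n)) x - h x\<bar> \<le> e"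
      by (intro exI[of _ M]) (auto simp: less_imp_le)
  qed
  have h1: "N h = r"
    using LIMSEQ_unique[OF LpN_tendsto[OF TgL hL _ a] LIMSEQ_subseq_LIMSEQ[OF Tg_lim km, unfolded o_def N_def]]
    by (simp add: N_def)
  have ho: "orth h" unfolding orth_def
  proof (intro conjI hL allI impI)
    fix n :: nat assume n: "n \<ge> 1"
    have "(\<lambda>j. LINT x|lu. TT (g (m j)) x * eU n x) \<longlonglongrightarrow> (LINT x|lu. h x * eU n x)"
      by (rule L2_inner_tendsto[OF TgL hL eU_L2 eU_L2 a LpN_zero_seq])
    moreover have "(LINT x|lu. TT (g (m j)) x * eU n x) = 0" for j using orth_TT[OF g(1)[of "m j"]] n by (simp add: orth_def)
    ultimately show "(LINT x|lu. h x * eU n x) = 0" by (simp add: LIMSEQ_const_iff)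
  qed
  \<comment> \<open>\<open>h\<close> is the limit of \<open>TT g\<close>, so \<open>TT h\<close> is
    close to \<open>TT (TT g)\<close> and thus to \<open>r^2 * g\<close>; one more application of
    \<open>TT\<close> leads to \<open>r^2 * TT g\<close>, which is close to
    \<open>r^2 * h\<close>.\<close>
  have lim0: "LpD lu 2 (TT (TT h)) (sc (r^2) h) \<le> 0"
  proof (rule LIMSEQ_le_const)
    let ?b = "\<lambda>n. LpD lu 2 (TT (g (m n))) h + LpD lu 2 (TT (TT (g (m n)))) (sc (r^2) (g (m n)))
      + r^2 * LpD lu 2 (TT (g (m n))) h"
    have "?b \<longlonglongrightarrow> 0 + 0 + r^2 * 0"
      using LIMSEQ_subseq_LIMSEQ[OF b km] by (intro tendsto_add tendsto_mult tendsto_const a) (simp add: o_def)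
    thus "?b \<longlonglongrightarrow> 0" by simp
    show "\<exists>N. \<forall>n\<ge>N. LpD lu 2 (TT (TT h)) (sc (r^2) h) \<le> ?b n"
    proof (intro exI allI impI)
      fix n
      let ?g = "g (m n)"
      have "LpD lu 2 (TT (TT h)) (sc (r^2) h) \<le> LpD lu 2 (TT (TT h)) (TT (sc (r^2) ?g)) + LpD lu 2 (TT (sc (r^2) ?g)) (sc (r^2) h)"
        by (intro Minkowski_diff TT_L2 scL hL gL) simp
      also have "LpD lu 2 (TT (TT h)) (TT (sc (r^2) ?g)) \<le> LpD lu 2 (TT h) (sc (r^2) ?g)"
        by (intro TT_contraction TT_L2 scL hL gL)
      also have "... \<le> LpD lu 2 (TT h) (TT (TT ?g)) + LpD lu 2 (TT (TT ?g)) (sc (r^2) ?g)"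
        by (intro Minkowski_diff TT_L2 scL hL gL) simp
      also have "LpD lu 2 (TT h) (TT (TT ?g)) \<le> LpD lu 2 h (TT ?g)" by (intro TT_contraction hL TgL)
      also have "... = LpD lu 2 (TT ?g) h" by (rule LpN_diff_commute)
      also have "LpD lu 2 (TT (sc (r^2) ?g)) (sc (r^2) h) = r^2 * LpD lu 2 (TT ?g) h"
        unfolding sc_def TT_scale by (rule LpN_scale) (auto simp: abs_mult simp flip: right_diff_distrib)
      finally show "LpD lu 2 (TT (TT h)) (sc (r^2) h) \<le> ?b n" by simp
    qed
  qed
  have dL: "(\<lambda>x. TT (TT h) x - sc (r^2) h x) \<in> LpS lu 2"
    by (intro LpS_diff scL TT_L2 hL) simp
  have ae: "AE x in lu. TT (TT h) x = r^2 * h x"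
    using LpN_eq_0_iff[OF dL] antisym[OF lim0 LpN_nonneg] by (simp add: sc_def)
  \<comment> \<open>The square of \<open>TT\<close> minus \<open>r^2\<close> factors:
    \<open>y = (TT + r) h\<close> satisfies \<open>TT y = r y\<close> and so vanishes. Then
    \<open>TT h = - r h\<close> with \<open>h\<close> nonzero, against the positivity of
    \<open>TT\<close>.\<close>
  define y where "y = (\<lambda>x. TT h x + r * h x)"
  have y: "orth y" unfolding y_def by (rule orth_lincomb[OF orth_TT[OF ho] ho])
  have "AE x in lu. TT y x = r * y x"
    using ae AE_space
  proof eventually_elim
    fix x assume x: "TT (TT h) x = r^2 * h x" "x \<in> space lu"
    have "TT y x = TT (TT h) x + r * TT h x"
      using TT_add[OF TT_L2[OF hL] scL[OF hL, of r], of x] x(2) unfolding y_def sc_def TT_scale by simp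
    thus "TT y x = r * y x" using x(1) by (simp add: y_def power2_eq_square algebra_simps)
  qed
  hence y0: "AE x in lu. y x = 0" by (rule no_orth_eigenfunction[OF y r])
  have "(LINT x|lu. y x * h x) = (LINT x|lu. 0)"
    using LpS_measurable[OF orth_L2[OF y]] hm y0 by (intro integral_cong_AE) (auto elim: eventually_mono)
  moreover have "(LINT x|lu. y x * h x) = (LINT x|lu. TT h x * h x + r * (h x * h x))"
    by (simp add: y_def algebra_simps)
  moreover have "... = (LINT x|lu. TT h x * h x) + (LINT x|lu. r * (h x * h x))"
    by (intro bint_add integrable_mult_right L2_inner_integrable TT_L2 hL)
  moreover have "(LINT x|lu. r * (h x * h x)) = r * r^2" using LpN_2_squared[of lu h] h1 by (simp add: N_def)
  ultimately show False using TT_positive[OF hL] r by (simp add: add_nonneg_eq_0_iff)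
qed

section \<open>Transfer to \<open>rho \<nu>\<close> and completeness of the
  \<open>phi n\<close>\<close>

lemma integral_rho_lu:
  fixes f :: "real \<Rightarrow> real"
  assumes "f \<in> borel_measurable rh"
  shows "(LINT x|rh. f x) = (LINT x|lu. ww x * f x)" "integrable rh f \<longleftrightarrow> integrable lu (\<lambda>x. ww x * f x)"
  using integral_rho[OF assms] by (simp_all add: integral_lu integrable_lu set_lebesgue_integral_def set_integrable_def)

lemma measurable_rho_lu:
  fixes f :: "real \<Rightarrow> real"
  shows "f \<in> borel_measurable rh \<longleftrightarrow> f \<in> borel_measurable lu"
proof -
  have "sets lu = sets rh" by (simp add: sets_rho sets_restrict_space)
  thus ?thesis using measurable_cong_sets[of lu rh borel borel] by blast
qed

text \<open>Multiplication by the square root of \<open>ww\<close>; it takes \<open>phi n\<close> to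
  \<open>cn n * eU n\<close> on the unit interval.\<close>

definition tr :: "(real \<Rightarrow> real) \<Rightarrow> real \<Rightarrow> real" where "tr f x = x powr al * (1 - x) * f x"

lemma powr_a0_al: "x powr a0 = x powr al * x powr al"
  by (simp add: a0_al flip: powr_add)

lemma ww_al: "0 < x ==> ww x = (x powr al * (1 - x)) * (x powr al * (1 - x))"
  by (simp add: ww_def powr_a0_al power2_eq_square mult_ac)

lemma tr_L2:
  assumes f: "f \<in> LpS rh 2"
  shows "tr f \<in> LpS lu 2"
  unfolding LpS_2
proof
  have fm: "f \<in> borel_measurable lu" using LpS_measurable[OF f] by (simp add: measurable_rho_lu)
  have "(\<lambda>x. x powr al * (1 - x)) \<in> borel_measurable lu" by (rule measurable_lu) measurable
  thus "tr f \<in> borel_measurable lu" unfolding tr_def[abs_def] by (rule borel_measurable_times[OF _ fm])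
  have f2: "integrable rh (\<lambda>x. (f x)^2)" using f unfolding LpS_2 by simp
  hence "integrable lu (\<lambda>x. ww x * (f x)^2)" using integral_rho_lu(2)[of "\<lambda>x. (f x)^2"] by auto
  moreover have "integrable lu (\<lambda>x. ww x * (f x)^2) = integrable lu (\<lambda>x. (tr f x)^2)"
    by (rule bintegrable_cong) (auto simp: tr_def ww_al power_mult_distrib power2_eq_square)
  ultimately show "integrable lu (\<lambda>x. (tr f x)^2)" by simp
qed

lemma AE_rho_lu: "(AE x in rh. P x) \<longleftrightarrow> (AE x in lu. P x)"
  by (simp add: AE_rho AE_lu)

lemma tr_zero:
  assumes "AE x in lu. tr f x = 0"
  shows "AE x in rh. f x = 0"
  unfolding AE_rho_lu using assms AE_space
  by eventually_elim (auto simp: tr_def)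

lemma phi_complete:
  assumes f: "f \<in> LpS rh 2" and o: "\<And>n. n \<ge> 1 ==> (LINT x|rh. f x * phi n x) = 0"
  shows "AE x in rh. f x = 0"
proof (rule tr_zero, rule orth_imp_zero)
  show "orth (tr f)" unfolding orth_def
  proof (intro conjI allI impI tr_L2 f)
    fix n :: nat assume n: "n \<ge> 1"
    have "(LINT x|rh. f x * phi n x) = (LINT x|lu. ww x * (f x * phi n x))"
      by (intro integral_rho_lu borel_measurable_times LpS_measurable[OF f] continuous_measurable_rho phi_cont n)
    also have "... = (LINT x|lu. cn n * (tr f x * eU n x))"
      by (rule bint_cong) (auto simp: tr_def ww_al eU_def phi_def)
    finally have "cn n * (LINT x|lu. tr f x * eU n x) = 0" using o[OF n] by simp
    thus "(LINT x|lu. tr f x * eU n x) = 0" using cn_pos[OF n] by simp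
  qed
qed


section \<open>Completeness of the \<open>chi n\<close>\<close>

lemma eU_mult: "eU n x * eU m x = x powr a0 * (U n x * U m x)"
  by (simp add: eU_def powr_a0_al)

lemma eU_inner: "(LINT x|lu. eU n x * eU m x) = m_UU n m"
  by (simp add: eU_mult m_UU_def integral_lu set_lebesgue_integral_def)

text \<open>For \<open>n \<ge> 2\<close>, \<open>wronski n x / mu n\<close> is the integral of
  \<open>eU 1 * eU n\<close> over \<open>(x, 1)\<close>, and also minus that over
  \<open>(0, x)\<close>. For each \<open>x\<close> the kernel takes the interval at the nearer end,
  which makes the estimate \<open>sK_bound\<close> possible.\<close>

definition sK :: "real \<Rightarrow> real \<Rightarrow> real" where
  "sK x y = (if x < 1/2 then (if y < x then -1 else 0) else (if x < y then 1 else 0))"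

lemma sK_wronski:
  assumes n: "n \<ge> 2" and x: "0 < x" "x < 1"
  shows "(LINT y|lu. sK x y * (eU 1 y * eU n y)) = wronski n x / mu n"
proof -
  have n1: "n \<ge> 1" using n by simp
  let ?F = "\<lambda>y. y powr a0 * (U 1 y * U n y)"
  have Fc: "continuous_on {0..1} ?F"
    by (intro continuous_on_mult continuous_on_powr_a0 continuous_on_U) auto
  have ftc: "integral {a..b} ?F = (wronski n a - wronski n b) / mu n" if ab: "0 \<le> a" "a \<le> b" "b \<le> 1" for a b
  proof -
    have "(?F has_integral (- wronski n b / mu n) - (- wronski n a / mu n)) {a..b}"
    proof (rule fundamental_theorem_of_calculus_interior[OF ab(2)])
      show "continuous_on {a..b} (\<lambda>x. - wronski n x / mu n)"
        by (intro continuous_on_divide continuous_on_minus continuous_on_const continuous_on_subset[OF wronski_cont])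
           (use ab mu_pos[OF n] in auto)
      fix y assume y: "y \<in> {a<..<b}"
      have "DERIV (\<lambda>x. - wronski n x / mu n) y :> - (- mu n * (y powr a0 * U 1 y * U n y)) / mu n"
        using y ab by (intro DERIV_cdivide DERIV_minus wronski_deriv n1) auto
      thus "((\<lambda>x. - wronski n x / mu n) has_vector_derivative y powr a0 * (U 1 y * U n y)) (at y)"
        using mu_pos[OF n] by (simp add: has_real_derivative_iff_has_vector_derivative mult_ac)
    qed
    hence "integral {a..b} ?F = (- wronski n b / mu n) - (- wronski n a / mu n)" by (rule integral_unique)
    thus ?thesis by (simp add: diff_divide_distrib)
  qed
  show ?thesis
  proof (cases "x < 1/2")
    case True
    have "(LINT y|lu. sK x y * (eU 1 y * eU n y)) = (LINT y|lu. - (indicator {0<..<x} y * ?F y))"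
      by (rule bint_cong[OF refl]) (use True in \<open>auto simp: sK_def eU_mult indicator_def\<close>)
    also have "... = - integral {0..x} ?F"
      using integral_lu_Icc[OF continuous_on_subset[OF Fc], of 0 x "{0<..<x}"] x by (simp add: subset_eq)
    also have "... = wronski n x / mu n"
      using ftc[of 0 x] x a0 by (simp add: wronski_def)
    finally show ?thesis .
  next
    case False
    have "(LINT y|lu. sK x y * (eU 1 y * eU n y)) = (LINT y|lu. indicator {x<..<1} y * ?F y)"
      by (rule bint_cong[OF refl]) (use False in \<open>auto simp: sK_def eU_mult indicator_def\<close>)
    also have "... = integral {x..1} ?F"
      using integral_lu_Icc[OF continuous_on_subset[OF Fc], of x 1 "{x<..<1}"] x by (simp add: subset_eq)
    also have "... = wronski n x / mu n"
      using ftc[of x 1] x n1 by (simp add: wronski_def)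
    finally show ?thesis .
  qed
qed

definition Csk :: real where "Csk = exp al * (2 + lam 1 * 2 powr al)"

lemma eU_ground_pos: "0 < x ==> x < 1 ==> eU 1 x > 0"
  using U_ground_pos[of x] by (simp add: eU_def)

text \<open>On the interval between \<open>x\<close> and its nearer end, \<open>eU 1\<close> is
  bounded above by a multiple of \<open>y powr al\<close> or of \<open>1 - y\<close>, which is
  monotone and comparable to \<open>eU 1\<close> at \<open>x\<close>.\<close>

lemma sK_bound:
  assumes x: "0 < x" "x < 1" and y: "0 < y" "y < 1"
  shows "\<bar>sK x y\<bar> * eU 1 y \<le> Csk * eU 1 x"
proof -
  have l: "lam 1 > 0" by (rule lam_pos) simp
  have low: "x powr al * (exp (- al) * (1 - x)) \<le> eU 1 x"
    unfolding eU_def using U_ground_lower[of x] x by (intro mult_left_mono) (auto simp: al_def)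
  have C0: "Csk * eU 1 x \<ge> 0" using eU_ground_pos[OF x] l by (simp add: Csk_def)
  have C1: "exp al * 2 * eU 1 x \<le> Csk * eU 1 x"
    unfolding Csk_def using eU_ground_pos[OF x] l by (intro mult_right_mono) auto
  have C2: "exp al * (lam 1 * 2 powr al) * eU 1 x \<le> Csk * eU 1 x"
    unfolding Csk_def using eU_ground_pos[OF x] l by (intro mult_right_mono) auto
  have ee: "exp al * exp (- al) = 1" by (simp flip: exp_add)
  consider "x < 1/2" "y < x" | "\<not> x < 1/2" "x < y" | "sK x y = 0"
    by (cases "x < 1/2"; cases "y < x"; cases "x < y") (auto simp: sK_def)
  thus ?thesis
  proof cases
    case 1
    have "eU 1 y \<le> y powr al * 1" unfolding eU_def using U_le_1[of y 1] y by (intro mult_left_mono) auto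
    also have "... \<le> x powr al * (2 * (1 - x))"
      using 1 x y al_pos by (intro mult_mono powr_mono2) auto
    also have "... = exp al * 2 * (x powr al * (exp (- al) * (1 - x)))"
    proof -
      have "exp al * 2 * (x powr al * (exp (- al) * (1 - x))) = (exp al * exp (- al)) * (x powr al * (2 * (1 - x)))"
        by (simp only: mult_ac)
      thus ?thesis unfolding ee by (simp only: mult_1_left)
    qed
    also have "... \<le> exp al * 2 * eU 1 x" by (intro mult_left_mono low) auto
    finally show ?thesis using C1 1 by (simp add: sK_def)
  next
    case 2
    have "eU 1 y \<le> 1 * (lam 1 * (1 - y))"
      unfolding eU_def using U_le_linear[of 1 y] y al_pos U_ground_pos[of y]
      by (intro mult_mono) (auto simp: powr_le1)
    also have "... \<le> (2 powr al * x powr al) * (lam 1 * (1 - x))"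
    proof (intro mult_mono)
      have "1 \<le> (2 * x) powr al" using 2 al_pos by (intro ge_one_powr_ge_zero) auto
      thus "1 \<le> 2 powr al * x powr al" using x by (simp add: powr_mult)
    qed (use 2 x y l in auto)
    also have "... = exp al * (lam 1 * 2 powr al) * (x powr al * (exp (- al) * (1 - x)))"
    proof -
      have "exp al * (lam 1 * 2 powr al) * (x powr al * (exp (- al) * (1 - x)))
        = (exp al * exp (- al)) * ((2 powr al * x powr al) * (lam 1 * (1 - x)))" by (simp only: mult_ac)
      thus ?thesis unfolding ee by (simp only: mult_1_left)
    qed
    also have "... \<le> exp al * (lam 1 * 2 powr al) * eU 1 x" using l by (intro mult_left_mono low) auto
    finally show ?thesis using C2 2 by (simp add: sK_def)
  qed (use C0 in simp)
qed

lemma sK_measurable: "(\<lambda>z. sK (snd z) (fst z)) \<in> borel_measurable (lu \<Otimes>\<^sub>M lu)"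
proof -
  have i: "(\<lambda>x. x) \<in> borel_measurable lu" by (rule measurable_lu) simp
  note [measurable] = measurable_compose[OF measurable_fst i] measurable_compose[OF measurable_snd i]
  show ?thesis unfolding sK_def by measurable
qed

text \<open>Inverting the Darboux transformation: \<open>x powr al * Z n\<close> is
  \<open>mu n / eU 1\<close> times an integral operator with kernel \<open>sK\<close>. Fubini's
  theorem moves this operator to the other factor. The resulting \<open>J\<close> is orthogonal to
  \<open>eU n\<close> for \<open>n \<ge> 2\<close>, hence a multiple of \<open>eU 1\<close>, so
  \<open>I = J / eU 1\<close> is constant almost everywhere. Since increments of \<open>I\<close>
  are integrals of \<open>H\<close>, \<open>H\<close> vanishes.\<close>

lemma chi_complete:
  assumes e: "e \<in> LpS rh 2" and o: "\<And>n. n \<ge> 2 ==> (LINT x|rh. e x * chi n x) = 0"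
  shows "AE x in rh. e x = 0"
proof -
  define d where "d = tr e"
  have eL: "d \<in> LpS lu 2" unfolding d_def by (rule tr_L2[OF e])
  note em = LpS_measurable[OF eL]
  have e1: "integrable lu d" using L1_le_L2(1)[OF finite_measure_lu eL] .
  interpret P: pair_sigma_finite lu lu ..
  define H where "H x = d x / eU 1 x" for x
  have Hm: "H \<in> borel_measurable lu"
    unfolding H_def[abs_def] by (rule borel_measurable_divide[OF em measurable_lu[OF eU_measurable]])
  have C0: "Csk \<ge> 0" using lam_pos[of 1] by (simp add: Csk_def)
  define h where "h y x = sK x y * (H x * eU 1 y)" for y x
  have hb: "\<bar>h y x\<bar> \<le> Csk * \<bar>d x\<bar>" if "x \<in> space lu" "y \<in> space lu" for x y
  proof -
    have p: "eU 1 x > 0" "eU 1 y > 0" using that eU_ground_pos by auto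
    have "\<bar>h y x\<bar> = (\<bar>d x\<bar> / eU 1 x) * (\<bar>sK x y\<bar> * eU 1 y)"
      using p by (simp add: h_def H_def abs_mult)
    also have "... \<le> (\<bar>d x\<bar> / eU 1 x) * (Csk * eU 1 x)"
      using p that by (intro mult_left_mono sK_bound) auto
    also have "... = Csk * \<bar>d x\<bar>" using p by simp
    finally show ?thesis .
  qed
  have hm: "case_prod h \<in> borel_measurable (lu \<Otimes>\<^sub>M lu)"
    unfolding h_def split_beta'
    by (intro borel_measurable_times sK_measurable measurable_compose[OF measurable_snd Hm]
        measurable_compose[OF measurable_fst measurable_lu[OF eU_measurable]])
  define J where "J y = (LINT x|lu. h y x)" for y
  have Jm: "J \<in> borel_measurable lu" unfolding J_def by (rule lu.borel_measurable_lebesgue_integral[OF hm])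
  have hi: "integrable lu (h y)" if y: "y \<in> space lu" for y
  proof (rule bint_bound[where f = "\<lambda>x. Csk * d x"])
    show "h y \<in> borel_measurable lu" using measurable_Pair2[OF hm y] by simp
    show "AE x in lu. norm (h y x) \<le> norm (Csk * d x)"
      using hb[OF _ y] C0 by (intro AE_I2) (auto simp: abs_mult)
  qed (use e1 in simp)
  have Jb: "\<bar>J y\<bar> \<le> Csk * (LINT x|lu. \<bar>d x\<bar>)" if y: "y \<in> space lu" for y
  proof -
    have "\<bar>J y\<bar> \<le> (LINT x|lu. \<bar>h y x\<bar>)" unfolding J_def by (rule integral_abs_bound)
    also have "... \<le> (LINT x|lu. Csk * \<bar>d x\<bar>)"
      by (rule integral_mono) (use hi[OF y] e1 hb[OF _ y] in auto)
    finally show ?thesis by simp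
  qed
  have JL: "J \<in> LpS lu 2"
    by (rule LpS_bounded[OF finite_measure_lu Jm, of "Csk * (LINT x|lu. \<bar>d x\<bar>)"]) (use Jb in \<open>auto intro!: AE_I2\<close>)
  have Jo: "(LINT y|lu. J y * eU n y) = 0" if n: "n \<ge> 2" for n
  proof -
    have um: "eU n \<in> borel_measurable lu" by (rule measurable_lu[OF eU_measurable])
    have ub: "\<bar>eU n y\<bar> \<le> 1" if "y \<in> space lu" for y
      using that U_le_1[of y n] al_pos by (auto simp: eU_def abs_mult intro!: mult_le_one powr_le1)
    have dom: "integrable (lu \<Otimes>\<^sub>M lu) (\<lambda>(y, x). Csk * \<bar>d x\<bar>)"
    proof (rule P.Fubini_integrable)
      show "(\<lambda>(y, x). Csk * \<bar>d x\<bar>) \<in> borel_measurable (lu \<Otimes>\<^sub>M lu)"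
        unfolding split_beta' by (intro borel_measurable_times borel_measurable_const borel_measurable_abs measurable_compose[OF measurable_snd em])
    qed (use e1 in auto)
    have int: "integrable (lu \<Otimes>\<^sub>M lu) (\<lambda>(y, x). h y x * eU n y)"
    proof (rule bint_bound[OF dom])
      show "(\<lambda>(y, x). h y x * eU n y) \<in> borel_measurable (lu \<Otimes>\<^sub>M lu)"
        using borel_measurable_times[OF hm measurable_compose[OF measurable_fst um]] by (simp add: split_beta')
      show "AE z in lu \<Otimes>\<^sub>M lu. norm (case z of (y, x) \<Rightarrow> h y x * eU n y) \<le> norm (case z of (y, x) \<Rightarrow> Csk * \<bar>d x\<bar>)"
      proof (rule AE_I2)
        fix z assume "z \<in> space (lu \<Otimes>\<^sub>M lu)"
        then obtain y x where z: "z = (y, x)" "x \<in> space lu" "y \<in> space lu" by (auto simp: space_pair_measure)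
        have "\<bar>h y x\<bar> * \<bar>eU n y\<bar> \<le> (Csk * \<bar>d x\<bar>) * 1" using C0 by (intro mult_mono hb ub z) auto
        thus "norm (case z of (y, x) \<Rightarrow> h y x * eU n y) \<le> norm (case z of (y, x) \<Rightarrow> Csk * \<bar>d x\<bar>)"
          unfolding z(1) using C0 by (simp add: abs_mult)
      qed
    qed
    have "(LINT y|lu. J y * eU n y) = (LINT y|lu. (LINT x|lu. h y x * eU n y))"
      unfolding J_def by (simp only: integral_mult_left_zero)
    also have "... = (LINT x|lu. (LINT y|lu. h y x * eU n y))" by (rule P.Fubini_integral[OF int, symmetric])
    also have "... = (LINT x|lu. 1 / mu n * (d x * (x powr al * Z n x)))"
    proof (rule bint_cong[OF refl])
      fix x assume "x \<in> space lu"
      hence x: "0 < x" "x < 1" by auto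
      have "(LINT y|lu. h y x * eU n y) = (LINT y|lu. H x * (sK x y * (eU 1 y * eU n y)))"
        by (simp only: h_def mult_ac)
      also have "... = H x * (wronski n x / mu n)" by (simp only: integral_mult_right_zero sK_wronski[OF n x])
      also have "wronski n x = eU 1 x * (x powr al * Z n x)" by (simp add: wronski_eq[OF x] powr_a0_al eU_def)
      also have "H x * (eU 1 x * (x powr al * Z n x) / mu n) = 1 / mu n * (d x * (x powr al * Z n x))"
        using eU_ground_pos[OF x] by (simp add: H_def)
      finally show "(LINT y|lu. h y x * eU n y) = 1 / mu n * (d x * (x powr al * Z n x))" .
    qed
    also have "... = 1 / mu n * (LINT x|lu. d x * (x powr al * Z n x))" by (rule integral_mult_right_zero)
    also have "(LINT x|lu. d x * (x powr al * Z n x)) = 0"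
    proof -
      have n1: "n \<ge> 1" using n by simp
      have "(LINT x|rh. e x * chi n x) = (LINT x|lu. ww x * (e x * chi n x))"
        by (intro integral_rho_lu borel_measurable_times LpS_measurable[OF e] continuous_measurable_rho chi_cont n1)
      also have "... = (LINT x|lu. dn n * (d x * (x powr al * Z n x)))"
        by (rule bint_cong) (auto simp: tr_def ww_al d_def chi_def)
      finally have "dn n * (LINT x|lu. d x * (x powr al * Z n x)) = 0" using o[OF n] by simp
      thus ?thesis using dn_pos[OF n] by simp
    qed
    finally show ?thesis by simp
  qed
  have m11: "m_UU 1 1 > 0"
  proof -
    have "(jp (lam 1))^2 > 0" using jp_lam_nz[of 1] by simp
    thus ?thesis using m_UU_norm(1)[of 1] by linarith
  qed
  \<comment> \<open>The coefficient of the projection of \<open>J\<close> onto \<open>eU 1\<close>,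
    whose squared norm is \<open>m_UU 1 1\<close>.\<close>
  define c where "c = (LINT y|lu. J y * eU 1 y) / m_UU 1 1"
  have ceL: "(\<lambda>y. c * eU 1 y) \<in> LpS lu 2"
    by (rule LpS_scale[OF eU_L2, of _ "\<bar>c\<bar>"]) (auto simp: abs_mult intro!: measurable_lu)
  have "orth (\<lambda>y. J y - c * eU 1 y)" unfolding orth_def
  proof (intro conjI allI impI)
    show "(\<lambda>y. J y - c * eU 1 y) \<in> LpS lu 2" by (rule LpS_diff[OF JL ceL]) simp
    fix n :: nat assume n: "n \<ge> 1"
    have "(LINT y|lu. (J y - c * eU 1 y) * eU n y) = (LINT y|lu. J y * eU n y - c * (eU 1 y * eU n y))"
      by (simp add: algebra_simps)
    also have "... = (LINT y|lu. J y * eU n y) - (LINT y|lu. c * (eU 1 y * eU n y))"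
      by (intro bint_diff integrable_mult_right L2_inner_integrable JL eU_L2)
    also have "... = (LINT y|lu. J y * eU n y) - c * m_UU 1 n" by (simp add: eU_inner)
    also have "... = 0"
    proof (cases "n = 1")
      case True thus ?thesis using m11 by (simp add: c_def)
    next
      case False thus ?thesis using n Jo[of n] m_UU_orth[of 1 n] by simp
    qed
    finally show "(LINT y|lu. (J y - c * eU 1 y) * eU n y) = 0" .
  qed
  hence Jc: "AE y in lu. J y - c * eU 1 y = 0" by (rule orth_imp_zero)
  define I where "I y = (LINT x|lu. sK x y * H x)" for y
  have JI: "J y = I y * eU 1 y" for y
  proof -
    have "J y = (LINT x|lu. (sK x y * H x) * eU 1 y)" unfolding J_def h_def by (simp only: mult_ac)
    thus ?thesis by (simp add: I_def)
  qed
  have Ic: "AE y in lborel. 0 < y \<and> y < 1 \<longrightarrow> I y = c"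
    using Jc unfolding AE_lu
  proof eventually_elim
    fix y assume "0 < y \<and> y < 1 \<longrightarrow> J y - c * eU 1 y = 0"
    thus "0 < y \<and> y < 1 \<longrightarrow> I y = c" using eU_ground_pos[of y] by (auto simp: JI)
  qed
  have Ii: "integrable lu (\<lambda>x. sK x y * H x)" if y: "0 < y" "y < 1" for y
  proof -
    have "integrable lu (\<lambda>x. h y x / eU 1 y)" using hi[of y] y by (intro integrable_divide_zero) auto
    moreover have "h y x / eU 1 y = sK x y * H x" for x using eU_ground_pos[OF y] by (simp add: h_def)
    ultimately show ?thesis by simp
  qed
  have dI: "integrable lu (\<lambda>x. indicator {s<..<b} x * H x)" "(LINT x|lu. indicator {s<..<b} x * H x) = I b - I s"
    if sb: "0 < s" "s < b" "b < 1" for s b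
  proof -
    have i: "integrable lu (\<lambda>x. sK x b * H x - sK x s * H x)" using Ii[of b] Ii[of s] sb by simp
    have m: "(\<lambda>x. indicator {s<..<b} x * H x) \<in> borel_measurable lu"
      by (rule borel_measurable_times[OF measurable_lu Hm]) simp
    have ae: "AE x in lu. sK x b * H x - sK x s * H x = indicator {s<..<b} x * H x"
      unfolding AE_lu using AE_lborel_singleton[of s] AE_lborel_singleton[of b]
      by eventually_elim (use sb in \<open>auto simp: sK_def indicator_def\<close>)
    show "integrable lu (\<lambda>x. indicator {s<..<b} x * H x)"
      by (rule iffD1[OF integrable_cong_AE[OF _ m ae] i]) (use i in auto)
    have "(LINT x|lu. indicator {s<..<b} x * H x) = (LINT x|lu. sK x b * H x - sK x s * H x)"
      by (rule sym, rule integral_cong_AE[OF _ m ae]) (use i in auto)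
    also have "... = I b - I s" unfolding I_def using Ii[of b] Ii[of s] sb by (intro bint_diff) auto
    finally show "(LINT x|lu. indicator {s<..<b} x * H x) = I b - I s" .
  qed
  have H0: "AE x in lborel. a < x \<and> x < b \<longrightarrow> H x = 0"
    if ab: "0 < a" "a < b" "b < 1" and I: "I a = c" for a b
  proof -
    define q where "q x = indicator {0<..<1} x * (indicator {a<..<b} x * H x)" for x
    have qi: "integrable lborel q" using dI(1)[OF ab] unfolding integrable_lu q_def .
    have "AE x in lborel. a < x \<and> x < b \<longrightarrow> q x = 0"
    proof (rule AE_eq_0_if_integrals_0[OF qi])
      show "AE t in lborel. a < t \<and> t < b \<longrightarrow> (LINT x|lborel. indicator {a<..<t} x * q x) = 0"
        using Ic
      proof (eventually_elim, intro impI)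
        fix t assume t: "0 < t \<and> t < 1 \<longrightarrow> I t = c" "a < t \<and> t < b"
        have "(LINT x|lborel. indicator {a<..<t} x * q x) = (LINT x|lu. indicator {a<..<t} x * H x)"
          unfolding integral_lu q_def using t by (intro bint_cong) (auto simp: indicator_def)
        also have "... = I t - I a" by (rule dI(2)) (use t ab in auto)
        finally show "(LINT x|lborel. indicator {a<..<t} x * q x) = 0" using t ab I by simp
      qed
    qed
    thus ?thesis by eventually_elim (use ab in \<open>auto simp: q_def\<close>)
  qed
  \<comment> \<open>That \<open>I\<close> equals \<open>c\<close> is known almost everywhere only,
    so the left end points are chosen among the points where it holds.\<close>
  have "\<exists>a. 0 < a \<and> a < 1 / real (n + 2) \<and> I a = c" for n
  proof -
    have p: "0 < 1 / real (n + 2)" "1 / real (n + 2) < 1" by auto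
    obtain a where a: "0 < a" "a < 1 / real (n + 2)" "0 < a \<and> a < 1 \<longrightarrow> I a = c"
      using AE_lborel_ex[OF Ic p(1)] by blast
    hence "a < 1" using p by linarith
    thus ?thesis using a by blast
  qed
  then obtain a where ab: "\<And>n. 0 < a n" "\<And>n. a n < 1 / real (n + 2)" "\<And>n. I (a n) = c" by metis
  define b where "b n = 1 - 1 / real (n + 3)" for n
  have "AE x in lborel. a n < x \<and> x < b n \<longrightarrow> H x = 0" for n
  proof (rule H0)
    have "1 / real (n + 2) \<le> 1 / 2" "1 / real (n + 3) < 1 / 2" by (auto simp: divide_simps)
    thus "a n < b n" using ab(2)[of n] unfolding b_def by linarith
  qed (use ab in \<open>auto simp: b_def\<close>)
  hence "AE x in lborel. \<forall>n. a n < x \<and> x < b n \<longrightarrow> H x = 0" unfolding AE_all_countable ..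
  hence "AE x in lu. d x = 0" unfolding AE_lu
  proof eventually_elim
    fix x assume x: "\<forall>n. a n < x \<and> x < b n \<longrightarrow> H x = 0"
    show "0 < x \<and> x < 1 \<longrightarrow> d x = 0"
    proof
      assume x01: "0 < x \<and> x < 1"
      then obtain n where n: "inverse (real (Suc n)) < min x (1 - x)" using reals_Archimedean[of "min x (1 - x)"] by auto
      have "1 / real (n + 2) \<le> inverse (real (Suc n))" "1 / real (n + 3) \<le> inverse (real (Suc n))"
        by (simp_all add: inverse_eq_divide frac_le)
      hence "a n < x" "x < b n" using ab(2)[of n] n by (auto simp: b_def)
      hence "H x = 0" using x by blast
      thus "d x = 0" using eU_ground_pos[of x] x01 by (simp add: H_def)
    qed
  qed
  thus ?thesis unfolding d_def by (rule tr_zero)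
qed

end

section \<open>The Riesz transform on real-valued functions\<close>

text \<open>Half of the exponential absorbs the power, by \<open>y \<le> exp y\<close> at
  \<open>y = t / (2 * b / s)\<close>.\<close>

lemma powr_exp_bound:
  fixes t :: real
  assumes "t > 0" "s > 0" "b > 0"
  shows "t powr b * exp (- s * t) \<le> (2 * b / s) powr b * exp (- (s / 2) * t)"
proof -
  let ?K = "2 * b / s"
  have K: "?K > 0" using assms by simp
  have "t / ?K \<le> exp (t / ?K)" using exp_ge_add_one_self[of "t / ?K"] by linarith
  hence "t \<le> exp (t / ?K) * ?K" using pos_divide_le_eq[OF K] by blast
  hence "t \<le> ?K * exp (t / ?K)" by (simp only: mult.commute)
  hence "t powr b \<le> (?K * exp (t / ?K)) powr b" using assms by (intro powr_mono2) auto
  also have "... = ?K powr b * exp (t / ?K * b)"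
    using K by (subst powr_mult) (auto simp: exp_powr_real)
  also have "t / ?K * b = (s / 2) * t" using assms by (simp add: field_simps)
  finally have "t powr b * exp (- s * t) \<le> ?K powr b * exp ((s / 2) * t) * exp (- s * t)" by (intro mult_right_mono) auto
  also have "... = ?K powr b * exp ((s / 2) * t + - s * t)" by (simp only: exp_add mult.assoc)
  also have "(s / 2) * t + - s * t = - (s / 2) * t" by (simp add: field_simps)
  finally show ?thesis .
qed

section \<open>The systems \<open>phi\<close> and \<open>chi\<close> as Poisson systems\<close>

context bessel
begin

lemma cn_le: "n \<ge> 1 ==> cn n \<le> sqrt 2 / (lam 1 powr a0 * \<bar>jp (lam 1)\<bar>) * lam n powr a0"
proof -
  assume n: "n \<ge> 1"
  have l: "lam n > 0" "lam 1 > 0" using lam_pos n by auto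
  have j: "jp (lam 1) \<noteq> 0" by (rule jp_lam_nz) simp
  have "(lam 1 / lam n) powr a0 * \<bar>jp (lam 1)\<bar> \<le> \<bar>jp (lam n)\<bar>" using jp_lam_lower[OF n] by (simp add: a0_def)
  moreover have "(lam 1 / lam n) powr a0 * \<bar>jp (lam 1)\<bar> > 0" using l j by simp
  ultimately have "cn n \<le> sqrt 2 / ((lam 1 / lam n) powr a0 * \<bar>jp (lam 1)\<bar>)"
    unfolding cn_def by (intro divide_left_mono mult_pos_pos) auto
  also have "... = sqrt 2 / (lam 1 powr a0 * \<bar>jp (lam 1)\<bar>) * lam n powr a0"
    using l by (simp add: powr_divide)
  finally show ?thesis .
qed

lemma cn_lam_summable:
  assumes s: "s > 0"
  shows "summable (\<lambda>n. exp (- s * lam n) * (cn n * lam n))"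
proof (rule summable_comparison_test_ev)
  let ?C = "sqrt 2 / (lam 1 powr a0 * \<bar>jp (lam 1)\<bar>)" and ?K = "(2 * (a0 + 1) / s) powr (a0 + 1)"
  have C: "?C > 0" using lam_pos[of 1] jp_lam_nz[of 1] by simp
  show "summable (\<lambda>n. ?C * ?K * exp (- (s / 2) * gap) ^ n)"
    by (intro summable_mult summable_geometric) (use s gap_pos in auto)
  show "\<forall>\<^sub>F n in sequentially. norm (exp (- s * lam n) * (cn n * lam n)) \<le> ?C * ?K * exp (- (s / 2) * gap) ^ n"
    using eventually_ge_at_top[of 1]
  proof eventually_elim
    fix n :: nat assume n: "1 \<le> n"
    have l: "lam n > 0" by (rule lam_pos[OF n])
    have "norm (exp (- s * lam n) * (cn n * lam n)) = exp (- s * lam n) * (cn n * lam n)"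
      using l cn_pos[OF n] by simp
    also have "... \<le> exp (- s * lam n) * (?C * lam n powr a0 * lam n)"
      using l by (intro mult_left_mono mult_right_mono cn_le n) auto
    also have "... = ?C * (lam n powr (a0 + 1) * exp (- s * lam n))" using l by (simp add: powr_add mult_ac)
    also have "... \<le> ?C * (?K * exp (- (s / 2) * lam n))"
      by (intro mult_left_mono powr_exp_bound) (use l s a0 C in auto)
    also have "... \<le> ?C * (?K * exp (- (s / 2) * gap) ^ n)"
    proof (intro mult_left_mono)
      have "(s / 2) * (real n * gap) \<le> (s / 2) * lam n" using lam_ge[of n] s by (intro mult_left_mono) auto
      hence "exp (- (s / 2) * lam n) \<le> exp (real n * (- (s / 2) * gap))" by (simp add: mult_ac)
      thus "exp (- (s / 2) * lam n) \<le> exp (- (s / 2) * gap) ^ n" by (simp only: exp_of_nat_mult)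
    qed (use C in auto)
    finally show "norm (exp (- s * lam n) * (cn n * lam n)) \<le> ?C * ?K * exp (- (s / 2) * gap) ^ n" by (simp only: mult.assoc)
  qed
qed

lemma dn_mu_le: "n \<ge> 2 ==> dn n * (CZ * mu n) \<le> CZ * (cn n * lam n)"
proof -
  assume n: "n \<ge> 2"
  have m: "mu n > 0" by (rule mu_pos[OF n])
  have l: "lam n > 0" using lam_pos[of n] n by simp
  have "sqrt (mu n) \<le> lam n" using mu_le[of n] l real_le_lsqrt[of "lam n" "mu n"] by simp
  have "dn n * (CZ * mu n) = CZ * (cn n * sqrt (mu n))"
    using m real_sqrt_mult_self[of "mu n"] by (simp add: dn_def field_simps)
  also have "... \<le> CZ * (cn n * lam n)"
    using \<open>sqrt (mu n) \<le> lam n\<close> CZ_pos cn_pos[of n] n by (intro mult_left_mono) auto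
  finally show ?thesis .
qed

lemma phi_system: "orthonormal_system rh phi 1 (\<lambda>n. cn n * lam n)"
proof (intro orthonormal_system.intro finite_measure_rho orthonormal_system_axioms.intro)
  show "phi n \<in> borel_measurable rh" if "n \<ge> 1" for n by (intro continuous_measurable_rho phi_cont that)
  show "(LINT x|rh. phi n x * phi m x) = (if n = m then 1 else 0)" if "n \<ge> 1" "m \<ge> 1" for n m
    by (rule phi_orthonormal[OF that])
qed (auto intro: phi_bound phi_complete)

lemma chi_system: "orthonormal_system rh chi 2 (\<lambda>n. dn n * (CZ * mu n))"
proof (intro orthonormal_system.intro finite_measure_rho orthonormal_system_axioms.intro)
  show "chi n \<in> borel_measurable rh" if "n \<ge> 2" for n
    by (intro continuous_measurable_rho chi_cont) (use that in auto)
  show "(LINT x|rh. chi n x * chi m x) = (if n = m then 1 else 0)" if "n \<ge> 2" "m \<ge> 2" for n m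
    by (rule chi_orthonormal[OF that])
qed (auto intro: chi_bound chi_complete)

sublocale P: poisson_system rh phi 1 "\<lambda>n. cn n * lam n" lam
proof (intro poisson_system.intro phi_system poisson_system_axioms.intro)
  show "lam n \<ge> 0" for n by (rule lam_Suc(1))
  show "summable (\<lambda>n. exp (- s * lam n) * (cn n * lam n))" if "s > 0" for s by (rule cn_lam_summable[OF that])
  show "(LINT x|rh. \<bar>orthonormal_system.fsum phi 1 (\<lambda>n. exp (- s * lam n) * c n) N x\<bar>) \<le>
      (LINT x|rh. \<bar>orthonormal_system.fsum phi 1 c N x\<bar>)" if "s \<ge> 0" for s c N
    unfolding orthonormal_system.fsum_def[OF phi_system] by (rule phi_contraction[OF that])
qed

sublocale Q: poisson_system rh chi 2 "\<lambda>n. dn n * (CZ * mu n)" lam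
proof (intro poisson_system.intro chi_system poisson_system_axioms.intro)
  show "lam n \<ge> 0" for n by (rule lam_Suc(1))
  show "summable (\<lambda>n. exp (- s * lam n) * (dn n * (CZ * mu n)))" if s: "s > 0" for s
  proof (rule summable_comparison_test_ev)
    show "summable (\<lambda>n. CZ * (exp (- s * lam n) * (cn n * lam n)))" by (intro summable_mult cn_lam_summable s)
    show "\<forall>\<^sub>F n in sequentially. norm (exp (- s * lam n) * (dn n * (CZ * mu n))) \<le> CZ * (exp (- s * lam n) * (cn n * lam n))"
      using eventually_ge_at_top[of 2]
    proof eventually_elim
      fix n :: nat assume n: "2 \<le> n"
      have "norm (exp (- s * lam n) * (dn n * (CZ * mu n))) = exp (- s * lam n) * (dn n * (CZ * mu n))"
        using dn_pos[OF n] CZ_pos mu_pos[OF n] by simp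
      also have "... \<le> exp (- s * lam n) * (CZ * (cn n * lam n))" by (intro mult_left_mono dn_mu_le n) auto
      finally show "norm (exp (- s * lam n) * (dn n * (CZ * mu n))) \<le> CZ * (exp (- s * lam n) * (cn n * lam n))"
        by (simp only: mult_ac)
    qed
  qed
  show "(LINT x|rh. \<bar>orthonormal_system.fsum chi 2 (\<lambda>n. exp (- s * lam n) * c n) N x\<bar>) \<le>
      (LINT x|rh. \<bar>orthonormal_system.fsum chi 2 c N x\<bar>)" if "s \<ge> 0" for s c N
    unfolding orthonormal_system.fsum_def[OF chi_system] by (rule chi_contraction[OF that])
qed

lemma Q_fsum: "Q.fsum = Gs" unfolding Q.fsum_def[abs_def] Gs_def[abs_def] ..

definition sg :: "nat \<Rightarrow> real" where "sg n = sqrt (mu n) / lam n"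

lemma sg_bounds: "n \<ge> 1 ==> 0 \<le> sg n" "n \<ge> 1 ==> sg n \<le> 1"
proof -
  assume n: "n \<ge> 1"
  have l: "lam n > 0" by (rule lam_pos[OF n])
  show "0 \<le> sg n" using mu_nonneg[OF n] l by (simp add: sg_def)
  have "sqrt (mu n) \<le> lam n" using mu_le[of n] l real_le_lsqrt[of "lam n" "mu n"] by simp
  thus "sg n \<le> 1" using l by (simp add: sg_def)
qed

text \<open>A relation, since the \<open>L^2\<close> limit is determined up to null sets only. The
  coefficient identity is recorded because the pairings and the \<open>L^2\<close> contraction are
  computed from it.\<close>

definition riesz :: "(real \<Rightarrow> real) \<Rightarrow> (real \<Rightarrow> real) \<Rightarrow> bool" where
  "riesz f g \<longleftrightarrow> f \<in> LpS rh 2 \<and> g \<in> LpS rh 2 \<and>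
     (\<lambda>N. LpN rh 2 (\<lambda>x. Gs (\<lambda>n. P.coef f n * sg n) N x - g x)) \<longlonglongrightarrow> 0 \<and>
     (\<forall>n\<ge>2. Q.coef g n = P.coef f n * sg n)"

lemma rieszD:
  assumes "riesz f g"
  shows "f \<in> LpS rh 2" "g \<in> LpS rh 2" "n \<ge> 2 ==> Q.coef g n = P.coef f n * sg n"
  using assms by (auto simp: riesz_def)

lemma sum_sg_le:
  "(\<Sum>n=2..N. (c n * sg n)^2) \<le> (\<Sum>n=1..N. (c n)^2)"
proof -
  have "(\<Sum>n=2..N. (c n * sg n)^2) \<le> (\<Sum>n=2..N. (c n)^2)"
  proof (rule sum_mono)
    fix n assume n: "n \<in> {2..N}"
    have "(sg n)^2 \<le> 1" using sg_bounds[of n] n by (simp add: power_le_one)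
    hence "(c n)^2 * (sg n)^2 \<le> (c n)^2 * 1" by (intro mult_left_mono) auto
    thus "(c n * sg n)^2 \<le> (c n)^2" by (simp add: power_mult_distrib)
  qed
  also have "... \<le> (\<Sum>n=1..N. (c n)^2)" by (rule sum_mono2) auto
  finally show ?thesis .
qed

lemma riesz_exists:
  assumes f: "f \<in> LpS rh 2"
  obtains g where "riesz f g"
proof (rule Q.fsum_converges)
  show "(\<Sum>n=2..N. (P.coef f n * sg n)^2) \<le> (LINT x|rh. (f x)^2)" for N
    using sum_sg_le[where c = "P.coef f" and N = N] P.Bessel[OF f, of N] by linarith
  fix g assume "g \<in> LpS rh 2"
    "(\<lambda>N. LpN rh 2 (\<lambda>x. Q.fsum (\<lambda>n. P.coef f n * sg n) N x - g x)) \<longlonglongrightarrow> 0"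
    "\<And>n. 2 \<le> n ==> Q.coef g n = P.coef f n * sg n"
  thus thesis using f that unfolding Q_fsum by (auto simp: riesz_def)
qed

lemma P_coef_diff:
  assumes "f \<in> LpS rh 2" "f' \<in> LpS rh 2" "n \<ge> 1"
  shows "P.coef (\<lambda>x. f x - f' x) n = P.coef f n - P.coef f' n"
  unfolding P.coef_def left_diff_distrib
  by (intro bint_diff L2_inner_integrable assms P.e_L2)

lemma Q_coef_diff:
  assumes "f \<in> LpS rh 2" "f' \<in> LpS rh 2" "n \<ge> 2"
  shows "Q.coef (\<lambda>x. f x - f' x) n = Q.coef f n - Q.coef f' n"
  unfolding Q.coef_def left_diff_distrib
  by (intro bint_diff L2_inner_integrable assms Q.e_L2)

lemma riesz_L2_contraction:
  assumes r: "riesz f g" "riesz f' g'"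
  shows "LpD rh 2 g g' \<le> LpD rh 2 f f'"
proof -
  note D = rieszD[OF r(1)] rieszD[OF r(2)]
  have d: "(\<lambda>x. f x - f' x) \<in> LpS rh 2" "(\<lambda>x. g x - g' x) \<in> LpS rh 2"
    by (intro LpS_diff D; simp)+
  have "(\<Sum>n=2..N. (Q.coef (\<lambda>x. g x - g' x) n)^2) \<le> (LINT x|rh. (f x - f' x)^2)" for N
  proof -
    have "(\<Sum>n=2..N. (Q.coef (\<lambda>x. g x - g' x) n)^2) = (\<Sum>n=2..N. (P.coef (\<lambda>x. f x - f' x) n * sg n)^2)"
      by (rule sum.cong) (auto simp: Q_coef_diff[OF D(2,5)] P_coef_diff[OF D(1,4)] D(3,6) left_diff_distrib)
    also have "... \<le> (\<Sum>n=1..N. (P.coef (\<lambda>x. f x - f' x) n)^2)" by (rule sum_sg_le)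
    also have "... \<le> (LINT x|rh. (f x - f' x)^2)" by (rule P.Bessel[OF d(1)])
    finally show ?thesis .
  qed
  hence "(LINT x|rh. (g x - g' x)^2) \<le> (LINT x|rh. (f x - f' x)^2)"
    by (intro LIMSEQ_le_const2[OF Q.Parseval[OF d(2)]]) auto
  thus ?thesis unfolding LpN_2 by (rule real_sqrt_le_mono)
qed

text \<open>Homogeneity; the norms are enlarged by \<open>d > 0\<close> before dividing, so that
  zero norms are covered, and \<open>d\<close> tends to 0.\<close>

lemma pairing_scaled:
  assumes p: "p > 1" "q > 1" "1 / p + 1 / q = 1"
  shows "\<bar>pairing f g N\<bar> \<le> 10 * (1 + sqrt KK) * (max p q - 1) * LpN rh p (Fs f N) * LpN rh q (Gs g N)"
proof -
  let ?A = "LpN rh p (Fs f N)" and ?B = "LpN rh q (Gs g N)" and ?C = "10 * (1 + sqrt KK) * (max p q - 1)"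
  have C: "?C \<ge> 0" using KK_nonneg p by (intro mult_nonneg_nonneg) auto
  have eps: "\<bar>pairing f g N\<bar> \<le> ?C * (?A + d) * (?B + d)" if e: "d > 0" for d
  proof -
    let ?a = "?A + d" and ?b = "?B + d"
    have a: "?a > 0" "?b > 0" using e by (simp_all add: add_nonneg_pos)
    have F: "Fs (\<lambda>n. f n / ?a) N x = Fs f N x / ?a" for x unfolding Fs_def by (simp add: sum_divide_distrib)
    have G: "Gs (\<lambda>n. g n / ?b) N x = Gs g N x / ?b" for x unfolding Gs_def by (simp add: sum_divide_distrib)
    have "LpN rh p (Fs (\<lambda>n. f n / ?a) N) = (1 / ?a) * ?A"
      by (rule LpN_scale) (use a p F in \<open>auto simp: abs_mult\<close>)
    also have "... \<le> 1" using a e by (simp add: divide_le_eq)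
    finally have f1: "LpN rh p (Fs (\<lambda>n. f n / ?a) N) \<le> 1" .
    have "LpN rh q (Gs (\<lambda>n. g n / ?b) N) = (1 / ?b) * ?B"
      by (rule LpN_scale) (use a p G in \<open>auto simp: abs_mult\<close>)
    also have "... \<le> 1" using a e by (simp add: divide_le_eq)
    finally have g1: "LpN rh q (Gs (\<lambda>n. g n / ?b) N) \<le> 1" .
    have "pairing (\<lambda>n. f n / ?a) (\<lambda>n. g n / ?b) N = pairing f g N / (?a * ?b)"
      unfolding pairing_def sum_divide_distrib by (intro sum.cong) (auto simp: field_simps)
    hence "\<bar>pairing f g N\<bar> / (?a * ?b) \<le> ?C" using pairing_bound[OF p f1 g1] a by (simp add: abs_mult)
    thus ?thesis using a by (simp add: divide_le_eq mult_ac)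
  qed
  have "(\<lambda>n. ?C * (?A + inverse (real (Suc n))) * (?B + inverse (real (Suc n)))) \<longlonglongrightarrow> ?C * (?A + 0) * (?B + 0)"
    by (intro tendsto_mult tendsto_add tendsto_const LIMSEQ_inverse_real_of_nat)
  hence "\<bar>pairing f g N\<bar> \<le> ?C * (?A + 0) * (?B + 0)"
    by (rule LIMSEQ_le_const) (intro exI allI impI eps, simp)
  thus ?thesis by simp
qed

end

lemma sum_truncate:
  fixes a b :: "nat \<Rightarrow> real"
  shows "M \<le> N ==> (\<Sum>n=m..N. (if n \<le> M then a n else 0) * b n) = (\<Sum>n=m..M. a n * b n)"
  by (rule sum.mono_neutral_cong_right) auto

section \<open>Duality and the \<open>L^p\<close> bound for real functions\<close>

context bessel
begin

definition Cpq :: "real \<Rightarrow> real \<Rightarrow> real" where "Cpq p q = 10 * (1 + sqrt KK) * (max p q - 1)"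

lemma Cpq_nonneg: "p > 1 ==> Cpq p q \<ge> 0"
  unfolding Cpq_def using KK_nonneg by (intro mult_nonneg_nonneg) auto

text \<open>The estimate for finite sums is uniform, so \<open>f\<close> can be approximated.
  \<open>pairing\<close> has a single cut-off, hence both coefficient sequences are extended by
  zeros to \<open>L = max M (N k)\<close>.\<close>

lemma riesz_pairing_finite:
  assumes p: "p > 1" "q > 1" "1 / p + 1 / q = 1"
    and f: "f \<in> borel_measurable rh" "\<And>x. x \<in> space rh ==> \<bar>f x\<bar> \<le> K"
    and r: "riesz f h"
  shows "\<bar>\<Sum>n=2..M. d n * Q.coef h n\<bar> \<le> Cpq p q * LpN rh p f * LpN rh q (Gs d M)"
proof -
  obtain c :: "nat \<Rightarrow> nat \<Rightarrow> real" and N where lim: "Lp_lim rh 2 (\<lambda>k. P.fsum (c k) (N k)) f"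
    and limp: "\<And>p. p \<ge> 1 ==> (\<lambda>k. LpN rh p (P.fsum (c k) (N k))) \<longlonglongrightarrow> LpN rh p f"
    using P.smoothing_Lp[OF f] by blast
  have fL: "f \<in> LpS rh 2" by (rule rieszD(1)[OF r])
  define a where "a k = P.coef (P.fsum (c k) (N k))" for k
  have a_lim: "(\<lambda>k. a k n) \<longlonglongrightarrow> P.coef f n" if "n \<ge> 1" for n
    unfolding a_def P.coef_def
    by (rule L2_inner_tendsto[OF P.fsum_LpS fL P.e_L2[OF that] P.e_L2[OF that] lim LpN_zero_seq]) simp
  have bd: "\<bar>\<Sum>n=2..M. d n * (a k n * sg n)\<bar> \<le> Cpq p q * LpN rh p (P.fsum (c k) (N k)) * LpN rh q (Gs d M)" for k
  proof -
    define L where "L = max M (N k)"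
    define d' where "d' n = (if n \<le> M then d n else 0)" for n
    have F: "Fs (a k) L = P.fsum (c k) (N k)"
    proof
      fix x
      have "Fs (a k) L x = (\<Sum>n=1..L. (if n \<le> N k then c k n else 0) * phi n x)"
        unfolding Fs_def a_def by (rule sum.cong[OF refl], subst P.coef_fsum) auto
      also have "... = (\<Sum>n=1..N k. c k n * phi n x)" by (rule sum_truncate) (simp add: L_def)
      finally show "Fs (a k) L x = P.fsum (c k) (N k) x" unfolding P.fsum_def .
    qed
    have G: "Gs d' L = Gs d M"
      by (rule ext) (simp add: Gs_def d'_def L_def sum_truncate)
    have "pairing (a k) d' L = (\<Sum>n=2..L. (if n \<le> M then d n else 0) * (a k n * sg n))"
      unfolding pairing_def d'_def sg_def by (intro sum.cong) auto
    also have "... = (\<Sum>n=2..M. d n * (a k n * sg n))" by (rule sum_truncate) (simp add: L_def)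
    finally show ?thesis using pairing_scaled[OF p, of "a k" d' L] unfolding F G Cpq_def by simp
  qed
  have "(\<Sum>n=2..M. d n * Q.coef h n) = (\<Sum>n=2..M. d n * (P.coef f n * sg n))"
    by (rule sum.cong) (auto simp: rieszD(3)[OF r])
  moreover have "\<bar>\<Sum>n=2..M. d n * (P.coef f n * sg n)\<bar> \<le> Cpq p q * LpN rh p f * LpN rh q (Gs d M)"
  proof (rule LIMSEQ_le)
    show "(\<lambda>k. \<bar>\<Sum>n=2..M. d n * (a k n * sg n)\<bar>) \<longlonglongrightarrow> \<bar>\<Sum>n=2..M. d n * (P.coef f n * sg n)\<bar>"
      by (intro tendsto_rabs tendsto_sum tendsto_mult tendsto_const a_lim) auto
    show "(\<lambda>k. Cpq p q * LpN rh p (P.fsum (c k) (N k)) * LpN rh q (Gs d M))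
        \<longlonglongrightarrow> Cpq p q * LpN rh p f * LpN rh q (Gs d M)"
      by (intro tendsto_mult tendsto_const limp) (use p in simp)
  qed (use bd in auto)
  ultimately show ?thesis by simp
qed

lemma riesz_pairing:
  assumes p: "p > 1" "q > 1" "1 / p + 1 / q = 1"
    and f: "f \<in> borel_measurable rh" "\<And>x. x \<in> space rh ==> \<bar>f x\<bar> \<le> K"
    and g: "g \<in> borel_measurable rh" "\<And>x. x \<in> space rh ==> \<bar>g x\<bar> \<le> L"
    and r: "riesz f h"
  shows "\<bar>LINT x|rh. h x * g x\<bar> \<le> Cpq p q * LpN rh p f * LpN rh q g"
proof -
  obtain d :: "nat \<Rightarrow> nat \<Rightarrow> real" and M where lim: "Lp_lim rh 2 (\<lambda>k. Q.fsum (d k) (M k)) g"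
    and limp: "\<And>p. p \<ge> 1 ==> (\<lambda>k. LpN rh p (Q.fsum (d k) (M k))) \<longlonglongrightarrow> LpN rh p g"
    using Q.smoothing_Lp[OF g] by blast
  have gL: "g \<in> LpS rh 2"
    by (rule LpS_bounded[OF finite_measure_rho g(1), of L]) (use g(2) in \<open>auto intro!: AE_I2\<close>)
  note hL = rieszD(2)[OF r]
  show ?thesis
  proof (rule LIMSEQ_le)
    show "(\<lambda>k. \<bar>LINT x|rh. h x * Q.fsum (d k) (M k) x\<bar>) \<longlonglongrightarrow> \<bar>LINT x|rh. h x * g x\<bar>"
      by (intro tendsto_rabs L2_inner_tendsto[OF hL hL Q.fsum_LpS gL LpN_zero_seq lim]) simp
    show "(\<lambda>k. Cpq p q * LpN rh p f * LpN rh q (Q.fsum (d k) (M k)))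
        \<longlonglongrightarrow> Cpq p q * LpN rh p f * LpN rh q g"
      by (intro tendsto_mult tendsto_const limp) (use p in simp)
    show "\<exists>N. \<forall>k\<ge>N. \<bar>LINT x|rh. h x * Q.fsum (d k) (M k) x\<bar>
        \<le> Cpq p q * LpN rh p f * LpN rh q (Q.fsum (d k) (M k))"
    proof (intro exI allI impI)
      fix k
      show "\<bar>LINT x|rh. h x * Q.fsum (d k) (M k) x\<bar>
        \<le> Cpq p q * LpN rh p f * LpN rh q (Q.fsum (d k) (M k))"
        unfolding Q.inner_fsum[OF hL] unfolding Q_fsum by (rule riesz_pairing_finite[OF p f r])
    qed
  qed
qed

text \<open>The converse of Hoelder's inequality, tested with
  \<open>sgn h * |h| powr (p - 1)\<close>. That \<open>h\<close> lies in \<open>L^p\<close> is part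
  of the claim, so \<open>h\<close> is truncated first; this makes the test function bounded and
  \<open>X\<close> finite, and Fatou's lemma removes the truncation.\<close>

lemma riesz_Lp_bounded:
  assumes p: "p > 1" and f: "f \<in> borel_measurable rh" "\<And>x. x \<in> space rh ==> \<bar>f x\<bar> \<le> K"
    and r: "riesz f h"
  shows "h \<in> LpS rh p" "LpN rh p h \<le> Cpq p (p / (p - 1)) * LpN rh p f"
proof -
  define q where "q = p / (p - 1)"
  have q: "q > 1" "1 / p + 1 / q = 1" "(p - 1) * q = p" using p by (auto simp: q_def field_simps)
  define A where "A = Cpq p q * LpN rh p f"
  have A: "A \<ge> 0" unfolding A_def using Cpq_nonneg[OF p] by simp
  have hm: "h \<in> borel_measurable rh" by (rule LpS_measurable[OF rieszD(2)[OF r]])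
  have tm: "trunc k h \<in> borel_measurable rh" for k by (rule trunc_measurable[OF hm])
  have tL: "trunc k h \<in> LpS rh p" for k
    by (rule LpS_bounded[OF finite_measure_rho tm, of _ "real k"]) (use p norm_trunc_le(2)[of k h] in \<open>auto intro!: AE_I2\<close>)
  have tA: "LpN rh p (trunc k h) \<le> A" for k
  proof -
    define g where "g x = sgn (trunc k h x) * \<bar>trunc k h x\<bar> powr (p - 1)" for x
    have gm: "g \<in> borel_measurable rh" unfolding g_def[abs_def] using tm[of k] by measurable
    have gb: "\<bar>g x\<bar> \<le> real k powr (p - 1)" for x
    proof -
      have "\<bar>g x\<bar> \<le> 1 * \<bar>trunc k h x\<bar> powr (p - 1)"
        unfolding g_def abs_mult by (intro mult_mono) (auto simp: sgn_if)
      also have "... \<le> 1 * real k powr (p - 1)"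
        using norm_trunc_le(2)[of k h x] p by (intro mult_left_mono powr_mono2) auto
      finally show ?thesis by simp
    qed
    define X where "X = (LINT x|rh. norm (trunc k h x) powr p)"
    have X0: "X \<ge> 0" unfolding X_def by (intro integral_nonneg_AE AE_I2) simp
    have hg: "h x * g x = norm (trunc k h x) powr p" for x
    proof (cases "trunc k h x = 0")
      case False
      hence e: "trunc k h x = h x" by (simp add: trunc_def split: if_splits)
      have "h x * g x = \<bar>h x\<bar> powr 1 * \<bar>h x\<bar> powr (p - 1)" unfolding g_def e using False e
        by (simp add: mult.assoc[symmetric] abs_sgn[symmetric])
      also have "... = \<bar>h x\<bar> powr p" unfolding powr_add[symmetric] by simp
      finally show ?thesis by (simp add: e)
    qed (simp add: g_def)
    have "\<bar>g x\<bar> powr q = norm (trunc k h x) powr p" for x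
      by (cases "trunc k h x = 0") (simp_all add: g_def abs_mult abs_sgn_eq powr_powr q(3))
    hence gq: "LpN rh q g = X powr (1 / q)" by (simp add: LpN_def X_def)
    have "\<bar>LINT x|rh. h x * g x\<bar> \<le> Cpq p q * LpN rh p f * LpN rh q g"
      by (rule riesz_pairing[OF p q(1,2) f gm gb r])
    hence XA: "X \<le> A * X powr (1 / q)" unfolding hg gq A_def X_def[symmetric] using X0 by simp
    show ?thesis
    proof (cases "X = 0")
      case True
      thus ?thesis using A by (simp add: LpN_def X_def)
    next
      case False
      hence X: "X > 0" using X0 by simp
      have "X powr (1 / p) * X powr (1 / q) = X" using X q(2) by (simp flip: powr_add)
      hence "X powr (1 / p) * X powr (1 / q) \<le> A * X powr (1 / q)" using XA by simp
      hence "X powr (1 / p) \<le> A" using X by simp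
      thus ?thesis by (simp add: LpN_def X_def)
    qed
  qed
  have lim: "AE x in rh. (\<lambda>k. trunc k h x) \<longlonglongrightarrow> h x"
  proof (rule AE_I2, rule tendsto_eventually)
    fix x
    have "eventually (\<lambda>k. norm (h x) \<le> real k) sequentially"
      using eventually_ge_at_top[of "nat \<lceil>norm (h x)\<rceil>"] by eventually_elim linarith
    thus "\<forall>\<^sub>F k in sequentially. trunc k h x = h x" by eventually_elim (simp add: trunc_def)
  qed
  show "h \<in> LpS rh p" "LpN rh p h \<le> Cpq p (p / (p - 1)) * LpN rh p f"
    using LpS_Fatou[OF tL hm _ A tA lim] p by (auto simp: A_def q_def)
qed

text \<open>Truncations of \<open>f\<close> converge in \<open>L^2\<close>, hence so do their
  transforms, and almost everywhere along a subsequence; Fatou's lemma carries over the uniform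
  bound.\<close>

lemma riesz_Lp:
  assumes p: "p > 1" and f: "f \<in> LpS rh p" and r: "riesz f h"
  shows "h \<in> LpS rh p" "LpN rh p h \<le> Cpq p (p / (p - 1)) * LpN rh p f"
proof -
  note fL = rieszD(1)[OF r] and hL = rieszD(2)[OF r]
  have t2: "trunc k f \<in> LpS rh 2" for k by (rule trunc_LpS[OF fL]) simp
  have "\<exists>g. riesz (trunc k f) g" for k using riesz_exists[OF t2[of k]] by blast
  then obtain g where g: "\<And>k. riesz (trunc k f) (g k)" by metis
  have gL: "g k \<in> LpS rh 2" for k by (rule rieszD(2)[OF g])
  have l: "Lp_lim rh 2 g h"
    by (rule tendsto_0_le[OF trunc_tendsto[OF fL] _ riesz_L2_contraction[OF g r]]) simp_all
  obtain s where s: "strict_mono (s :: nat \<Rightarrow> nat)" "AE x in rh. (\<lambda>n. g (s n) x) \<longlonglongrightarrow> h x"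
    by (rule LpN_tendsto_AE_subseq[OF gL hL _ l]) simp_all
  have b: "g k \<in> LpS rh p" "LpN rh p (g k) \<le> Cpq p (p / (p - 1)) * LpN rh p f" for k
  proof -
    have tb: "\<bar>trunc k f x\<bar> \<le> real k" for x using norm_trunc_le(2)[of k f x] by simp
    show "g k \<in> LpS rh p" by (rule riesz_Lp_bounded(1)[OF p LpS_measurable[OF t2] tb g])
    have "LpN rh p (g k) \<le> Cpq p (p / (p - 1)) * LpN rh p (trunc k f)"
      by (rule riesz_Lp_bounded(2)[OF p LpS_measurable[OF t2] tb g])
    also have "... \<le> Cpq p (p / (p - 1)) * LpN rh p f"
      using trunc_LpS(2)[OF f, of k] p Cpq_nonneg[OF p] by (intro mult_left_mono) auto
    finally show "LpN rh p (g k) \<le> Cpq p (p / (p - 1)) * LpN rh p f" .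
  qed
  have C: "Cpq p (p / (p - 1)) * LpN rh p f \<ge> 0" using Cpq_nonneg[OF p] by simp
  show "h \<in> LpS rh p" "LpN rh p h \<le> Cpq p (p / (p - 1)) * LpN rh p f"
    using LpS_Fatou[OF b(1) LpS_measurable[OF hL] _ C b(2) s(2)] p by auto
qed

end

section \<open>Extension to complex-valued functions in \<open>L\<^sup>p\<close>\<close>

lemma LpS_mult_const:
  fixes f :: "'a \<Rightarrow> complex"
  assumes "f \<in> LpS M p"
  shows "(\<lambda>x. c * f x) \<in> LpS M p"
  by (rule LpS_scale[OF assms, of _ "cmod c"]) (use LpS_measurable[OF assms] in \<open>auto simp: norm_mult\<close>)

lemma LpN_mult_const:
  fixes f :: "'a \<Rightarrow> complex"
  assumes "p > 0"
  shows "LpN M p (\<lambda>x. c * f x) = cmod c * LpN M p f"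
  by (rule LpN_scale) (use assms in \<open>auto simp: norm_mult\<close>)

text \<open>\<open>S\<close> is a relation because the operator is determined up to null sets only.
  \<open>E\<close> is the closure of its graph; linearity and the norm bound pass to
  \<open>E\<close>, the bound makes \<open>E\<close> single-valued almost everywhere, and
  \<open>T\<close> selects a representative.\<close>

lemma Lp_extension:
  fixes M :: "'a measure" and D :: "('a \<Rightarrow> complex) set"
    and S :: "('a \<Rightarrow> complex) \<Rightarrow> ('a \<Rightarrow> complex) \<Rightarrow> bool"
  assumes M: "finite_measure M" and p1: "p > 1" and K: "K \<ge> 0" and D: "D \<subseteq> LpS M p"
    and D_add: "\<And>f f'. f \<in> D ==> f' \<in> D ==> (\<lambda>x. f x + f' x) \<in> D"
    and D_scale: "\<And>c f. f \<in> D ==> (\<lambda>x. c * f x) \<in> D"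
    and ex: "\<And>f. f \<in> D ==> \<exists>g. S f g"
    and bnd: "\<And>f g. f \<in> D ==> S f g ==> g \<in> LpS M p" "\<And>f g. f \<in> D ==> S f g ==> LpN M p g \<le> K * LpN M p f"
    and add: "\<And>f f' g g'. f \<in> D ==> f' \<in> D ==> S f g ==> S f' g' ==> S (\<lambda>x. f x + f' x) (\<lambda>x. g x + g' x)"
    and scale: "\<And>c f g. f \<in> D ==> S f g ==> S (\<lambda>x. c * f x) (\<lambda>x. c * g x)"
    and cong: "\<And>f g g'. f \<in> D ==> S f g ==> g' \<in> LpS M p ==> AE x in M. g x = g' x ==> S f g'"
    and dense: "\<And>f. f \<in> LpS M p ==> \<exists>h. (\<forall>k::nat. h k \<in> D) \<and> Lp_lim M p h f"
  obtains T where "\<And>f. f \<in> LpS M p ==> T f \<in> LpS M p"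
    and "\<And>f. f \<in> LpS M p ==> LpN M p (T f) \<le> K * LpN M p f"
    and "\<And>f g. f \<in> LpS M p ==> g \<in> LpS M p ==> AE x in M. T (\<lambda>y. f y + g y) x = T f x + T g x"
    and "\<And>c f. f \<in> LpS M p ==> AE x in M. T (\<lambda>y. c * f y) x = c * T f x"
    and "\<And>f. f \<in> D ==> S f (T f)"
proof -
  have p: "p \<ge> 1" and p0: "p > 0" using p1 by auto
  have DL: "f \<in> LpS M p" if "f \<in> D" for f using D that by blast
  define E where "E f g \<longleftrightarrow> g \<in> LpS M p \<and> (\<exists>h r. (\<forall>k::nat. h k \<in> D \<and> S (h k) (r k)) \<and>
     Lp_lim M p h f \<and> Lp_lim M p r g)" for f g
  have E_L: "g \<in> LpS M p" if "E f g" for f g using that by (simp add: E_def)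
  have diff: "LpD M p r r' \<le> K * LpD M p h h'"
    if "h \<in> D" "S h r" "h' \<in> D" "S h' r'" for h h' r r'
  proof -
    have "(\<lambda>x. h x + (-1) * h' x) \<in> D" "S (\<lambda>x. h x + (-1) * h' x) (\<lambda>x. r x + (-1) * r' x)"
      using that by (intro D_add add D_scale scale; simp)+
    from bnd(2)[OF this] show ?thesis by simp
  qed
  have E_ex: "\<exists>g. E f g" if f: "f \<in> LpS M p" for f
  proof -
    obtain h where h: "\<And>k::nat. h k \<in> D" and lim: "Lp_lim M p h f" using dense[OF f] by blast
    obtain r where r: "\<And>k. S (h k) (r k)" using ex[OF h] by metis
    have rL: "r k \<in> LpS M p" for k by (rule bnd(1)[OF h r])
    have cauchy: "\<exists>N. \<forall>m\<ge>N. \<forall>n\<ge>N. LpD M p (r m) (r n) < e" if e: "e > 0" for e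
    proof -
      \<comment> \<open>\<open>K + 1\<close> replaces \<open>K\<close> as divisor because
        \<open>K\<close> may be 0.\<close>
      have "e / (2 * (K + 1)) > 0" using e K by simp
      then obtain N where N: "\<And>n. n \<ge> N ==> LpD M p (h n) f < e / (2 * (K + 1))"
        using LIMSEQ_D[OF lim] by force
      show ?thesis
      proof (intro exI allI impI)
        fix m n assume mn: "m \<ge> N" "n \<ge> N"
        have "LpD M p (h m) (h n) \<le> LpD M p (h m) f + LpD M p f (h n)"
          by (rule Minkowski_diff[OF DL[OF h] f DL[OF h] p])
        also have "LpD M p f (h n) = LpD M p (h n) f" by (rule LpN_diff_commute)
        finally have "LpD M p (h m) (h n) < 2 * (e / (2 * (K + 1)))" using N[OF mn(1)] N[OF mn(2)] by linarith
        moreover have "2 * (e / (2 * (K + 1))) = e / (K + 1)"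
          unfolding times_divide_eq_right by (rule mult_divide_mult_cancel_left) simp
        ultimately have lt: "LpD M p (h m) (h n) < e / (K + 1)" by (rule ord_less_eq_trans)
        have "LpD M p (r m) (r n) \<le> K * LpD M p (h m) (h n)" by (rule diff[OF h r h r])
        also have "... \<le> (K + 1) * LpD M p (h m) (h n)" by (intro mult_right_mono) auto
        also have "... < (K + 1) * (e / (K + 1))" using lt K by (intro mult_strict_left_mono) auto
        also have "... = e" using K by simp
        finally show "LpD M p (r m) (r n) < e" .
      qed
    qed
    obtain g where "g \<in> LpS M p" "Lp_lim M p r g"
      by (rule LpS_complete[OF M rL p1 cauchy])
    thus ?thesis unfolding E_def using h r lim by blast
  qed
  have E_norm: "LpN M p g \<le> K * LpN M p f" if f: "f \<in> LpS M p" and E: "E f g" for f g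
  proof -
    obtain h r where h: "\<And>k::nat. h k \<in> D" "\<And>k. S (h k) (r k)"
      and l: "Lp_lim M p h f" "Lp_lim M p r g"
      using E unfolding E_def by blast
    show ?thesis
    proof (rule LIMSEQ_le)
      show "(\<lambda>k. LpN M p (r k)) \<longlonglongrightarrow> LpN M p g" by (rule LpN_tendsto[OF bnd(1)[OF h] E_L[OF E] p l(2)])
      show "(\<lambda>k. K * LpN M p (h k)) \<longlonglongrightarrow> K * LpN M p f"
        by (intro tendsto_mult tendsto_const LpN_tendsto[OF DL[OF h(1)] f p l(1)])
    qed (use bnd(2)[OF h] in auto)
  qed
  have E_add: "E (\<lambda>x. f x + f' x) (\<lambda>x. g x + g' x)"
    if f: "f \<in> LpS M p" "f' \<in> LpS M p" and E: "E f g" "E f' g'" for f f' g g'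
  proof -
    obtain h r where h: "\<And>k::nat. h k \<in> D" "\<And>k. S (h k) (r k)"
      and l: "Lp_lim M p h f" "Lp_lim M p r g"
      using E(1) unfolding E_def by blast
    obtain h' r' where h': "\<And>k::nat. h' k \<in> D" "\<And>k. S (h' k) (r' k)"
      and l': "Lp_lim M p h' f'" "Lp_lim M p r' g'"
      using E(2) unfolding E_def by blast
    show ?thesis unfolding E_def
    proof (intro conjI exI allI)
      show "(\<lambda>x. g x + g' x) \<in> LpS M p" by (rule LpS_add[OF E_L[OF E(1)] E_L[OF E(2)] p0])
      show "(\<lambda>x. h k x + h' k x) \<in> D" "S (\<lambda>x. h k x + h' k x) (\<lambda>x. r k x + r' k x)" for k
        using h h' by (intro D_add add; simp)+
      show "(\<lambda>k. LpN M p (\<lambda>x. h k x + h' k x - (f x + f' x))) \<longlonglongrightarrow> 0"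
        by (rule Lp_lim_add[OF DL[OF h(1)] DL[OF h'(1)] f p l(1) l'(1)])
      show "(\<lambda>k. LpN M p (\<lambda>x. r k x + r' k x - (g x + g' x))) \<longlonglongrightarrow> 0"
        by (rule Lp_lim_add[OF bnd(1)[OF h] bnd(1)[OF h'] E_L[OF E(1)] E_L[OF E(2)] p l(2) l'(2)])
    qed
  qed
  have E_scale: "E (\<lambda>x. c * f x) (\<lambda>x. c * g x)" if E: "E f g" for c f g
  proof -
    obtain h r where h: "\<And>k::nat. h k \<in> D" "\<And>k. S (h k) (r k)"
      and l: "Lp_lim M p h f" "Lp_lim M p r g"
      using E unfolding E_def by blast
    have lim: "(\<lambda>k. LpN M p (\<lambda>x. c * u k x - c * v x)) \<longlonglongrightarrow> 0"
      if "Lp_lim M p u v" for u :: "nat \<Rightarrow> 'a \<Rightarrow> complex" and v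
      using tendsto_mult[OF tendsto_const[of "cmod c"] that] LpN_mult_const[OF p0, of M c] by (simp flip: right_diff_distrib)
    show ?thesis unfolding E_def
    proof (intro conjI exI allI)
      show "(\<lambda>x. c * g x) \<in> LpS M p" by (rule LpS_mult_const[OF E_L[OF E]])
      show "(\<lambda>x. c * h k x) \<in> D" "S (\<lambda>x. c * h k x) (\<lambda>x. c * r k x)" for k
        using h by (intro D_scale scale; simp)+
      show "(\<lambda>k. LpN M p (\<lambda>x. c * h k x - c * f x)) \<longlonglongrightarrow> 0" by (rule lim[OF l(1)])
      show "(\<lambda>k. LpN M p (\<lambda>x. c * r k x - c * g x)) \<longlonglongrightarrow> 0" by (rule lim[OF l(2)])
    qed
  qed
  \<comment> \<open>\<open>E\<close> relates \<open>f - f\<close> to \<open>g - g'\<close>, so the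
    norm bound forces the latter to vanish.\<close>
  have E_unique: "AE x in M. g x = g' x" if f: "f \<in> LpS M p" and E: "E f g" "E f g'" for f g g'
  proof -
    have "E (\<lambda>x. f x + (-1) * f x) (\<lambda>x. g x + (-1) * g' x)"
      by (intro E_add E_scale E LpS_mult_const f)
    hence "LpN M p (\<lambda>x. g x + (-1) * g' x) \<le> K * LpN M p (\<lambda>x. f x + (-1) * f x)"
      by (rule E_norm[rotated]) (simp add: LpS_def)
    hence "LpD M p g g' \<le> 0" using p0 by simp
    hence "LpD M p g g' = 0" by (rule antisym) simp
    thus ?thesis using LpN_eq_0_iff[OF LpS_diff[OF E_L[OF E(1)] E_L[OF E(2)] p0] p0] by simp
  qed
  have E_D: "E f g" if "f \<in> D" "S f g" for f g
    unfolding E_def using that bnd(1)[OF that] p0 by (intro conjI exI[of _ "\<lambda>_. f"] exI[of _ "\<lambda>_. g"]) auto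
  define T where "T f = (SOME g. E f g)" for f
  have T: "E f (T f)" if "f \<in> LpS M p" for f unfolding T_def by (rule someI_ex[OF E_ex[OF that]])
  show thesis
  proof (rule that[of T])
    fix f :: "'a \<Rightarrow> complex" assume f: "f \<in> LpS M p"
    show "T f \<in> LpS M p" by (rule E_L[OF T[OF f]])
    show "LpN M p (T f) \<le> K * LpN M p f" by (rule E_norm[OF f T[OF f]])
    show "AE x in M. T (\<lambda>y. c * f y) x = c * T f x" for c
      by (rule E_unique[OF LpS_mult_const[OF f] T[OF LpS_mult_const[OF f]] E_scale[OF T[OF f]]])
    show "AE x in M. T (\<lambda>y. f y + g y) x = T f x + T g x" if g: "g \<in> LpS M p" for g :: "'a \<Rightarrow> complex"
      by (rule E_unique[OF LpS_add[OF f g p0] T[OF LpS_add[OF f g p0]] E_add[OF f g T[OF f] T[OF g]]])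
  next
    fix f assume f: "f \<in> D"
    obtain g where g: "S f g" using ex[OF f] by blast
    show "S f (T f)"
      by (rule cong[OF f g E_L[OF T[OF DL[OF f]]] E_unique[OF DL[OF f] E_D[OF f g] T[OF DL[OF f]]]])
  qed
qed

lemma Lp_tendsto_iff:
  "Lp_tendsto M p F f \<longleftrightarrow> (\<forall>n. F n \<in> LpS M p) \<and> f \<in> LpS M p \<and> Lp_lim M p F f"
  by (simp add: Lp_tendsto_def Lp_eq_LpS Lp_norm_eq_LpN)

lemma Lp_tendsto_unique:
  assumes p: "p \<ge> 1" and l: "Lp_tendsto M p F f" "Lp_tendsto M p F g"
  shows "AE x in M. f x = g x"
proof -
  have F: "F n \<in> LpS M p" "f \<in> LpS M p" "g \<in> LpS M p" for n using l by (auto simp: Lp_tendsto_iff)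
  have "LpD M p f g \<le> 0"
  proof (rule LIMSEQ_le_const)
    show "(\<lambda>n. LpD M p (F n) f + LpD M p (F n) g) \<longlonglongrightarrow> 0"
      using l tendsto_add[of "\<lambda>n. LpD M p (F n) f" 0 sequentially "\<lambda>n. LpD M p (F n) g" 0]
      by (simp add: Lp_tendsto_iff)
    show "\<exists>N. \<forall>n\<ge>N. LpD M p f g \<le> LpD M p (F n) f + LpD M p (F n) g"
      using Minkowski_diff[OF F(2) F(1) F(3) p] LpN_diff_commute[of M p f] by (intro exI[of _ 0]) auto
  qed
  hence "LpD M p f g = 0" by (rule antisym) simp
  thus ?thesis using LpN_eq_0_iff[OF LpS_diff[OF F(2,3)]] p by simp
qed

lemma bounded_linear_Lp_diff:
  assumes T: "bounded_linear_Lp M p T" and p: "p > 0"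
  obtains C where "\<And>f g. f \<in> LpS M p ==> g \<in> LpS M p ==> LpD M p (T f) (T g) \<le> C * LpD M p f g"
proof -
  obtain C where C: "\<And>f. f \<in> LpS M p ==> LpN M p (T f) \<le> C * LpN M p f"
    using T unfolding bounded_linear_Lp_def Lp_eq_LpS Lp_norm_eq_LpN by blast
  have TL: "\<And>f. f \<in> LpS M p ==> T f \<in> LpS M p"
    and add: "\<And>f g. f \<in> LpS M p ==> g \<in> LpS M p ==> AE x in M. T (\<lambda>y. f y + g y) x = T f x + T g x"
    using T by (auto simp: bounded_linear_Lp_def Lp_eq_LpS)
  show thesis
  proof (rule that)
    fix f g :: "'a \<Rightarrow> complex" assume f: "f \<in> LpS M p" and g: "g \<in> LpS M p"
    have d: "(\<lambda>x. f x - g x) \<in> LpS M p" by (rule LpS_diff[OF f g p])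
    have "LpD M p (T f) (T g) = LpN M p (T (\<lambda>x. f x - g x))"
    proof (rule LpN_cong_AE)
      show "(\<lambda>x. T f x - T g x) \<in> borel_measurable M" "T (\<lambda>x. f x - g x) \<in> borel_measurable M"
        using LpS_measurable[OF TL[OF f]] LpS_measurable[OF TL[OF g]] LpS_measurable[OF TL[OF d]] by auto
      show "AE x in M. T f x - T g x = T (\<lambda>x. f x - g x) x"
        using add[OF d g] by eventually_elim simp
    qed
    thus "LpD M p (T f) (T g) \<le> C * LpD M p f g" using C[OF d] by simp
  qed
qed

section \<open>The complex Riesz transform and its extension\<close>

context bessel
begin

lemma LpS_Re_Im:
  fixes f :: "real \<Rightarrow> complex"
  assumes f: "f \<in> LpS M p" and p: "p > 0"
  shows "(\<lambda>x. Re (f x)) \<in> LpS M p" "LpN M p (\<lambda>x. Re (f x)) \<le> LpN M p f"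
    "(\<lambda>x. Im (f x)) \<in> LpS M p" "LpN M p (\<lambda>x. Im (f x)) \<le> LpN M p f"
proof -
  have m: "(\<lambda>x. Re (f x)) \<in> borel_measurable M" "(\<lambda>x. Im (f x)) \<in> borel_measurable M"
    using LpS_measurable[OF f] by auto
  show "(\<lambda>x. Re (f x)) \<in> LpS M p" "LpN M p (\<lambda>x. Re (f x)) \<le> LpN M p f"
    using LpS_mono[OF f m(1)] p abs_Re_le_cmod by auto
  show "(\<lambda>x. Im (f x)) \<in> LpS M p" "LpN M p (\<lambda>x. Im (f x)) \<le> LpN M p f"
    using LpS_mono[OF f m(2)] p abs_Im_le_cmod by auto
qed

lemma LpS_Complex:
  fixes g h :: "real \<Rightarrow> real"
  assumes g: "g \<in> LpS M p" and h: "h \<in> LpS M p" and p: "p \<ge> 1"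
  shows "(\<lambda>x. Complex (g x) (h x)) \<in> LpS M p" "LpN M p (\<lambda>x. Complex (g x) (h x)) \<le> LpN M p g + LpN M p h"
proof -
  have e: "Complex (g x) (h x) = of_real (g x) + \<i> * of_real (h x)" for x by (simp add: complex_eq_iff)
  have m: "(\<lambda>x. complex_of_real (g x)) \<in> LpS M p" "(\<lambda>x. \<i> * complex_of_real (h x)) \<in> LpS M p"
    by (rule LpS_scale[OF g, of _ 1] LpS_scale[OF h, of _ 1];
        use LpS_measurable[OF g] LpS_measurable[OF h] in \<open>auto simp: norm_mult\<close>)+
  have n: "LpN M p (\<lambda>x. complex_of_real (g x)) = 1 * LpN M p g" "LpN M p (\<lambda>x. \<i> * complex_of_real (h x)) = 1 * LpN M p h"
    by (rule LpN_scale; use p in \<open>auto simp: norm_mult\<close>)+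
  show "(\<lambda>x. Complex (g x) (h x)) \<in> LpS M p" unfolding e by (rule LpS_add[OF m]) (use p in simp)
  show "LpN M p (\<lambda>x. Complex (g x) (h x)) \<le> LpN M p g + LpN M p h"
    unfolding e using Minkowski[OF m p] n by simp
qed

lemma integrable_mult_phi:
  fixes f :: "real \<Rightarrow> complex"
  assumes f: "f \<in> LpS rh 2" and n: "n \<ge> 1"
  shows "integrable rh (\<lambda>x. f x * complex_of_real (phi n x))"
proof -
  have "f \<in> LpS rh 1" by (rule LpS_subset[OF finite_measure_rho f]) auto
  hence i: "integrable rh f"
    using LpS_D[of f rh 1] by (simp add: integrable_norm_iff)
  have pm: "phi n \<in> borel_measurable rh" by (intro continuous_measurable_rho phi_cont n)
  show ?thesis
  proof (rule bint_bound[where f = "\<lambda>x. complex_of_real (cn n * lam n) * f x"])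
    show "integrable rh (\<lambda>x. complex_of_real (cn n * lam n) * f x)" using i by (rule integrable_mult_right)
    show "(\<lambda>x. f x * complex_of_real (phi n x)) \<in> borel_measurable rh"
      using LpS_measurable[OF f] pm by simp
    have "cmod (f x * complex_of_real (phi n x)) \<le> cmod (complex_of_real (cn n * lam n) * f x)" if "x \<in> space rh" for x
    proof -
      have "\<bar>phi n x\<bar> \<le> \<bar>cn n * lam n\<bar>" using phi_bound[OF n, of x] that by auto
      thus ?thesis by (simp add: norm_mult mult.commute mult_left_mono flip: abs_mult)
    qed
    thus "AE x in rh. cmod (f x * complex_of_real (phi n x)) \<le> cmod (complex_of_real (cn n * lam n) * f x)"
      by (intro AE_I2) auto
  qed
qed

lemma L2_inner_phi_check:
  assumes n: "n \<ge> 1"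
  shows "L2_inner rh f (\<lambda>y. of_real (phi_check \<nu> n y)) = (LINT x|rh. f x * of_real (phi n x))"
  unfolding L2_inner_def
  by (rule bint_cong[OF refl]) (auto simp: phi_check_eq[OF n])

lemma L2_inner_phi_Complex:
  assumes f: "f \<in> LpS rh 2" and n: "n \<ge> 1"
  shows "L2_inner rh f (\<lambda>y. of_real (phi_check \<nu> n y)) =
    Complex (P.coef (\<lambda>x. Re (f x)) n) (P.coef (\<lambda>x. Im (f x)) n)"
  unfolding L2_inner_phi_check[OF n] P.coef_def
  using integral_Re[OF integrable_mult_phi[OF f n]] integral_Im[OF integrable_mult_phi[OF f n]]
  by (simp add: complex_eq_iff)

text \<open>The \<open>phi_check \<nu> n\<close> are real, so inner products split into real
  coefficients, and \<open>d_check_phi_check\<close> turns the derivative into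
  \<open>sqrt (mu n) * chi n\<close>. This links the series of the definition to the relation
  \<open>riesz\<close>.\<close>

lemma riesz_partial_sum_eq:
  assumes f: "f \<in> LpS rh 2" and x: "x \<in> space rh"
  shows "riesz_partial_sum \<nu> f N x =
    Complex (Gs (\<lambda>n. P.coef (\<lambda>x. Re (f x)) n * sg n) N x) (Gs (\<lambda>n. P.coef (\<lambda>x. Im (f x)) n * sg n) N x)"
proof -
  have t: "inverse (complex_of_real (lam n)) * L2_inner rh f (\<lambda>y. of_real (phi_check \<nu> n y))
        * of_real (d_check \<nu> (phi_check \<nu> n) x) =
      Complex (P.coef (\<lambda>x. Re (f x)) n * sg n * chi n x) (P.coef (\<lambda>x. Im (f x)) n * sg n * chi n x)"
    if n: "n \<in> {2..N}" for n
  proof -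
    have "d_check \<nu> (phi_check \<nu> n) x = sqrt (mu n) * chi n x" using x n by (intro d_check_phi_check) auto
    moreover have "1 \<le> n" using n by auto
    ultimately show ?thesis
      by (simp add: L2_inner_phi_Complex[OF f] sg_def complex_eq_iff field_simps flip: of_real_inverse)
  qed
  have "riesz_partial_sum \<nu> f N x = (\<Sum>n=2..N. Complex (P.coef (\<lambda>x. Re (f x)) n * sg n * chi n x) (P.coef (\<lambda>x. Im (f x)) n * sg n * chi n x))"
    unfolding riesz_partial_sum_def by (rule sum.cong[OF refl t])
  also have "... = Complex (Gs (\<lambda>n. P.coef (\<lambda>x. Re (f x)) n * sg n) N x) (Gs (\<lambda>n. P.coef (\<lambda>x. Im (f x)) n * sg n) N x)"
    unfolding Gs_def by (simp add: complex_eq_iff)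
  finally show ?thesis .
qed

lemma is_riesz_transform_iff:
  "is_riesz_transform \<nu> f g \<longleftrightarrow> (\<forall>N. riesz_partial_sum \<nu> f N \<in> LpS rh 2) \<and> g \<in> LpS rh 2 \<and> Lp_lim rh 2 (riesz_partial_sum \<nu> f) g"
  by (simp add: is_riesz_transform_def Lp_tendsto_iff)

lemma is_riesz_transform_Complex:
  assumes f: "f \<in> LpS rh 2" and r: "riesz (\<lambda>x. Re (f x)) g" "riesz (\<lambda>x. Im (f x)) h"
  shows "is_riesz_transform \<nu> f (\<lambda>x. Complex (g x) (h x))"
proof -
  define A where "A N = Gs (\<lambda>n. P.coef (\<lambda>x. Re (f x)) n * sg n) N" for N
  define B where "B N = Gs (\<lambda>n. P.coef (\<lambda>x. Im (f x)) n * sg n) N" for N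
  have AB: "A N \<in> LpS rh 2" "B N \<in> LpS rh 2" for N
    unfolding A_def B_def using Q.fsum_LpS[of 2] unfolding Q_fsum by simp_all
  have lA: "Lp_lim rh 2 A g" "Lp_lim rh 2 B h"
    using r by (auto simp: riesz_def A_def B_def)
  have gh: "g \<in> LpS rh 2" "h \<in> LpS rh 2" using r by (auto simp: riesz_def)
  have C: "(\<lambda>x. Complex (A N x) (B N x)) \<in> LpS rh 2" "(\<lambda>x. Complex (g x) (h x)) \<in> LpS rh 2" for N
    by (intro LpS_Complex AB gh; simp)+
  have eq: "riesz_partial_sum \<nu> f N x = Complex (A N x) (B N x)" if "x \<in> space rh" for N x
    unfolding A_def B_def by (rule riesz_partial_sum_eq[OF f that])
  have m: "riesz_partial_sum \<nu> f N \<in> borel_measurable rh" for N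
    by (rule iffD2[OF measurable_cong[OF eq] LpS_measurable[OF C(1)]])
  show ?thesis unfolding is_riesz_transform_iff
  proof (intro conjI allI C(2))
    show "riesz_partial_sum \<nu> f N \<in> LpS rh 2" for N
      by (rule LpS_mono(1)[OF C(1)[of N] m]) (auto intro!: AE_I2 simp: eq simp del: space_rho)
    show "(\<lambda>N. LpN rh 2 (\<lambda>x. riesz_partial_sum \<nu> f N x - Complex (g x) (h x))) \<longlonglongrightarrow> 0"
    proof (rule tendsto_0_le)
      show "(\<lambda>N. LpD rh 2 (A N) g + LpD rh 2 (B N) h) \<longlonglongrightarrow> 0" using tendsto_add[OF lA] by simp
      fix N
      have d: "(\<lambda>x. A N x - g x) \<in> LpS rh 2" "(\<lambda>x. B N x - h x) \<in> LpS rh 2"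
        by (intro LpS_diff AB gh; simp)+
      have "LpN rh 2 (\<lambda>x. riesz_partial_sum \<nu> f N x - Complex (g x) (h x))
          = LpN rh 2 (\<lambda>x. Complex (A N x - g x) (B N x - h x))"
        unfolding LpN_def by (rule arg_cong[where f = "\<lambda>I. I powr _"], rule bint_cong) (simp_all only: eq complex_diff)
      thus "LpN rh 2 (\<lambda>x. riesz_partial_sum \<nu> f N x - Complex (g x) (h x)) \<le> LpD rh 2 (A N) g + LpD rh 2 (B N) h"
        using LpS_Complex(2)[OF d] by simp
    qed simp
  qed
qed

lemma is_riesz_transform_exists:
  assumes f: "f \<in> LpS rh 2"
  obtains g h where "riesz (\<lambda>x. Re (f x)) g" "riesz (\<lambda>x. Im (f x)) h" "is_riesz_transform \<nu> f (\<lambda>x. Complex (g x) (h x))"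
proof -
  have "(\<lambda>x. Re (f x)) \<in> LpS rh 2" "(\<lambda>x. Im (f x)) \<in> LpS rh 2" by (rule LpS_Re_Im[OF f], simp)+
  then obtain g h where "riesz (\<lambda>x. Re (f x)) g" "riesz (\<lambda>x. Im (f x)) h" using riesz_exists by metis
  thus thesis using that is_riesz_transform_Complex[OF f] by blast
qed

lemma is_riesz_transform_unique:
  "is_riesz_transform \<nu> f g ==> is_riesz_transform \<nu> f g' ==> AE x in rh. g x = g' x"
  unfolding is_riesz_transform_def
  using Lp_tendsto_unique[of 2 rh "riesz_partial_sum \<nu> f" g g'] by simp

lemma is_riesz_transform_Lp:
  assumes p: "p > 1" and f: "f \<in> LpS rh 2" "f \<in> LpS rh p" and r: "is_riesz_transform \<nu> f k"
  shows "k \<in> LpS rh p" "LpN rh p k \<le> 2 * Cpq p (p / (p - 1)) * LpN rh p f"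
proof -
  let ?C = "Cpq p (p / (p - 1))"
  obtain g h where gh: "riesz (\<lambda>x. Re (f x)) g" "riesz (\<lambda>x. Im (f x)) h" and i: "is_riesz_transform \<nu> f (\<lambda>x. Complex (g x) (h x))"
    by (rule is_riesz_transform_exists[OF f(1)])
  have p0: "p > 0" using p by simp
  note RI = LpS_Re_Im[OF f(2) p0]
  note g = riesz_Lp[OF p RI(1) gh(1)] and h = riesz_Lp[OF p RI(3) gh(2)]
  have p1: "p \<ge> 1" using p by simp
  note C = LpS_Complex[OF g(1) h(1) p1]
  have km: "k \<in> borel_measurable rh"
    using r by (auto simp: is_riesz_transform_iff LpS_def)
  have ae: "AE x in rh. k x = Complex (g x) (h x)" by (rule is_riesz_transform_unique[OF r i])
  have le: "AE x in rh. norm (k x) \<le> norm (Complex (g x) (h x))" using ae by eventually_elim simp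
  show "k \<in> LpS rh p" by (rule LpS_mono(1)[OF C(1) km _ le]) (use p in simp)
  have "LpN rh p k \<le> LpN rh p (\<lambda>x. Complex (g x) (h x))"
    by (rule LpS_mono(2)[OF C(1) km _ le]) (use p in simp)
  also have "... \<le> LpN rh p g + LpN rh p h" by (rule C(2))
  also have "... \<le> ?C * LpN rh p f + ?C * LpN rh p f"
  proof (intro add_mono)
    show "LpN rh p g \<le> ?C * LpN rh p f"
      using g(2) mult_left_mono[OF RI(2) Cpq_nonneg[OF p]] by (rule order_trans)
    show "LpN rh p h \<le> ?C * LpN rh p f"
      using h(2) mult_left_mono[OF RI(4) Cpq_nonneg[OF p]] by (rule order_trans)
  qed
  finally show "LpN rh p k \<le> 2 * ?C * LpN rh p f" by (simp only: mult_2 distrib_right)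
qed

lemma is_riesz_transform_add:
  assumes f: "f \<in> LpS rh 2" "f' \<in> LpS rh 2"
    and r: "is_riesz_transform \<nu> f g" "is_riesz_transform \<nu> f' g'"
  shows "is_riesz_transform \<nu> (\<lambda>x. f x + f' x) (\<lambda>x. g x + g' x)"
proof -
  have s: "riesz_partial_sum \<nu> (\<lambda>x. f x + f' x) N = (\<lambda>x. riesz_partial_sum \<nu> f N x + riesz_partial_sum \<nu> f' N x)" for N
  proof
    fix x
    have i: "L2_inner rh (\<lambda>x. f x + f' x) (\<lambda>y. of_real (phi_check \<nu> n y)) =
        L2_inner rh f (\<lambda>y. of_real (phi_check \<nu> n y)) + L2_inner rh f' (\<lambda>y. of_real (phi_check \<nu> n y))"
      if n: "n \<ge> 1" for n
      unfolding L2_inner_phi_check[OF n] distrib_right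
      by (rule bint_add[OF integrable_mult_phi[OF f(1) n] integrable_mult_phi[OF f(2) n]])
    show "riesz_partial_sum \<nu> (\<lambda>x. f x + f' x) N x = riesz_partial_sum \<nu> f N x + riesz_partial_sum \<nu> f' N x"
      unfolding riesz_partial_sum_def sum.distrib[symmetric]
      by (rule sum.cong) (auto simp: i algebra_simps)
  qed
  have D: "riesz_partial_sum \<nu> f N \<in> LpS rh 2" "riesz_partial_sum \<nu> f' N \<in> LpS rh 2"
    "g \<in> LpS rh 2" "g' \<in> LpS rh 2" for N
    using r by (auto simp: is_riesz_transform_iff)
  show ?thesis unfolding is_riesz_transform_iff s
  proof (intro conjI allI LpS_add D)
    show "(\<lambda>n. LpN rh 2 (\<lambda>x. riesz_partial_sum \<nu> f n x + riesz_partial_sum \<nu> f' n x - (g x + g' x))) \<longlonglongrightarrow> 0"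
      using r by (intro Lp_lim_add D) (auto simp: is_riesz_transform_iff)
  qed simp_all
qed

lemma is_riesz_transform_scale:
  assumes r: "is_riesz_transform \<nu> f g"
  shows "is_riesz_transform \<nu> (\<lambda>x. c * f x) (\<lambda>x. c * g x)"
proof -
  have s: "riesz_partial_sum \<nu> (\<lambda>x. c * f x) N = (\<lambda>x. c * riesz_partial_sum \<nu> f N x)" for N
    unfolding riesz_partial_sum_def L2_inner_def mult.assoc integral_mult_right_zero sum_distrib_left
    by (intro ext sum.cong) (simp_all only: mult_ac)
  have l: "LpN rh 2 (\<lambda>x. c * u x - c * v x) = cmod c * LpD rh 2 u v" for u v
    using LpN_mult_const[of 2 rh c "\<lambda>x. u x - v x"] by (simp add: right_diff_distrib)
  show ?thesis using r tendsto_mult_right_zero[of _ sequentially "cmod c"]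
    unfolding is_riesz_transform_iff s l by (auto intro: LpS_mult_const)
qed

lemma is_riesz_transform_cong:
  assumes r: "is_riesz_transform \<nu> f g" and g': "g' \<in> borel_measurable rh" and ae: "AE x in rh. g x = g' x"
  shows "is_riesz_transform \<nu> f g'"
proof -
  have D: "riesz_partial_sum \<nu> f N \<in> LpS rh 2" "g \<in> LpS rh 2" and l: "Lp_lim rh 2 (riesz_partial_sum \<nu> f) g" for N
    using r by (auto simp: is_riesz_transform_iff)
  have "g' \<in> LpS rh 2" by (rule LpS_mono(1)[OF D(2) g']) (use ae in \<open>auto elim: eventually_mono\<close>)
  moreover have "LpD rh 2 (riesz_partial_sum \<nu> f n) g = LpD rh 2 (riesz_partial_sum \<nu> f n) g'" for n
    using LpS_measurable[OF D(1)] LpS_measurable[OF D(2)] g' ae by (intro LpN_cong_AE) (auto elim: eventually_mono)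
  ultimately show ?thesis using D l by (simp add: is_riesz_transform_iff)
qed

lemma trunc_LpS_bounded:
  fixes f :: "real \<Rightarrow> complex"
  assumes "f \<in> borel_measurable rh" "p \<ge> 0"
  shows "trunc k f \<in> LpS rh p"
  by (rule LpS_bounded[OF finite_measure_rho trunc_measurable[OF assms(1)], of _ "real k"])
     (use norm_trunc_le(2)[of k f] assms in \<open>auto intro!: AE_I2\<close>)

text \<open>The abstract extension is applied with the intersection of \<open>L^2\<close> and
  \<open>L^p\<close> as domain. Truncations prove its density: they are bounded, hence in both
  spaces, and converge in \<open>L^p\<close>.\<close>

lemma riesz_extension_exists:
  assumes p: "p > 1"
  obtains T where "bounded_riesz_extension \<nu> p T"
    "\<And>f. f \<in> LpS rh p ==> LpN rh p (T f) \<le> 2 * Cpq p (p / (p - 1)) * LpN rh p f"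
proof -
  let ?D = "LpS rh 2 \<inter> LpS rh p :: (real \<Rightarrow> complex) set"
  have p': "p \<ge> 1" "p > 0" using p by auto
  obtain T where T: "\<And>f. f \<in> LpS rh p ==> T f \<in> LpS rh p"
    "\<And>f. f \<in> LpS rh p ==> LpN rh p (T f) \<le> 2 * Cpq p (p / (p - 1)) * LpN rh p f"
    "\<And>f g. f \<in> LpS rh p ==> g \<in> LpS rh p ==> AE x in rh. T (\<lambda>y. f y + g y) x = T f x + T g x"
    "\<And>c f. f \<in> LpS rh p ==> AE x in rh. T (\<lambda>y. c * f y) x = c * T f x"
    "\<And>f. f \<in> ?D ==> is_riesz_transform \<nu> f (T f)"
  proof (rule Lp_extension[of rh p "2 * Cpq p (p / (p - 1))" ?D "is_riesz_transform \<nu>"])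
    show "2 * Cpq p (p / (p - 1)) \<ge> 0" using Cpq_nonneg[OF p] by simp
    show "\<exists>g. is_riesz_transform \<nu> f g" if "f \<in> ?D" for f using that is_riesz_transform_exists[of f] by blast
    show "\<exists>h. (\<forall>k::nat. h k \<in> ?D) \<and> Lp_lim rh p h f" if f: "f \<in> LpS rh p" for f
      using trunc_LpS_bounded[OF LpS_measurable[OF f]] trunc_tendsto[OF f] p' by (intro exI[of _ "\<lambda>k. trunc k f"]) auto
  qed (use p p' finite_measure_rho in \<open>auto intro: LpS_add LpS_mult_const is_riesz_transform_add is_riesz_transform_scale
        is_riesz_transform_Lp[OF p] is_riesz_transform_cong LpS_measurable\<close>)
  show thesis
  proof (rule that[of T])
    show "bounded_riesz_extension \<nu> p T"
      unfolding bounded_riesz_extension_def bounded_linear_Lp_def Lp_eq_LpS Lp_norm_eq_LpN using T by blast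
  qed (rule T(2))
qed

text \<open>On truncations both operators give the same \<open>L^2\<close> limit, hence agree almost
  everywhere; boundedness of both carries the equality to all of \<open>L^p\<close>.\<close>

lemma riesz_extension_unique:
  assumes p: "p > 1" and T: "bounded_riesz_extension \<nu> p T" and T': "bounded_riesz_extension \<nu> p T'"
    and f: "f \<in> LpS rh p"
  shows "AE x in rh. T' f x = T f x"
proof -
  have p': "p \<ge> 1" "p > 0" using p by auto
  have B: "bounded_linear_Lp rh p T" "bounded_linear_Lp rh p T'"
    using T T' by (auto simp: bounded_riesz_extension_def)
  have TL: "\<And>f. f \<in> LpS rh p ==> T f \<in> LpS rh p" "\<And>f. f \<in> LpS rh p ==> T' f \<in> LpS rh p"
    using B by (auto simp: bounded_linear_Lp_def Lp_eq_LpS)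
  obtain C where C: "\<And>f g. f \<in> LpS rh p ==> g \<in> LpS rh p ==>
      LpD rh p (T f) (T g) \<le> C * LpD rh p f g"
    using bounded_linear_Lp_diff[OF B(1) p'(2)] by blast
  obtain C' where C': "\<And>f g. f \<in> LpS rh p ==> g \<in> LpS rh p ==>
      LpD rh p (T' f) (T' g) \<le> C' * LpD rh p f g"
    using bounded_linear_Lp_diff[OF B(2) p'(2)] by blast
  have t: "trunc k f \<in> LpS rh p" "trunc k f \<in> LpS rh 2" for k
    by (rule trunc_LpS_bounded[OF LpS_measurable[OF f]], use p in simp)+
  have "LpD rh p (T' f) (T f) \<le> 0"
  proof (rule LIMSEQ_le_const)
    have l: "Lp_lim rh p (\<lambda>k. trunc k f) f" by (rule trunc_tendsto[OF f p'(2)])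
    show "(\<lambda>k. (C' + C) * LpD rh p (trunc k f) f) \<longlonglongrightarrow> 0"
      using tendsto_mult[OF tendsto_const l] by simp
    show "\<exists>N. \<forall>k\<ge>N. LpD rh p (T' f) (T f) \<le> (C' + C) * LpD rh p (trunc k f) f"
    proof (intro exI allI impI)
      fix k
      have ae: "AE x in rh. T' (trunc k f) x = T (trunc k f) x"
        by (rule is_riesz_transform_unique[of "trunc k f"])
           (use T T' t in \<open>auto simp: bounded_riesz_extension_def Lp_eq_LpS\<close>)
      have "LpD rh p (T' f) (T f) \<le>
          LpD rh p (T' f) (T' (trunc k f)) + LpD rh p (T' (trunc k f)) (T f)"
        by (intro Minkowski_diff TL f t p')
      also have "LpD rh p (T' (trunc k f)) (T f) = LpD rh p (T (trunc k f)) (T f)"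
        using LpS_measurable[OF TL(1)[OF f]] LpS_measurable[OF TL(1)[OF t(1)[of k]]] LpS_measurable[OF TL(2)[OF t(1)[of k]]] ae
        by (intro LpN_cong_AE) (auto elim: eventually_mono)
      also have "... \<le> C * LpD rh p (trunc k f) f" by (rule C[OF t(1) f])
      also have "LpD rh p (T' f) (T' (trunc k f)) \<le> C' * LpD rh p (trunc k f) f"
        using C'[OF f t(1)] LpN_diff_commute[of rh p f] by simp
      finally show "LpD rh p (T' f) (T f) \<le> (C' + C) * LpD rh p (trunc k f) f"
        by (simp add: distrib_right)
    qed
  qed
  hence "LpD rh p (T' f) (T f) = 0" by (rule antisym) simp
  thus ?thesis using LpN_eq_0_iff[OF LpS_diff[OF TL(2)[OF f] TL(1)[OF f] p'(2)] p'(2)] by simp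
qed

end

theorem theorem6p6:
  fixes \<nu> p :: real
  assumes "\<nu> > -1/2" and "1 < p"
  shows "\<exists>T. bounded_riesz_extension \<nu> p T
    \<and> (\<forall>T'. bounded_riesz_extension \<nu> p T'
          \<longrightarrow> (\<forall>f \<in> Lp (rho \<nu>) p. AE x in rho \<nu>. T' f x = T f x))
    \<and> Lp_onorm (rho \<nu>) p T
        \<le> 48 * (1 + sqrt (1/8 * max (\<nu> + 1/2) (1 / (\<nu> + 1/2)))) * (max p (p / (p - 1)) - 1)"
proof -
  interpret bessel \<nu> by unfold_locales (use assms in simp)
  let ?C = "Cpq p (p / (p - 1))"
  obtain T where T: "bounded_riesz_extension \<nu> p T"
    and T_norm: "\<And>f. f \<in> LpS (rho \<nu>) p ==> LpN (rho \<nu>) p (T f) \<le> 2 * ?C * LpN (rho \<nu>) p f"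
    using riesz_extension_exists[OF assms(2)] by blast
  have C: "?C \<ge> 0" by (rule Cpq_nonneg[OF assms(2)])
  have "Lp_onorm (rho \<nu>) p T \<le> 2 * ?C"
    unfolding Lp_onorm_def Lp_eq_LpS Lp_norm_eq_LpN
  proof (rule cSUP_least)
    show "LpS (rho \<nu>) p \<noteq> ({} :: (real \<Rightarrow> complex) set)" using LpS_0[of "rho \<nu>" p] by blast
    fix f :: "real \<Rightarrow> complex" assume f: "f \<in> LpS (rho \<nu>) p"
    show "LpN (rho \<nu>) p (T f) / LpN (rho \<nu>) p f \<le> 2 * ?C"
    \<comment> \<open>For norm 0 the quotient is \<open>0\<close> by the convention for division,
      and the bound is nonnegative.\<close>
    proof (cases "LpN (rho \<nu>) p f = 0")
      case False
      hence "LpN (rho \<nu>) p f > 0" using LpN_nonneg[of "rho \<nu>" p f] by linarith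
      thus ?thesis using T_norm[OF f] by (simp add: divide_le_eq)
    qed (use C in simp)
  qed
  also have "2 * ?C = 20 * ((1 + sqrt KK) * (max p (p / (p - 1)) - 1))" by (simp add: Cpq_def)
  also have "... \<le> 48 * ((1 + sqrt KK) * (max p (p / (p - 1)) - 1))"
    using KK_nonneg assms(2) by (intro mult_right_mono mult_nonneg_nonneg) auto
  also have "... = 48 * (1 + sqrt (1/8 * max (\<nu> + 1/2) (1 / (\<nu> + 1/2)))) * (max p (p / (p - 1)) - 1)"
    by (simp add: KK_def)
  finally show ?thesis using T riesz_extension_unique[OF assms(2) T] by (auto simp: Lp_eq_LpS)
qed

end
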